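(* Let $\lambda\in\mathbb{C}\setminus\mathbb{R}$ with $\lambda\notin\Lambda$. Then $n_+\ne n_-$ if and only if exactly one of $\|\psi(\cdot,\lambda)\|$ and $\|\psi(\cdot,\overline{\lambda})\|$ is infinite.
   Context: Let $0<b\le\infty$ and $J=\begin{pmatrix}0&-1\\1&0\end{pmatrix}$. Let $q,w$ be $2\times2$ matrices whose entries are distributions of order $0$ on $(0,b)$, equivalently local complex measures on $(0,b)$ (complex measures when restricted to compact subsets of $(0,b)$). Here $q$ is Hermitian ($q=q^*$; off-diagonal entries may be non-real), and $w$ is non-negative (a matrix-valued measure with $w(E)\ge0$ as a Hermitian matrix) and not identically $0$. The endpoint $0$ is regular: $q$ and $w$ are finite measures on $(0,c)$ for each $c\in(0,b)$. For a function $u$ of locally bounded variation put $u^\pm(x)$ for its right/left limits; $u$ is balanced if $u=\frac12(u^-+u^+)$. A solution of $Ju'+qu=\lambda wu$ is a balanced function $u:(0,b)\to\mathbb{C}^2$ of locally bounded variation satisfying the equation as an identity of local measures, and $u(0)=\lim_{x\downarrow0}u(x)$. Let $\Delta_q(x)=q(\{x\})$, $\Delta_w(x)=w(\{x\})$, $B_\pm(x,\lambda)=J\pm\frac12(\Delta_q(x)-\lambda\Delta_w(x))$, and $\Lambda=\{\lambda\in\mathbb{C}:\exists x\in(0,b):\det B_+(x,\lambda)\det B_-(x,\lambda)=0\}$; it is assumed throughout that $\Lambda\ne\mathbb{C}$. The set $\Lambda$ is symmetric with respect to the real axis. For $\lambda\notin\Lambda$ initial value problems with data posed at $0$ have unique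 balanced solutions on $(0,b)$. Let $\|u\|^2=\int_{(0,b)}u^*wu\in[0,\infty]$; $\mathcal{L}^2(w)$ is the space of functions with $\|u\|<\infty$. $\mathcal{L}_0$ is the space of solutions of $Ju'+qu=0$ with norm $0$ (these solve $Ju'+qu=\lambda wu$ for every $\lambda$). The deficiency index $n_+$ (resp. $n_-$) is the number of linearly independent solutions of $Ju'+qu=\lambda wu$ of positive finite norm, i.e. the dimension of the space of solutions in $\mathcal{L}^2(w)$ modulo $\mathcal{L}_0$, for $\lambda$ in the upper (resp. lower) half-plane; it is known not to depend on the choice of $\lambda$ in that half-plane. Fix $\alpha\in[0,\pi)$. For $\lambda\notin\Lambda$ let $\psi(\cdot,\lambda)$ be the solution of $Ju'+qu=\lambda wu$ with $\psi(0,\lambda)=(-\sin\alpha,\cos\alpha)^\top$. *)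

theory Defs
  imports "HOL-Analysis.Analysis"
begin

section \<open>Local matrix-valued measures on \<open>(0, b)\<close>\<close>

definition oint :: "ereal \<Rightarrow> real set" where
  "oint b = {x. 0 < x \<and> ereal x < b}"

text \<open>
  Complex, vector and matrix measures are set functions on Borel sets.  A local measure on
  \<open>(0, b)\<close> is only meaningful on the Borel sets that are relatively compact in \<open>(0, b)\<close> (and on
  the Borel subsets of each \<open>(0, c)\<close> if \<open>0\<close> is regular); its values on all other sets are
  irrelevant.  Countable additivity includes \<open>\<mu> {} = 0\<close>, since the constant series
  \<open>\<mu> {} + \<mu> {} + \<dots>\<close> has to converge.
\<close>

definition measure_on :: "real set \<Rightarrow> (real set \<Rightarrow> 'a::real_normed_vector) \<Rightarrow> bool" where
  "measure_on S \<mu> \<longleftrightarrow>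
     (\<forall>A::nat \<Rightarrow> real set. (\<forall>n. A n \<in> sets borel \<and> A n \<subseteq> S) \<and> disjoint_family A
        \<longrightarrow> (\<lambda>n. \<mu> (A n)) sums \<mu> (\<Union>n. A n))"

definition rel_compact_borel :: "ereal \<Rightarrow> real set set" where
  "rel_compact_borel b = {E \<in> sets borel. \<exists>K. compact K \<and> K \<subseteq> oint b \<and> E \<subseteq> K}"

definition local_measure :: "ereal \<Rightarrow> (real set \<Rightarrow> 'a::real_normed_vector) \<Rightarrow> bool" where
  "local_measure b \<mu> \<longleftrightarrow> (\<forall>K. compact K \<and> K \<subseteq> oint b \<longrightarrow> measure_on K \<mu>)"

definition regular_at_0 :: "ereal \<Rightarrow> (real set \<Rightarrow> 'a::real_normed_vector) \<Rightarrow> bool" where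
  "regular_at_0 b \<mu> \<longleftrightarrow> (\<forall>c\<in>oint b. measure_on {0<..<c} \<mu>)"

definition hermitian_mat :: "complex^2^2 \<Rightarrow> bool" where
  "hermitian_mat A \<longleftrightarrow> (\<forall>i j. A $ j $ i = cnj (A $ i $ j))"

definition nonneg_mat :: "complex^2^2 \<Rightarrow> bool" where
  "nonneg_mat A \<longleftrightarrow> hermitian_mat A \<and>
     (\<forall>v::complex^2. 0 \<le> Re (\<Sum>i\<in>UNIV. cnj (v $ i) * (A *v v) $ i))"

definition hermitian_measure :: "ereal \<Rightarrow> (real set \<Rightarrow> complex^2^2) \<Rightarrow> bool" where
  "hermitian_measure b q \<longleftrightarrow> (\<forall>E\<in>rel_compact_borel b. hermitian_mat (q E))"

definition nonneg_measure :: "ereal \<Rightarrow> (real set \<Rightarrow> complex^2^2) \<Rightarrow> bool" where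
  "nonneg_measure b w \<longleftrightarrow> (\<forall>E\<in>rel_compact_borel b. nonneg_mat (w E))"

definition nonzero_measure :: "ereal \<Rightarrow> (real set \<Rightarrow> complex^2^2) \<Rightarrow> bool" where
  "nonzero_measure b w \<longleftrightarrow> (\<exists>E\<in>rel_compact_borel b. w E \<noteq> 0)"


section \<open>Integration against complex measures\<close>

text \<open>
  The positive variation \<open>E \<mapsto> sup {\<nu> A | A \<subseteq> E \<inter> S}\<close> of a signed measure \<open>\<nu>\<close> on \<open>S\<close>.
  The function \<open>ennreal\<close> sends negative reals to \<open>0\<close>, which is harmless as \<open>\<nu> {} = 0\<close>.
  The negative variation of \<open>\<nu>\<close> is the positive variation of \<open>- \<nu>\<close>.
\<close>

definition pos_variation :: "real set \<Rightarrow> (real set \<Rightarrow> real) \<Rightarrow> real measure" where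
  "pos_variation S \<nu> =
     measure_of UNIV (sets borel) (\<lambda>E. SUP A\<in>{A \<in> sets borel. A \<subseteq> E \<inter> S}. ennreal (\<nu> A))"

definition signed_integral :: "(real set \<Rightarrow> real) \<Rightarrow> real set \<Rightarrow> (real \<Rightarrow> complex) \<Rightarrow> complex" where
  "signed_integral \<nu> S f =
     (LINT x:S|pos_variation S \<nu>. f x) - (LINT x:S|pos_variation S (\<lambda>A. - \<nu> A). f x)"

definition cmeasure_integral :: "(real set \<Rightarrow> complex) \<Rightarrow> real set \<Rightarrow> (real \<Rightarrow> complex) \<Rightarrow> complex" where
  "cmeasure_integral \<nu> S f =
     signed_integral (\<lambda>A. Re (\<nu> A)) S f + \<i> * signed_integral (\<lambda>A. Im (\<nu> A)) S f"

text \<open>The vector measure \<open>q u\<close>, evaluated at \<open>E\<close>, is the integral of \<open>u\<close> over \<open>E\<close> against \<open>q\<close>.\<close>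

definition mat_measure_mult ::
    "(real set \<Rightarrow> complex^2^2) \<Rightarrow> (real \<Rightarrow> complex^2) \<Rightarrow> real set \<Rightarrow> complex^2" where
  "mat_measure_mult q u E =
     (\<chi> i. \<Sum>j\<in>UNIV. cmeasure_integral (\<lambda>A. q A $ i $ j) E (\<lambda>x. u x $ j))"

text \<open>
  The squared norm is the integral of \<open>u\<^sup>* w u\<close> over \<open>(0, b)\<close>, obtained by exhausting \<open>(0, b)\<close>
  by compact intervals.  It is meaningful for locally bounded Borel functions \<open>u\<close> on \<open>(0, b)\<close>,
  in particular for functions of locally bounded variation.
\<close>

definition norm_sq :: "ereal \<Rightarrow> (real set \<Rightarrow> complex^2^2) \<Rightarrow> (real \<Rightarrow> complex^2) \<Rightarrow> ennreal" where
  "norm_sq b w u =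
     (SUP (x, y)\<in>{(x, y). x \<in> oint b \<and> y \<in> oint b \<and> x \<le> y}.
        ennreal (Re (\<Sum>i\<in>UNIV. \<Sum>j\<in>UNIV.
          cmeasure_integral (\<lambda>A. w A $ i $ j) {x..y} (\<lambda>t. cnj (u t $ i) * u t $ j))))"


section \<open>Functions of locally bounded variation and solutions\<close>

definition bounded_variation_on :: "(real \<Rightarrow> 'a::real_normed_vector) \<Rightarrow> real \<Rightarrow> real \<Rightarrow> bool" where
  "bounded_variation_on u x y \<longleftrightarrow>
     (\<exists>M. \<forall>(n::nat) (t::nat \<Rightarrow> real).
        (\<forall>i\<le>n. t i \<in> {x..y}) \<and> (\<forall>i<n. t i \<le> t (Suc i))
          \<longrightarrow> (\<Sum>i<n. norm (u (t (Suc i)) - u (t i))) \<le> M)"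

definition locally_bv :: "ereal \<Rightarrow> (real \<Rightarrow> 'a::real_normed_vector) \<Rightarrow> bool" where
  "locally_bv b u \<longleftrightarrow> (\<forall>x\<in>oint b. \<forall>y\<in>oint b. bounded_variation_on u x y)"

definition right_lim :: "(real \<Rightarrow> 'a::real_normed_vector) \<Rightarrow> real \<Rightarrow> 'a" where
  "right_lim u x = Lim (at_right x) u"

definition left_lim :: "(real \<Rightarrow> 'a::real_normed_vector) \<Rightarrow> real \<Rightarrow> 'a" where
  "left_lim u x = Lim (at_left x) u"

definition balanced :: "ereal \<Rightarrow> (real \<Rightarrow> 'a::real_normed_vector) \<Rightarrow> bool" where
  "balanced b u \<longleftrightarrow> (\<forall>x\<in>oint b. u x = (1/2) *\<^sub>R (left_lim u x + right_lim u x))"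

text \<open>
  \<open>du\<close> is the local (Lebesgue--Stieltjes) measure \<open>u'\<close>; it is determined on all relatively
  compact Borel sets by its values on compact intervals.
\<close>

definition derivative_measure ::
    "ereal \<Rightarrow> (real \<Rightarrow> 'a::real_normed_vector) \<Rightarrow> (real set \<Rightarrow> 'a) \<Rightarrow> bool" where
  "derivative_measure b u du \<longleftrightarrow> local_measure b du \<and>
     (\<forall>x\<in>oint b. \<forall>y\<in>oint b. x \<le> y \<longrightarrow> du {x..y} = right_lim u y - left_lim u x)"

definition J :: "complex^2^2" where
  "J = vector [vector [0, -1], vector [1, 0]]"

text \<open>
  Only the values of \<open>u\<close> on \<open>(0, b)\<close> matter: a solution is a function on \<open>(0, b)\<close>, extended
  arbitrarily to the real line.
\<close>

definition solution ::
    "ereal \<Rightarrow> (real set \<Rightarrow> complex^2^2) \<Rightarrow> (real set \<Rightarrow> complex^2^2) \<Rightarrow> complex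
      \<Rightarrow> (real \<Rightarrow> complex^2) \<Rightarrow> bool" where
  "solution b q w z u \<longleftrightarrow> locally_bv b u \<and> balanced b u \<and>
     (\<exists>du. derivative_measure b u du \<and>
        (\<forall>E\<in>rel_compact_borel b.
           J *v du E + mat_measure_mult q u E = z *s mat_measure_mult w u E))"


section \<open>The exceptional set\<close>

definition B_plus ::
    "(real set \<Rightarrow> complex^2^2) \<Rightarrow> (real set \<Rightarrow> complex^2^2) \<Rightarrow> real \<Rightarrow> complex \<Rightarrow> complex^2^2" where
  "B_plus q w x z = J + (1/2) *\<^sub>R (q {x} - mat z ** w {x})"

definition B_minus ::
    "(real set \<Rightarrow> complex^2^2) \<Rightarrow> (real set \<Rightarrow> complex^2^2) \<Rightarrow> real \<Rightarrow> complex \<Rightarrow> complex^2^2" where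
  "B_minus q w x z = J - (1/2) *\<^sub>R (q {x} - mat z ** w {x})"

definition Lambda_set ::
    "ereal \<Rightarrow> (real set \<Rightarrow> complex^2^2) \<Rightarrow> (real set \<Rightarrow> complex^2^2) \<Rightarrow> complex set" where
  "Lambda_set b q w = {z. \<exists>x\<in>oint b. det (B_plus q w x z) * det (B_minus q w x z) = 0}"


section \<open>Deficiency indices\<close>

text \<open>
  The dimension of the quotient of \<open>V\<close> by \<open>W\<close> (for subspaces \<open>W \<subseteq> V\<close>): the largest number of
  elements of \<open>V\<close> that are linearly independent modulo \<open>W\<close>.
\<close>

definition quotient_dim :: "(real \<Rightarrow> complex^2) set \<Rightarrow> (real \<Rightarrow> complex^2) set \<Rightarrow> enat" where
  "quotient_dim V W =
     (SUP B\<in>{B. finite B \<and> B \<subseteq> V \<and>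
                (\<forall>c. (\<lambda>x. \<Sum>u\<in>B. c u *s u x) \<in> W \<longrightarrow> (\<forall>u\<in>B. c u = 0))}. enat (card B))"

definition L2_solutions ::
    "ereal \<Rightarrow> (real set \<Rightarrow> complex^2^2) \<Rightarrow> (real set \<Rightarrow> complex^2^2) \<Rightarrow> complex
      \<Rightarrow> (real \<Rightarrow> complex^2) set" where
  "L2_solutions b q w z = {u. solution b q w z u \<and> norm_sq b w u < \<infinity>}"

definition L_0 ::
    "ereal \<Rightarrow> (real set \<Rightarrow> complex^2^2) \<Rightarrow> (real set \<Rightarrow> complex^2^2) \<Rightarrow> (real \<Rightarrow> complex^2) set" where
  "L_0 b q w = {u. solution b q w 0 u \<and> norm_sq b w u = 0}"

text \<open>
  The deficiency index \<open>n\<^sub>+\<close> (resp. \<open>n\<^sub>-\<close>) is the following number for any \<open>z\<close> in the upper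
  (resp. lower) half-plane, including those \<open>z\<close> that lie in the exceptional set; two extensions
  to the real line of the same solution differ by an element of \<open>L_0\<close>.
\<close>

definition deficiency_index ::
    "ereal \<Rightarrow> (real set \<Rightarrow> complex^2^2) \<Rightarrow> (real set \<Rightarrow> complex^2^2) \<Rightarrow> complex \<Rightarrow> enat" where
  "deficiency_index b q w z = quotient_dim (L2_solutions b q w z) (L_0 b q w)"

end

theory Submission
  imports Defs
begin

text \<open>
  Weyl's alternative explains the theorem.  Let \<open>h u = - \<i> u\<^sup>* J u\<close> (\<open>hform\<close>), a Hermitian form of
  signature \<open>(1, 1)\<close>.  A solution for \<open>z\<close> satisfies
  \<open>h (u (x-)) = h (u 0) + 2 Im z \<parallel>u\<parallel>\<^sup>2\<close>, the norm being taken over \<open>(0, x)\<close> (\<open>energy_identity\<close>).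
  Let \<open>z\<close> be nonreal and outside the exceptional set, so that the solutions are parametrised by their
  values at \<open>0\<close>, and let \<open>V\<close> be the space of the initial values of the square-integrable solutions.
  There is always a square-integrable solution \<open>\<phi> \<noteq> 0\<close> on which \<open>sgn (Im z) h\<close> never becomes positive
  (\<open>weyl_solution\<close>), so \<open>V\<close> has dimension 1 or 2.  The initial value of \<open>\<psi>\<close> is a real vector, hence
  isotropic for \<open>h\<close>.  If \<open>\<psi>\<close> is square-integrable with positive norm, the energy identity makes
  \<open>sgn (Im z) h\<close> positive somewhere on \<open>\<psi>\<close>; then \<open>\<psi>\<close> is independent of \<open>\<phi>\<close> and \<open>V\<close> is everything
  (\<open>isotropic_limit_circle\<close>).  If \<open>\<psi>\<close> has norm \<open>0\<close>, it solves the equation for all parameters, its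
  Wronskian with solutions for \<open>z\<close> and for \<open>cnj z\<close> is constant, and this makes all solutions for \<open>z\<close>
  square-integrable if and only if those for \<open>cnj z\<close> are (\<open>isotropic_null_sols_limit_circle\<close>).  Since the
  deficiency index is the dimension of \<open>V\<close> minus the dimension of the space of initial values of \<open>L_0\<close>,
  the indices at \<open>z\<close> and \<open>cnj z\<close> differ exactly when one of the two norms of \<open>\<psi>\<close> is infinite and the
  other one is not (\<open>deficiency_dichotomy\<close>).

  The index must be the same at all points of an open half-plane, and there initial value problems
  may fail to be solvable, namely on the exceptional set.  A boundary value problem survives: split \<open>h\<close> as
  a difference of two squares and prescribe one component at \<open>0\<close> and the other one at \<open>x\<close>.  With the choice
  of components dictated by the sign of \<open>Im \<zeta>\<close> the energy identity gives uniqueness, and then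
  existence follows by continuation over short intervals (\<open>bvp\<close>); so the solutions on \<open>(0, x)\<close> form a
  two-dimensional space for every nonreal \<open>\<zeta>\<close>.  If \<open>u\<close> solves the equation for \<open>z\<close> and \<open>d\<close> solves it for
  \<open>\<zeta>\<close> with the same boundary data, Lagrange's identity yields
  \<open>\<bar>Im \<zeta>\<bar> \<parallel>u - d\<parallel> \<le> \<bar>z - \<zeta>\<bar> \<parallel>u\<parallel>\<close> (\<open>gap_estimate\<close>).  The orthogonal projections of \<open>u\<close> onto the
  solutions for \<open>\<zeta>\<close> on \<open>(0, x)\<close> satisfy the same estimate and converge as \<open>x\<close> tends to \<open>b\<close>
  (\<open>proj_limit_ex\<close>).  If \<open>\<bar>z - \<zeta>\<bar> < \<bar>Im \<zeta>\<bar>\<close>, only elements of \<open>L_0\<close> can have a limit in \<open>L_0\<close>, so the index at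
  \<open>z\<close> is at most that at \<open>\<zeta>\<close> (\<open>defect_le_if_close\<close>).  By symmetry the index is locally constant, and
  a half-plane is connected (\<open>defect_constant\<close>).

  All this takes place for an integral equation.  The measures \<open>q\<close> and \<open>w\<close> have densities with
  respect to one positive measure \<open>M\<close> (\<open>representation\<close>), and up to the values outside \<open>(0, b)\<close> the
  solutions in the sense of measures are the functions \<open>u\<close> with
  \<open>u t = u 0 + \<integral>\<^bsub>(0,t)\<^esub> F dM + M{t}/2 F t\<close> for \<open>F = J (Q - z W) u\<close> (\<open>solution_imp_sols\<close>,
  \<open>sols_imp_solution\<close>).  The factor \<open>1/2\<close> at the atoms of \<open>M\<close> expresses that \<open>u\<close> is balanced; it is also
  what makes integration by parts exact (\<open>product_rule\<close>).
\<close>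

section \<open>Signed measures on a ring of sets\<close>

text \<open>
  A local measure with a regular endpoint \<open>0\<close> is finite only on the subsets of \<open>(0, c)\<close> with \<open>c < b\<close>.
  These sets are closed under finite but not under countable unions, so countable additivity is
  required only when the union belongs to \<open>R\<close> again.
\<close>

locale signed_ring =
  fixes R :: "real set set" and \<nu> :: "real set \<Rightarrow> real"
  assumes R_borel: "A \<in> R \<Longrightarrow> A \<in> sets borel"
    and R_subset: "A \<in> R \<Longrightarrow> B \<in> sets borel \<Longrightarrow> B \<subseteq> A \<Longrightarrow> B \<in> R"
    and R_Un: "A \<in> R \<Longrightarrow> B \<in> R \<Longrightarrow> A \<union> B \<in> R"
    and R_empty: "{} \<in> R"
    and R_sums: "(\<And>n::nat. F n \<in> R) \<Longrightarrow> disjoint_family F \<Longrightarrow> (\<Union>n. F n) \<in> R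
                 \<Longrightarrow> (\<lambda>n. \<nu> (F n)) sums \<nu> (\<Union>n. F n)"

text \<open>
  The positive variation of \<open>\<nu>\<close>, now as one measure on the whole line; restricted to a single set
  \<open>S\<close> of the ring it is the measure \<open>pos_variation S \<nu>\<close>.
\<close>

definition variation :: "real set set \<Rightarrow> (real set \<Rightarrow> real) \<Rightarrow> real measure" where
  "variation R \<nu> = measure_of UNIV (sets borel) (\<lambda>E. SUP A\<in>{A\<in>R. A \<subseteq> E}. ennreal (\<nu> A))"

lemma sets_variation [simp]: "sets (variation R \<nu>) = sets borel"
  and space_variation [simp]: "space (variation R \<nu>) = UNIV"
  unfolding variation_def by (simp_all add: sets.sigma_sets_eq[of borel, simplified])

lemma measurable_variation [simp]: "measurable (variation R \<nu>) N = measurable borel N"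
  by (rule measurable_cong_sets) simp_all

context signed_ring begin

lemma measure_empty: "\<nu> {} = 0"
proof -
  have "(\<lambda>n::nat. \<nu> {}) sums \<nu> (\<Union>n::nat. {})"
    by (rule R_sums[where F="\<lambda>_. {}"]) (auto simp: R_empty disjoint_family_on_def)
  then show ?thesis
    using summable_LIMSEQ_zero[of "\<lambda>n::nat. \<nu> {}"] LIMSEQ_const_iff[of "\<nu> {}" 0] sums_summable by blast
qed

lemma measure_Un:
  assumes "A \<in> R" "B \<in> R" "A \<inter> B = {}" shows "\<nu> (A \<union> B) = \<nu> A + \<nu> B"
proof -
  have U: "(\<Union>n. binaryset A B n) = A \<union> B" by (rule UN_binaryset_eq)
  have "(\<lambda>n. \<nu> (binaryset A B n)) sums \<nu> (\<Union>n. binaryset A B n)"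
  proof (rule R_sums)
    show "binaryset A B n \<in> R" for n using assms by (auto simp: binaryset_def R_empty)
    show "disjoint_family (binaryset A B)"
      using assms by (auto simp: disjoint_family_on_def binaryset_def)
    show "(\<Union>n. binaryset A B n) \<in> R" using assms by (simp add: U R_Un)
  qed
  moreover have "(\<lambda>n. \<nu> (binaryset A B n)) sums (\<nu> A + \<nu> B)"
    by (rule binaryset_sums[where f=\<nu>, OF measure_empty])
  ultimately show ?thesis by (simp add: U sums_unique2)
qed

lemma measure_Diff:
  assumes "S \<in> R" "B \<in> sets borel" "B \<subseteq> S" shows "\<nu> (S - B) = \<nu> S - \<nu> B" "S - B \<in> R" "B \<in> R"
proof -
  show 1: "S - B \<in> R" "B \<in> R" using assms R_borel by (auto intro: R_subset)
  have "\<nu> ((S - B) \<union> B) = \<nu> (S - B) + \<nu> B" using 1 by (intro measure_Un) auto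
  then show "\<nu> (S - B) = \<nu> S - \<nu> B" using assms by (simp add: Un_absorb2)
qed

text \<open>
  If \<open>\<nu>\<close> is unbounded on the subsets of \<open>E\<close>, then there is \<open>A \<subseteq> E\<close> such that both \<open>\<nu> A\<close> and
  \<open>\<nu> (E - A)\<close> are at least \<open>1\<close> in modulus, and \<open>\<nu>\<close> is still unbounded on one of the two pieces.
  Iterating gives disjoint sets of \<open>\<nu>\<close>-measure at least \<open>1\<close> in modulus, which contradicts the
  convergence of the series over them.
\<close>

lemma measure_bounded:
  assumes S: "S \<in> R" shows "\<exists>C. \<forall>A\<in>sets borel. A \<subseteq> S \<longrightarrow> \<bar>\<nu> A\<bar> \<le> C"
proof (rule ccontr)
  define unb where "unb E \<longleftrightarrow> E \<in> R \<and> \<not> (\<exists>C. \<forall>A\<in>sets borel. A \<subseteq> E \<longrightarrow> \<bar>\<nu> A\<bar> \<le> C)" for E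
  assume "\<not> ?thesis"
  then have unbS: "unb S" using S by (simp add: unb_def)
  have step: "\<exists>E'. unb E' \<and> E' \<subseteq> E \<and> 1 \<le> \<bar>\<nu> (E - E')\<bar>" if "unb E" for E
  proof -
    have E: "E \<in> R" using that by (simp add: unb_def)
    have "\<not> (\<forall>A\<in>sets borel. A \<subseteq> E \<longrightarrow> \<bar>\<nu> A\<bar> \<le> 1 + \<bar>\<nu> E\<bar>)"
      using that unfolding unb_def by blast
    then obtain A where A: "A \<in> sets borel" "A \<subseteq> E" "\<bar>\<nu> A\<bar> > 1 + \<bar>\<nu> E\<bar>"
      by (auto simp: not_le)
    have D: "\<nu> (E - A) = \<nu> E - \<nu> A" "E - A \<in> R" "A \<in> R" using measure_Diff[OF E A(1,2)] by auto
    have b: "1 \<le> \<bar>\<nu> A\<bar>" "1 \<le> \<bar>\<nu> (E - A)\<bar>" using A(3) D(1) by auto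
    have "unb A \<or> unb (E - A)"
    proof (rule ccontr)
      assume "\<not> ?thesis"
      then have e: "\<exists>C. \<forall>B\<in>sets borel. B \<subseteq> A \<longrightarrow> \<bar>\<nu> B\<bar> \<le> C"
        "\<exists>C. \<forall>B\<in>sets borel. B \<subseteq> E - A \<longrightarrow> \<bar>\<nu> B\<bar> \<le> C"
        using D(2,3) unfolding unb_def by simp_all
      obtain C1 where C1: "\<forall>B\<in>sets borel. B \<subseteq> A \<longrightarrow> \<bar>\<nu> B\<bar> \<le> C1" using e(1) ..
      obtain C2 where C2: "\<forall>B\<in>sets borel. B \<subseteq> E - A \<longrightarrow> \<bar>\<nu> B\<bar> \<le> C2" using e(2) ..
      have "\<bar>\<nu> B\<bar> \<le> C1 + C2" if B: "B \<in> sets borel" "B \<subseteq> E" for B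
      proof -
        have "\<nu> ((B \<inter> A) \<union> (B - A)) = \<nu> (B \<inter> A) + \<nu> (B - A)"
          using A(1) B by (intro measure_Un R_subset[OF E] sets.Int sets.Diff) blast+
        moreover have "(B \<inter> A) \<union> (B - A) = B" by blast
        ultimately have "\<nu> B = \<nu> (B \<inter> A) + \<nu> (B - A)" by simp
        moreover have "\<bar>\<nu> (B \<inter> A)\<bar> \<le> C1"
          by (rule C1[rule_format, OF sets.Int[OF B(1) A(1)]]) simp
        moreover have "\<bar>\<nu> (B - A)\<bar> \<le> C2"
          by (rule C2[rule_format, OF sets.Diff[OF B(1) A(1)] Diff_mono[OF B(2) subset_refl]])
        ultimately show ?thesis by linarith
      qed
      then have "\<exists>C. \<forall>A\<in>sets borel. A \<subseteq> E \<longrightarrow> \<bar>\<nu> A\<bar> \<le> C" by (intro exI ballI impI)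
      then show False using that unfolding unb_def by (elim conjE notE)
    qed
    then show ?thesis
    proof
      assume "unb A" then show ?thesis using A b by (intro exI[of _ A]) simp
    next
      assume "unb (E - A)"
      moreover have "E - (E - A) = A" using A by auto
      ultimately show ?thesis using b by (intro exI[of _ "E - A"]) simp
    qed
  qed
  \<comment> \<open>A decreasing sequence of sets on which the measure stays unbounded.\<close>
  define F where "F = rec_nat S (\<lambda>_ E. SOME E'. unb E' \<and> E' \<subseteq> E \<and> 1 \<le> \<bar>\<nu> (E - E')\<bar>)"
  have F0: "F 0 = S" and FS: "F (Suc n) = (SOME E'. unb E' \<and> E' \<subseteq> F n \<and> 1 \<le> \<bar>\<nu> (F n - E')\<bar>)" for n
    by (simp_all add: F_def)
  have Fu: "unb (F n)" for n
  proof (induction n)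
    case 0 show ?case using unbS F0 by simp
  next
    case (Suc n) show ?case using someI_ex[OF step[OF Suc]] unfolding FS by simp
  qed
  have Fs: "F (Suc n) \<subseteq> F n" "1 \<le> \<bar>\<nu> (F n - F (Suc n))\<bar>" for n
    using someI_ex[OF step[OF Fu[of n]]] unfolding FS by simp_all
  have dec: "m \<le> n \<Longrightarrow> F n \<subseteq> F m" for m n
    using Fs(1) by (rule lift_Suc_antimono_le)
  define D where "D n = F n - F (Suc n)" for n
  have FR: "F n \<in> R" for n using Fu by (simp add: unb_def)
  have DR: "D n \<in> R" for n unfolding D_def
    by (rule R_subset[OF FR[of n]]) (use R_borel[OF FR] in auto)
  have "(\<lambda>n. \<nu> (D n)) sums \<nu> (\<Union>n. D n)"
  proof (rule R_sums[OF DR])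
    show "disjoint_family D"
    proof (unfold disjoint_family_on_def, intro ballI impI)
      fix m n :: nat assume "m \<noteq> n"
      then have "m < n \<or> n < m" by auto
      then show "D m \<inter> D n = {}"
        using dec[of "Suc m" n] dec[of "Suc n" m] by (auto simp: D_def)
    qed
    have "(\<Union>n. D n) \<subseteq> S" using dec[of 0] F0 by (auto simp: D_def)
    moreover have "(\<Union>n. D n) \<in> sets borel" using R_borel[OF DR] by auto
    ultimately show "(\<Union>n. D n) \<in> R" using R_subset[OF S] by blast
  qed
  then have "(\<lambda>n. \<nu> (D n)) \<longlonglongrightarrow> 0" using sums_summable summable_LIMSEQ_zero by blast
  then have "\<forall>\<^sub>F n in sequentially. \<bar>\<nu> (D n)\<bar> < 1"
    using order_tendstoD(2)[OF tendsto_rabs_zero zero_less_one] by blast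
  then obtain n where "\<bar>\<nu> (D n)\<bar> < 1" by (auto simp: eventually_sequentially)
  then show False using Fs(2)[of n] by (simp add: D_def)
qed

lemma emeasure_variation:
  assumes "E \<in> sets borel"
  shows "emeasure (variation R \<nu>) E = (SUP A\<in>{A\<in>R. A \<subseteq> E}. ennreal (\<nu> A))"
proof -
  let ?p = "\<lambda>E. SUP A\<in>{A\<in>R. A \<subseteq> E}. ennreal (\<nu> A)"
  have upper: "A \<in> R \<Longrightarrow> A \<subseteq> E \<Longrightarrow> ennreal (\<nu> A) \<le> ?p E" for A E
    by (rule SUP_upper) auto
  have p0: "?p {} = 0"
  proof -
    have "{A\<in>R. A \<subseteq> {}} = {{}}" using R_empty by auto
    then show ?thesis by (simp add: measure_empty)
  qed
  have padd: "?p A + ?p B \<le> ?p (A \<union> B)" if AB: "A \<inter> B = {}" for A B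
  proof -
    have "ennreal (\<nu> A') + ennreal (\<nu> B') \<le> ?p (A \<union> B)"
      if "A' \<in> R" "A' \<subseteq> A" "B' \<in> R" "B' \<subseteq> B" for A' B'
    proof (cases "0 \<le> \<nu> A' \<and> 0 \<le> \<nu> B'")
      case True
      have "\<nu> (A' \<union> B') = \<nu> A' + \<nu> B'" using that AB by (intro measure_Un) auto
      then have "ennreal (\<nu> A') + ennreal (\<nu> B') = ennreal (\<nu> (A' \<union> B'))" using True by simp
      also have "\<dots> \<le> ?p (A \<union> B)" using that by (intro upper R_Un) auto
      finally show ?thesis .
    next
      case False
      then show ?thesis
        using upper[of A' "A \<union> B"] upper[of B' "A \<union> B"] that
        by (auto simp: not_le ennreal_neg le_supI1 le_supI2 less_imp_le)
    qed
    note * = this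
    have ne: "{A'\<in>R. A' \<subseteq> A} \<noteq> {}" "{A'\<in>R. A' \<subseteq> B} \<noteq> {}" using R_empty by auto
    have "?p A + ?p B = (SUP A'\<in>{A'\<in>R. A' \<subseteq> A}. ennreal (\<nu> A') + ?p B)"
      by (rule ennreal_SUP_add_left[OF ne(1), symmetric])
    also have "\<dots> \<le> ?p (A \<union> B)"
    proof (rule SUP_least)
      fix A' assume A': "A' \<in> {A'\<in>R. A' \<subseteq> A}"
      have "ennreal (\<nu> A') + ?p B = (SUP B'\<in>{A'\<in>R. A' \<subseteq> B}. ennreal (\<nu> A') + ennreal (\<nu> B'))"
        by (rule ennreal_SUP_add_right[OF ne(2)])
      also have "\<dots> \<le> ?p (A \<union> B)" using A' * by (intro SUP_least) auto
      finally show "ennreal (\<nu> A') + ?p B \<le> ?p (A \<union> B)" .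
    qed
    finally show ?thesis .
  qed
  have mono: "A \<subseteq> B \<Longrightarrow> ?p A \<le> ?p B" for A B by (intro SUP_subset_mono) auto
  show ?thesis unfolding variation_def
  proof (rule emeasure_measure_of_sigma[OF _ _ _ assms])
    show "sigma_algebra UNIV (sets (borel :: real measure))"
      using sets.sigma_algebra_axioms[of borel] by simp
    show "positive (sets borel) ?p" using p0 by (simp add: positive_def)
    show "countably_additive (sets borel) ?p"
    proof (rule countably_additiveI)
      fix A :: "nat \<Rightarrow> real set"
      assume A: "range A \<subseteq> sets borel" "disjoint_family A" "(\<Union>i. A i) \<in> sets borel"
      have "?p (\<Union>i. A i) \<le> (\<Sum>i. ?p (A i))"
      proof (rule SUP_least)
        fix B assume B: "B \<in> {B\<in>R. B \<subseteq> (\<Union>i. A i)}"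
        have BR: "B \<in> R" using B by simp
        have BA: "B \<inter> A i \<in> R" for i
        proof (rule R_subset[OF BR])
          have "A i \<in> sets borel" using A(1) by blast
          then show "B \<inter> A i \<in> sets borel" using R_borel[OF BR] by blast
        qed simp
        have BU: "(\<Union>i. B \<inter> A i) = B" using B by auto
        have "disjoint_family (\<lambda>i. B \<inter> A i)"
          using A(2) by (fastforce simp: disjoint_family_on_def)
        then have s: "(\<lambda>i. \<nu> (B \<inter> A i)) sums \<nu> B"
          using R_sums[of "\<lambda>i. B \<inter> A i", OF BA] BR unfolding BU by blast
        have "\<nu> B \<le> (\<Sum>i. max 0 (\<nu> (B \<inter> A i)))"
          if "summable (\<lambda>i. max 0 (\<nu> (B \<inter> A i)))"
          using sums_le[OF _ s summable_sums[OF that]] by simp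
        note * = this
        show "ennreal (\<nu> B) \<le> (\<Sum>i. ?p (A i))"
        proof (cases "summable (\<lambda>i. max 0 (\<nu> (B \<inter> A i)))")
          case True
          have "ennreal (\<nu> B) \<le> ennreal (\<Sum>i. max 0 (\<nu> (B \<inter> A i)))"
            using *[OF True] by (rule ennreal_leI)
          also have "\<dots> = (\<Sum>i. ennreal (max 0 (\<nu> (B \<inter> A i))))"
            by (rule suminf_ennreal2[symmetric]) (use True in auto)
          also have "\<dots> \<le> (\<Sum>i. ?p (A i))"
            by (intro suminf_le) (simp_all add: ennreal_max_0 upper[OF BA])
          finally show ?thesis .
        next
          case False
          have "(\<Sum>i. ennreal (max 0 (\<nu> (B \<inter> A i)))) = top"
            by (rule ccontr) (use False summable_suminf_not_top[of "\<lambda>i. max 0 (\<nu> (B \<inter> A i))"] in simp)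
          moreover have "(\<Sum>i. ennreal (max 0 (\<nu> (B \<inter> A i)))) \<le> (\<Sum>i. ?p (A i))"
            by (intro suminf_le) (simp_all add: ennreal_max_0 upper[OF BA])
          ultimately show ?thesis by (simp add: top_unique)
        qed
      qed
      moreover have "(\<Sum>i. ?p (A i)) \<le> ?p (\<Union>i. A i)"
      proof -
        have "(\<Sum>i<n. ?p (A i)) \<le> ?p (\<Union>i<n. A i)" for n
        proof (induction n)
          case 0 show ?case using p0 by simp
        next
          case (Suc n)
          have "A i \<inter> A n = {}" if "i < n" for i
            using disjoint_family_onD[OF A(2)] that by simp
          then have "(\<Union>i<n. A i) \<inter> A n = {}" by blast
          then have 2: "?p (\<Union>i<n. A i) + ?p (A n) \<le> ?p ((\<Union>i<n. A i) \<union> A n)"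
            by (rule padd)
          have 3: "(\<Union>i<n. A i) \<union> A n = (\<Union>i<Suc n. A i)" by (auto simp: lessThan_Suc)
          have "(\<Sum>i<Suc n. ?p (A i)) \<le> ?p (\<Union>i<n. A i) + ?p (A n)"
            unfolding sum.lessThan_Suc by (rule add_right_mono[OF Suc])
          also note 2[unfolded 3]
          finally show ?case .
        qed
        then have "(\<Sum>i<n. ?p (A i)) \<le> ?p (\<Union>i. A i)" for n
          by (rule order_trans[OF _ mono]) auto
        then show ?thesis by (intro suminf_le_const) auto
      qed
      ultimately show "(\<Sum>i. ?p (A i)) = ?p (\<Union>i. A i)" by (intro antisym)
    qed
  qed
qed

lemma variation_finite:
  assumes "S \<in> R" shows "emeasure (variation R \<nu>) S < \<infinity>"
proof -
  obtain C where C: "\<And>A. A \<in> sets borel \<Longrightarrow> A \<subseteq> S \<Longrightarrow> \<bar>\<nu> A\<bar> \<le> C" using measure_bounded[OF assms] by blast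
  have "emeasure (variation R \<nu>) S \<le> ennreal C"
    unfolding emeasure_variation[OF R_borel[OF assms]]
  proof (intro SUP_least ennreal_leI)
    fix A assume "A \<in> {A\<in>R. A \<subseteq> S}"
    then show "\<nu> A \<le> C" using C[of A] R_borel[of A] by simp
  qed
  then show ?thesis by (simp add: le_less_trans)
qed

lemma signed_ring_uminus: "signed_ring R (\<lambda>A. - \<nu> A)"
proof
  show "(\<lambda>n. - \<nu> (F n)) sums - \<nu> (\<Union>n. F n)"
    if "\<And>n::nat. F n \<in> R" "disjoint_family F" "(\<Union>n. F n) \<in> R" for F
    by (intro sums_minus R_sums that)
  show "A \<in> sets borel" if "A \<in> R" for A using that by (rule R_borel)
  show "B \<in> R" if "A \<in> R" "B \<in> sets borel" "B \<subseteq> A" for A B using that by (rule R_subset)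
  show "A \<union> B \<in> R" if "A \<in> R" "B \<in> R" for A B using that by (rule R_Un)
  show "{} \<in> R" by (rule R_empty)
qed

text \<open>
  For \<open>A \<subseteq> S\<close> one has \<open>\<nu> A = \<nu> S - \<nu> (S - A)\<close>; the supremum over \<open>A\<close> turns this into the relation between
  the positive and the negative variation, without a Hahn decomposition.
\<close>

lemma jordan_decomposition:
  assumes S: "S \<in> R"
  shows "\<nu> S = measure (variation R \<nu>) S - measure (variation R (\<lambda>A. - \<nu> A)) S"
proof -
  interpret n: signed_ring R "\<lambda>A. - \<nu> A" by (rule signed_ring_uminus)
  let ?P = "variation R \<nu>" and ?N = "variation R (\<lambda>A. - \<nu> A)"
  have Sb: "S \<in> sets borel" using R_borel[OF S] .
  have P: "emeasure ?P S = ennreal (measure ?P S)" and N: "emeasure ?N S = ennreal (measure ?N S)"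
    using variation_finite[OF S] n.variation_finite[OF S]
    by (auto intro!: emeasure_eq_ennreal_measure simp: less_top)
  have 1: "\<nu> A \<le> measure ?P S" "- \<nu> A \<le> measure ?N S" if "A \<in> R" "A \<subseteq> S" for A
  proof -
    have "ennreal (\<nu> A) \<le> ennreal (measure ?P S)" "ennreal (- \<nu> A) \<le> ennreal (measure ?N S)"
      unfolding P[symmetric] N[symmetric] emeasure_variation[OF Sb] n.emeasure_variation[OF Sb]
      using that by (auto intro!: SUP_upper)
    then show "\<nu> A \<le> measure ?P S" "- \<nu> A \<le> measure ?N S"
      by (auto simp: ennreal_le_iff2 intro: order_trans[OF _ measure_nonneg])
  qed
  have split: "\<nu> (S - A) = \<nu> S - \<nu> A" "S - A \<in> R" if "A \<in> R" "A \<subseteq> S" for A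
    using measure_Diff[OF S R_borel[OF that(1)] that(2)] by auto
  have "measure ?P S \<le> \<nu> S + measure ?N S"
  proof -
    have "0 \<le> \<nu> S + measure ?N S" using 1(2)[OF S] by simp
    moreover have "emeasure ?P S \<le> ennreal (\<nu> S + measure ?N S)"
      unfolding emeasure_variation[OF Sb]
    proof (intro SUP_least ennreal_leI)
      fix A assume "A \<in> {A\<in>R. A \<subseteq> S}"
      then show "\<nu> A \<le> \<nu> S + measure ?N S" using 1(2)[of "S - A"] split[of A] by auto
    qed
    ultimately show ?thesis unfolding P by (simp add: ennreal_le_iff)
  qed
  moreover have "measure ?N S \<le> measure ?P S - \<nu> S"
  proof -
    have "0 \<le> measure ?P S - \<nu> S" using 1(1)[OF S] by simp
    moreover have "emeasure ?N S \<le> ennreal (measure ?P S - \<nu> S)"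
      unfolding n.emeasure_variation[OF Sb]
    proof (intro SUP_least ennreal_leI)
      fix A assume "A \<in> {A\<in>R. A \<subseteq> S}"
      then show "- \<nu> A \<le> measure ?P S - \<nu> S" using 1(1)[of "S - A"] split[of A] by auto
    qed
    ultimately show ?thesis unfolding N by (simp add: ennreal_le_iff)
  qed
  ultimately show ?thesis by simp
qed

lemma pos_variation_eq:
  assumes S: "S \<in> R"
  shows "pos_variation S \<nu> = density (variation R \<nu>) (indicator S)"
proof -
  have Sb: "S \<in> sets borel" using R_borel[OF S] .
  have "pos_variation S \<nu> = measure_of UNIV (sets borel) (emeasure (density (variation R \<nu>) (indicator S)))"
    unfolding pos_variation_def
  proof (rule measure_of_eq)
    fix E :: "real set" assume "E \<in> sigma_sets UNIV (sets borel)"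
    then have E: "E \<in> sets borel" by (simp add: sets.sigma_sets_eq[of borel, simplified])
    have "emeasure (density (variation R \<nu>) (indicator S)) E = emeasure (variation R \<nu>) (S \<inter> E)"
      using E Sb by (subst emeasure_density) (auto simp: indicator_inter_arith[symmetric])
    also have "\<dots> = (SUP A\<in>{A\<in>R. A \<subseteq> S \<inter> E}. ennreal (\<nu> A))"
      by (rule emeasure_variation) (use E Sb in auto)
    also have "{A\<in>R. A \<subseteq> S \<inter> E} = {A \<in> sets borel. A \<subseteq> E \<inter> S}"
    proof (rule Collect_cong, rule iffI)
      show "A \<in> sets borel \<and> A \<subseteq> E \<inter> S" if "A \<in> R \<and> A \<subseteq> S \<inter> E" for A
        using that R_borel[of A] by simp
      show "A \<in> R \<and> A \<subseteq> S \<inter> E" if "A \<in> sets borel \<and> A \<subseteq> E \<inter> S" for A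
        using that R_subset[OF S, of A] by simp
    qed
    finally show "(SUP A\<in>{A \<in> sets borel. A \<subseteq> E \<inter> S}. ennreal (\<nu> A)) =
        emeasure (density (variation R \<nu>) (indicator S)) E" by simp
  qed simp
  also have "\<dots> = density (variation R \<nu>) (indicator S)"
    using measure_of_of_measure[of "density (variation R \<nu>) (indicator S)"] by simp
  finally show ?thesis .
qed

lemma integral_pos_variation:
  fixes f :: "real \<Rightarrow> complex"
  assumes S: "S \<in> R" and f: "(\<lambda>x. indicator S x *\<^sub>R f x) \<in> borel_measurable borel"
  shows "(LINT x:S|pos_variation S \<nu>. f x) = (LINT x:S|variation R \<nu>. f x)"
proof -
  have Sb: "S \<in> sets borel" using R_borel[OF S] .
  have "(LINT x:S|pos_variation S \<nu>. f x) =
      integral\<^sup>L (density (variation R \<nu>) (\<lambda>x. ennreal (indicator S x))) (\<lambda>x. indicator S x *\<^sub>R f x)"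
    unfolding set_lebesgue_integral_def pos_variation_eq[OF S] ennreal_indicator ..
  also have "\<dots> = integral\<^sup>L (variation R \<nu>) (\<lambda>x. indicator S x *\<^sub>R (indicator S x *\<^sub>R f x))"
    using f Sb by (intro integral_density) auto
  also have "\<dots> = (LINT x:S|variation R \<nu>. f x)"
    unfolding set_lebesgue_integral_def by (intro Bochner_Integration.integral_cong) (auto split: split_indicator)
  finally show ?thesis .
qed

end

section \<open>Densities with respect to a dominating measure\<close>

lemma finite_sum_measure:
  fixes V :: "'k \<Rightarrow> real measure"
  assumes V: "\<And>k. k \<in> I \<Longrightarrow> sets (V k) = sets borel"
  shows "\<exists>M::real measure. sets M = sets borel \<and>
    (\<forall>E\<in>sets borel. emeasure M E = (\<Sum>k\<in>I. emeasure (V k) E))"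
proof -
  define M :: "real measure" where "M = measure_of UNIV (sets borel) (\<lambda>E. \<Sum>k\<in>I. emeasure (V k) E)"
  have 1: "sets M = sets borel" unfolding M_def by (simp add: sets.sigma_sets_eq[of borel, simplified])
  have 2: "emeasure M E = (\<Sum>k\<in>I. emeasure (V k) E)" if E: "E \<in> sets borel" for E
    unfolding M_def
  proof (rule emeasure_measure_of_sigma[OF _ _ _ E])
    show "sigma_algebra UNIV (sets (borel :: real measure))"
      using sets.sigma_algebra_axioms[of borel] by simp
    show "positive (sets borel) (\<lambda>E. \<Sum>k\<in>I. emeasure (V k) E)" by (simp add: positive_def)
    show "countably_additive (sets borel) (\<lambda>E. \<Sum>k\<in>I. emeasure (V k) E)"
    proof (rule countably_additiveI)
      fix A :: "nat \<Rightarrow> real set"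
      assume A: "range A \<subseteq> sets borel" "disjoint_family A" "(\<Union>i. A i) \<in> sets borel"
      have "(\<Sum>i. \<Sum>k\<in>I. emeasure (V k) (A i)) = (\<Sum>k\<in>I. \<Sum>i. emeasure (V k) (A i))"
        by (rule suminf_sum) simp
      also have "\<dots> = (\<Sum>k\<in>I. emeasure (V k) (\<Union>i. A i))"
        using A V by (intro sum.cong refl suminf_emeasure) simp_all
      finally show "(\<Sum>i. \<Sum>k\<in>I. emeasure (V k) (A i)) = (\<Sum>k\<in>I. emeasure (V k) (\<Union>i. A i))" .
    qed
  qed
  show ?thesis using 1 2 by (intro exI[of _ M]) simp
qed

text \<open>
  The Radon--Nikodym derivative, modified on a null set so as to be finite and real.
\<close>

lemma dominated_density:
  fixes M N :: "real measure"
  assumes M: "sigma_finite_measure M" "sets M = sets borel" and N: "sets N = sets borel"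
    and le: "\<And>E. E \<in> sets borel \<Longrightarrow> emeasure N E \<le> emeasure M E"
  shows "\<exists>h::real \<Rightarrow> real. h \<in> borel_measurable borel \<and> (\<forall>x. 0 \<le> h x) \<and> N = density M (\<lambda>x. ennreal (h x))"
proof -
  interpret M: sigma_finite_measure M by (rule M(1))
  have spM: "space M = UNIV" and spN: "space N = UNIV"
    using sets_eq_imp_space_eq[OF M(2)] sets_eq_imp_space_eq[OF N] by simp_all
  have mM: "measurable M X = measurable borel X" for X :: "'z measure"
    by (rule measurable_cong_sets[OF M(2) refl])
  have ac: "absolutely_continuous M N"
    unfolding absolutely_continuous_def
  proof
    fix E assume "E \<in> null_sets M"
    then have E: "E \<in> sets borel" "emeasure M E = 0" by (auto simp: null_sets_def M(2))
    then have "emeasure N E = 0" using le[OF E(1)] by simp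
    then show "E \<in> null_sets N" using E by (simp add: null_sets_def N)
  qed
  have "\<exists>A. countable A \<and> A \<subseteq> sets N \<and> \<Union>A = space N \<and> (\<forall>a\<in>A. emeasure N a \<noteq> \<infinity>)"
  proof -
    obtain A where A: "countable A" "A \<subseteq> sets M" "\<Union>A = space M" "\<forall>a\<in>A. emeasure M a \<noteq> \<infinity>"
      using M.sigma_finite_countable by blast
    have "emeasure N a \<noteq> \<infinity>" if "a \<in> A" for a
      using le[of a] A that unfolding M(2) by (metis infinity_ennreal_def neq_top_trans subsetD)
    then show ?thesis using A by (intro exI[of _ A]) (simp add: M(2) N spM spN)
  qed
  then have sN: "sigma_finite_measure N" by unfold_locales
  let ?h = "\<lambda>x. enn2real (RN_deriv M N x)"
  have fin: "AE x in M. RN_deriv M N x \<noteq> \<infinity>"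
    by (rule M.RN_deriv_finite[OF sN ac]) (simp add: M N)
  have "N = density M (RN_deriv M N)"
    by (rule M.density_RN_deriv[OF ac, symmetric]) (simp add: M N)
  also have "\<dots> = density M (\<lambda>x. ennreal (?h x))"
  proof (rule density_cong)
    show "AE x in M. RN_deriv M N x = ennreal (?h x)"
      using fin by eventually_elim (simp add: less_top)
  qed simp_all
  finally have "N = density M (\<lambda>x. ennreal (?h x))" .
  moreover have "?h \<in> borel_measurable borel" unfolding mM[symmetric] by measurable
  ultimately show ?thesis by (intro exI[of _ ?h]) simp
qed

text \<open>
  The last clause records that integrals against \<open>\<nu>\<close>, defined through variations that depend on the set
  \<open>E\<close>, are integrals with the density \<open>g\<close> for all bounded measurable functions on \<open>E\<close>.
\<close>

definition cdensity :: "real set set \<Rightarrow> real measure \<Rightarrow> (real set \<Rightarrow> complex) \<Rightarrow> (real \<Rightarrow> complex) \<Rightarrow> bool" where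
  "cdensity R M \<nu> g \<longleftrightarrow> g \<in> borel_measurable borel \<and>
     (\<forall>E\<in>R. set_integrable M E g \<and> \<nu> E = (LINT x:E|M. g x) \<and>
        (\<forall>f. (\<lambda>x. indicator E x *\<^sub>R f x) \<in> borel_measurable borel \<longrightarrow> (\<exists>C. \<forall>x\<in>E. norm (f x) \<le> C) \<longrightarrow>
           cmeasure_integral \<nu> E f = (LINT x:E|M. g x * f x)))"

lemma set_integrable_mult_bounded:
  fixes f g :: "real \<Rightarrow> complex"
  assumes M: "sets M = sets borel" and g: "set_integrable M E g" "g \<in> borel_measurable borel"
    and f: "(\<lambda>x. indicator E x *\<^sub>R f x) \<in> borel_measurable borel" and C: "\<And>x. x \<in> E \<Longrightarrow> norm (f x) \<le> C"
  shows "set_integrable M E (\<lambda>x. g x * f x)"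
  unfolding set_integrable_def
proof (rule Bochner_Integration.integrable_bound[where f="\<lambda>x. C *\<^sub>R (indicat_real E x *\<^sub>R g x)"])
  have mM: "measurable M X = measurable borel X" for X :: "'z measure"
    by (rule measurable_cong_sets[OF M refl])
  show "integrable M (\<lambda>x. C *\<^sub>R indicat_real E x *\<^sub>R g x)"
    using g(1) unfolding set_integrable_def by (rule integrable_scaleR_right)
  have "(\<lambda>x. g x * (indicator E x *\<^sub>R f x)) \<in> borel_measurable M"
    unfolding mM using g(2) f by (rule borel_measurable_times)
  then show "(\<lambda>x. indicat_real E x *\<^sub>R (g x * f x)) \<in> borel_measurable M" by simp
  show "AE x in M. norm (indicat_real E x *\<^sub>R (g x * f x)) \<le> norm (C *\<^sub>R indicat_real E x *\<^sub>R g x)"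
  proof (rule AE_I2)
    fix x
    show "norm (indicat_real E x *\<^sub>R (g x * f x)) \<le> norm (C *\<^sub>R indicat_real E x *\<^sub>R g x)"
    proof (cases "x \<in> E")
      case True
      have "norm (f x) * norm (g x) \<le> \<bar>C\<bar> * norm (g x)"
        using C[OF True] by (intro mult_right_mono) auto
      then show ?thesis using True by (simp add: norm_mult mult.commute)
    qed simp
  qed
qed

lemma set_integrable_complex_of_real:
  assumes "set_integrable M E f" shows "set_integrable M E (\<lambda>x. complex_of_real (f x))"
proof -
  have "(\<lambda>x. indicat_real E x *\<^sub>R complex_of_real (f x)) = (\<lambda>x. complex_of_real (indicat_real E x *\<^sub>R f x))"
    by (simp add: scaleR_conv_of_real fun_eq_iff)
  then show ?thesis using assms unfolding set_integrable_def by (simp only: integrable_of_real)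
qed

definition sdensity :: "real set set \<Rightarrow> real measure \<Rightarrow> (real set \<Rightarrow> real) \<Rightarrow> (real \<Rightarrow> real) \<Rightarrow> bool" where
  "sdensity R M \<nu> g \<longleftrightarrow> g \<in> borel_measurable borel \<and>
     (\<forall>E\<in>R. set_integrable M E g \<and> \<nu> E = (LINT x:E|M. g x) \<and>
        (\<forall>f. (\<lambda>x. indicator E x *\<^sub>R f x) \<in> borel_measurable borel \<longrightarrow> (\<exists>C. \<forall>x\<in>E. norm (f x) \<le> C) \<longrightarrow>
           signed_integral \<nu> E f = (LINT x:E|M. of_real (g x) * f x)))"

text \<open>
  Both variations of \<open>\<nu>\<close> are dominated by \<open>M\<close>; the density of \<open>\<nu>\<close> is the difference of their densities.
\<close>

lemma signed_density:
  assumes \<nu>: "signed_ring R \<nu>" and M: "sigma_finite_measure M" "sets M = sets borel"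
    and le1: "\<And>E. E \<in> sets borel \<Longrightarrow> emeasure (variation R \<nu>) E \<le> emeasure M E"
    and le2: "\<And>E. E \<in> sets borel \<Longrightarrow> emeasure (variation R (\<lambda>A. - \<nu> A)) E \<le> emeasure M E"
  shows "\<exists>g. sdensity R M \<nu> g"
proof -
  interpret p: signed_ring R \<nu> by (rule \<nu>)
  interpret n: signed_ring R "\<lambda>A. - \<nu> A" by (rule p.signed_ring_uminus)
  have mM: "measurable M X = measurable borel X" for X :: "'z measure"
    by (rule measurable_cong_sets[OF M(2) refl])
  let ?P = "variation R \<nu>" and ?N = "variation R (\<lambda>A. - \<nu> A)"
  obtain h where h: "h \<in> borel_measurable borel" "\<And>x. 0 \<le> h x" "?P = density M (\<lambda>x. ennreal (h x))"
    using dominated_density[OF M sets_variation le1] by blast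
  obtain k where k: "k \<in> borel_measurable borel" "\<And>x. 0 \<le> k x" "?N = density M (\<lambda>x. ennreal (k x))"
    using dominated_density[OF M sets_variation le2] by blast
  have one: "set_integrable M E h' \<and> measure (density M (\<lambda>x. ennreal (h' x))) E = (LINT x:E|M. h' x) \<and>
     (\<forall>f. (\<lambda>x. indicator E x *\<^sub>R f x) \<in> borel_measurable borel \<longrightarrow>
        (LINT x:E|density M (\<lambda>x. ennreal (h' x)). f x) = (LINT x:E|M. complex_of_real (h' x) * f x))"
    if h': "h' \<in> borel_measurable borel" "\<And>x. 0 \<le> h' x"
      and fin: "emeasure (density M (\<lambda>x. ennreal (h' x))) E < \<infinity>" and E: "E \<in> sets borel" for E and h' :: "real \<Rightarrow> real"
  proof -
    have hM: "h' \<in> borel_measurable M" using h' by (simp add: mM)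
    have EM: "E \<in> sets M" using E M by simp
    have "emeasure (density M (\<lambda>x. ennreal (h' x))) E = (\<integral>\<^sup>+x. ennreal (h' x) * indicator E x \<partial>M)"
      using hM EM by (intro emeasure_density) auto
    also have "\<dots> = (\<integral>\<^sup>+x. ennreal (indicator E x *\<^sub>R h' x) \<partial>M)"
      by (intro nn_integral_cong) (simp split: split_indicator)
    finally have em: "emeasure (density M (\<lambda>x. ennreal (h' x))) E = (\<integral>\<^sup>+x. ennreal (indicator E x *\<^sub>R h' x) \<partial>M)" .
    have meas: "(\<lambda>x. indicator E x *\<^sub>R h' x) \<in> borel_measurable M"
      using hM EM by measurable
    have int: "integrable M (\<lambda>x. indicator E x *\<^sub>R h' x)"
      using meas fin h'(2) unfolding em by (intro integrableI_nonneg) (auto simp: less_top)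
    have "emeasure (density M (\<lambda>x. ennreal (h' x))) E = ennreal (LINT x:E|M. h' x)"
      unfolding em set_lebesgue_integral_def using int h'(2) by (intro nn_integral_eq_integral) auto
    moreover have "0 \<le> (LINT x:E|M. h' x)"
      unfolding set_lebesgue_integral_def using h'(2) by (intro integral_nonneg_AE) auto
    ultimately have "measure (density M (\<lambda>x. ennreal (h' x))) E = (LINT x:E|M. h' x)"
      by (simp add: measure_def)
    moreover have "(LINT x:E|density M (\<lambda>x. ennreal (h' x)). f x) = (LINT x:E|M. complex_of_real (h' x) * f x)"
      if f: "(\<lambda>x. indicator E x *\<^sub>R f x) \<in> borel_measurable borel" for f :: "real \<Rightarrow> complex"
    proof -
      have "(LINT x:E|density M (\<lambda>x. ennreal (h' x)). f x) = integral\<^sup>L M (\<lambda>x. h' x *\<^sub>R (indicator E x *\<^sub>R f x))"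
        unfolding set_lebesgue_integral_def using f hM h'(2) by (intro integral_density) (auto simp: mM)
      also have "\<dots> = (LINT x:E|M. complex_of_real (h' x) * f x)"
        unfolding set_lebesgue_integral_def
        by (intro Bochner_Integration.integral_cong) (auto simp: scaleR_conv_of_real)
      finally show ?thesis .
    qed
    ultimately show ?thesis using int by (simp add: set_integrable_def)
  qed
  let ?g = "\<lambda>x. h x - k x"
  have "set_integrable M E ?g \<and> \<nu> E = (LINT x:E|M. ?g x) \<and>
        (\<forall>f. (\<lambda>x. indicator E x *\<^sub>R f x) \<in> borel_measurable borel \<longrightarrow> (\<exists>C. \<forall>x\<in>E. norm (f x) \<le> C) \<longrightarrow>
           signed_integral \<nu> E f = (LINT x:E|M. of_real (?g x) * f x))" if E: "E \<in> R" for E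
  proof -
    have Eb: "E \<in> sets borel" using p.R_borel[OF E] .
    note H = one[OF h(1,2) _ Eb, unfolded h(3)[symmetric], OF p.variation_finite[OF E]]
    note K = one[OF k(1,2) _ Eb, unfolded k(3)[symmetric], OF n.variation_finite[OF E]]
    have 1: "set_integrable M E ?g" using H K by (intro set_integral_diff) auto
    have 2: "\<nu> E = (LINT x:E|M. ?g x)"
      using p.jordan_decomposition[OF E] H K set_integral_diff(2)[of M E h k] by simp
    have 3: "signed_integral \<nu> E f = (LINT x:E|M. of_real (?g x) * f x)"
      if f: "(\<lambda>x. indicator E x *\<^sub>R f x) \<in> borel_measurable borel" and C: "\<exists>C. \<forall>x\<in>E. norm (f x) \<le> C" for f
    proof -
      obtain C where C: "\<And>x. x \<in> E \<Longrightarrow> norm (f x) \<le> C" using C by blast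
      have i: "set_integrable M E (\<lambda>x. complex_of_real (h x))" "set_integrable M E (\<lambda>x. complex_of_real (k x))"
        using H K by (blast intro: set_integrable_complex_of_real)+
      have i2: "set_integrable M E (\<lambda>x. complex_of_real (h x) * f x)" "set_integrable M E (\<lambda>x. complex_of_real (k x) * f x)"
        using i h(1) k(1) by (auto intro!: set_integrable_mult_bounded[OF M(2) _ _ f C])
      have "signed_integral \<nu> E f = (LINT x:E|M. complex_of_real (h x) * f x) - (LINT x:E|M. complex_of_real (k x) * f x)"
        unfolding signed_integral_def p.integral_pos_variation[OF E f] n.integral_pos_variation[OF E f]
        using H K f by simp
      also have "\<dots> = (LINT x:E|M. complex_of_real (h x) * f x - complex_of_real (k x) * f x)"
        by (rule set_integral_diff(2)[symmetric, OF i2])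
      finally show ?thesis by (simp add: left_diff_distrib)
    qed
    show ?thesis using 1 2 3 by blast
  qed
  moreover have "?g \<in> borel_measurable borel" using h(1) k(1) by simp
  ultimately show ?thesis unfolding sdensity_def by (intro exI[of _ ?g]) blast
qed

lemma complex_density:
  fixes \<nu> :: "real set \<Rightarrow> complex"
  assumes re: "signed_ring R (\<lambda>A. Re (\<nu> A))" and im: "signed_ring R (\<lambda>A. Im (\<nu> A))"
    and M: "sigma_finite_measure M" "sets M = sets borel"
    and le: "\<And>E. E \<in> sets borel \<Longrightarrow> emeasure (variation R (\<lambda>A. Re (\<nu> A))) E \<le> emeasure M E"
       "\<And>E. E \<in> sets borel \<Longrightarrow> emeasure (variation R (\<lambda>A. - Re (\<nu> A))) E \<le> emeasure M E"
       "\<And>E. E \<in> sets borel \<Longrightarrow> emeasure (variation R (\<lambda>A. Im (\<nu> A))) E \<le> emeasure M E"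
       "\<And>E. E \<in> sets borel \<Longrightarrow> emeasure (variation R (\<lambda>A. - Im (\<nu> A))) E \<le> emeasure M E"
  shows "\<exists>g. cdensity R M \<nu> g"
proof -
  obtain g where g0: "sdensity R M (\<lambda>A. Re (\<nu> A)) g"
    using signed_density[OF re M le(1,2)] by blast
  have g: "g \<in> borel_measurable borel" "\<And>E. E \<in> R \<Longrightarrow> set_integrable M E g"
     "\<And>E. E \<in> R \<Longrightarrow> Re (\<nu> E) = (LINT x:E|M. g x)"
     "\<And>E f. E \<in> R \<Longrightarrow> (\<lambda>x. indicator E x *\<^sub>R f x) \<in> borel_measurable borel \<Longrightarrow> \<exists>C. \<forall>x\<in>E. norm (f x) \<le> C \<Longrightarrow>
           signed_integral (\<lambda>A. Re (\<nu> A)) E f = (LINT x:E|M. of_real (g x) * f x)"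
    using g0 unfolding sdensity_def by simp_all
  obtain h where h0: "sdensity R M (\<lambda>A. Im (\<nu> A)) h"
    using signed_density[OF im M le(3,4)] by blast
  have h: "h \<in> borel_measurable borel" "\<And>E. E \<in> R \<Longrightarrow> set_integrable M E h"
     "\<And>E. E \<in> R \<Longrightarrow> Im (\<nu> E) = (LINT x:E|M. h x)"
     "\<And>E f. E \<in> R \<Longrightarrow> (\<lambda>x. indicator E x *\<^sub>R f x) \<in> borel_measurable borel \<Longrightarrow> \<exists>C. \<forall>x\<in>E. norm (f x) \<le> C \<Longrightarrow>
           signed_integral (\<lambda>A. Im (\<nu> A)) E f = (LINT x:E|M. of_real (h x) * f x)"
    using h0 unfolding sdensity_def by simp_all
  let ?G = "\<lambda>x. complex_of_real (g x) + \<i> * complex_of_real (h x)"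
  have meas: "?G \<in> borel_measurable borel" using g(1) h(1) by simp
  have "set_integrable M E ?G \<and> \<nu> E = (LINT x:E|M. ?G x) \<and>
        (\<forall>f. (\<lambda>x. indicator E x *\<^sub>R f x) \<in> borel_measurable borel \<longrightarrow> (\<exists>C. \<forall>x\<in>E. norm (f x) \<le> C) \<longrightarrow>
           cmeasure_integral \<nu> E f = (LINT x:E|M. ?G x * f x))" if E: "E \<in> R" for E
  proof -
    have i: "set_integrable M E (\<lambda>x. complex_of_real (g x))" "set_integrable M E (\<lambda>x. \<i> * complex_of_real (h x))"
      using set_integrable_complex_of_real[OF g(2)[OF E]] set_integrable_complex_of_real[OF h(2)[OF E]] by simp_all
    have 1: "set_integrable M E ?G" by (rule set_integral_add(1)[OF i])
    have "(LINT x:E|M. ?G x) = (LINT x:E|M. complex_of_real (g x)) + (LINT x:E|M. \<i> * complex_of_real (h x))"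
      by (rule set_integral_add(2)[OF i])
    also have "\<dots> = complex_of_real (Re (\<nu> E)) + \<i> * complex_of_real (Im (\<nu> E))"
      using g(3)[OF E] h(3)[OF E] by (simp add: set_integral_complex_of_real)
    finally have 2: "\<nu> E = (LINT x:E|M. ?G x)" by (simp add: complex_eq[symmetric])
    have 3: "cmeasure_integral \<nu> E f = (LINT x:E|M. ?G x * f x)"
      if f: "(\<lambda>x. indicator E x *\<^sub>R f x) \<in> borel_measurable borel" and C: "\<exists>C. \<forall>x\<in>E. norm (f x) \<le> C" for f
    proof -
      obtain C' where C': "\<And>x. x \<in> E \<Longrightarrow> norm (f x) \<le> C'" using C by blast
      have i2: "set_integrable M E (\<lambda>x. complex_of_real (g x) * f x)"
        using g(1) by (intro set_integrable_mult_bounded[OF M(2) i(1) _ f C']) simp_all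
      have i3: "set_integrable M E (\<lambda>x. \<i> * complex_of_real (h x) * f x)"
        using h(1) by (intro set_integrable_mult_bounded[OF M(2) i(2) _ f C']) simp_all
      have "(LINT x:E|M. ?G x * f x) = (LINT x:E|M. complex_of_real (g x) * f x + \<i> * complex_of_real (h x) * f x)"
        by (simp add: distrib_right)
      also have "\<dots> = (LINT x:E|M. complex_of_real (g x) * f x) + (LINT x:E|M. \<i> * complex_of_real (h x) * f x)"
        by (rule set_integral_add(2)[OF i2 i3])
      also have "\<dots> = cmeasure_integral \<nu> E f"
        unfolding cmeasure_integral_def g(4)[OF E f C] h(4)[OF E f C] by (simp add: mult.assoc)
      finally show ?thesis ..
    qed
    show ?thesis using 1 2 3 by blast
  qed
  then show ?thesis using meas unfolding cdensity_def by blast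
qed

lemma cdensity_cong_AE:
  assumes c: "cdensity R M \<nu> g" and g': "g' \<in> borel_measurable borel" and ae: "AE x in M. g x = g' x"
    and R: "\<And>E. E \<in> R \<Longrightarrow> E \<in> sets borel" and M: "sets M = sets borel"
  shows "cdensity R M \<nu> g'"
proof -
  have mM: "measurable M X = measurable borel X" for X :: "'z measure"
    by (rule measurable_cong_sets[OF M refl])
  have g: "g \<in> borel_measurable borel" using c by (simp add: cdensity_def)
  have 1: "(\<lambda>x. indicat_real E x *\<^sub>R k x) \<in> borel_measurable M" if "E \<in> R" "k \<in> borel_measurable borel" for E and k :: "real \<Rightarrow> complex"
    unfolding mM using R[OF that(1)] that(2) by measurable
  have ae2: "AE x in M. indicat_real E x *\<^sub>R g x = indicat_real E x *\<^sub>R g' x" for E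
    using ae by eventually_elim simp
  have ae3: "AE x in M. indicat_real E x *\<^sub>R (g x * f x) = indicat_real E x *\<^sub>R (g' x * f x)" for E f
    using ae by eventually_elim simp
  have 2: "set_integrable M E g'" if "E \<in> R" for E
    using c that integrable_cong_AE[OF 1[OF that g] 1[OF that g'] ae2]
    by (simp add: cdensity_def set_integrable_def)
  have 3: "\<nu> E = (LINT x:E|M. g' x)" if "E \<in> R" for E
    using c that integral_cong_AE[OF 1[OF that g] 1[OF that g'] ae2]
    by (simp add: cdensity_def set_lebesgue_integral_def)
  have 4: "(LINT x:E|M. g x * f x) = (LINT x:E|M. g' x * f x)"
    if "E \<in> R" "(\<lambda>x. indicator E x *\<^sub>R f x) \<in> borel_measurable borel" for E f
  proof -
    have "(\<lambda>x. k x * (indicat_real E x *\<^sub>R f x)) \<in> borel_measurable M" if "k \<in> borel_measurable borel" for k :: "real \<Rightarrow> complex"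
      unfolding mM by (rule borel_measurable_times) fact+
    then have m: "(\<lambda>x. indicat_real E x *\<^sub>R (k x * f x)) \<in> borel_measurable M" if "k \<in> borel_measurable borel" for k :: "real \<Rightarrow> complex"
      using that by simp
    show ?thesis unfolding set_lebesgue_integral_def by (rule integral_cong_AE[OF m[OF g] m[OF g'] ae3])
  qed
  show ?thesis using c 2 3 4 g' unfolding cdensity_def by simp
qed

lemma AE_nonneg_if_set_integral_nonneg:
  fixes f :: "real \<Rightarrow> real"
  assumes M: "sets M = sets borel" and S: "S \<in> sets borel" and f: "set_integrable M S f" "f \<in> borel_measurable borel"
    and nn: "\<And>E. E \<in> sets borel \<Longrightarrow> E \<subseteq> S \<Longrightarrow> 0 \<le> (LINT x:E|M. f x)"
  shows "AE x in M. x \<in> S \<longrightarrow> 0 \<le> f x"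
proof -
  define E where "E = S \<inter> {x. f x < 0}"
  have "{x. f x < 0} \<in> sets borel" using f(2) by measurable
  then have E: "E \<in> sets borel" "E \<subseteq> S" using S unfolding E_def by (blast intro: sets.Int)+
  have i: "integrable M (\<lambda>x. - (indicator E x *\<^sub>R f x))"
    using set_integrable_subset[OF f(1) _ E(2)] E(1) M unfolding set_integrable_def by (intro integrable_minus) simp
  have nneg: "0 \<le> - (indicator E x *\<^sub>R f x)" for x by (auto simp: E_def split: split_indicator)
  have "0 \<le> integral\<^sup>L M (\<lambda>x. - (indicator E x *\<^sub>R f x))" by (intro integral_nonneg_AE AE_I2 nneg)
  moreover have "integral\<^sup>L M (\<lambda>x. - (indicator E x *\<^sub>R f x)) \<le> 0"
    using nn[OF E] by (simp add: set_lebesgue_integral_def)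
  ultimately have "integral\<^sup>L M (\<lambda>x. - (indicator E x *\<^sub>R f x)) = 0" by simp
  then have "AE x in M. - (indicator E x *\<^sub>R f x) = 0"
    using integral_nonneg_eq_0_iff_AE[OF i AE_I2[OF nneg]] by blast
  then show ?thesis by eventually_elim (auto simp: E_def split: split_indicator_asm)
qed

section \<open>The coefficients as densities\<close>

text \<open>
  The sets on which a local measure with regular endpoint \<open>0\<close> is finite.
\<close>

definition reg_sets :: "ereal \<Rightarrow> real set set" where
  "reg_sets b = {A \<in> sets borel. \<exists>c\<in>oint b. A \<subseteq> {0<..<c}}"

text \<open>
  The equation in terms of densities.  The matrices \<open>Q x\<close> and \<open>W x\<close> are Hermitian, respectively
  non-negative, at every point and not merely almost everywhere, so that pointwise identities for
  the forms they define need no exceptional sets.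
\<close>

locale canonical_system =
  fixes b :: ereal and M :: "real measure" and Q W :: "real \<Rightarrow> complex^2^2"
  assumes b_pos: "0 < b"
    and sets_M: "sets M = sets borel"
    and sigma_M: "sigma_finite_measure M"
    and AE_oint: "AE x in M. x \<in> oint b"
    and M_finite: "c \<in> oint b \<Longrightarrow> emeasure M {0<..<c} < \<infinity>"
    and Q_meas: "(\<lambda>x. Q x $ i $ j) \<in> borel_measurable borel"
    and W_meas: "(\<lambda>x. W x $ i $ j) \<in> borel_measurable borel"
    and Q_int: "c \<in> oint b \<Longrightarrow> set_integrable M {0<..<c} (\<lambda>x. Q x $ i $ j)"
    and W_int: "c \<in> oint b \<Longrightarrow> set_integrable M {0<..<c} (\<lambda>x. W x $ i $ j)"
    and Q_herm: "hermitian_mat (Q x)"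
    and W_nonneg: "nonneg_mat (W x)"

lemma oint_larger:
  assumes "x \<in> oint b" obtains y where "y \<in> oint b" "x < y" "y \<in> \<rat>"
proof -
  have "ereal x < b" "0 < x" using assms by (auto simp: oint_def)
  then obtain z where z: "ereal x < ereal z" "ereal z < b" using ereal_dense2 by blast
  then obtain y where y: "y \<in> \<rat>" "x < y" "y < z" using Rats_dense_in_real[of x z] by auto
  have "ereal y < b" using y(3) z(2) less_trans[of "ereal y" "ereal z" b] by simp
  then show ?thesis using that[of y] y \<open>0 < x\<close> by (simp add: oint_def)
qed

lemma oint_smaller: "x \<in> oint b \<Longrightarrow> 0 < y \<Longrightarrow> y \<le> x \<Longrightarrow> y \<in> oint b"
  unfolding oint_def using le_less_trans[of "ereal y" "ereal x" b] by simp

lemma oint_borel: "oint b \<in> sets borel"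
  unfolding oint_def by measurable

lemma signed_ring_reg_sets:
  assumes b: "0 < b" and reg: "regular_at_0 b \<mu>" and lin: "bounded_linear f"
  shows "signed_ring (reg_sets b) (\<lambda>A. f (\<mu> A))"
proof
  show "A \<in> sets borel" if "A \<in> reg_sets b" for A using that by (simp add: reg_sets_def)
  show "B \<in> reg_sets b" if "A \<in> reg_sets b" "B \<in> sets borel" "B \<subseteq> A" for A B
    using that unfolding reg_sets_def by (blast intro: subset_trans)
  show "A \<union> B \<in> reg_sets b" if AB: "A \<in> reg_sets b" "B \<in> reg_sets b" for A B
  proof -
    obtain c d where c: "c \<in> oint b" "A \<subseteq> {0<..<c}" and d: "d \<in> oint b" "B \<subseteq> {0<..<d}"
      using AB unfolding reg_sets_def by blast
    have "max c d \<in> oint b" using c d by (simp add: max_def)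
    moreover have "{0<..<c} \<subseteq> {0<..<max c d}" "{0<..<d} \<subseteq> {0<..<max c d}" by auto
    then have "A \<union> B \<subseteq> {0<..<max c d}" using c d by blast
    moreover have "A \<union> B \<in> sets borel" using AB unfolding reg_sets_def by (intro sets.Un) simp_all
    ultimately show ?thesis unfolding reg_sets_def by blast
  qed
  show "{} \<in> reg_sets b"
  proof -
    obtain z where "0 < ereal z" "ereal z < b" using ereal_dense2[OF b] by blast
    then have "z \<in> oint b" by (simp add: oint_def)
    then show ?thesis by (auto simp: reg_sets_def)
  qed
  fix F :: "nat \<Rightarrow> real set"
  assume F: "\<And>n. F n \<in> reg_sets b" "disjoint_family F" "(\<Union>n. F n) \<in> reg_sets b"
  obtain c where c: "c \<in> oint b" "(\<Union>n. F n) \<subseteq> {0<..<c}" using F(3) unfolding reg_sets_def by blast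
  have "measure_on {0<..<c} \<mu>" using reg c(1) unfolding regular_at_0_def by blast
  moreover have "\<forall>n. F n \<in> sets borel \<and> F n \<subseteq> {0<..<c}" using F(1) c(2) unfolding reg_sets_def by blast
  ultimately have "(\<lambda>n. \<mu> (F n)) sums \<mu> (\<Union>n. F n)" using F(2) unfolding measure_on_def by blast
  then show "(\<lambda>n. f (\<mu> (F n))) sums f (\<mu> (\<Union>n. F n))" by (rule bounded_linear.sums[OF lin])
qed

lemma rel_compact_reg:
  assumes b: "0 < b" and "E \<in> rel_compact_borel b" shows "E \<in> reg_sets b"
proof -
  obtain K where K: "compact K" "K \<subseteq> oint b" "E \<subseteq> K" and E: "E \<in> sets borel"
    using assms unfolding rel_compact_borel_def by blast
  obtain z where "0 < ereal z" "ereal z < b" using ereal_dense2[OF b] by blast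
  then have z: "z \<in> oint b" by (simp add: oint_def)
  obtain s where s: "s \<in> insert z K" "\<And>t. t \<in> insert z K \<Longrightarrow> t \<le> s"
    using compact_attains_sup[OF compact_insert[OF K(1), of z]] by blast
  have "s \<in> oint b" using s(1) z K(2) by blast
  then obtain c where c: "c \<in> oint b" "s < c" using oint_larger by blast
  have "E \<subseteq> {0<..<c}"
  proof
    fix x assume "x \<in> E"
    then have "x \<in> K" using K(3) by blast
    then have "x \<le> s" "0 < x" using s(2) K(2) by (auto simp: oint_def)
    then show "x \<in> {0<..<c}" using c(2) by simp
  qed
  then show ?thesis using E c(1) unfolding reg_sets_def by blast
qed

text \<open>
  The hypothesis concerns only sets that are relatively compact in \<open>(0, b)\<close>; countably many
  intervals with rational endpoints cover \<open>(0, b)\<close>, and \<open>M\<close> has no mass elsewhere.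
\<close>

lemma AE_nonneg_oint:
  fixes f :: "real \<Rightarrow> real"
  assumes M: "sets M = sets borel" and ae: "AE x in M. x \<in> oint b" and f: "f \<in> borel_measurable borel"
    and int: "\<And>c. c \<in> oint b \<Longrightarrow> set_integrable M {0<..<c} f"
    and nn: "\<And>E. E \<in> rel_compact_borel b \<Longrightarrow> 0 \<le> (LINT x:E|M. f x)"
  shows "AE x in M. 0 \<le> f x"
proof -
  let ?I = "(\<rat> \<inter> oint b) \<times> (\<rat> \<inter> oint b)"
  have "AE x in M. \<forall>p\<in>?I. x \<in> {fst p..snd p} \<longrightarrow> 0 \<le> f x"
  proof (rule AE_ball_countable')
    show "countable ?I" using countable_rat by (intro countable_SIGMA countable_Int1)
    fix p assume p: "p \<in> ?I"
    then have p': "fst p \<in> oint b" "snd p \<in> oint b" by auto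
    obtain c where c: "c \<in> oint b" "snd p < c" using oint_larger[OF p'(2)] by blast
    have sub: "{fst p..snd p} \<subseteq> {0<..<c}" using p' c by (auto simp: oint_def)
    show "AE x in M. x \<in> {fst p..snd p} \<longrightarrow> 0 \<le> f x"
    proof (rule AE_nonneg_if_set_integral_nonneg[OF M _ _ f])
      show "set_integrable M {fst p..snd p} f"
        by (rule set_integrable_subset[OF int[OF c(1)] _ sub]) (simp add: M)
      fix E assume E: "E \<in> sets borel" "E \<subseteq> {fst p..snd p}"
      have "{fst p..snd p} \<subseteq> oint b" using p' oint_smaller[OF p'(2)] by (auto simp: oint_def)
      then have "E \<in> rel_compact_borel b" using E compact_Icc unfolding rel_compact_borel_def by blast
      then show "0 \<le> (LINT x:E|M. f x)" by (rule nn)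
    qed simp
  qed
  with ae show ?thesis
  proof eventually_elim
    case (elim x)
    obtain s where s: "s \<in> oint b" "x < s" "s \<in> \<rat>" using oint_larger[OF elim(1)] by blast
    have "0 < x" using elim(1) by (simp add: oint_def)
    then obtain r where r: "r \<in> \<rat>" "0 < r" "r < x" using Rats_dense_in_real by blast
    have "r \<in> oint b" using oint_smaller[OF elim(1)] r by simp
    then have "(r, s) \<in> ?I" using r s by simp
    from bspec[OF elim(2) this] show ?case using r(3) s(2) by simp
  qed
qed

lemma set_integral_Re:
  assumes "set_integrable M E f"
  shows "set_integrable M E (\<lambda>x. Re (f x))" "(LINT x:E|M. Re (f x)) = Re (LINT x:E|M. f x)"
proof -
  have eq: "(\<lambda>x. indicat_real E x *\<^sub>R Re (f x)) = (\<lambda>x. Re (indicat_real E x *\<^sub>R f x))" by simp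
  show "set_integrable M E (\<lambda>x. Re (f x))"
    using assms unfolding set_integrable_def eq by (rule integrable_bounded_linear[OF bounded_linear_Re])
  show "(LINT x:E|M. Re (f x)) = Re (LINT x:E|M. f x)"
    using assms unfolding set_integrable_def set_lebesgue_integral_def eq
    by (rule integral_bounded_linear[OF bounded_linear_Re])
qed

lemma AE_zero_oint:
  fixes f :: "real \<Rightarrow> complex"
  assumes M: "sets M = sets borel" and ae: "AE x in M. x \<in> oint b" and f: "f \<in> borel_measurable borel"
    and int: "\<And>c. c \<in> oint b \<Longrightarrow> set_integrable M {0<..<c} f"
    and intE: "\<And>E. E \<in> rel_compact_borel b \<Longrightarrow> set_integrable M E f"
    and z: "\<And>E. E \<in> rel_compact_borel b \<Longrightarrow> (LINT x:E|M. f x) = 0"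
  shows "AE x in M. f x = 0"
proof -
  have *: "AE x in M. 0 \<le> Re (a * f x)" if "a \<noteq> 0" for a
  proof (rule AE_nonneg_oint[OF M ae])
    show "(\<lambda>x. Re (a * f x)) \<in> borel_measurable borel" using f by measurable
    show "set_integrable M {0<..<c} (\<lambda>x. Re (a * f x))" if "c \<in> oint b" for c
      using int[OF that] by (intro set_integral_Re) simp
    show "0 \<le> (LINT x:E|M. Re (a * f x))" if "E \<in> rel_compact_borel b" for E
      using intE[OF that] z[OF that] by (subst set_integral_Re) simp_all
  qed
  have "AE x in M. 0 \<le> Re (1 * f x)" "AE x in M. 0 \<le> Re (-1 * f x)"
    "AE x in M. 0 \<le> Re (\<i> * f x)" "AE x in M. 0 \<le> Re (-\<i> * f x)"
    by (rule *; simp)+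
  then show ?thesis by eventually_elim (simp add: complex_eq_iff)
qed

lemma set_integral_double_sum:
  fixes G :: "2 \<Rightarrow> 2 \<Rightarrow> real \<Rightarrow> complex"
  assumes "\<And>i j. set_integrable M E (G i j)"
  shows "set_integrable M E (\<lambda>x. \<Sum>i\<in>UNIV. \<Sum>j\<in>UNIV. a i j * G i j x)"
    "(LINT x:E|M. \<Sum>i\<in>UNIV. \<Sum>j\<in>UNIV. a i j * G i j x) = (\<Sum>i\<in>UNIV. \<Sum>j\<in>UNIV. a i j * (LINT x:E|M. G i j x))"
proof -
  have eq: "(\<lambda>x. indicat_real E x *\<^sub>R (\<Sum>i\<in>UNIV. \<Sum>j\<in>UNIV. a i j * G i j x)) =
     (\<lambda>x. \<Sum>i\<in>UNIV. \<Sum>j\<in>UNIV. a i j * (indicat_real E x *\<^sub>R G i j x))"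
    by (simp add: scaleR_sum_right)
  have i: "integrable M (\<lambda>x. a i j * (indicat_real E x *\<^sub>R G i j x))" for i j
    using assms[of i j] unfolding set_integrable_def by (rule integrable_mult_right)
  show "set_integrable M E (\<lambda>x. \<Sum>i\<in>UNIV. \<Sum>j\<in>UNIV. a i j * G i j x)"
    unfolding set_integrable_def eq by (intro Bochner_Integration.integrable_sum i)
  have "(LINT x:E|M. \<Sum>i\<in>UNIV. \<Sum>j\<in>UNIV. a i j * G i j x) =
     (\<Sum>i\<in>UNIV. \<Sum>j\<in>UNIV. integral\<^sup>L M (\<lambda>x. a i j * (indicat_real E x *\<^sub>R G i j x)))"
    unfolding set_lebesgue_integral_def eq
    by (subst Bochner_Integration.integral_sum, intro Bochner_Integration.integrable_sum i,
        intro sum.cong refl Bochner_Integration.integral_sum i)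
  then show "(LINT x:E|M. \<Sum>i\<in>UNIV. \<Sum>j\<in>UNIV. a i j * G i j x) = (\<Sum>i\<in>UNIV. \<Sum>j\<in>UNIV. a i j * (LINT x:E|M. G i j x))"
    unfolding set_lebesgue_integral_def by (simp only: integral_mult_right_zero)
qed

text \<open>
  The exceptional null set may depend on \<open>v\<close>; a countable dense set of vectors and continuity in \<open>v\<close>
  remove this dependence.
\<close>

lemma AE_nonneg_mat:
  fixes G :: "real \<Rightarrow> complex^2^2"
  assumes "\<And>v. AE x in M. 0 \<le> Re (\<Sum>i\<in>UNIV. cnj (v $ i) * (G x *v v) $ i)"
    and herm: "AE x in M. hermitian_mat (G x)"
  shows "AE x in M. nonneg_mat (G x)"
proof -
  obtain D :: "(complex^2) set" where D: "countable D" "\<And>X. open X \<Longrightarrow> X \<noteq> {} \<Longrightarrow> \<exists>d\<in>D. d \<in> X"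
    using countable_dense_setE by blast
  have "AE x in M. \<forall>v\<in>D. 0 \<le> Re (\<Sum>i\<in>UNIV. cnj (v $ i) * (G x *v v) $ i)"
    by (rule AE_ball_countable'[OF assms(1) D(1)])
  with herm show ?thesis
  proof eventually_elim
    case (elim x)
    let ?\<phi> = "\<lambda>v::complex^2. Re (\<Sum>i\<in>UNIV. cnj (v $ i) * (G x *v v) $ i)"
    have "continuous_on UNIV ?\<phi>"
      unfolding matrix_vector_mult_def by (auto intro!: continuous_intros)
    then have "open {v. ?\<phi> v < 0}"
      by (intro open_Collect_less continuous_on_const)
    moreover have "\<not> (\<exists>d\<in>D. d \<in> {v. ?\<phi> v < 0})" using elim(2) by (auto simp: not_less)
    ultimately have "{v. ?\<phi> v < 0} = {}" using D(2) by blast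
    then have "0 \<le> ?\<phi> v" for v by (auto simp: not_less)
    then show ?case using elim(1) by (simp add: nonneg_mat_def)
  qed
qed

lemma cdensity_modify:
  fixes G :: "real \<Rightarrow> complex^2^2"
  assumes c: "\<And>i j. cdensity R M (\<lambda>A. q A $ i $ j) (\<lambda>x. G x $ i $ j)" and P0: "P (0::complex^2^2)"
    and ae: "AE x in M. P (G x)"
    and R: "\<And>E. E \<in> R \<Longrightarrow> E \<in> sets borel" and M: "sets M = sets borel"
  shows "\<exists>G'. (\<forall>i j. cdensity R M (\<lambda>A. q A $ i $ j) (\<lambda>x. G' x $ i $ j)) \<and> (\<forall>x. P (G' x))"
proof -
  obtain N where N: "\<And>x. x \<in> space M - N \<Longrightarrow> P (G x)" "N \<in> null_sets M"
    using AE_E3[OF ae] by blast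
  have sp: "space M = UNIV" using sets_eq_imp_space_eq[OF M] by simp
  have Nb: "N \<in> sets borel" using N(2) M by (auto simp: null_sets_def)
  have aeN: "AE x in M. x \<notin> N" using N(2) by (rule AE_not_in)
  define G' where "G' x = (if x \<in> N then 0 else G x)" for x
  have "cdensity R M (\<lambda>A. q A $ i $ j) (\<lambda>x. G' x $ i $ j)" for i j
  proof (rule cdensity_cong_AE[OF c _ _ R M])
    have "(\<lambda>x. G x $ i $ j) \<in> borel_measurable borel" using c[of i j] by (simp add: cdensity_def)
    then have "(\<lambda>x. if x \<in> N then 0 else G x $ i $ j) \<in> borel_measurable borel"
      using Nb by (intro measurable_If_set) simp_all
    then show "(\<lambda>x. G' x $ i $ j) \<in> borel_measurable borel"
      unfolding G'_def by (simp add: if_distrib[of "\<lambda>v. v $ i $ j"] cong: if_cong)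
    show "AE x in M. G x $ i $ j = G' x $ i $ j" using aeN by eventually_elim (simp add: G'_def)
  qed simp
  moreover have "P (G' x)" for x using N(1)[of x] P0 by (simp add: G'_def sp)
  ultimately show ?thesis by (intro exI[of _ G']) blast
qed

text \<open>
  For \<open>M\<close> one can take the sum of the positive and negative variations of the real and imaginary
  parts of all entries of \<open>q\<close> and \<open>w\<close>: sixteen positive and sixteen negative variations.
\<close>

theorem representation:
  assumes b: "0 < b" and q: "regular_at_0 b q" "hermitian_measure b q"
    and w: "regular_at_0 b w" "nonneg_measure b w"
  obtains M Q W where "canonical_system b M Q W"
    "\<And>i j. cdensity (reg_sets b) M (\<lambda>A. q A $ i $ j) (\<lambda>x. Q x $ i $ j)"
    "\<And>i j. cdensity (reg_sets b) M (\<lambda>A. w A $ i $ j) (\<lambda>x. W x $ i $ j)"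
proof -
  define \<nu> :: "bool \<times> 2 \<times> 2 \<times> bool \<times> bool \<Rightarrow> real set \<Rightarrow> real" where
    "\<nu> = (\<lambda>(m,i,j,r,s) A. (if s then 1 else -1) * (if r then Re else Im) ((if m then q else w) A $ i $ j))"
  let ?R = "reg_sets b"
  have Rb: "E \<in> sets borel" if "E \<in> ?R" for E using that by (simp add: reg_sets_def)
  have lin: "bounded_linear (\<lambda>A::complex^2^2. Re (A $ i $ j))" "bounded_linear (\<lambda>A::complex^2^2. Im (A $ i $ j))" for i j
    by (intro bounded_linear_compose[OF bounded_linear_Re] bounded_linear_compose[OF bounded_linear_Im]
        bounded_linear_compose[OF bounded_linear_vec_nth bounded_linear_vec_nth])+
  have sr: "signed_ring ?R (\<lambda>A. Re (\<mu> A $ i $ j))" "signed_ring ?R (\<lambda>A. Im (\<mu> A $ i $ j))"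
    if "regular_at_0 b \<mu>" for \<mu> :: "real set \<Rightarrow> complex^2^2" and i j
    using signed_ring_reg_sets[OF b that lin(1)[of i j]] signed_ring_reg_sets[OF b that lin(2)[of i j]] by auto
  have srk: "signed_ring ?R (\<nu> k)" for k
  proof -
    obtain m i j r s where k: "k = (m,i,j,r,s)" by (metis prod.exhaust)
    show ?thesis unfolding k \<nu>_def
      using sr[OF q(1), of i j] sr[OF w(1), of i j]
        signed_ring.signed_ring_uminus[OF sr(1)[OF q(1), of i j]] signed_ring.signed_ring_uminus[OF sr(2)[OF q(1), of i j]]
        signed_ring.signed_ring_uminus[OF sr(1)[OF w(1), of i j]] signed_ring.signed_ring_uminus[OF sr(2)[OF w(1), of i j]]
      by (cases m; cases r; cases s) simp_all
  qed
  obtain M :: "real measure" where M: "sets M = sets borel"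
    and eM: "\<And>E. E \<in> sets borel \<Longrightarrow> emeasure M E = (\<Sum>k\<in>UNIV. emeasure (variation ?R (\<nu> k)) E)"
    using finite_sum_measure[of UNIV "\<lambda>k. variation ?R (\<nu> k)"] by auto
  have le: "emeasure (variation ?R (\<nu> k)) E \<le> emeasure M E" if "E \<in> sets borel" for k E
    unfolding eM[OF that] by (rule member_le_sum) simp_all
  have fin: "emeasure M E < \<infinity>" if "E \<in> ?R" for E
    unfolding eM[OF Rb[OF that]] using signed_ring.variation_finite[OF srk that] by simp
  have sp: "space M = UNIV" using sets_eq_imp_space_eq[OF M] by simp
  have null: "emeasure M (- oint b) = 0"
  proof -
    have c: "- oint b \<in> sets borel" using oint_borel by (metis sets.compl_sets space_borel Compl_eq_Diff_UNIV)
    have "{A \<in> ?R. A \<subseteq> - oint b} = {{}}"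
    proof -
      have "{0<..<c} \<subseteq> oint b" if "c \<in> oint b" for c
        using oint_smaller[OF that] by auto
      then have "A \<subseteq> oint b" if "A \<in> ?R" for A using that unfolding reg_sets_def by blast
      moreover have "{} \<in> ?R" by (rule signed_ring.R_empty[OF srk])
      ultimately show ?thesis by blast
    qed
    then have "emeasure (variation ?R (\<nu> k)) (- oint b) = 0" for k
      unfolding signed_ring.emeasure_variation[OF srk c] by (simp add: signed_ring.measure_empty[OF srk])
    then show ?thesis unfolding eM[OF c] by simp
  qed
  have compl: "- oint b \<in> sets M"
    unfolding M using oint_borel by (metis sets.compl_sets space_borel Compl_eq_Diff_UNIV)
  have ae: "AE x in M. x \<in> oint b"
    using null compl AE_iff_null_sets[of "- oint b" M] by (auto simp: null_sets_def)
  have sf: "sigma_finite_measure M"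
  proof
    let ?A = "insert (- oint b) ((\<lambda>c. {0<..<c}) ` (\<rat> \<inter> oint b))"
    have "countable ?A" by (intro countable_insert countable_image countable_Int1 countable_rat)
    moreover have "?A \<subseteq> sets M" using compl by (auto simp: M)
    moreover have "\<Union>?A = space M"
    proof -
      have "x \<in> \<Union>?A" for x
      proof (cases "x \<in> oint b")
        case True
        obtain c where "c \<in> oint b" "x < c" "c \<in> \<rat>" using oint_larger[OF True] by blast
        moreover have "0 < x" using True by (simp add: oint_def)
        ultimately have "x \<in> {0<..<c}" "{0<..<c} \<in> ?A" by auto
        then show ?thesis by blast
      qed simp
      then show ?thesis by (auto simp: sp)
    qed
    moreover have "\<forall>a\<in>?A. emeasure M a \<noteq> \<infinity>"
    proof
      fix a assume "a \<in> ?A"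
      then show "emeasure M a \<noteq> \<infinity>"
      proof
        assume "a = - oint b" then show ?thesis using null by simp
      next
        assume "a \<in> (\<lambda>c. {0<..<c}) ` (\<rat> \<inter> oint b)"
        then have "a \<in> ?R" unfolding reg_sets_def by auto
        then show ?thesis using fin by fastforce
      qed
    qed
    ultimately show "\<exists>A. countable A \<and> A \<subseteq> sets M \<and> \<Union>A = space M \<and> (\<forall>a\<in>A. emeasure M a \<noteq> \<infinity>)" by blast
  qed
  have "\<exists>g. cdensity ?R M (\<lambda>A. (if m then q else w) A $ i $ j) g" for m i j
  proof (rule complex_density[OF _ _ sf M])
    show "signed_ring ?R (\<lambda>A. Re ((if m then q else w) A $ i $ j))"
      "signed_ring ?R (\<lambda>A. Im ((if m then q else w) A $ i $ j))"
      using sr[OF q(1)] sr[OF w(1)] by (cases m; simp)+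
    fix E :: "real set" assume E: "E \<in> sets borel"
    show "emeasure (variation ?R (\<lambda>A. Re ((if m then q else w) A $ i $ j))) E \<le> emeasure M E"
      using le[OF E, of "(m,i,j,True,True)"] by (simp add: \<nu>_def)
    show "emeasure (variation ?R (\<lambda>A. - Re ((if m then q else w) A $ i $ j))) E \<le> emeasure M E"
      using le[OF E, of "(m,i,j,True,False)"] by (simp add: \<nu>_def)
    show "emeasure (variation ?R (\<lambda>A. Im ((if m then q else w) A $ i $ j))) E \<le> emeasure M E"
      using le[OF E, of "(m,i,j,False,True)"] by (simp add: \<nu>_def)
    show "emeasure (variation ?R (\<lambda>A. - Im ((if m then q else w) A $ i $ j))) E \<le> emeasure M E"
      using le[OF E, of "(m,i,j,False,False)"] by (simp add: \<nu>_def)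
  qed
  then obtain g where g: "\<And>m i j. cdensity ?R M (\<lambda>A. (if m then q else w) A $ i $ j) (g m i j)" by metis
  define Q0 :: "real \<Rightarrow> complex^2^2" where "Q0 x = (\<chi> i j. g True i j x)" for x
  define W0 :: "real \<Rightarrow> complex^2^2" where "W0 x = (\<chi> i j. g False i j x)" for x
  have Q0: "cdensity ?R M (\<lambda>A. q A $ i $ j) (\<lambda>x. Q0 x $ i $ j)" for i j using g[of True i j] by (simp add: Q0_def)
  have W0: "cdensity ?R M (\<lambda>A. w A $ i $ j) (\<lambda>x. W0 x $ i $ j)" for i j using g[of False i j] by (simp add: W0_def)
  have Rc: "{0<..<c} \<in> ?R" if "c \<in> oint b" for c using that unfolding reg_sets_def by auto
  have herm: "AE x in M. hermitian_mat (G x)"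
    if \<mu>: "hermitian_measure b \<mu>" and c: "\<And>i j. cdensity ?R M (\<lambda>A. \<mu> A $ i $ j) (\<lambda>x. G x $ i $ j)" for \<mu> and G :: "real \<Rightarrow> complex^2^2"
  proof -
    have "AE x in M. G x $ j $ i - cnj (G x $ i $ j) = 0" for i j
    proof (rule AE_zero_oint[OF M ae])
      have m: "(\<lambda>x. G x $ j $ i) \<in> borel_measurable borel" for i j using c[of j i] by (simp add: cdensity_def)
      show "(\<lambda>x. G x $ j $ i - cnj (G x $ i $ j)) \<in> borel_measurable borel"
        by (intro borel_measurable_diff m measurable_compose[OF m, of cnj]
            borel_measurable_continuous_onI continuous_intros)
      have I: "set_integrable M E (\<lambda>x. cnj (G x $ i $ j)) \<and> (LINT x:E|M. cnj (G x $ i $ j)) = cnj (\<mu> E $ i $ j)" if "E \<in> ?R" for E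
      proof -
        have eq: "(\<lambda>x. indicat_real E x *\<^sub>R cnj (G x $ i $ j)) = (\<lambda>x. cnj (indicat_real E x *\<^sub>R (G x $ i $ j)))" by simp
        show ?thesis
          using c[of i j] that unfolding cdensity_def set_integrable_def set_lebesgue_integral_def eq
          by (simp add: integral_cnj integrable_cnj del: complex_cnj_scaleR)
      qed
      have J: "set_integrable M E (\<lambda>x. G x $ j $ i)" "(LINT x:E|M. G x $ j $ i) = \<mu> E $ j $ i" if "E \<in> ?R" for E
        using c[of j i] that unfolding cdensity_def by simp_all
      show K: "set_integrable M E (\<lambda>x. G x $ j $ i - cnj (G x $ i $ j))" if "E \<in> rel_compact_borel b" for E
        using I J rel_compact_reg[OF b that] by (intro set_integral_diff) blast+
      show "set_integrable M {0<..<c} (\<lambda>x. G x $ j $ i - cnj (G x $ i $ j))" if "c \<in> oint b" for c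
        using I J Rc[OF that] by (intro set_integral_diff) blast+
      show "(LINT x:E|M. G x $ j $ i - cnj (G x $ i $ j)) = 0" if E: "E \<in> rel_compact_borel b" for E
      proof -
        have "(LINT x:E|M. G x $ j $ i - cnj (G x $ i $ j)) = \<mu> E $ j $ i - cnj (\<mu> E $ i $ j)"
          using I J rel_compact_reg[OF b E] by (subst set_integral_diff(2)) auto
        moreover have "hermitian_mat (\<mu> E)" using \<mu> E unfolding hermitian_measure_def by blast
        then have "\<mu> E $ j $ i = cnj (\<mu> E $ i $ j)" unfolding hermitian_mat_def by blast
        ultimately show ?thesis by (simp only: right_minus_eq)
      qed
    qed
    then have "AE x in M. \<forall>i j. G x $ j $ i - cnj (G x $ i $ j) = 0" by (simp add: AE_all_countable)
    then show ?thesis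
    proof eventually_elim
      case (elim x) then show ?case unfolding hermitian_mat_def right_minus_eq .
    qed
  qed
  have hw: "hermitian_measure b w" using w(2) unfolding nonneg_measure_def hermitian_measure_def nonneg_mat_def by blast
  have W0nn: "AE x in M. nonneg_mat (W0 x)"
  proof (rule AE_nonneg_mat[OF _ herm[OF hw W0]])
    fix v :: "complex^2"
    have i: "set_integrable M E (\<lambda>x. W0 x $ i $ j)" "(LINT x:E|M. W0 x $ i $ j) = w E $ i $ j" if "E \<in> ?R" for E i j
      using W0[of i j] that unfolding cdensity_def by simp_all
    have ex: "(\<Sum>i\<in>UNIV. cnj (v $ i) * (A *v v) $ i) = (\<Sum>i\<in>UNIV. \<Sum>j\<in>UNIV. (cnj (v $ i) * v $ j) * A $ i $ j)" for A :: "complex^2^2"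
      by (simp add: matrix_vector_mult_def sum_distrib_left mult_ac)
    show "AE x in M. 0 \<le> Re (\<Sum>i\<in>UNIV. cnj (v $ i) * (W0 x *v v) $ i)"
      unfolding ex
    proof (rule AE_nonneg_oint[OF M ae])
      have [measurable]: "(\<lambda>x. W0 x $ i $ j) \<in> borel_measurable borel" for i j using W0[of i j] by (simp add: cdensity_def)
      show "(\<lambda>x. Re (\<Sum>i\<in>UNIV. \<Sum>j\<in>UNIV. cnj (v $ i) * v $ j * W0 x $ i $ j)) \<in> borel_measurable borel"
        by measurable
      show "set_integrable M {0<..<c} (\<lambda>x. Re (\<Sum>i\<in>UNIV. \<Sum>j\<in>UNIV. cnj (v $ i) * v $ j * W0 x $ i $ j))" if "c \<in> oint b" for c
        by (intro set_integral_Re set_integral_double_sum i Rc that)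
      show "0 \<le> (LINT x:E|M. Re (\<Sum>i\<in>UNIV. \<Sum>j\<in>UNIV. cnj (v $ i) * v $ j * W0 x $ i $ j))" if E: "E \<in> rel_compact_borel b" for E
      proof -
        note iE = i[OF rel_compact_reg[OF b E]]
        have "(LINT x:E|M. Re (\<Sum>i\<in>UNIV. \<Sum>j\<in>UNIV. cnj (v $ i) * v $ j * W0 x $ i $ j)) =
           Re (\<Sum>i\<in>UNIV. \<Sum>j\<in>UNIV. cnj (v $ i) * v $ j * w E $ i $ j)"
          by (subst set_integral_Re(2), rule set_integral_double_sum(1), rule iE, subst set_integral_double_sum(2), rule iE)
            (simp add: iE)
        moreover have "0 \<le> Re (\<Sum>i\<in>UNIV. \<Sum>j\<in>UNIV. cnj (v $ i) * v $ j * w E $ i $ j)"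
          using w(2) E unfolding nonneg_measure_def nonneg_mat_def ex[symmetric] by blast
        ultimately show ?thesis by simp
      qed
    qed
  qed
  have 0: "hermitian_mat 0" "nonneg_mat 0" by (simp_all add: hermitian_mat_def nonneg_mat_def)
  obtain Q where Q: "\<And>i j. cdensity ?R M (\<lambda>A. q A $ i $ j) (\<lambda>x. Q x $ i $ j)" "\<And>x. hermitian_mat (Q x)"
    using cdensity_modify[OF Q0 0(1) herm[OF q(2) Q0] Rb M] by blast
  obtain W where W: "\<And>i j. cdensity ?R M (\<lambda>A. w A $ i $ j) (\<lambda>x. W x $ i $ j)" "\<And>x. nonneg_mat (W x)"
    using cdensity_modify[OF W0 0(2) W0nn Rb M] by blast
  have "canonical_system b M Q W"
  proof (unfold canonical_system_def, intro conjI allI impI)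
    show "emeasure M {0<..<c} < \<infinity>" if "c \<in> oint b" for c using fin[OF Rc[OF that]] .
    show "(\<lambda>x. Q x $ i $ j) \<in> borel_measurable borel" "(\<lambda>x. W x $ i $ j) \<in> borel_measurable borel" for i j
      using Q(1)[of i j] W(1)[of i j] by (simp_all add: cdensity_def)
    show "set_integrable M {0<..<c} (\<lambda>x. Q x $ i $ j)" "set_integrable M {0<..<c} (\<lambda>x. W x $ i $ j)" if "c \<in> oint b" for i j c
      using Q(1)[of i j] W(1)[of i j] Rc[OF that] by (simp_all add: cdensity_def)
  qed (rule b M sf ae Q(2) W(2))+
  then show ?thesis using that Q(1) W(1) by blast
qed

section \<open>Integrals of the coefficients and integration by parts\<close>

lemma J_mult: "(J *v a) $ 1 = - a $ 2" "(J *v a) $ 2 = a $ 1"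
  by (simp_all add: J_def matrix_vector_mult_def sum_2)

text \<open>
  The Wronskian form \<open>v\<^sup>* J u\<close>.
\<close>

definition sform :: "complex^2 \<Rightarrow> complex^2 \<Rightarrow> complex" where
  "sform v u = cnj (v $ 2) * u $ 1 - cnj (v $ 1) * u $ 2"

text \<open>
  The Hermitian form \<open>- \<i> u\<^sup>* J u\<close>.
\<close>

definition hform :: "complex^2 \<Rightarrow> real" where
  "hform u = 2 * Im (cnj (u $ 2) * u $ 1)"

lemma sform_self: "sform u u = \<i> * hform u"
proof -
  have "sform u u = cnj (u $ 2) * u $ 1 - cnj (cnj (u $ 2) * u $ 1)" by (simp add: sform_def mult.commute)
  also have "\<dots> = \<i> * hform u" by (subst complex_diff_cnj) (simp add: hform_def)
  finally show ?thesis .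
qed

lemma norm_smult: "norm (c *s v) = norm c * norm v" for v :: "complex^2"
  by (simp add: norm_vec_def norm_mult L2_set_right_distrib)

context canonical_system begin

lemma measurable_M [simp]: "measurable M X = measurable borel X"
  by (rule measurable_cong_sets[OF sets_M refl])

lemma space_M [simp]: "space M = UNIV"
  using sets_eq_imp_space_eq[OF sets_M] by simp

text \<open>
  Solving \<open>J u' + q u = z w u\<close> for the density of \<open>u'\<close>: as \<open>J\<^bsup>-1\<^esup> = - J\<close>, it equals \<open>J (Q - z W) u\<close>.
\<close>

definition rhs :: "complex \<Rightarrow> real \<Rightarrow> complex^2 \<Rightarrow> complex^2" where
  "rhs z t v = J *v (Q t *v v - z *s (W t *v v))"

lemma rhs_nth:
  "rhs z t v $ 1 = - (\<Sum>j\<in>UNIV. (Q t $ 2 $ j - z * W t $ 2 $ j) * v $ j)"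
  "rhs z t v $ 2 = (\<Sum>j\<in>UNIV. (Q t $ 1 $ j - z * W t $ 1 $ j) * v $ j)"
  unfolding rhs_def J_mult by (simp_all add: matrix_vector_mult_def sum_2 algebra_simps)

lemma rhs_add: "rhs z t (u + v) = rhs z t u + rhs z t v"
  and rhs_smult: "rhs z t (c *s u) = c *s rhs z t u"
  and rhs_zero [simp]: "rhs z t 0 = 0"
  by (simp_all add: vec_eq_iff forall_2 rhs_nth sum_2 algebra_simps)

text \<open>
  An upper bound of the operator norm of \<open>Q t - z W t\<close> that is additive in the entries and
  therefore visibly integrable.
\<close>

definition coeff_size :: "complex \<Rightarrow> real \<Rightarrow> real" where
  "coeff_size z t = (\<Sum>i\<in>UNIV. \<Sum>j\<in>UNIV. norm (Q t $ i $ j) + norm z * norm (W t $ i $ j))"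

lemma coeff_size_nonneg [simp]: "0 \<le> coeff_size z t"
  unfolding coeff_size_def by (intro sum_nonneg) simp

lemma norm_rhs_le: "norm (rhs z t v) \<le> coeff_size z t * norm v"
proof -
  have *: "norm ((Q t $ i $ j - z * W t $ i $ j) * v $ j) \<le> (norm (Q t $ i $ j) + norm z * norm (W t $ i $ j)) * norm v" for i j
    unfolding norm_mult
    by (intro mult_mono Finite_Cartesian_Product.norm_nth_le)
       (auto intro: order_trans[OF norm_triangle_ineq4] simp: norm_mult)
  have **: "norm (\<Sum>j\<in>UNIV. (Q t $ i $ j - z * W t $ i $ j) * v $ j) \<le> (\<Sum>j\<in>UNIV. norm (Q t $ i $ j) + norm z * norm (W t $ i $ j)) * norm v" for i
    unfolding sum_distrib_right by (intro order_trans[OF norm_sum] sum_mono *)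
  have "norm (rhs z t v) \<le> norm (rhs z t v $ 1) + norm (rhs z t v $ 2)"
    using norm_le_componentwise_cart[of "rhs z t v"] L2_set_le_sum[of UNIV "\<lambda>i. norm (rhs z t v $ i)"]
    by (simp add: norm_vec_def sum_2)
  also have "\<dots> \<le> coeff_size z t * norm v"
    using **[of 1] **[of 2] unfolding rhs_nth norm_minus_cancel coeff_size_def sum_2[of "\<lambda>i. \<Sum>j\<in>UNIV. _ i j"]
    by (simp add: distrib_right sum_2)
  finally show ?thesis .
qed

lemma coeff_size_measurable [measurable]: "coeff_size z \<in> borel_measurable borel"
  unfolding coeff_size_def[abs_def] using Q_meas W_meas
  by (intro borel_measurable_sum borel_measurable_add borel_measurable_times borel_measurable_norm) simp_all

lemma coeff_size_integrable: "c \<in> oint b \<Longrightarrow> set_integrable M {0<..<c} (coeff_size z)"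
proof -
  assume c: "c \<in> oint b"
  have *: "integrable M (\<lambda>x. norm (indicat_real {0<..<c} x *\<^sub>R (Q x $ i $ j)) + norm z * norm (indicat_real {0<..<c} x *\<^sub>R (W x $ i $ j)))" for i j
    using Q_int[OF c, of i j] W_int[OF c, of i j] unfolding set_integrable_def
    by (intro Bochner_Integration.integrable_add integrable_mult_right integrable_norm)
  have eq: "(\<lambda>x. indicat_real {0<..<c} x *\<^sub>R coeff_size z x) = (\<lambda>x. \<Sum>i\<in>UNIV. \<Sum>j\<in>UNIV.
     norm (indicat_real {0<..<c} x *\<^sub>R (Q x $ i $ j)) + norm z * norm (indicat_real {0<..<c} x *\<^sub>R (W x $ i $ j)))"
    by (auto simp: coeff_size_def fun_eq_iff split: split_indicator)
  show ?thesis unfolding set_integrable_def eq by (intro Bochner_Integration.integrable_sum *)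
qed

text \<open>
  Bounded Borel functions on the open interval; values elsewhere are left arbitrary because solutions
  are only determined on \<open>(0, b)\<close>.
\<close>

definition bdd_borel :: "real \<Rightarrow> real \<Rightarrow> (real \<Rightarrow> complex^2) \<Rightarrow> bool" where
  "bdd_borel x y u \<longleftrightarrow> (\<forall>j. (\<lambda>t. indicator {x<..<y} t *\<^sub>R (u t $ j)) \<in> borel_measurable borel) \<and> (\<exists>C. \<forall>t\<in>{x<..<y}. norm (u t) \<le> C)"

lemma borel_measurable_vec2:
  fixes f :: "real \<Rightarrow> complex^2"
  assumes "\<And>j. (\<lambda>x. f x $ j) \<in> borel_measurable borel"
  shows "f \<in> borel_measurable borel"
proof (subst borel_measurable_euclidean_space, rule ballI)
  fix e :: "complex^2" assume "e \<in> Basis"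
  then obtain j k where e: "e = axis j k" by (auto simp: Basis_vec_def)
  show "(\<lambda>x. f x \<bullet> e) \<in> borel_measurable borel"
    unfolding e inner_axis using assms[of j] by measurable
qed

lemma bdd_borel_subset:
  assumes u: "bdd_borel x y u" and "x \<le> x'" "y' \<le> y" shows "bdd_borel x' y' u"
proof -
  have "(\<lambda>t. indicator {x'<..<y'} t *\<^sub>R (indicator {x<..<y} t *\<^sub>R (u t $ j))) \<in> borel_measurable borel" for j
  proof (rule borel_measurable_scaleR)
    show "(\<lambda>t. indicator {x<..<y} t *\<^sub>R (u t $ j)) \<in> borel_measurable borel" using u unfolding bdd_borel_def by blast
  qed simp
  moreover have "(\<lambda>t. indicator {x'<..<y'} t *\<^sub>R (indicator {x<..<y} t *\<^sub>R (u t $ j))) = (\<lambda>t. indicator {x'<..<y'} t *\<^sub>R (u t $ j))" for j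
    using assms(2,3) by (auto simp: fun_eq_iff split: split_indicator)
  moreover have "{x'<..<y'} \<subseteq> {x<..<y}" using assms(2,3) by auto
  ultimately show ?thesis using u unfolding bdd_borel_def by (metis subsetD)
qed

lemma bdd_borel_lincomb:
  assumes u: "bdd_borel x y u" and v: "bdd_borel x y v" shows "bdd_borel x y (\<lambda>t. a *s u t + c *s v t)"
proof -
  have "(\<lambda>t. indicator {x<..<y} t *\<^sub>R ((a *s u t + c *s v t) $ j)) =
     (\<lambda>t. a * (indicator {x<..<y} t *\<^sub>R (u t $ j)) + c * (indicator {x<..<y} t *\<^sub>R (v t $ j)))" for j
    by (simp add: fun_eq_iff scaleR_add_right)
  moreover have "(\<lambda>t. a * (indicator {x<..<y} t *\<^sub>R (u t $ j)) + c * (indicator {x<..<y} t *\<^sub>R (v t $ j))) \<in> borel_measurable borel" for j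
    using u v unfolding bdd_borel_def by (intro borel_measurable_add borel_measurable_times borel_measurable_const) auto
  moreover obtain C D where "\<forall>t\<in>{x<..<y}. norm (u t) \<le> C" "\<forall>t\<in>{x<..<y}. norm (v t) \<le> D"
    using u v unfolding bdd_borel_def by blast
  then have "\<forall>t\<in>{x<..<y}. norm (a *s u t + c *s v t) \<le> norm a * C + norm c * D"
    by (auto intro!: order_trans[OF norm_triangle_ineq] add_mono mult_left_mono simp: norm_smult)
  ultimately show ?thesis unfolding bdd_borel_def by (metis (no_types, lifting))
qed

lemma rhs_measurable:
  assumes u: "bdd_borel x y u"
  shows "(\<lambda>t. indicator {x<..<y} t *\<^sub>R rhs z t (u t)) \<in> borel_measurable borel"
proof (rule borel_measurable_vec2)
  fix j :: 2
  have m: "(\<lambda>t. (Q t $ i $ k - z * W t $ i $ k) * (indicator {x<..<y} t *\<^sub>R (u t $ k))) \<in> borel_measurable borel" for i k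
    using u Q_meas W_meas unfolding bdd_borel_def
    by (intro borel_measurable_times borel_measurable_diff borel_measurable_const) auto
  have "(\<lambda>t. (indicator {x<..<y} t *\<^sub>R rhs z t (u t)) $ 1) =
     (\<lambda>t. - (\<Sum>k\<in>UNIV. (Q t $ 2 $ k - z * W t $ 2 $ k) * (indicator {x<..<y} t *\<^sub>R (u t $ k))))"
    by (auto simp: fun_eq_iff rhs_nth split: split_indicator)
  moreover have "(\<lambda>t. (indicator {x<..<y} t *\<^sub>R rhs z t (u t)) $ 2) =
     (\<lambda>t. (\<Sum>k\<in>UNIV. (Q t $ 1 $ k - z * W t $ 1 $ k) * (indicator {x<..<y} t *\<^sub>R (u t $ k))))"
    by (auto simp: fun_eq_iff rhs_nth split: split_indicator)
  ultimately show "(\<lambda>t. (indicator {x<..<y} t *\<^sub>R rhs z t (u t)) $ j) \<in> borel_measurable borel"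
    using exhaust_2[of j]
    by (elim disjE; simp only:; intro borel_measurable_uminus borel_measurable_sum m)
qed

lemma coeff_size_integrable': "0 \<le> x \<Longrightarrow> y \<in> oint b \<Longrightarrow> E \<in> sets borel \<Longrightarrow> E \<subseteq> {x<..<y} \<Longrightarrow> set_integrable M E (coeff_size z)"
  by (rule set_integrable_subset[OF coeff_size_integrable]) (auto simp: sets_M)

lemma rhs_integrable:
  assumes x: "0 \<le> x" "y \<in> oint b" and u: "bdd_borel x y u"
  shows "set_integrable M {x<..<y} (\<lambda>t. rhs z t (u t))"
proof -
  obtain C where C: "\<And>t. t \<in> {x<..<y} \<Longrightarrow> norm (u t) \<le> C" using u unfolding bdd_borel_def by blast
  have k: "integrable M (\<lambda>t. C * (indicat_real {x<..<y} t *\<^sub>R coeff_size z t))"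
    using coeff_size_integrable'[OF x, of "{x<..<y}" z] unfolding set_integrable_def by (intro integrable_mult_right) simp
  show ?thesis unfolding set_integrable_def
  proof (rule Bochner_Integration.integrable_bound[OF k])
    show "(\<lambda>t. indicat_real {x<..<y} t *\<^sub>R rhs z t (u t)) \<in> borel_measurable M"
      using rhs_measurable[OF u] by simp
    show "AE t in M. norm (indicat_real {x<..<y} t *\<^sub>R rhs z t (u t)) \<le> norm (C * (indicat_real {x<..<y} t *\<^sub>R coeff_size z t))"
    proof (rule AE_I2)
      fix t
      show "norm (indicat_real {x<..<y} t *\<^sub>R rhs z t (u t)) \<le> norm (C * (indicat_real {x<..<y} t *\<^sub>R coeff_size z t))"
      proof (cases "t \<in> {x<..<y}")
        case True
        have "norm (rhs z t (u t)) \<le> coeff_size z t * norm (u t)" by (rule norm_rhs_le)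
        also have "\<dots> \<le> coeff_size z t * \<bar>C\<bar>" using C[OF True] by (intro mult_left_mono) auto
        finally show ?thesis using True by (simp add: abs_mult mult.commute)
      qed simp
    qed
  qed
qed

lemma rhs_integrable_sub:
  assumes "0 \<le> x" "y \<in> oint b" "bdd_borel x y u" "E \<in> sets borel" "E \<subseteq> {x<..<y}"
  shows "set_integrable M E (\<lambda>t. rhs z t (u t))"
  by (rule set_integrable_subset[OF rhs_integrable[OF assms(1-3)]]) (use assms sets_M in auto)

lemma norm_rhs_integral_le:
  assumes x: "0 \<le> x" "y \<in> oint b" and u: "bdd_borel x y u" and C: "\<And>t. t \<in> {x<..<y} \<Longrightarrow> norm (u t) \<le> C"
    and E: "E \<in> sets borel" "E \<subseteq> {x<..<y}"
  shows "norm (LINT t:E|M. rhs z t (u t)) \<le> C * (LINT t:E|M. coeff_size z t)"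
proof -
  have i: "integrable M (\<lambda>t. C * (indicat_real E t *\<^sub>R coeff_size z t))"
    using coeff_size_integrable'[OF x E, of z] unfolding set_integrable_def by (intro integrable_mult_right) simp
  have j: "integrable M (\<lambda>t. norm (indicat_real E t *\<^sub>R rhs z t (u t)))"
    using rhs_integrable_sub[OF x u E, of z] unfolding set_integrable_def by (rule integrable_norm)
  have "norm (LINT t:E|M. rhs z t (u t)) \<le> integral\<^sup>L M (\<lambda>t. norm (indicat_real E t *\<^sub>R rhs z t (u t)))"
    unfolding set_lebesgue_integral_def by (rule integral_norm_bound)
  also have "\<dots> \<le> integral\<^sup>L M (\<lambda>t. C * (indicat_real E t *\<^sub>R coeff_size z t))"
  proof (rule integral_mono[OF j i])
    fix t
    show "norm (indicat_real E t *\<^sub>R rhs z t (u t)) \<le> C * (indicat_real E t *\<^sub>R coeff_size z t)"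
    proof (cases "t \<in> E")
      case True
      have "norm (rhs z t (u t)) \<le> coeff_size z t * norm (u t)" by (rule norm_rhs_le)
      also have "\<dots> \<le> coeff_size z t * C" using C True E(2) by (intro mult_left_mono) auto
      finally show ?thesis using True by (simp add: mult.commute)
    qed simp
  qed
  also have "\<dots> = C * (LINT t:E|M. coeff_size z t)" by (simp add: set_lebesgue_integral_def)
  finally show ?thesis .
qed

lemma set_integral_vec_nth:
  fixes f :: "real \<Rightarrow> complex^2"
  assumes "set_integrable M E f"
  shows "set_integrable M E (\<lambda>t. f t $ j)" "(LINT t:E|M. f t) $ j = (LINT t:E|M. f t $ j)"
proof -
  have eq: "(\<lambda>t. indicat_real E t *\<^sub>R (f t $ j)) = (\<lambda>t. (indicat_real E t *\<^sub>R f t) $ j)" by simp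
  show "set_integrable M E (\<lambda>t. f t $ j)"
    using assms unfolding set_integrable_def eq by (rule integrable_bounded_linear[OF bounded_linear_vec_nth])
  show "(LINT t:E|M. f t) $ j = (LINT t:E|M. f t $ j)"
    using assms unfolding set_integrable_def set_lebesgue_integral_def eq
    by (rule integral_bounded_linear[OF bounded_linear_vec_nth, symmetric])
qed

lemma singleton_integral:
  fixes f :: "real \<Rightarrow> 'a::{banach,second_countable_topology}"
  assumes "x \<in> oint b" shows "set_integrable M {x} f" "(LINT t:{x}|M. f t) = measure M {x} *\<^sub>R f x"
proof -
  obtain c where c: "c \<in> oint b" "x < c" using oint_larger[OF assms] by blast
  have "0 < x" using assms by (simp add: oint_def)
  then have "emeasure M {x} \<le> emeasure M {0<..<c}" using c by (intro emeasure_mono) (auto simp: sets_M)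
  then have fin: "emeasure M {x} < \<infinity>" using M_finite[OF c(1)] by (rule le_less_trans)
  have eq: "(\<lambda>t. indicat_real {x} t *\<^sub>R f t) = (\<lambda>t. indicat_real {x} t *\<^sub>R f x)"
    by (auto simp: fun_eq_iff split: split_indicator)
  show "set_integrable M {x} f" unfolding set_integrable_def eq
    using fin by (intro integrable_scaleR_left integrable_real_indicator) (auto simp: sets_M)
  show "(LINT t:{x}|M. f t) = measure M {x} *\<^sub>R f x"
    unfolding set_lebesgue_integral_def eq using fin by (subst integral_scaleR_left) (auto simp: sets_M)
qed

lemma measure_zero [simp]: "x \<notin> oint b \<Longrightarrow> measure M {x} = 0"
proof -
  assume "x \<notin> oint b"
  then have "t \<in> oint b \<Longrightarrow> t \<notin> {x}" for t by auto
  then have "AE t in M. t \<notin> {x}" by (rule eventually_mono[OF AE_oint])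
  then have "{x} \<in> null_sets M" by (subst AE_iff_null_sets) (simp_all add: sets_M)
  then show ?thesis by (simp add: measure_def null_setsD1)
qed

text \<open>
  Integration by parts for functions that take at each atom the mean of their one-sided limits.
  By Fubini, the product of the integrals of \<open>\<phi>\<close> and \<open>\<gamma>\<close> is an integral over a square; the square is cut
  along its diagonal and each half receives half of the diagonal.  So the half atoms produce
  no correction term.
\<close>

lemma product_rule:
  fixes \<phi> \<gamma> :: "real \<Rightarrow> complex" and f0 g0 :: complex
  assumes "set_integrable M {0<..<x} \<phi>" "set_integrable M {0<..<x} \<gamma>"
  defines "F \<equiv> \<lambda>t. f0 + (LINT s:{0<..<t}|M. \<phi> s)" and "G \<equiv> \<lambda>t. g0 + (LINT s:{0<..<t}|M. \<gamma> s)"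
  assumes x: "x \<in> oint b"
  shows "set_integrable M {0<..<x} (\<lambda>t. \<phi> t * (G t + (measure M {t} / 2) *\<^sub>R \<gamma> t) + (F t + (measure M {t} / 2) *\<^sub>R \<phi> t) * \<gamma> t)" (is ?int)
    and "F x * G x - f0 * g0 = (LINT t:{0<..<x}|M. \<phi> t * (G t + (measure M {t} / 2) *\<^sub>R \<gamma> t) + (F t + (measure M {t} / 2) *\<^sub>R \<phi> t) * \<gamma> t)" (is ?eq)
proof -
  interpret P: pair_sigma_finite M M
    by (rule pair_sigma_finite.intro[OF sigma_M sigma_M])
  define p where "p t = indicat_real {0<..<x} t *\<^sub>R \<phi> t" for t
  define g where "g t = indicat_real {0<..<x} t *\<^sub>R \<gamma> t" for t
  have p: "integrable M p" and g: "integrable M g"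
    using assms(1,2) unfolding set_integrable_def p_def[abs_def] g_def[abs_def] by auto
  have pm [measurable]: "p \<in> borel_measurable borel" and gm [measurable]: "g \<in> borel_measurable borel"
    using borel_measurable_integrable[OF p] borel_measurable_integrable[OF g] by simp_all
  have setsP: "sets (M \<Otimes>\<^sub>M M) = sets (borel \<Otimes>\<^sub>M borel)" by (intro sets_pair_measure_cong sets_M)
  have mP: "measurable (M \<Otimes>\<^sub>M M) X = measurable (borel \<Otimes>\<^sub>M borel) X" for X :: "'z measure"
    by (rule measurable_cong_sets[OF setsP refl])
  define H where "H s t = p s * g t" for s t
  have H: "integrable (M \<Otimes>\<^sub>M M) (case_prod H)"
  proof (rule P.Fubini_integrable)
    show "case_prod H \<in> borel_measurable (M \<Otimes>\<^sub>M M)" unfolding mP H_def by measurable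
    have "integrable M (\<lambda>s. norm (p s) * integral\<^sup>L M (\<lambda>t. norm (g t)))"
      using p by (intro integrable_mult_left integrable_norm)
    then show "integrable M (\<lambda>s. \<integral>t. norm (case (s, t) of (s, t) \<Rightarrow> H s t) \<partial>M)"
      by (simp add: H_def norm_mult)
    show "AE s in M. integrable M (\<lambda>t. case (s, t) of (s, t) \<Rightarrow> H s t)"
      using g by (simp add: H_def)
  qed
  \<comment> \<open>The indicator function of one half of the square, with weight \<open>1/2\<close> on the diagonal.\<close>
  define k1 :: "real \<Rightarrow> real \<Rightarrow> real" where "k1 s t = (if s < t then 1 else if s = t then 1/2 else 0)" for s t
  have k1m: "case_prod k1 \<in> borel_measurable (borel \<Otimes>\<^sub>M borel)" unfolding k1_def by measurable
  have H1: "integrable (M \<Otimes>\<^sub>M M) (case_prod (\<lambda>s t. k1 s t *\<^sub>R H s t))"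
  proof (rule Bochner_Integration.integrable_bound[OF H])
    have "(\<lambda>a. case_prod k1 a *\<^sub>R case_prod H a) \<in> borel_measurable (M \<Otimes>\<^sub>M M)"
      using k1m borel_measurable_integrable[OF H] unfolding mP by (rule borel_measurable_scaleR)
    then show "case_prod (\<lambda>s t. k1 s t *\<^sub>R H s t) \<in> borel_measurable (M \<Otimes>\<^sub>M M)"
      by (simp add: case_prod_unfold)
  qed (auto simp: k1_def)
  have H2: "integrable (M \<Otimes>\<^sub>M M) (case_prod (\<lambda>s t. k1 t s *\<^sub>R H s t))"
  proof -
    have "(\<lambda>a. case_prod H a - case_prod (\<lambda>s t. k1 s t *\<^sub>R H s t) a) = case_prod (\<lambda>s t. k1 t s *\<^sub>R H s t)"
      by (auto simp: fun_eq_iff k1_def algebra_simps scaleR_conv_of_real)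
    then show ?thesis using Bochner_Integration.integrable_diff[OF H H1] by simp
  qed
  have sum: "H s t = k1 s t *\<^sub>R H s t + k1 t s *\<^sub>R H s t" for s t
    by (auto simp: k1_def scaleR_conv_of_real)
  have half: "(\<integral>s. k1 s t *\<^sub>R (indicat_real {0<..<x} s *\<^sub>R h s) \<partial>M) = (LINT s:{0<..<t}|M. h s) + (measure M {t} / 2) *\<^sub>R h t"
    if h: "set_integrable M {0<..<x} h" and t: "t \<in> {0<..<x}" for h :: "real \<Rightarrow> complex" and t
  proof -
    have to: "t \<in> oint b" using oint_smaller[OF x, of t] t by simp
    have sub: "{0<..<t} \<subseteq> {0<..<x}" using t by auto
    have i: "integrable M (\<lambda>s. indicat_real {0<..<t} s *\<^sub>R h s)"
      "integrable M (\<lambda>s. (1/2::real) *\<^sub>R (indicat_real {t} s *\<^sub>R h s))"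
      using set_integrable_subset[OF h _ sub] singleton_integral(1)[OF to, of h]
      unfolding set_integrable_def by (simp add: sets_M, intro integrable_scaleR_right)
    have e1: "(\<lambda>s. k1 s t *\<^sub>R (indicat_real {0<..<x} s *\<^sub>R h s)) =
        (\<lambda>s. indicat_real {0<..<t} s *\<^sub>R h s + (1/2::real) *\<^sub>R (indicat_real {t} s *\<^sub>R h s))"
      using t by (auto simp: fun_eq_iff k1_def split: split_indicator)
    have e2: "(\<integral>s. (1/2::real) *\<^sub>R (indicat_real {t} s *\<^sub>R h s) \<partial>M) = (1/2::real) *\<^sub>R (measure M {t} *\<^sub>R h t)"
      unfolding singleton_integral(2)[OF to, of h, symmetric] set_lebesgue_integral_def by (rule integral_scaleR_right)
    show ?thesis unfolding e1 Bochner_Integration.integral_add[OF i] e2 by (simp add: set_lebesgue_integral_def)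
  qed
  define K1 where "K1 t = (\<integral>s. k1 s t *\<^sub>R H s t \<partial>M)" for t
  define K2 where "K2 s = (\<integral>t. k1 t s *\<^sub>R H s t \<partial>M)" for s
  have K1: "K1 t = ((LINT s:{0<..<t}|M. \<phi> s) + (measure M {t} / 2) *\<^sub>R \<phi> t) * g t" for t
  proof (cases "t \<in> {0<..<x}")
    case True
    have "K1 t = (\<integral>s. (k1 s t *\<^sub>R p s) * g t \<partial>M)" by (simp add: K1_def H_def)
    also have "\<dots> = (\<integral>s. k1 s t *\<^sub>R p s \<partial>M) * g t" by (rule integral_mult_left_zero)
    finally show ?thesis using half[OF assms(1) True] by (simp add: p_def)
  next
    case False
    then show ?thesis by (simp add: K1_def H_def g_def)
  qed
  have K2: "K2 t = p t * ((LINT s:{0<..<t}|M. \<gamma> s) + (measure M {t} / 2) *\<^sub>R \<gamma> t)" for t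
  proof (cases "t \<in> {0<..<x}")
    case True
    have "K2 t = (\<integral>s. p t * (k1 s t *\<^sub>R g s) \<partial>M)" by (simp add: K2_def H_def)
    also have "\<dots> = p t * (\<integral>s. k1 s t *\<^sub>R g s \<partial>M)" by (rule integral_mult_right_zero)
    finally show ?thesis using half[OF assms(2) True] by (simp add: g_def)
  next
    case False
    then show ?thesis by (simp add: K2_def H_def p_def)
  qed
  have iK: "integrable M K1" "integrable M K2"
    unfolding K1_def[abs_def] K2_def[abs_def] by (rule P.integrable_snd[OF H1], rule P.integrable_fst[OF H2])
  have prod: "integral\<^sup>L M p * integral\<^sup>L M g = integral\<^sup>L M K1 + integral\<^sup>L M K2"
  proof -
    have "integral\<^sup>L M K1 = integral\<^sup>L (M \<Otimes>\<^sub>M M) (case_prod (\<lambda>s t. k1 s t *\<^sub>R H s t))"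
      unfolding K1_def[abs_def] by (rule P.integral_snd[OF H1])
    moreover have "integral\<^sup>L M K2 = integral\<^sup>L (M \<Otimes>\<^sub>M M) (case_prod (\<lambda>s t. k1 t s *\<^sub>R H s t))"
      unfolding K2_def[abs_def] by (rule P.integral_fst[OF H2])
    moreover have "integral\<^sup>L (M \<Otimes>\<^sub>M M) (case_prod H) = integral\<^sup>L (M \<Otimes>\<^sub>M M) (\<lambda>a. case_prod (\<lambda>s t. k1 s t *\<^sub>R H s t) a + case_prod (\<lambda>s t. k1 t s *\<^sub>R H s t) a)"
      by (intro Bochner_Integration.integral_cong refl) (auto simp: sum[symmetric])
    moreover have "\<dots> = integral\<^sup>L (M \<Otimes>\<^sub>M M) (case_prod (\<lambda>s t. k1 s t *\<^sub>R H s t)) + integral\<^sup>L (M \<Otimes>\<^sub>M M) (case_prod (\<lambda>s t. k1 t s *\<^sub>R H s t))"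
      by (rule Bochner_Integration.integral_add[OF H1 H2])
    moreover have "integral\<^sup>L (M \<Otimes>\<^sub>M M) (case_prod H) = (\<integral>s. \<integral>t. H s t \<partial>M \<partial>M)"
      by (rule P.integral_fst[OF H, symmetric])
    moreover have "\<dots> = integral\<^sup>L M p * integral\<^sup>L M g" by (simp add: H_def)
    ultimately show ?thesis by simp
  qed
  have eq: "(\<lambda>t. indicat_real {0<..<x} t *\<^sub>R (\<phi> t * (G t + (measure M {t} / 2) *\<^sub>R \<gamma> t) + (F t + (measure M {t} / 2) *\<^sub>R \<phi> t) * \<gamma> t))
     = (\<lambda>t. (g0 * p t + f0 * g t) + (K1 t + K2 t))"
    by (auto simp: fun_eq_iff K1 K2 p_def g_def F_def G_def algebra_simps split: split_indicator)
  have i4: "integrable M (\<lambda>t. g0 * p t + f0 * g t)" "integrable M (\<lambda>t. K1 t + K2 t)"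
    using p g iK by (intro Bochner_Integration.integrable_add integrable_mult_right; simp)+
  show ?int unfolding set_integrable_def eq by (intro Bochner_Integration.integrable_add i4)
  have "(LINT t:{0<..<x}|M. \<phi> t * (G t + (measure M {t} / 2) *\<^sub>R \<gamma> t) + (F t + (measure M {t} / 2) *\<^sub>R \<phi> t) * \<gamma> t)
     = integral\<^sup>L M (\<lambda>t. (g0 * p t + f0 * g t)) + integral\<^sup>L M (\<lambda>t. K1 t + K2 t)"
    unfolding set_lebesgue_integral_def eq by (rule Bochner_Integration.integral_add[OF i4])
  also have "\<dots> = g0 * integral\<^sup>L M p + f0 * integral\<^sup>L M g + integral\<^sup>L M p * integral\<^sup>L M g"
    using p g iK prod by simp
  also have "\<dots> = F x * G x - f0 * g0"
    by (simp add: F_def G_def p_def[abs_def] g_def[abs_def] set_lebesgue_integral_def algebra_simps)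
  finally show ?eq by simp
qed

section \<open>The semi-inner product given by the weight\<close>

lemma hermitian_mat_cnj: "hermitian_mat A \<Longrightarrow> cnj (A $ i $ j) = A $ j $ i"
  unfolding hermitian_mat_def by (drule spec, drule spec, erule sym)

lemma Q_cnj: "cnj (Q t $ i $ j) = Q t $ j $ i"
  by (rule hermitian_mat_cnj[OF Q_herm])

lemma W_cnj: "cnj (W t $ i $ j) = W t $ j $ i"
  using W_nonneg[of t] unfolding nonneg_mat_def by (intro hermitian_mat_cnj) (elim conjE)

definition w_form :: "real \<Rightarrow> complex^2 \<Rightarrow> complex^2 \<Rightarrow> complex" where
  "w_form t u v = (\<Sum>i\<in>UNIV. \<Sum>j\<in>UNIV. cnj (v $ i) * u $ j * W t $ i $ j)"

definition w_inner :: "real \<Rightarrow> (real \<Rightarrow> complex^2) \<Rightarrow> (real \<Rightarrow> complex^2) \<Rightarrow> complex" where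
  "w_inner x u v = (LINT t:{0<..<x}|M. w_form t (u t) (v t))"

definition nrm2 :: "real \<Rightarrow> (real \<Rightarrow> complex^2) \<Rightarrow> real" where
  "nrm2 x u = Re (w_inner x u u)"

lemma w_form_linear: "w_form t (a *s u + c *s u') v = a * w_form t u v + c * w_form t u' v"
  by (simp add: w_form_def sum_2 algebra_simps)

lemma w_form_linear2: "w_form t v (a *s u + c *s u') = cnj a * w_form t v u + cnj c * w_form t v u'"
  by (simp add: w_form_def sum_2 algebra_simps)

lemma w_form_cnj: "w_form t v u = cnj (w_form t u v)"
  by (simp add: w_form_def sum_2 W_cnj algebra_simps)

lemma w_form_nonneg: "0 \<le> Re (w_form t u u)"
proof -
  have "w_form t u u = (\<Sum>i\<in>UNIV. cnj (u $ i) * (W t *v u) $ i)"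
    by (simp add: w_form_def matrix_vector_mult_def sum_2 algebra_simps)
  then show ?thesis using W_nonneg[of t] unfolding nonneg_mat_def by simp
qed

lemma w_form_integrable:
  assumes x: "x \<in> oint b" and u: "bdd_borel 0 x u" and v: "bdd_borel 0 x v" and E: "E \<in> sets borel" "E \<subseteq> {0<..<x}"
  shows "set_integrable M E (\<lambda>t. w_form t (u t) (v t))"
proof -
  obtain C D where C: "\<And>t. t \<in> {0<..<x} \<Longrightarrow> norm (u t) \<le> C" and D: "\<And>t. t \<in> {0<..<x} \<Longrightarrow> norm (v t) \<le> D"
    using u v unfolding bdd_borel_def by blast
  have "set_integrable M {0<..<x} (\<lambda>t. W t $ i $ j * (cnj (v t $ i) * u t $ j))" for i j
  proof (rule set_integrable_mult_bounded[OF sets_M W_int[OF x] W_meas])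
    have m: "(\<lambda>t. indicator {0<..<x} t *\<^sub>R (v t $ i)) \<in> borel_measurable borel"
      "(\<lambda>t. indicator {0<..<x} t *\<^sub>R (u t $ j)) \<in> borel_measurable borel"
      using u v unfolding bdd_borel_def by blast+
    have c: "cnj \<in> borel_measurable borel" by (intro borel_measurable_continuous_onI continuous_intros)
    have "(\<lambda>t. cnj (indicator {0<..<x} t *\<^sub>R (v t $ i)) * (indicator {0<..<x} t *\<^sub>R (u t $ j))) \<in> borel_measurable borel"
      by (rule borel_measurable_times[OF measurable_compose[OF m(1) c] m(2)])
    moreover have "(\<lambda>t. cnj (indicator {0<..<x} t *\<^sub>R (v t $ i)) * (indicator {0<..<x} t *\<^sub>R (u t $ j))) =
       (\<lambda>t. indicator {0<..<x} t *\<^sub>R (cnj (v t $ i) * u t $ j))"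
      by (auto simp: fun_eq_iff split: split_indicator)
    ultimately show "(\<lambda>t. indicator {0<..<x} t *\<^sub>R (cnj (v t $ i) * u t $ j)) \<in> borel_measurable borel" by simp
    show "norm (cnj (v t $ i) * u t $ j) \<le> D * C" if "t \<in> {0<..<x}" for t
    proof -
      have "norm (v t $ i) \<le> D" "norm (u t $ j) \<le> C"
        using C[OF that] D[OF that] Finite_Cartesian_Product.norm_nth_le order_trans by blast+
      then show ?thesis unfolding norm_mult complex_mod_cnj by (intro mult_mono) (auto intro: order_trans[OF norm_ge_zero])
    qed
  qed
  then have "set_integrable M {0<..<x} (\<lambda>t. \<Sum>i\<in>UNIV. \<Sum>j\<in>UNIV. 1 * (W t $ i $ j * (cnj (v t $ i) * u t $ j)))"
    by (rule set_integral_double_sum(1))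
  then have "set_integrable M {0<..<x} (\<lambda>t. w_form t (u t) (v t))" by (simp add: w_form_def mult_ac)
  then show ?thesis by (rule set_integrable_subset) (use E sets_M in auto)
qed

lemma w_form_int0: "x \<in> oint b \<Longrightarrow> bdd_borel 0 x u \<Longrightarrow> bdd_borel 0 x v \<Longrightarrow> set_integrable M {0<..<x} (\<lambda>t. w_form t (u t) (v t))"
  by (rule w_form_integrable) auto

lemma w_inner_linear:
  assumes "x \<in> oint b" "bdd_borel 0 x u" "bdd_borel 0 x u'" "bdd_borel 0 x v"
  shows "w_inner x (\<lambda>t. a *s u t + c *s u' t) v = a * w_inner x u v + c * w_inner x u' v"
proof -
  have i: "integrable M (\<lambda>t. a * (indicat_real {0<..<x} t *\<^sub>R w_form t (u t) (v t)))"
    "integrable M (\<lambda>t. c * (indicat_real {0<..<x} t *\<^sub>R w_form t (u' t) (v t)))"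
    using w_form_int0[OF assms(1,2,4)] w_form_int0[OF assms(1,3,4)] unfolding set_integrable_def
    by (intro integrable_mult_right; simp)+
  have "w_inner x (\<lambda>t. a *s u t + c *s u' t) v = (\<integral>t. a * (indicat_real {0<..<x} t *\<^sub>R w_form t (u t) (v t)) + c * (indicat_real {0<..<x} t *\<^sub>R w_form t (u' t) (v t)) \<partial>M)"
    unfolding w_inner_def set_lebesgue_integral_def w_form_linear by (simp add: scaleR_add_right)
  also have "\<dots> = a * w_inner x u v + c * w_inner x u' v"
    unfolding Bochner_Integration.integral_add[OF i] by (simp only: integral_mult_right_zero w_inner_def set_lebesgue_integral_def)
  finally show ?thesis .
qed

lemma w_inner_cnj: "w_inner x v u = cnj (w_inner x u v)"
proof -
  have eq: "(\<lambda>t. indicat_real {0<..<x} t *\<^sub>R w_form t (v t) (u t)) = (\<lambda>t. cnj (indicat_real {0<..<x} t *\<^sub>R w_form t (u t) (v t)))"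
  proof
    fix t show "indicat_real {0<..<x} t *\<^sub>R w_form t (v t) (u t) = cnj (indicat_real {0<..<x} t *\<^sub>R w_form t (u t) (v t))"
      unfolding w_form_cnj[of t "v t" "u t"] by simp
  qed
  show ?thesis unfolding w_inner_def set_lebesgue_integral_def eq by (simp del: complex_cnj_scaleR)
qed

lemma w_inner_self: "w_inner x u u = of_real (nrm2 x u)"
  using w_inner_cnj[of x u u] by (simp add: nrm2_def complex_eq_iff)

lemma w_inner_linear2:
  assumes "x \<in> oint b" "bdd_borel 0 x u" "bdd_borel 0 x u'" "bdd_borel 0 x v"
  shows "w_inner x v (\<lambda>t. a *s u t + c *s u' t) = cnj a * w_inner x v u + cnj c * w_inner x v u'"
  unfolding w_inner_cnj[of x v] w_inner_linear[OF assms] by simp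

lemma nrm2_eq:
  assumes "x \<in> oint b" "bdd_borel 0 x u"
  shows "nrm2 x u = (LINT t:{0<..<x}|M. Re (w_form t (u t) (u t)))"
  unfolding nrm2_def w_inner_def by (rule set_integral_Re(2)[symmetric, OF w_form_int0[OF assms(1,2,2)]])

lemma nrm2_nonneg: "x \<in> oint b \<Longrightarrow> bdd_borel 0 x u \<Longrightarrow> 0 \<le> nrm2 x u"
  unfolding nrm2_eq set_lebesgue_integral_def by (intro integral_nonneg_AE AE_I2) (simp add: w_form_nonneg)

lemma nrm2_mono:
  assumes y: "y \<in> oint b" and u: "bdd_borel 0 y u" and x: "0 < x" "x \<le> y"
  shows "nrm2 x u \<le> nrm2 y u"
proof -
  have xo: "x \<in> oint b" using oint_smaller[OF y x] .
  have ux: "bdd_borel 0 x u" using bdd_borel_subset[OF u _ x(2)] by simp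
  show ?thesis
    unfolding nrm2_eq[OF xo ux] nrm2_eq[OF y u] set_lebesgue_integral_def
    using set_integral_Re(1)[OF w_form_int0[OF xo ux ux]] set_integral_Re(1)[OF w_form_int0[OF y u u]] x
    unfolding set_integrable_def
    by (intro integral_mono) (auto simp: w_form_nonneg split: split_indicator)
qed

lemma nrm2_lincomb:
  assumes "x \<in> oint b" "bdd_borel 0 x u" "bdd_borel 0 x v"
  shows "nrm2 x (\<lambda>t. a *s u t + c *s v t) =
    (norm a)\<^sup>2 * nrm2 x u + (norm c)\<^sup>2 * nrm2 x v + 2 * Re (a * cnj c * w_inner x u v)"
proof -
  define r where "r = a * cnj c * w_inner x u v"
  have "w_inner x (\<lambda>t. a *s u t + c *s v t) (\<lambda>t. a *s u t + c *s v t) =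
     a * (cnj a * w_inner x u u + cnj c * w_inner x u v) + c * (cnj a * w_inner x v u + cnj c * w_inner x v v)"
    using assms bdd_borel_lincomb[OF assms(2,3)] by (simp only: w_inner_linear w_inner_linear2)
  also have "\<dots> = of_real ((norm a)\<^sup>2 * nrm2 x u + (norm c)\<^sup>2 * nrm2 x v) + (r + cnj r)"
    unfolding w_inner_self w_inner_cnj[of x v u] r_def
    by (simp add: complex_norm_square algebra_simps del: of_real_power)
  finally have "w_inner x (\<lambda>t. a *s u t + c *s v t) (\<lambda>t. a *s u t + c *s v t) =
     of_real ((norm a)\<^sup>2 * nrm2 x u + (norm c)\<^sup>2 * nrm2 x v) + (r + cnj r)" .
  then have "nrm2 x (\<lambda>t. a *s u t + c *s v t) = Re (of_real ((norm a)\<^sup>2 * nrm2 x u + (norm c)\<^sup>2 * nrm2 x v) + (r + cnj r))"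
    unfolding nrm2_def[of x "\<lambda>t. a *s u t + c *s v t"] by (rule arg_cong)
  then show ?thesis unfolding r_def[symmetric] plus_complex.sel Re_complex_of_real complex_cnj by simp
qed

lemma cauchy_schwarz:
  assumes x: "x \<in> oint b" and u: "bdd_borel 0 x u" and v: "bdd_borel 0 x v"
  shows "(norm (w_inner x u v))\<^sup>2 \<le> nrm2 x u * nrm2 x v"
proof -
  define p where "p = w_inner x u v"
  have pos: "0 \<le> nrm2 x u - 2 * s * (norm p)\<^sup>2 + s\<^sup>2 * (norm p)\<^sup>2 * nrm2 x v" for s :: real
  proof -
    have "0 \<le> nrm2 x (\<lambda>t. 1 *s u t + (- (of_real s * p)) *s v t)"
      by (intro nrm2_nonneg[OF x] bdd_borel_lincomb u v)
    also have "\<dots> = nrm2 x u - 2 * s * (norm p)\<^sup>2 + s\<^sup>2 * (norm p)\<^sup>2 * nrm2 x v"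
    proof -
      have "Re (1 * cnj (- (of_real s * p)) * p) = - (s * (norm p)\<^sup>2)"
        unfolding cmod_power2 by (simp add: algebra_simps power2_eq_square)
      then show ?thesis unfolding nrm2_lincomb[OF x u v] p_def[symmetric]
        by (simp add: norm_mult power_mult_distrib algebra_simps)
    qed
    finally show ?thesis .
  qed
  have v0: "0 \<le> nrm2 x v" and u0: "0 \<le> nrm2 x u" using nrm2_nonneg x u v by auto
  show ?thesis
  proof (cases "nrm2 x v = 0")
    case True
    have "(norm p)\<^sup>2 = 0"
    proof (rule ccontr)
      assume "(norm p)\<^sup>2 \<noteq> 0"
      then have "0 < (norm p)\<^sup>2" by simp
      then have "(nrm2 x u + 1) / (norm p)\<^sup>2 * (norm p)\<^sup>2 = nrm2 x u + 1" by simp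
      then have "0 \<le> nrm2 x u - 2 * (nrm2 x u + 1)"
        using pos[of "(nrm2 x u + 1) / (norm p)\<^sup>2"] unfolding True by (simp only: mult.assoc mult_zero_right add_0_right)
      then show False using u0 by simp
    qed
    then show ?thesis using True by (simp add: p_def)
  next
    case False
    then have v1: "0 < nrm2 x v" using v0 by simp
    have "0 \<le> nrm2 x u - (norm p)\<^sup>2 / nrm2 x v"
      using pos[of "1 / nrm2 x v"] v1 by (simp add: field_simps power2_eq_square)
    then show ?thesis using v1 by (simp add: field_simps p_def)
  qed
qed

text \<open>
  A vector on which a non-negative Hermitian matrix has the value \<open>0\<close> lies in its kernel; this is the usual
  argument with a quadratic polynomial in a real variable \<open>s\<close>.
\<close>

lemma nrm2_zero_AE:
  assumes x: "x \<in> oint b" and u: "bdd_borel 0 x u" and z: "nrm2 x u = 0"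
  shows "AE t in M. t \<in> {0<..<x} \<longrightarrow> W t *v u t = 0"
proof -
  have i: "integrable M (\<lambda>t. indicat_real {0<..<x} t *\<^sub>R Re (w_form t (u t) (u t)))"
    using set_integral_Re(1)[OF w_form_int0[OF x u u]] unfolding set_integrable_def .
  have "AE t in M. indicat_real {0<..<x} t *\<^sub>R Re (w_form t (u t) (u t)) = 0"
    using z integral_nonneg_eq_0_iff_AE[OF i AE_I2] unfolding nrm2_eq[OF x u] set_lebesgue_integral_def
    by (simp add: w_form_nonneg)
  then show ?thesis
  proof eventually_elim
    case (elim t)
    show ?case
    proof
      assume "t \<in> {0<..<x}"
      then have w0: "Re (w_form t (u t) (u t)) = 0" using elim by simp
      let ?u = "u t"
      have pos: "0 \<le> 2 * s * Re (w_form t ?u v) + s\<^sup>2 * Re (w_form t v v)" for s :: real and v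
      proof -
        have "0 \<le> Re (w_form t (1 *s ?u + of_real s *s v) (1 *s ?u + of_real s *s v))" by (rule w_form_nonneg)
        also have "\<dots> = Re (w_form t ?u ?u + of_real s * (w_form t ?u v + w_form t v ?u) + of_real (s\<^sup>2) * w_form t v v)"
          unfolding w_form_linear w_form_linear2 by (simp add: algebra_simps power2_eq_square)
        also have "\<dots> = 2 * s * Re (w_form t ?u v) + s\<^sup>2 * Re (w_form t v v)"
          unfolding w_form_cnj[of t v ?u] using w0 by simp
        finally show ?thesis .
      qed
      have re0: "Re (w_form t ?u v) \<ge> 0" for v
      proof (rule ccontr)
        assume "\<not> ?thesis"
        then have n: "Re (w_form t ?u v) < 0" by simp
        define A where "A = Re (w_form t v v)"
        have A: "0 \<le> A" unfolding A_def by (rule w_form_nonneg)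
        \<comment> \<open>Small enough that the linear term of the polynomial dominates the quadratic one.\<close>
        define s where "s = - Re (w_form t ?u v) / (A + 1)"
        have s: "0 < s" unfolding s_def by (rule divide_pos_pos) (use n A in auto)
        have "s * A \<le> - Re (w_form t ?u v)" using n A by (simp add: s_def field_simps)
        then have "s * (2 * Re (w_form t ?u v) + s * A) < 0"
          using s n by (intro mult_pos_neg) auto
        then show False using pos[of s v] by (simp add: A_def algebra_simps power2_eq_square)
      qed
      have "w_form t ?u v = (\<Sum>i\<in>UNIV. cnj (v $ i) * (W t *v ?u) $ i)" for v
        by (simp add: w_form_def matrix_vector_mult_def sum_2 algebra_simps)
      then have "Re (w_form t ?u (- (W t *v ?u))) = - ((norm ((W t *v ?u) $ 1))\<^sup>2 + (norm ((W t *v ?u) $ 2))\<^sup>2)"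
        unfolding cmod_power2 by (simp add: sum_2 power2_eq_square)
      then have "(norm ((W t *v ?u) $ 1))\<^sup>2 + (norm ((W t *v ?u) $ 2))\<^sup>2 \<le> 0"
        using re0[of "- (W t *v ?u)"] by simp
      then have "(W t *v ?u) $ 1 = 0" "(W t *v ?u) $ 2 = 0"
        by (smt (verit) zero_le_power2 zero_eq_power2 norm_eq_zero)+
      then show "W t *v ?u = 0" by (simp add: vec_eq_iff forall_2)
    qed
  qed
qed

section \<open>The integral equation and Lagrange's identity\<close>

text \<open>
  For a solution \<open>u\<close> this is the left limit \<open>u (x-)\<close>; at \<open>x = 0\<close> it is \<open>u 0\<close>.
\<close>

definition left_val :: "complex \<Rightarrow> real \<Rightarrow> (real \<Rightarrow> complex^2) \<Rightarrow> complex^2" where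
  "left_val z x u = u 0 + (LINT t:{0<..<x}|M. rhs z t (u t))"

text \<open>
  The integral equation on \<open>(0, x)\<close>.  The half atom makes \<open>u t\<close> the mean of the one-sided limits at \<open>t\<close>.
\<close>

definition solves :: "complex \<Rightarrow> real \<Rightarrow> (real \<Rightarrow> complex^2) \<Rightarrow> bool" where
  "solves z x u \<longleftrightarrow> bdd_borel 0 x u \<and> (\<forall>t\<in>{0<..<x}. u t = left_val z t u + (measure M {t} / 2) *\<^sub>R rhs z t (u t))"

lemma left_val_0 [simp]: "left_val z 0 u = u 0"
  by (simp add: left_val_def set_lebesgue_integral_def)

lemma solves_bdd_borel: "solves z x u \<Longrightarrow> bdd_borel 0 x u"
  by (simp add: solves_def)

lemma solves_restrict: "solves z y u \<Longrightarrow> x \<le> y \<Longrightarrow> solves z x u"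
  unfolding solves_def using bdd_borel_subset[of 0 y u 0 x] by auto

lemma rhs_integral_lincomb:
  assumes "0 \<le> x" "y \<in> oint b" "bdd_borel x y u" "bdd_borel x y v" "A \<in> sets borel" "A \<subseteq> {x<..<y}"
  shows "(LINT t:A|M. rhs z t (a *s u t + c *s v t)) = a *s (LINT t:A|M. rhs z t (u t)) + c *s (LINT t:A|M. rhs z t (v t))"
proof -
  have iu: "set_integrable M A (\<lambda>t. rhs z t (u t))" and iv: "set_integrable M A (\<lambda>t. rhs z t (v t))"
    using rhs_integrable_sub assms by blast+
  have bl: "bounded_linear (\<lambda>v::complex^2. a *s v)" for a
    by (rule bounded_linear_intro[of _ "norm a"]) (simp_all add: vec_eq_iff norm_smult algebra_simps)
  have i: "integrable M (\<lambda>t. a *s (indicat_real A t *\<^sub>R rhs z t (u t)))" "integrable M (\<lambda>t. c *s (indicat_real A t *\<^sub>R rhs z t (v t)))"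
    using iu iv unfolding set_integrable_def by (auto intro: integrable_bounded_linear[OF bl])
  have "(LINT t:A|M. rhs z t (a *s u t + c *s v t)) = (\<integral>t. a *s (indicat_real A t *\<^sub>R rhs z t (u t)) + c *s (indicat_real A t *\<^sub>R rhs z t (v t)) \<partial>M)"
    unfolding set_lebesgue_integral_def
    by (intro Bochner_Integration.integral_cong refl) (simp add: rhs_add rhs_smult vec_eq_iff scaleR_add_right)
  also have "\<dots> = a *s (LINT t:A|M. rhs z t (u t)) + c *s (LINT t:A|M. rhs z t (v t))"
    using iu iv unfolding Bochner_Integration.integral_add[OF i] set_lebesgue_integral_def set_integrable_def
    by (simp add: integral_bounded_linear[OF bl])
  finally show ?thesis .
qed

lemma left_val_lincomb:
  assumes "x \<in> oint b" "bdd_borel 0 x u" "bdd_borel 0 x v"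
  shows "left_val z x (\<lambda>t. a *s u t + c *s v t) = a *s left_val z x u + c *s left_val z x v"
  unfolding left_val_def using rhs_integral_lincomb[OF _ assms(1-3), of "{0<..<x}" z a c]
  by (simp add: vec_eq_iff algebra_simps)

lemma solves_lincomb:
  assumes x: "x \<in> oint b" and u: "solves z x u" and v: "solves z x v"
  shows "solves z x (\<lambda>t. a *s u t + c *s v t)"
proof -
  have "a *s u t + c *s v t = left_val z t (\<lambda>t. a *s u t + c *s v t) + (measure M {t} / 2) *\<^sub>R rhs z t (a *s u t + c *s v t)"
    if t: "t \<in> {0<..<x}" for t
  proof -
    have to: "t \<in> oint b" using oint_smaller[OF x] t by simp
    have eu: "u t = left_val z t u + (measure M {t} / 2) *\<^sub>R rhs z t (u t)" and ev: "v t = left_val z t v + (measure M {t} / 2) *\<^sub>R rhs z t (v t)"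
      using u v t unfolding solves_def by blast+
    have "left_val z t (\<lambda>t. a *s u t + c *s v t) = a *s left_val z t u + c *s left_val z t v"
      using t by (intro left_val_lincomb to bdd_borel_subset[OF solves_bdd_borel[OF u] order_refl] bdd_borel_subset[OF solves_bdd_borel[OF v] order_refl]) simp_all
    moreover have "a *s u t + c *s v t = a *s (left_val z t u + (measure M {t} / 2) *\<^sub>R rhs z t (u t)) + c *s (left_val z t v + (measure M {t} / 2) *\<^sub>R rhs z t (v t))"
      using eu ev by simp
    ultimately show ?thesis by (simp add: rhs_add rhs_smult vec_eq_iff algebra_simps)
  qed
  then show ?thesis unfolding solves_def using bdd_borel_lincomb[OF solves_bdd_borel[OF u] solves_bdd_borel[OF v]] by blast
qed

text \<open>
  The product rule, applied to the components of \<open>v\<^sup>*\<close> and \<open>u\<close>, and the pointwise identity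
  \<open>(J (Q - \<zeta> W) p)\<^sup>* J r + p\<^sup>* J (J (Q - z W) r) = (z - cnj \<zeta>) p\<^sup>* W r\<close>, in which \<open>Q\<close> cancels because it is
  Hermitian.
\<close>

theorem lagrange:
  assumes x: "x \<in> oint b" and u: "solves z x u" and v: "solves \<zeta> x v"
  shows "sform (left_val \<zeta> x v) (left_val z x u) = sform (v 0) (u 0) + (z - cnj \<zeta>) * w_inner x u v"
proof -
  have uB: "bdd_borel 0 x u" and vB: "bdd_borel 0 x v" using u v by (simp_all add: solves_bdd_borel)
  have iu: "set_integrable M {0<..<t} (\<lambda>t. rhs z t (u t))" and iv: "set_integrable M {0<..<t} (\<lambda>t. rhs \<zeta> t (v t))" if "t \<le> x" for t
    using that by (intro rhs_integrable_sub[OF _ x] uB vB; auto)+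
  have cn: "set_integrable M E' (\<lambda>t. cnj (f t)) \<and> (LINT t:E'|M. cnj (f t)) = cnj (LINT t:E'|M. f t)"
    if "set_integrable M E' f" for E' and f :: "real \<Rightarrow> complex"
  proof -
    have eq: "(\<lambda>x. indicat_real E' x *\<^sub>R cnj (f x)) = (\<lambda>x. cnj (indicat_real E' x *\<^sub>R f x))" by simp
    show ?thesis using that unfolding set_integrable_def set_lebesgue_integral_def eq
      by (simp add: integral_cnj integrable_cnj del: complex_cnj_scaleR)
  qed
  have Eu: "u 0 $ j + (LINT s:{0<..<t}|M. rhs z s (u s) $ j) = left_val z t u $ j" if "t \<le> x" for t j
    using set_integral_vec_nth(2)[OF iu[OF that], of j] by (simp add: left_val_def)
  have Ev: "cnj (v 0 $ j) + (LINT s:{0<..<t}|M. cnj (rhs \<zeta> s (v s) $ j)) = cnj (left_val \<zeta> t v $ j)" if "t \<le> x" for t j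
    using set_integral_vec_nth[OF iv[OF that], of j] cn by (simp add: left_val_def)
  have ut: "left_val z t u $ j + (measure M {t} / 2) *\<^sub>R (rhs z t (u t) $ j) = u t $ j" if "t \<in> {0<..<x}" for t j
    using u that unfolding solves_def by (metis vector_add_component vector_scaleR_component)
  have vt: "cnj (left_val \<zeta> t v $ j) + (measure M {t} / 2) *\<^sub>R cnj (rhs \<zeta> t (v t) $ j) = cnj (v t $ j)" if "t \<in> {0<..<x}" for t j
    using v that unfolding solves_def by (metis vector_add_component vector_scaleR_component complex_cnj_add complex_cnj_scaleR)
  have main: "set_integrable M {0<..<x} (\<lambda>t. cnj (rhs \<zeta> t (v t) $ j) * u t $ k + cnj (v t $ j) * rhs z t (u t) $ k) \<and>
    cnj (left_val \<zeta> x v $ j) * left_val z x u $ k - cnj (v 0 $ j) * u 0 $ k =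
      (LINT t:{0<..<x}|M. cnj (rhs \<zeta> t (v t) $ j) * u t $ k + cnj (v t $ j) * rhs z t (u t) $ k)" for j k
  proof -
    have i1: "set_integrable M {0<..<x} (\<lambda>t. cnj (rhs \<zeta> t (v t) $ j))" "set_integrable M {0<..<x} (\<lambda>t. rhs z t (u t) $ k)"
      using set_integral_vec_nth(1)[OF iu[of x]] set_integral_vec_nth(1)[OF iv[of x]] cn by auto
    note pr = product_rule[OF i1 x, where ?f0.0 = "cnj (v 0 $ j)" and ?g0.0 = "u 0 $ k"]
    have eq: "(\<lambda>t. indicat_real {0<..<x} t *\<^sub>R (cnj (rhs \<zeta> t (v t) $ j) * (u 0 $ k + (LINT s:{0<..<t}|M. rhs z s (u s) $ k) + (measure M {t} / 2) *\<^sub>R rhs z t (u t) $ k)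
        + (cnj (v 0 $ j) + (LINT s:{0<..<t}|M. cnj (rhs \<zeta> s (v s) $ j)) + (measure M {t} / 2) *\<^sub>R cnj (rhs \<zeta> t (v t) $ j)) * rhs z t (u t) $ k)) =
       (\<lambda>t. indicat_real {0<..<x} t *\<^sub>R (cnj (rhs \<zeta> t (v t) $ j) * u t $ k + cnj (v t $ j) * rhs z t (u t) $ k))"
    proof
      fix t
      show "indicat_real {0<..<x} t *\<^sub>R (cnj (rhs \<zeta> t (v t) $ j) * (u 0 $ k + (LINT s:{0<..<t}|M. rhs z s (u s) $ k) + (measure M {t} / 2) *\<^sub>R rhs z t (u t) $ k)
        + (cnj (v 0 $ j) + (LINT s:{0<..<t}|M. cnj (rhs \<zeta> s (v s) $ j)) + (measure M {t} / 2) *\<^sub>R cnj (rhs \<zeta> t (v t) $ j)) * rhs z t (u t) $ k) =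
        indicat_real {0<..<x} t *\<^sub>R (cnj (rhs \<zeta> t (v t) $ j) * u t $ k + cnj (v t $ j) * rhs z t (u t) $ k)"
      proof (cases "t \<in> {0<..<x}")
        case True
        then have "t \<le> x" by simp
        show ?thesis unfolding Eu[OF \<open>t \<le> x\<close>] Ev[OF \<open>t \<le> x\<close>] ut[OF True] vt[OF True] ..
      next
        case False
        then have "indicat_real {0<..<x} t = 0" by simp
        then show ?thesis by (simp only: scaleR_zero_left)
      qed
    qed
    show ?thesis using pr unfolding set_integrable_def set_lebesgue_integral_def[of M "{0<..<x}" "\<lambda>t. _ t + _ t"] eq
      unfolding Eu[OF order_refl] Ev[OF order_refl] by blast
  qed
  have pt: "(cnj (rhs \<zeta> t p $ 2) * r $ 1 + cnj (p $ 2) * rhs z t r $ 1) - (cnj (rhs \<zeta> t p $ 1) * r $ 2 + cnj (p $ 1) * rhs z t r $ 2)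
      = (z - cnj \<zeta>) * w_form t r p" for t p r
    unfolding rhs_nth w_form_def by (simp add: sum_2 Q_cnj W_cnj algebra_simps)
  have "sform (left_val \<zeta> x v) (left_val z x u) - sform (v 0) (u 0) =
     (LINT t:{0<..<x}|M. (cnj (rhs \<zeta> t (v t) $ 2) * u t $ 1 + cnj (v t $ 2) * rhs z t (u t) $ 1) - (cnj (rhs \<zeta> t (v t) $ 1) * u t $ 2 + cnj (v t $ 1) * rhs z t (u t) $ 2))"
    by (subst set_integral_diff(2)) (simp_all add: main[THEN conjunct1] main[THEN conjunct2, symmetric] sform_def)
  also have "\<dots> = (z - cnj \<zeta>) * w_inner x u v" unfolding pt w_inner_def by (rule set_integral_mult_right)
  finally show ?thesis by (simp add: algebra_simps)
qed

lemma energy_identity: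
  assumes x: "x \<in> oint b" and u: "solves z x u"
  shows "hform (left_val z x u) = hform (u 0) + 2 * Im z * nrm2 x u"
proof -
  have "\<i> * hform (left_val z x u) = \<i> * hform (u 0) + (z - cnj z) * of_real (nrm2 x u)"
    using lagrange[OF x u u] unfolding sform_self w_inner_self .
  then have "Im (\<i> * hform (left_val z x u)) = Im (\<i> * hform (u 0) + (z - cnj z) * of_real (nrm2 x u))" by (rule arg_cong)
  then show ?thesis by simp
qed

text \<open>
  A solution of norm \<open>0\<close> satisfies \<open>W u = 0\<close> almost everywhere and at every atom of \<open>M\<close>, so the parameter drops
  out of the equation.
\<close>

lemma nrm2_zero_solves:
  assumes x: "x \<in> oint b" and u: "solves z x u" and n: "nrm2 x u = 0"
  shows "solves \<zeta> x u"
proof -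
  have uB: "bdd_borel 0 x u" using u by (rule solves_bdd_borel)
  have ae: "AE t in M. t \<in> {0<..<x} \<longrightarrow> rhs z t (u t) = rhs \<zeta> t (u t)"
    using nrm2_zero_AE[OF x uB n] by eventually_elim (simp add: rhs_def)
  have E: "left_val z t u = left_val \<zeta> t u" if "t \<le> x" for t
  proof -
    have uBt: "bdd_borel 0 t u" using bdd_borel_subset[OF uB _ that] by simp
    have "(\<integral>s. indicat_real {0<..<t} s *\<^sub>R rhs z s (u s) \<partial>M) = (\<integral>s. indicat_real {0<..<t} s *\<^sub>R rhs \<zeta> s (u s) \<partial>M)"
    proof (rule integral_cong_AE)
      show "AE s in M. indicat_real {0<..<t} s *\<^sub>R rhs z s (u s) = indicat_real {0<..<t} s *\<^sub>R rhs \<zeta> s (u s)"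
        using ae
      proof eventually_elim
        case (elim s) then show ?case using that by (cases "s \<in> {0<..<t}") auto
      qed
    qed (use rhs_measurable[OF uBt] in simp_all)
    then show ?thesis by (simp add: left_val_def set_lebesgue_integral_def)
  qed
  have at: "measure M {t} *\<^sub>R rhs z t (u t) = measure M {t} *\<^sub>R rhs \<zeta> t (u t)" if "t \<in> {0<..<x}" for t
  proof (cases "rhs z t (u t) = rhs \<zeta> t (u t)")
    case False
    have "AE s in M. s \<noteq> t" using ae by eventually_elim (use False that in auto)
    then have "{t} \<in> null_sets M" by (subst AE_iff_null_sets) (simp_all add: sets_M)
    then show ?thesis by (simp add: measure_def null_setsD1)
  qed simp
  have half: "(m / 2) *\<^sub>R a = (1/2::real) *\<^sub>R (m *\<^sub>R a)" for m :: real and a :: "complex^2" by simp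
  show ?thesis unfolding solves_def
  proof (intro conjI ballI uB)
    fix t assume t: "t \<in> {0<..<x}"
    have "u t = left_val z t u + (measure M {t} / 2) *\<^sub>R rhs z t (u t)" using u t unfolding solves_def by blast
    also have "\<dots> = left_val \<zeta> t u + (measure M {t} / 2) *\<^sub>R rhs \<zeta> t (u t)"
      unfolding half[of "measure M {t}"] at[OF t] using E[of t] t by simp
    finally show "u t = left_val \<zeta> t u + (measure M {t} / 2) *\<^sub>R rhs \<zeta> t (u t)" .
  qed
qed

end

section \<open>Existence and uniqueness on short intervals\<close>

text \<open>
  Unknown vectors of a linear problem in \<open>\<complex>\<^sup>2\<close> are found below by proving that the homogeneous problem has
  only the trivial solution.
\<close>

lemma linear_inj_surj:
  fixes f :: "complex^2 \<Rightarrow> complex^2"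
  assumes add: "\<And>u v. f (u + v) = f u + f v" and sc: "\<And>c v. f (c *s v) = c *s f v"
    and inj: "\<And>v. f v = 0 \<Longrightarrow> v = 0"
  shows "\<exists>v. f v = w"
proof -
  have lin: "Vector_Spaces.linear (*s) (*s) f"
    by unfold_locales (simp_all add: add sc)
  have "inj f"
  proof (rule injI)
    fix u v assume "f u = f v"
    then have "f (u + (-1) *s v) = 0" unfolding add sc by (simp add: vec_eq_iff)
    from inj[OF this] show "u = v" by (simp add: vec_eq_iff)
  qed
  then have "surj f" by (rule vec.linear_inj_imp_surj[OF lin])
  then show ?thesis by (metis surjD)
qed

context canonical_system begin

text \<open>
  On an open interval of small mass the integral operator of the equation is a contraction.  The
  endpoints are excluded because an atom there may be large.
\<close>

definition mass :: "complex \<Rightarrow> real \<Rightarrow> real \<Rightarrow> real" where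
  "mass z x y = (LINT t:{x<..<y}|M. coeff_size z t)"

lemma coeff_size_integral_mono:
  assumes "0 \<le> x" "y \<in> oint b" "A \<in> sets borel" "B \<in> sets borel" "A \<subseteq> B" "B \<subseteq> {x<..<y}"
  shows "(LINT t:A|M. coeff_size z t) \<le> (LINT t:B|M. coeff_size z t)"
  using coeff_size_integrable'[OF assms(1,2,3), of z] coeff_size_integrable'[OF assms(1,2,4), of z] assms(5,6)
  unfolding set_lebesgue_integral_def set_integrable_def
  by (intro integral_mono) (auto split: split_indicator)

lemma mass_mono: "0 \<le> x \<Longrightarrow> x \<le> x' \<Longrightarrow> y' \<le> y \<Longrightarrow> y \<in> oint b \<Longrightarrow> mass z x' y' \<le> mass z x y"
  unfolding mass_def by (rule coeff_size_integral_mono[of x y]) auto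

lemma mass_nonneg: "0 \<le> mass z x y"
  unfolding mass_def set_lebesgue_integral_def by (intro integral_nonneg_AE AE_I2) simp

lemma atom_le_mass:
  assumes "0 \<le> x" "y \<in> oint b" "t \<in> {x<..<y}"
  shows "measure M {t} * coeff_size z t \<le> mass z x y"
proof -
  have "t \<in> oint b" using oint_smaller[OF assms(2), of t] assms(1,3) by simp
  then have "measure M {t} * coeff_size z t = (LINT s:{t}|M. coeff_size z s)" using singleton_integral(2)[of t "coeff_size z"] by simp
  also have "\<dots> \<le> mass z x y" unfolding mass_def by (rule coeff_size_integral_mono[OF assms(1,2)]) (use assms in auto)
  finally show ?thesis .
qed

text \<open>
  Dominated convergence.  Used for intervals that shrink to one of their excluded endpoints.
\<close>

lemma coeff_size_integral_to_0:
  fixes A :: "nat \<Rightarrow> real set"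
  assumes c: "c \<in> oint b" and A: "\<And>n. A n \<in> sets borel" "\<And>n. A n \<subseteq> {0<..<c}"
    and ev: "\<And>t. \<forall>\<^sub>F n in sequentially. t \<notin> A n"
  shows "(\<lambda>n. LINT t:A n|M. coeff_size z t) \<longlonglongrightarrow> 0"
proof -
  have "(\<lambda>n. \<integral>t. indicat_real (A n) t *\<^sub>R coeff_size z t \<partial>M) \<longlonglongrightarrow> integral\<^sup>L M (\<lambda>t. 0)"
  proof (rule integral_dominated_convergence[where w="\<lambda>t. indicat_real {0<..<c} t *\<^sub>R coeff_size z t"])
    show "integrable M (\<lambda>t. indicat_real {0<..<c} t *\<^sub>R coeff_size z t)"
      using coeff_size_integrable[OF c, of z] unfolding set_integrable_def .
    show "(\<lambda>t. indicat_real (A n) t *\<^sub>R coeff_size z t) \<in> borel_measurable M" for n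
      using A(1)[of n] by simp
    show "AE t in M. (\<lambda>n. indicat_real (A n) t *\<^sub>R coeff_size z t) \<longlonglongrightarrow> 0"
    proof (rule AE_I2)
      fix t show "(\<lambda>n. indicat_real (A n) t *\<^sub>R coeff_size z t) \<longlonglongrightarrow> 0"
        by (rule tendsto_eventually) (use ev[of t] in \<open>eventually_elim, simp\<close>)
    qed
    show "AE t in M. norm (indicat_real (A n) t *\<^sub>R coeff_size z t) \<le> indicat_real {0<..<c} t *\<^sub>R coeff_size z t" for n
      by (rule AE_I2) (use A(2)[of n] in \<open>auto split: split_indicator\<close>)
  qed simp
  then show ?thesis by (simp add: set_lebesgue_integral_def)
qed

lemma mass_left:
  assumes s: "s \<in> oint b" and e: "0 < e"
  shows "\<exists>x0. 0 \<le> x0 \<and> x0 < s \<and> mass z x0 s < e"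
proof -
  have s0: "0 < s" using s by (simp add: oint_def)
  let ?a = "\<lambda>n. max 0 (s - 1 / real (Suc n))"
  have "(\<lambda>n. LINT t:{?a n<..<s}|M. coeff_size z t) \<longlonglongrightarrow> 0"
  proof (rule coeff_size_integral_to_0[OF s])
    fix t
    show "\<forall>\<^sub>F n in sequentially. t \<notin> {?a n<..<s}"
    proof (cases "t < s")
      case True
      then obtain n0 where n0: "1 / real (Suc n0) < s - t" using nat_approx_posE[of "s - t"] by auto
      have "t \<notin> {?a n<..<s}" if "n \<ge> n0" for n
      proof -
        have "1 / real (Suc n) \<le> 1 / real (Suc n0)" using that by (simp add: frac_le)
        then show ?thesis using n0 by auto
      qed
      then show ?thesis unfolding eventually_sequentially by blast
    qed simp
  qed auto
  then have "\<forall>\<^sub>F n in sequentially. (LINT t:{?a n<..<s}|M. coeff_size z t) < e" using e by (rule order_tendstoD)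
  then obtain n where n: "(LINT t:{?a n<..<s}|M. coeff_size z t) < e" by (auto simp: eventually_sequentially)
  show ?thesis using n s0 by (intro exI[of _ "?a n"]) (simp add: mass_def)
qed

lemma mass_right:
  assumes s: "0 \<le> s" "s < c" and c: "c \<in> oint b" and e: "0 < e"
  shows "\<exists>y0. s < y0 \<and> y0 \<le> c \<and> mass z s y0 < e"
proof -
  let ?a = "\<lambda>n. min c (s + 1 / real (Suc n))"
  have "(\<lambda>n. LINT t:{s<..<?a n}|M. coeff_size z t) \<longlonglongrightarrow> 0"
  proof (rule coeff_size_integral_to_0[OF c])
    fix t
    show "\<forall>\<^sub>F n in sequentially. t \<notin> {s<..<?a n}"
    proof (cases "s < t")
      case True
      then obtain n0 where n0: "1 / real (Suc n0) < t - s" using nat_approx_posE[of "t - s"] by auto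
      have "t \<notin> {s<..<?a n}" if "n \<ge> n0" for n
      proof -
        have "1 / real (Suc n) \<le> 1 / real (Suc n0)" using that by (simp add: frac_le)
        then show ?thesis using n0 by auto
      qed
      then show ?thesis unfolding eventually_sequentially by blast
    qed simp
  qed (use s in auto)
  then have "\<forall>\<^sub>F n in sequentially. (LINT t:{s<..<?a n}|M. coeff_size z t) < e" using e by (rule order_tendstoD)
  then obtain n where n: "(LINT t:{s<..<?a n}|M. coeff_size z t) < e" by (auto simp: eventually_sequentially)
  show ?thesis using n s by (intro exI[of _ "?a n"]) (simp add: mass_def)
qed

text \<open>
  Real induction: the supremum of the points reached is itself reached, and can be passed, since every
  point \<open>s\<close> has punctured one-sided neighbourhoods of small mass.  Finitely many large atoms in \<open>(0, c)\<close>
  do no harm as they may serve as endpoints.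
\<close>

lemma interval_induction:
  assumes c: "c \<in> oint b" and e: "0 < e" and P0: "P 0"
    and step: "\<And>x y. 0 \<le> x \<Longrightarrow> x < y \<Longrightarrow> y \<le> c \<Longrightarrow> mass z x y < e \<Longrightarrow> P x \<Longrightarrow> P y"
  shows "P c"
proof -
  have c0: "0 < c" using c by (simp add: oint_def)
  define S where "S = {x. 0 \<le> x \<and> x \<le> c \<and> P x}"
  define s where "s = Sup S"
  have S0: "0 \<in> S" using P0 c0 by (simp add: S_def)
  have bdd: "bdd_above S" unfolding S_def by (rule bdd_aboveI[of _ c]) simp
  have s0: "0 \<le> s" unfolding s_def by (rule cSup_upper[OF S0 bdd])
  have sc: "s \<le> c" unfolding s_def by (rule cSup_least) (use S0 in \<open>auto simp: S_def\<close>)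
  have Ps: "P s"
  proof (cases "s = 0")
    case False
    then have so: "s \<in> oint b" using oint_smaller[OF c] s0 sc by simp
    obtain x0 where x0: "0 \<le> x0" "x0 < s" "mass z x0 s < e" using mass_left[OF so e] by blast
    obtain x where x: "x \<in> S" "x0 < x" using less_cSupD[of S x0] S0 x0(2) unfolding s_def by blast
    have xs: "x \<le> s" unfolding s_def by (rule cSup_upper[OF x(1) bdd])
    show ?thesis
    proof (cases "x = s")
      case True then show ?thesis using x by (simp add: S_def)
    next
      case False
      have "mass z x s \<le> mass z x0 s" by (rule mass_mono[OF x0(1) _ _ so]) (use x in auto)
      then show ?thesis using step[of x s] x xs sc False x0 by (simp add: S_def)
    qed
  qed (use P0 in simp)
  show ?thesis
  proof (cases "s = c")
    case False
    then obtain y0 where y0: "s < y0" "y0 \<le> c" "mass z s y0 < e" using mass_right[OF s0 _ c e, of z] sc by auto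
    then have "P y0" using step[of s y0] s0 Ps by simp
    then have "y0 \<in> S" using y0 s0 by (simp add: S_def)
    then have "y0 \<le> s" unfolding s_def by (rule cSup_upper[OF _ bdd])
    then show ?thesis using y0 by simp
  qed (use Ps in simp)
qed

definition balanced_integral :: "complex \<Rightarrow> real \<Rightarrow> (real \<Rightarrow> complex^2) \<Rightarrow> real \<Rightarrow> complex^2" where
  "balanced_integral z x u t = (LINT r:{x<..<t}|M. rhs z r (u r)) + (measure M {t} / 2) *\<^sub>R rhs z t (u t)"

text \<open>
  The factor \<open>3/2\<close> consists of \<open>1\<close> for the integral and \<open>1/2\<close> for the half atom at \<open>t\<close>.
\<close>

lemma balanced_integral_bound:
  assumes x: "0 \<le> x" "y \<in> oint b" and u: "bdd_borel x y u" and C: "\<And>t. t \<in> {x<..<y} \<Longrightarrow> norm (u t) \<le> C"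
    and t: "t \<in> {x<..<y}"
  shows "norm (balanced_integral z x u t) \<le> 3/2 * C * mass z x y"
proof -
  have C0: "0 \<le> C" using C[OF t] norm_ge_zero order_trans by blast
  have "norm (LINT r:{x<..<t}|M. rhs z r (u r)) \<le> C * (LINT r:{x<..<t}|M. coeff_size z r)"
    by (rule norm_rhs_integral_le[OF x u C]) (use t in auto)
  also have "\<dots> \<le> C * mass z x y"
    unfolding mass_def using t by (intro mult_left_mono[OF _ C0] coeff_size_integral_mono[OF x]) auto
  finally have 1: "norm (LINT r:{x<..<t}|M. rhs z r (u r)) \<le> C * mass z x y" .
  have "norm ((measure M {t} / 2) *\<^sub>R rhs z t (u t)) \<le> measure M {t} / 2 * (coeff_size z t * C)"
    using order_trans[OF norm_rhs_le mult_left_mono[OF C[OF t] coeff_size_nonneg]]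
    by (simp add: mult_left_mono)
  also have "\<dots> = (measure M {t} * coeff_size z t) * (C / 2)" by simp
  also have "\<dots> \<le> mass z x y * (C / 2)" by (rule mult_right_mono[OF atom_le_mass[OF x t]]) (use C0 in simp)
  finally have 2: "norm ((measure M {t} / 2) *\<^sub>R rhs z t (u t)) \<le> mass z x y * (C / 2)" .
  have "3/2 * C * mass z x y = C * mass z x y + mass z x y * (C / 2)" by (simp add: algebra_simps)
  then show ?thesis unfolding balanced_integral_def by (rule ssubst) (rule norm_triangle_le[OF add_mono[OF 1 2]])
qed

lemma balanced_integral_lincomb:
  assumes x: "0 \<le> x" "y \<in> oint b" and u: "bdd_borel x y u" and v: "bdd_borel x y v" and t: "t \<in> {x<..<y}"
  shows "balanced_integral z x (\<lambda>t. a *s u t + c *s v t) t = a *s balanced_integral z x u t + c *s balanced_integral z x v t"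
proof -
  have "(LINT r:{x<..<t}|M. rhs z r (a *s u r + c *s v r)) = a *s (LINT r:{x<..<t}|M. rhs z r (u r)) + c *s (LINT r:{x<..<t}|M. rhs z r (v r))"
    by (rule rhs_integral_lincomb[OF x u v]) (use t in auto)
  then show ?thesis by (simp add: balanced_integral_def rhs_add rhs_smult vec_eq_iff algebra_simps)
qed

lemma balanced_integral_bdd_borel:
  assumes x: "0 \<le> x" "y \<in> oint b" and u: "bdd_borel x y u"
  shows "bdd_borel x y (balanced_integral z x u)"
proof -
  interpret sigma_finite_measure M by (rule sigma_M)
  define h where "h r = indicator {x<..<y} r *\<^sub>R rhs z r (u r)" for r
  have h [measurable]: "h \<in> borel_measurable borel" unfolding h_def[abs_def] by (rule rhs_measurable[OF u])
  define g where "g t = (\<integral>r. (if x < r \<and> r < t then 1 else 0::real) *\<^sub>R h r \<partial>M)" for t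
  define m where "m t = (\<integral>r. (if r = t then 1 else 0::real) \<partial>M)" for t
  have setsP: "sets (borel \<Otimes>\<^sub>M M) = sets (borel \<Otimes>\<^sub>M borel)" by (intro sets_pair_measure_cong refl sets_M)
  have mP: "measurable (borel \<Otimes>\<^sub>M M) X = measurable (borel \<Otimes>\<^sub>M borel) X" for X :: "'z measure"
    by (rule measurable_cong_sets[OF setsP refl])
  have g: "g \<in> borel_measurable borel" unfolding g_def
  proof (rule borel_measurable_lebesgue_integral)
    show "(\<lambda>(t, r). (if x < r \<and> r < t then 1 else 0::real) *\<^sub>R h r) \<in> borel_measurable (borel \<Otimes>\<^sub>M M)"
      unfolding mP by measurable
  qed
  have m: "m \<in> borel_measurable borel" unfolding m_def
  proof (rule borel_measurable_lebesgue_integral)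
    show "(\<lambda>(t, r). (if r = t then 1 else 0::real)) \<in> borel_measurable (borel \<Otimes>\<^sub>M M)"
      unfolding mP by measurable
  qed
  have mm: "m t = measure M {t}" for t
  proof -
    have "m t = integral\<^sup>L M (indicator {t})" unfolding m_def
      by (intro Bochner_Integration.integral_cong refl) (simp add: indicator_def)
    then show ?thesis by simp
  qed
  have gg: "g t = (LINT r:{x<..<t}|M. rhs z r (u r))" if "t \<in> {x<..<y}" for t
    unfolding g_def set_lebesgue_integral_def h_def using that
    by (intro Bochner_Integration.integral_cong refl) (auto split: split_indicator)
  have eq: "(\<lambda>t. indicator {x<..<y} t *\<^sub>R balanced_integral z x u t) = (\<lambda>t. indicat_real {x<..<y} t *\<^sub>R g t + (m t / 2) *\<^sub>R h t)"
    by (auto simp: fun_eq_iff balanced_integral_def mm gg h_def split: split_indicator)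
  have "(\<lambda>t. indicator {x<..<y} t *\<^sub>R balanced_integral z x u t) \<in> borel_measurable borel"
    unfolding eq using g h m by (intro borel_measurable_add borel_measurable_scaleR borel_measurable_divide) simp_all
  note meas = this
  have "(\<lambda>t. indicator {x<..<y} t *\<^sub>R (balanced_integral z x u t $ j)) \<in> borel_measurable borel" for j
  proof -
    have "(\<lambda>v::complex^2. v $ j) \<in> borel_measurable borel"
      by (intro borel_measurable_continuous_onI continuous_intros)
    from measurable_compose[OF meas this] show ?thesis by simp
  qed
  moreover obtain C where "\<And>t. t \<in> {x<..<y} \<Longrightarrow> norm (u t) \<le> C" using u unfolding bdd_borel_def by blast
  then have "\<forall>t\<in>{x<..<y}. norm (balanced_integral z x u t) \<le> 3/2 * C * mass z x y"
    using balanced_integral_bound[OF x u] by blast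
  ultimately show ?thesis unfolding bdd_borel_def by blast
qed

text \<open>
  A solution on the open interval \<open>(x, y)\<close> with the right limit \<open>p\<close> at \<open>x\<close>.
\<close>

definition local_sol :: "complex \<Rightarrow> real \<Rightarrow> real \<Rightarrow> complex^2 \<Rightarrow> (real \<Rightarrow> complex^2) \<Rightarrow> bool" where
  "local_sol z x y p s \<longleftrightarrow> bdd_borel x y s \<and> (\<forall>t\<in>{x<..<y}. s t = p + balanced_integral z x s t)"

lemma bdd_borel_const: "bdd_borel x y (\<lambda>_. p)"
  unfolding bdd_borel_def by auto

text \<open>
  With mass at most \<open>1/3\<close> the integral operator has norm at most \<open>1/2\<close>, so a fixed point is bounded by
  \<open>C / 2 ^ n\<close> for all \<open>n\<close>.
\<close>

lemma local_sol_unique: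
  assumes x: "0 \<le> x" "y \<in> oint b" and m: "mass z x y \<le> 1/3" and s: "local_sol z x y 0 s" and t: "t \<in> {x<..<y}"
  shows "s t = 0"
proof -
  obtain C where C: "\<And>t. t \<in> {x<..<y} \<Longrightarrow> norm (s t) \<le> C" using s unfolding local_sol_def bdd_borel_def by blast
  have b: "norm (s t) \<le> C / 2 ^ n" if "t \<in> {x<..<y}" for n t
    using that
  proof (induction n arbitrary: t)
    case 0 show ?case using C[OF 0] by simp
  next
    case (Suc n)
    have c0: "0 \<le> C / 2 ^ n" using Suc.IH[OF Suc.prems] norm_ge_zero order_trans by blast
    have "norm (s t) = norm (balanced_integral z x s t)" using s Suc.prems unfolding local_sol_def by auto
    also have "\<dots> \<le> 3/2 * (C / 2 ^ n) * mass z x y"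
      by (rule balanced_integral_bound[OF x _ Suc.IH Suc.prems]) (use s in \<open>simp add: local_sol_def\<close>)
    also have "\<dots> \<le> 3/2 * (C / 2 ^ n) * (1/3)" using m c0 by (intro mult_left_mono) auto
    finally show ?case by simp
  qed
  have "(\<lambda>n. C * (1/2) ^ n) \<longlonglongrightarrow> C * 0" by (intro tendsto_intros LIMSEQ_realpow_zero) auto
  then have "(\<lambda>n. C / 2 ^ n) \<longlonglongrightarrow> 0" by (simp add: power_divide)
  then have "norm (s t) \<le> 0" by (rule LIMSEQ_le_const) (use b[OF t] in auto)
  then show ?thesis by simp
qed

text \<open>
  The Neumann series of the constant function \<open>p\<close>.
\<close>

lemma local_sol_ex:
  assumes x: "0 \<le> x" "y \<in> oint b" and m: "mass z x y \<le> 1/3"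
  shows "\<exists>s. local_sol z x y p s"
proof -
  define d where "d n = ((balanced_integral z x) ^^ n) (\<lambda>_. p)" for n
  have d0: "d 0 = (\<lambda>_. p)" and dS: "d (Suc n) = balanced_integral z x (d n)" for n by (simp_all add: d_def)
  have dB: "bdd_borel x y (d n)" for n by (induction n) (simp_all add: d0 dS bdd_borel_const balanced_integral_bdd_borel[OF x])
  have db: "norm (d n t) \<le> norm p * (1/2) ^ n" if "t \<in> {x<..<y}" for n t
    using that
  proof (induction n arbitrary: t)
    case 0 then show ?case by (simp add: d0)
  next
    case (Suc n)
    have "norm (d (Suc n) t) \<le> 3/2 * (norm p * (1/2) ^ n) * mass z x y"
      unfolding dS by (rule balanced_integral_bound[OF x dB Suc.IH Suc.prems])
    also have "\<dots> \<le> 3/2 * (norm p * (1/2) ^ n) * (1/3)" using m by (intro mult_left_mono) auto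
    finally show ?case by simp
  qed
  define S where "S N t = (\<Sum>n<N. d n t)" for N t
  have SB: "bdd_borel x y (S N)" for N
  proof (induction N)
    case 0 show ?case using bdd_borel_const[of x y 0] by (simp add: S_def[abs_def])
  next
    case (Suc N)
    have "S (Suc N) = (\<lambda>t. 1 *s S N t + 1 *s d N t)" by (simp add: S_def fun_eq_iff)
    then show ?case by (simp only: bdd_borel_lincomb[OF Suc dB])
  qed
  have TS: "p + balanced_integral z x (S N) t = S (Suc N) t" if "t \<in> {x<..<y}" for N t
  proof (induction N)
    case 0
    have "balanced_integral z x (\<lambda>_. 0) t = 0" by (simp add: balanced_integral_def set_lebesgue_integral_def)
    then show ?case by (simp add: S_def[abs_def] d0)
  next
    case (Suc N)
    have "S (Suc N) = (\<lambda>t. 1 *s S N t + 1 *s d N t)" by (simp add: S_def fun_eq_iff)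
    then have "balanced_integral z x (S (Suc N)) t = balanced_integral z x (S N) t + d (Suc N) t"
      using balanced_integral_lincomb[OF x SB dB that, of z 1 N 1 N] by (simp add: dS)
    then have "p + balanced_integral z x (S (Suc N)) t = (p + balanced_integral z x (S N) t) + d (Suc N) t" by (simp only: add.assoc)
    also have "\<dots> = S (Suc N) t + d (Suc N) t" by (simp only: Suc)
    also have "\<dots> = S (Suc (Suc N)) t" by (simp add: S_def)
    finally show ?case .
  qed
  define s where "s t = (\<Sum>n. d n t)" for t
  have sm: "summable (\<lambda>n. norm p * (1/2::real) ^ n)" by (intro summable_mult summable_geometric) simp
  have sd: "summable (\<lambda>n. d n t)" if "t \<in> {x<..<y}" for t
    by (rule summable_comparison_test'[OF sm]) (use db[OF that] in simp)
  have tail: "norm (s t - S N t) \<le> 2 * norm p * (1/2) ^ N" if t: "t \<in> {x<..<y}" for N t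
  proof -
    have "s t = (\<Sum>n. d (n + N) t) + S N t"
      unfolding s_def S_def by (rule suminf_split_initial_segment[OF sd[OF t]])
    then have "norm (s t - S N t) = norm (\<Sum>n. d (n + N) t)" by simp
    also have "\<dots> \<le> (\<Sum>n. norm p * (1/2) ^ (n + N))"
      by (rule norm_suminf_le[OF db[OF t]]) (use summable_ignore_initial_segment[OF sm, of N] in simp)
    also have "\<dots> = (\<Sum>n. (norm p * (1/2) ^ N) * (1/2) ^ n)" by (simp add: power_add mult_ac)
    also have "\<dots> = (norm p * (1/2) ^ N) * (\<Sum>n. (1/2) ^ n)" by (rule suminf_mult) (simp add: summable_geometric)
    also have "\<dots> = 2 * norm p * (1/2) ^ N" using suminf_geometric[of "1/2::real"] by simp
    finally show ?thesis .
  qed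
  have z0: "(\<lambda>N. K * (1/2::real) ^ N) \<longlonglongrightarrow> 0" for K
    using tendsto_mult_right_zero[OF LIMSEQ_realpow_zero[of "1/2::real"], of K] by simp
  have lim: "(\<lambda>N. S N t) \<longlonglongrightarrow> s t" if "t \<in> {x<..<y}" for t
    unfolding S_def s_def by (rule summable_LIMSEQ[OF sd[OF that]])
  have sB: "bdd_borel x y s"
  proof -
    have "(\<lambda>t. indicator {x<..<y} t *\<^sub>R (s t $ j)) \<in> borel_measurable borel" for j
    proof (rule borel_measurable_LIMSEQ_metric)
      show "(\<lambda>t. indicat_real {x<..<y} t *\<^sub>R (S N t $ j)) \<in> borel_measurable borel" for N
        using SB[of N] unfolding bdd_borel_def by blast
      show "(\<lambda>N. indicat_real {x<..<y} t *\<^sub>R (S N t $ j)) \<longlonglongrightarrow> indicat_real {x<..<y} t *\<^sub>R (s t $ j)" for t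
        using tendsto_vec_nth[OF lim[of t], of j] by (cases "t \<in> {x<..<y}") simp_all
    qed
    moreover have "\<forall>t\<in>{x<..<y}. norm (s t) \<le> 2 * norm p" using tail[of _ 0] by (simp add: S_def)
    ultimately show ?thesis unfolding bdd_borel_def by blast
  qed
  have "s t = p + balanced_integral z x s t" if t: "t \<in> {x<..<y}" for t
  proof -
    have "norm (s t - (p + balanced_integral z x s t)) \<le> 3 * norm p * (1/2) ^ N" for N
    proof -
      have dB': "bdd_borel x y (\<lambda>t. 1 *s s t + (-1) *s S N t)" by (rule bdd_borel_lincomb[OF sB SB])
      have "norm (balanced_integral z x (\<lambda>t. 1 *s s t + (-1) *s S N t) t) \<le> 3/2 * (2 * norm p * (1/2) ^ N) * mass z x y"
      proof (rule balanced_integral_bound[OF x dB' _ t])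
        show "norm (1 *s s r + (-1) *s S N r) \<le> 2 * norm p * (1/2) ^ N" if "r \<in> {x<..<y}" for r
        proof -
          have "1 *s s r + (-1) *s S N r = s r - S N r" by (simp add: vec_eq_iff)
          then show ?thesis using tail[OF that, of N] by simp
        qed
      qed
      also have "\<dots> \<le> 3/2 * (2 * norm p * (1/2) ^ N) * (1/3)" using m by (intro mult_left_mono) auto
      finally have 1: "norm (balanced_integral z x s t - balanced_integral z x (S N) t) \<le> norm p * (1/2) ^ N"
        unfolding balanced_integral_lincomb[OF x sB SB t] by (simp add: vector_smult_lneg)
      have 2: "norm (s t - S (Suc N) t) \<le> norm p * (1/2) ^ N"
        using tail[OF t, of "Suc N"] by simp
      have "s t - (p + balanced_integral z x s t) = (s t - S (Suc N) t) - (balanced_integral z x s t - balanced_integral z x (S N) t)"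
        using TS[OF t, of N, symmetric] by simp
      then have "norm (s t - (p + balanced_integral z x s t)) \<le> norm (s t - S (Suc N) t) + norm (balanced_integral z x s t - balanced_integral z x (S N) t)"
        using norm_triangle_ineq4 by metis
      also have "\<dots> \<le> norm p * (1/2) ^ N + norm p * (1/2) ^ N" using 1 2 by linarith
      also have "\<dots> \<le> 3 * norm p * (1/2) ^ N" by simp
      finally show ?thesis .
    qed
    then have "norm (s t - (p + balanced_integral z x s t)) \<le> 0" by (intro LIMSEQ_le_const[OF z0]) auto
    then show ?thesis by simp
  qed
  then show ?thesis using sB unfolding local_sol_def by blast
qed

lemma local_sol_lincomb:
  assumes x: "0 \<le> x" "y \<in> oint b" and s: "local_sol z x y p s" and s': "local_sol z x y p' s'"
  shows "local_sol z x y (a *s p + c *s p') (\<lambda>t. a *s s t + c *s s' t)"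
proof -
  have B: "bdd_borel x y s" "bdd_borel x y s'" using s s' by (simp_all add: local_sol_def)
  have "a *s s t + c *s s' t = (a *s p + c *s p') + balanced_integral z x (\<lambda>t. a *s s t + c *s s' t) t" if t: "t \<in> {x<..<y}" for t
  proof -
    have 1: "s t = p + balanced_integral z x s t" "s' t = p' + balanced_integral z x s' t" using s s' t unfolding local_sol_def by blast+
    show ?thesis unfolding balanced_integral_lincomb[OF x B t] by (subst 1(1), subst 1(2)) (simp add: vec_eq_iff algebra_simps)
  qed
  then show ?thesis using bdd_borel_lincomb[OF B] unfolding local_sol_def by blast
qed

section \<open>Continuation of solutions\<close>

lemma solves_0 [simp]: "solves z 0 u"
  by (simp add: solves_def bdd_borel_def)

text \<open>
  The left endpoint \<open>0\<close> does not belong to \<open>(0, b)\<close>, but intervals may start there.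
\<close>

definition start_point :: "real \<Rightarrow> bool" where "start_point x \<longleftrightarrow> x = 0 \<or> x \<in> oint b"

lemma start_point_nonneg: "start_point x \<Longrightarrow> 0 \<le> x"
  by (auto simp: start_point_def oint_def)

lemma start_point_smaller: "y \<in> oint b \<Longrightarrow> 0 \<le> x \<Longrightarrow> x \<le> y \<Longrightarrow> start_point x"
  using oint_smaller[of y b x] unfolding start_point_def by (cases "x = 0") auto

lemma solves_lincomb':
  assumes "start_point x" "solves z x u" "solves z x v" shows "solves z x (\<lambda>t. a *s u t + c *s v t)"
  using assms solves_lincomb[of x z u v a c] by (auto simp: start_point_def)

lemma left_val_lincomb':
  assumes "start_point x" "solves z x u" "solves z x v" shows "left_val z x (\<lambda>t. a *s u t + c *s v t) = a *s left_val z x u + c *s left_val z x v"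
  using assms left_val_lincomb[of x u v z a c] solves_bdd_borel by (auto simp: start_point_def)

lemma left_val_split:
  assumes x: "0 \<le> x" "x < y" "y \<in> oint b" and u: "bdd_borel 0 y u"
  shows "left_val z y u = left_val z x u + measure M {x} *\<^sub>R rhs z x (u x) + (LINT t:{x<..<y}|M. rhs z t (u t))"
proof (cases "x = 0")
  case True
  have "0 \<notin> oint b" by (simp add: oint_def)
  then show ?thesis using True by (simp add: left_val_def set_lebesgue_integral_def)
next
  case False
  then have xo: "x \<in> oint b" using oint_smaller[OF x(3)] x by simp
  have i: "set_integrable M A (\<lambda>t. rhs z t (u t))" if "A \<in> sets borel" "A \<subseteq> {0<..<y}" for A
    by (rule rhs_integrable_sub[OF _ x(3) u that]) simp
  have "{0<..<y} = ({0<..<x} \<union> {x}) \<union> {x<..<y}" using x False by auto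
  then have "(LINT t:{0<..<y}|M. rhs z t (u t)) = (LINT t:({0<..<x} \<union> {x}) \<union> {x<..<y}|M. rhs z t (u t))" by simp
  also have "\<dots> = (LINT t:{0<..<x} \<union> {x}|M. rhs z t (u t)) + (LINT t:{x<..<y}|M. rhs z t (u t))"
    using x False by (intro set_integral_Un i) auto
  also have "(LINT t:{0<..<x} \<union> {x}|M. rhs z t (u t)) = (LINT t:{0<..<x}|M. rhs z t (u t)) + (LINT t:{x}|M. rhs z t (u t))"
    using x False by (intro set_integral_Un i) auto
  finally show ?thesis unfolding left_val_def using singleton_integral(2)[OF xo, of "\<lambda>t. rhs z t (u t)"] by simp
qed

text \<open>
  Passing the point \<open>x\<close>, a solution jumps from its left limit by the full atom at \<open>x\<close>.
\<close>

lemma solves_local_sol: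
  assumes x: "0 \<le> x" "x < y" "y \<in> oint b" and u: "solves z y u"
  shows "local_sol z x y (left_val z x u + measure M {x} *\<^sub>R rhs z x (u x)) u"
  unfolding local_sol_def
proof (intro conjI ballI)
  show "bdd_borel x y u" using bdd_borel_subset[OF solves_bdd_borel[OF u] x(1) order_refl] .
  fix t assume t: "t \<in> {x<..<y}"
  have to: "t \<in> oint b" using oint_smaller[OF x(3)] t x by simp
  have "bdd_borel 0 t u" using bdd_borel_subset[OF solves_bdd_borel[OF u] order_refl] t by simp
  then have "left_val z t u = left_val z x u + measure M {x} *\<^sub>R rhs z x (u x) + (LINT t:{x<..<t}|M. rhs z t (u t))"
    using left_val_split[OF x(1) _ to] t by simp
  moreover have "u t = left_val z t u + (measure M {t} / 2) *\<^sub>R rhs z t (u t)"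
    using u t x(1) unfolding solves_def by simp
  ultimately show "u t = left_val z x u + measure M {x} *\<^sub>R rhs z x (u x) + balanced_integral z x u t"
    unfolding balanced_integral_def by (simp only: add.assoc)
qed

text \<open>
  The equation for \<open>u x\<close> in terms of the left limit at \<open>x\<close> is uniquely solvable for every \<open>x\<close>; it is the
  invertibility of the matrix \<open>B_plus\<close>.
\<close>

definition nonsingular :: "complex \<Rightarrow> bool" where
  "nonsingular z \<longleftrightarrow> (\<forall>x\<in>oint b. \<forall>v. v = (measure M {x} / 2) *\<^sub>R rhs z x v \<longrightarrow> v = 0)"

text \<open>
  Nonsingularity is needed to pass an atom, and contraction to pass the open interval that follows it.
\<close>

lemma solves_zero:
  assumes ns: "nonsingular z" and c: "c \<in> oint b" and u: "solves z c u" and u0: "u 0 = 0"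
  shows "\<forall>t\<in>{0..<c}. u t = 0"
proof (rule interval_induction[OF c, of "1/3" "\<lambda>x. \<forall>t\<in>{0..<x}. u t = 0"])
  fix x y assume xy: "0 \<le> x" "x < y" "y \<le> c" "mass z x y < 1/3" and IH: "\<forall>t\<in>{0..<x}. u t = 0"
  have yo: "y \<in> oint b" using oint_smaller[OF c] xy by simp
  have uy: "solves z y u" by (rule solves_restrict[OF u xy(3)])
  have "(LINT t:{0<..<x}|M. rhs z t (u t)) = (\<integral>t. 0 \<partial>M)"
    unfolding set_lebesgue_integral_def using IH
    by (intro Bochner_Integration.integral_cong refl) (auto split: split_indicator)
  then have Ex: "left_val z x u = 0" by (simp add: left_val_def u0)
  have ux: "u x = 0"
  proof (cases "x = 0")
    case False
    then have "x \<in> {0<..<y}" using xy by simp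
    then have "u x = left_val z x u + (measure M {x} / 2) *\<^sub>R rhs z x (u x)" using uy unfolding solves_def by blast
    moreover have "x \<in> oint b" using oint_smaller[OF yo] xy False by simp
    ultimately show ?thesis using ns Ex unfolding nonsingular_def by (metis add_0)
  qed (simp add: u0)
  have "local_sol z x y 0 u" using solves_local_sol[OF xy(1,2) yo uy] by (simp add: Ex ux)
  note local_sol_unique[OF xy(1) yo less_imp_le[OF xy(4)] this]
  then show "\<forall>t\<in>{0..<y}. u t = 0" using IH ux by (metis atLeastLessThan_iff greaterThanLessThan_iff linorder_neqE)
qed simp_all

lemma nrm2_cong: "(\<And>t. t \<in> {0<..<x} \<Longrightarrow> u t = v t) \<Longrightarrow> nrm2 x u = nrm2 x v"
  unfolding nrm2_def w_inner_def set_lebesgue_integral_def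
  by (intro arg_cong[where f=Re] Bochner_Integration.integral_cong refl) (auto split: split_indicator)

lemma left_val_cong: "(\<And>t. t \<in> {0<..<x} \<Longrightarrow> u t = v t) \<Longrightarrow> u 0 = v 0 \<Longrightarrow> left_val z x u = left_val z x v"
  unfolding left_val_def set_lebesgue_integral_def
  by (intro arg_cong2[where f="(+)"] Bochner_Integration.integral_cong refl) (auto split: split_indicator)

lemma bdd_borel_cong: "(\<And>t. t \<in> {x<..<y} \<Longrightarrow> u t = v t) \<Longrightarrow> bdd_borel x y u \<Longrightarrow> bdd_borel x y v"
proof -
  assume eq: "\<And>t. t \<in> {x<..<y} \<Longrightarrow> u t = v t" and u: "bdd_borel x y u"
  have "(\<lambda>t. indicator {x<..<y} t *\<^sub>R (v t $ j)) = (\<lambda>t. indicator {x<..<y} t *\<^sub>R (u t $ j))" for j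
    using eq by (auto simp: fun_eq_iff split: split_indicator)
  then show ?thesis using u eq unfolding bdd_borel_def by simp
qed

lemma solves_cong:
  assumes eq: "\<And>t. t \<in> {0<..<x} \<Longrightarrow> u t = v t" "u 0 = v 0" and u: "solves z x u"
  shows "solves z x v"
  unfolding solves_def
proof (intro conjI ballI)
  show "bdd_borel 0 x v" by (rule bdd_borel_cong[OF eq(1) solves_bdd_borel[OF u]])
  fix t assume t: "t \<in> {0<..<x}"
  have "left_val z t u = left_val z t v" by (rule left_val_cong) (use eq t in auto)
  moreover have "u t = left_val z t u + (measure M {t} / 2) *\<^sub>R rhs z t (u t)" using u t unfolding solves_def by blast
  ultimately show "v t = left_val z t v + (measure M {t} / 2) *\<^sub>R rhs z t (v t)" using eq(1)[OF t] by simp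
qed

text \<open>
  Left of \<open>x\<close> a solution \<open>u\<close>, at \<open>x\<close> a vector \<open>v\<close>, right of \<open>x\<close> a solution \<open>s\<close> fit together if \<open>v\<close> differs from the
  left limit of \<open>u\<close> and from the right limit of \<open>s\<close> by half the atom.  For singular parameters \<open>u\<close> does not
  determine \<open>v\<close>, so \<open>v\<close> is part of the data.
\<close>

lemma glue_solutions:
  assumes x: "start_point x" "x < y" "y \<in> oint b" and u: "solves z x u"
    and v: "left_val z x u = v - (measure M {x} / 2) *\<^sub>R rhs z x v"
    and s: "local_sol z x y (v + (measure M {x} / 2) *\<^sub>R rhs z x v) s"
  defines "w \<equiv> \<lambda>t. if t < x then u t else if t = x then v else s t"
  shows "solves z y w" "left_val z x w = left_val z x u" "w 0 = u 0" "w x = v"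
    "left_val z y w = v + (measure M {x} / 2) *\<^sub>R rhs z x v + (LINT t:{x<..<y}|M. rhs z t (s t))"
proof -
  have x0: "0 \<le> x" by (rule start_point_nonneg[OF x(1)])
  have m0: "measure M {0} = 0" by (rule measure_zero) (simp add: oint_def)
  show w0: "w 0 = u 0" using v x0 m0 by (auto simp: w_def)
  show wx: "w x = v" by (simp add: w_def)
  have wu: "w t = u t" if "t \<in> {0<..<x}" for t using that by (simp add: w_def)
  have ws: "w t = s t" if "t \<in> {x<..<y}" for t using that by (simp add: w_def)
  have Ew: "left_val z t w = left_val z t u" if "t \<le> x" for t by (rule left_val_cong) (use wu w0 that in auto)
  show Exw: "left_val z x w = left_val z x u" by (rule Ew) simp
  have sB: "bdd_borel x y s" using s by (simp add: local_sol_def)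
  have wB: "bdd_borel 0 y w"
  proof -
    have "(\<lambda>t. indicat_real {0<..<y} t *\<^sub>R (w t $ j)) =
      (\<lambda>t. indicat_real {0<..<x} t *\<^sub>R (u t $ j) + indicat_real ({x} \<inter> {0<..}) t *\<^sub>R (v $ j) + indicat_real {x<..<y} t *\<^sub>R (s t $ j))" for j
      using x0 x(2) by (auto simp: fun_eq_iff w_def split: split_indicator)
    moreover have "(\<lambda>t. indicat_real {0<..<x} t *\<^sub>R (u t $ j) + indicat_real ({x} \<inter> {0<..}) t *\<^sub>R (v $ j) + indicat_real {x<..<y} t *\<^sub>R (s t $ j)) \<in> borel_measurable borel" for j
    proof (intro borel_measurable_add)
      show "(\<lambda>t. indicat_real {0<..<x} t *\<^sub>R (u t $ j)) \<in> borel_measurable borel"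
        "(\<lambda>t. indicat_real {x<..<y} t *\<^sub>R (s t $ j)) \<in> borel_measurable borel"
        using solves_bdd_borel[OF u] sB unfolding bdd_borel_def by blast+
    qed simp
    moreover obtain C D where "\<forall>t\<in>{0<..<x}. norm (u t) \<le> C" "\<forall>t\<in>{x<..<y}. norm (s t) \<le> D"
      using solves_bdd_borel[OF u] sB unfolding bdd_borel_def by blast
    then have "\<forall>t\<in>{0<..<y}. norm (w t) \<le> max C (max D (norm v))"
      by (auto simp: w_def le_max_iff_disj)
    ultimately show ?thesis unfolding bdd_borel_def by (metis (no_types, lifting))
  qed
  have half: "v - (measure M {x} / 2) *\<^sub>R rhs z x v + measure M {x} *\<^sub>R rhs z x v = v + (measure M {x} / 2) *\<^sub>R rhs z x v"
  proof -
    have "measure M {x} *\<^sub>R rhs z x v = (measure M {x} / 2) *\<^sub>R rhs z x v + (measure M {x} / 2) *\<^sub>R rhs z x v"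
      by (simp add: scaleR_add_left[symmetric])
    then show ?thesis by simp
  qed
  have int: "(LINT r:{x<..<t}|M. rhs z r (w r)) = (LINT r:{x<..<t}|M. rhs z r (s r))" if "t \<le> y" for t
    unfolding set_lebesgue_integral_def using ws that
    by (intro Bochner_Integration.integral_cong refl) (auto split: split_indicator)
  have Et: "left_val z t w = v + (measure M {x} / 2) *\<^sub>R rhs z x v + (LINT r:{x<..<t}|M. rhs z r (s r))"
    if t: "x < t" "t \<le> y" for t
  proof -
    have to: "t \<in> oint b" using oint_smaller[OF x(3)] t x0 by simp
    show ?thesis
      unfolding left_val_split[OF x0 t(1) to bdd_borel_subset[OF wB order_refl t(2)]] wx Exw v half int[OF t(2)] ..
  qed
  show "left_val z y w = v + (measure M {x} / 2) *\<^sub>R rhs z x v + (LINT t:{x<..<y}|M. rhs z t (s t))"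
    using Et[of y] x(2) by simp
  show "solves z y w" unfolding solves_def
  proof (intro conjI ballI wB)
    fix t assume t: "t \<in> {0<..<y}"
    consider "t < x" | "t = x" | "x < t" by linarith
    then show "w t = left_val z t w + (measure M {t} / 2) *\<^sub>R rhs z t (w t)"
    proof cases
      case 1
      then have "t \<in> {0<..<x}" using t by simp
      then show ?thesis using u Ew[of t] wu[of t] unfolding solves_def by simp
    next
      case 2
      then show ?thesis using Exw v wx by simp
    next
      case 3
      then have tt: "t \<in> {x<..<y}" using t by simp
      have "s t = v + (measure M {x} / 2) *\<^sub>R rhs z x v + balanced_integral z x s t" using s tt unfolding local_sol_def by blast
      moreover have "left_val z t w = v + (measure M {x} / 2) *\<^sub>R rhs z x v + (LINT r:{x<..<t}|M. rhs z r (s r))"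
        using Et[of t] 3 t by simp
      ultimately show ?thesis unfolding ws[OF tt] balanced_integral_def by (simp only: add.assoc)
    qed
  qed
qed

section \<open>Boundary value problems for nonreal parameters\<close>

text \<open>
  With \<open>\<sigma> = \<plusminus>1\<close> the moduli of these two components diagonalise \<open>hform\<close>, see \<open>comps_hform\<close>.
\<close>

definition comp_plus :: "real \<Rightarrow> complex^2 \<Rightarrow> complex" where "comp_plus \<sigma> u = u $ 1 + of_real \<sigma> * \<i> * u $ 2"
definition comp_minus :: "real \<Rightarrow> complex^2 \<Rightarrow> complex" where "comp_minus \<sigma> u = u $ 1 - of_real \<sigma> * \<i> * u $ 2"

lemma comp_plus_add: "comp_plus \<sigma> (u + v) = comp_plus \<sigma> u + comp_plus \<sigma> v" and comp_plus_smult: "comp_plus \<sigma> (c *s u) = c * comp_plus \<sigma> u"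
  and comp_minus_add: "comp_minus \<sigma> (u + v) = comp_minus \<sigma> u + comp_minus \<sigma> v" and comp_minus_smult: "comp_minus \<sigma> (c *s u) = c * comp_minus \<sigma> u"
  and comp_plus_0 [simp]: "comp_plus \<sigma> 0 = 0" and comp_minus_0 [simp]: "comp_minus \<sigma> 0 = 0"
  by (simp_all add: comp_plus_def comp_minus_def algebra_simps)

lemma comps_eqI:
  assumes "\<sigma> \<noteq> 0" "comp_plus \<sigma> u = comp_plus \<sigma> v" "comp_minus \<sigma> u = comp_minus \<sigma> v" shows "u = v"
proof -
  have "2 * u $ 1 = comp_plus \<sigma> u + comp_minus \<sigma> u" "2 * v $ 1 = comp_plus \<sigma> v + comp_minus \<sigma> v" by (simp_all add: comp_plus_def comp_minus_def)
  then have "2 * u $ 1 = 2 * v $ 1" by (simp only: assms)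
  then have 1: "u $ 1 = v $ 1" by simp
  then have "of_real \<sigma> * \<i> * u $ 2 = of_real \<sigma> * \<i> * v $ 2" using assms(2) by (simp add: comp_plus_def)
  then have "u $ 2 = v $ 2" using assms(1) by simp
  then show ?thesis using 1 by (simp add: vec_eq_iff forall_2)
qed

lemma comps_ex:
  assumes "\<sigma> \<noteq> 0" shows "\<exists>u. comp_plus \<sigma> u = \<alpha> \<and> comp_minus \<sigma> u = \<beta>"
  using assms by (intro exI[of _ "vector [(\<alpha> + \<beta>) / 2, (\<alpha> - \<beta>) / (2 * of_real \<sigma> * \<i>)]"])
    (simp add: comp_plus_def comp_minus_def field_simps)

lemma comps_hform: "(norm (comp_plus \<sigma> u))\<^sup>2 - (norm (comp_minus \<sigma> u))\<^sup>2 = 2 * \<sigma> * hform u"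
  unfolding comp_plus_def comp_minus_def hform_def cmod_power2 by (simp add: power2_eq_square algebra_simps)

text \<open>
  The energy identity as a balance between incoming and outgoing waves: for \<open>\<sigma> Im z \<ge> 0\<close> the data on the
  left-hand side, \<open>comp_minus\<close> at \<open>0\<close> and \<open>comp_plus\<close> at \<open>x\<close>, control everything on the right-hand side.
\<close>

lemma boundary_energy:
  assumes x: "x \<in> oint b" and u: "solves z x u"
  shows "(norm (comp_plus \<sigma> (left_val z x u)))\<^sup>2 + (norm (comp_minus \<sigma> (u 0)))\<^sup>2 =
     (norm (comp_plus \<sigma> (u 0)))\<^sup>2 + (norm (comp_minus \<sigma> (left_val z x u)))\<^sup>2 + 4 * \<sigma> * Im z * nrm2 x u"
proof -
  have "2 * \<sigma> * hform (left_val z x u) = 2 * \<sigma> * hform (u 0) + 4 * \<sigma> * Im z * nrm2 x u"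
    unfolding energy_identity[OF x u] by (simp add: algebra_simps)
  then show ?thesis using comps_hform[of \<sigma> "left_val z x u"] comps_hform[of \<sigma> "u 0"] by simp
qed

lemma sgn_Im: "Im z \<noteq> 0 \<Longrightarrow> 0 < sgn (Im z) * Im z" "Im z \<noteq> 0 \<Longrightarrow> sgn (Im z) \<noteq> 0"
  by (simp_all add: sgn_if)

text \<open>
  Zero boundary data force the norm and the remaining component at \<open>0\<close> to vanish.  A solution of norm
  \<open>0\<close> also solves the equation for \<open>z0\<close>, where a solution with initial value \<open>0\<close> is trivial.
\<close>

lemma bvp_unique:
  assumes ns: "nonsingular z0" and im: "Im z \<noteq> 0" and x: "x \<in> oint b" and u: "solves z x u"
    and bc: "comp_minus (sgn (Im z)) (u 0) = 0" "comp_plus (sgn (Im z)) (left_val z x u) = 0"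
  shows "\<forall>t\<in>{0..<x}. u t = 0"
proof -
  let ?\<sigma> = "sgn (Im z)"
  have nn: "0 \<le> nrm2 x u" by (rule nrm2_nonneg[OF x solves_bdd_borel[OF u]])
  have pos: "0 < ?\<sigma> * Im z" by (rule sgn_Im(1)[OF im])
  have "(norm (comp_plus ?\<sigma> (u 0)))\<^sup>2 + (norm (comp_minus ?\<sigma> (left_val z x u)))\<^sup>2 + 4 * ((?\<sigma> * Im z) * nrm2 x u) = 0"
    using boundary_energy[OF x u, of ?\<sigma>] bc by (simp add: mult.assoc)
  moreover have "0 \<le> (?\<sigma> * Im z) * nrm2 x u" by (rule mult_nonneg_nonneg[OF less_imp_le[OF pos] nn])
  ultimately have "(norm (comp_plus ?\<sigma> (u 0)))\<^sup>2 = 0" "(?\<sigma> * Im z) * nrm2 x u = 0"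
    using zero_le_power2[of "norm (comp_plus ?\<sigma> (u 0))"] zero_le_power2[of "norm (comp_minus ?\<sigma> (left_val z x u))"] by linarith+
  then have a0: "comp_plus ?\<sigma> (u 0) = 0" and n0: "nrm2 x u = 0" using pos by auto
  have "u 0 = 0" by (rule comps_eqI[OF sgn_Im(2)[OF im]]) (use a0 bc in simp_all)
  then show ?thesis by (rule solves_zero[OF ns x nrm2_zero_solves[OF x u n0]])
qed

text \<open>
  The unknown is the value \<open>v\<close> at the point \<open>x\<close>.  A solution on \<open>(0, x)\<close> with the prescribed \<open>comp_minus\<close> at \<open>0\<close> and
  the matching \<open>comp_plus\<close> at \<open>x\<close> exists by hypothesis, and one on \<open>(x, y)\<close> by contraction.  There remain
  two linear conditions on \<open>v\<close>, the matching of \<open>comp_minus\<close> at \<open>x\<close> and the boundary condition at \<open>y\<close>.  They are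
  uniquely solvable because a solution of the homogeneous problem vanishes.
\<close>

lemma bvp_step:
  assumes ns: "nonsingular z0" and im: "Im z \<noteq> 0" and x: "start_point x" "x < y" "y \<in> oint b" and m: "mass z x y \<le> 1/3"
    and IH: "\<forall>\<alpha> \<beta>. \<exists>u. solves z x u \<and> comp_minus (sgn (Im z)) (u 0) = \<alpha> \<and> comp_plus (sgn (Im z)) (left_val z x u) = \<beta>"
  shows "\<exists>u. solves z y u \<and> comp_minus (sgn (Im z)) (u 0) = \<alpha> \<and> comp_plus (sgn (Im z)) (left_val z y u) = \<beta>"
proof -
  let ?\<sigma> = "sgn (Im z)"
  have \<sigma>: "?\<sigma> \<noteq> 0" by (rule sgn_Im(2)[OF im])
  have x0: "0 \<le> x" by (rule start_point_nonneg[OF x(1)])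
  obtain s1 where s1: "solves z x s1" "comp_minus ?\<sigma> (s1 0) = 1" "comp_plus ?\<sigma> (left_val z x s1) = 0" using IH by blast
  obtain s2 where s2: "solves z x s2" "comp_minus ?\<sigma> (s2 0) = 0" "comp_plus ?\<sigma> (left_val z x s2) = 1" using IH by blast
  obtain r1 where r1: "local_sol z x y (vector [1, 0]) r1" using local_sol_ex[OF x0 x(3) m] by blast
  obtain r2 where r2: "local_sol z x y (vector [0, 1]) r2" using local_sol_ex[OF x0 x(3) m] by blast
  define L1 where "L1 = (LINT t:{x<..<y}|M. rhs z t (r1 t))"
  define L2 where "L2 = (LINT t:{x<..<y}|M. rhs z t (r2 t))"
  \<comment> \<open>\<open>vm v\<close> and \<open>vp v\<close> are the one-sided limits at \<open>x\<close> of a solution with value \<open>v\<close> there,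
    \<open>R p\<close> is the solution on \<open>(x, y)\<close> with right limit \<open>p\<close> at \<open>x\<close>, and \<open>D p\<close> is its left limit at \<open>y\<close>.\<close>
  define vm where "vm v = v - (measure M {x} / 2) *\<^sub>R rhs z x v" for v
  define vp where "vp v = v + (measure M {x} / 2) *\<^sub>R rhs z x v" for v
  define R where "R p t = p $ 1 *s r1 t + p $ 2 *s r2 t" for p :: "complex^2" and t
  define D where "D p = p + p $ 1 *s L1 + p $ 2 *s L2" for p :: "complex^2"
  have R: "local_sol z x y p (R p)" for p
  proof -
    have "p $ 1 *s vector [1, 0] + p $ 2 *s vector [0, 1] = p" by (simp add: vec_eq_iff forall_2)
    then show ?thesis using local_sol_lincomb[OF x0 x(3) r1 r2, of "p $ 1" "p $ 2"] unfolding R_def by simp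
  qed
  have D: "D p = p + (LINT t:{x<..<y}|M. rhs z t (R p t))" for p
  proof -
    have B: "bdd_borel x y r1" "bdd_borel x y r2" using r1 r2 by (simp_all add: local_sol_def)
    show ?thesis unfolding D_def R_def L1_def L2_def
      using rhs_integral_lincomb[OF x0 x(3) B, of "{x<..<y}" z "p $ 1" "p $ 2"] by (simp add: add.assoc)
  qed
  define U where "U \<alpha> v t = \<alpha> *s s1 t + comp_plus ?\<sigma> (vm v) *s s2 t" for \<alpha> v t
  define w where "w \<alpha> v t = (if t < x then U \<alpha> v t else if t = x then v else R (vp v) t)" for \<alpha> v t
  have U: "solves z x (U \<alpha> v)" for \<alpha> v unfolding U_def by (rule solves_lincomb'[OF x(1) s1(1) s2(1)])
  have EU: "left_val z x (U \<alpha> v) = \<alpha> *s left_val z x s1 + comp_plus ?\<sigma> (vm v) *s left_val z x s2" for \<alpha> v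
    unfolding U_def by (rule left_val_lincomb'[OF x(1) s1(1) s2(1)])
  have U0: "comp_minus ?\<sigma> (U \<alpha> v 0) = \<alpha>" for \<alpha> v by (simp add: U_def comp_minus_add comp_minus_smult s1 s2)
  have key: "solves z y (w \<alpha> v) \<and> comp_minus ?\<sigma> (w \<alpha> v 0) = \<alpha> \<and> left_val z y (w \<alpha> v) = D (vp v) \<and> w \<alpha> v x = v"
    if eq: "comp_minus ?\<sigma> (vm v) = \<alpha> * comp_minus ?\<sigma> (left_val z x s1) + comp_plus ?\<sigma> (vm v) * comp_minus ?\<sigma> (left_val z x s2)" for \<alpha> v
  proof -
    have v: "left_val z x (U \<alpha> v) = vm v"
      by (rule comps_eqI[OF \<sigma>]) (simp_all add: EU comp_plus_add comp_plus_smult comp_minus_add comp_minus_smult s1 s2 eq)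
    show ?thesis
      using glue_solutions[OF x U v[unfolded vm_def] R[of "vp v", unfolded vp_def]] U0[of \<alpha> v]
      unfolding w_def[abs_def] D vp_def by simp
  qed
  \<comment> \<open>The first component is the matching condition at \<open>x\<close>, the second one the boundary value at \<open>y\<close>.\<close>
  define F :: "complex^2 \<Rightarrow> complex^2" where
    "F v = vector [comp_minus ?\<sigma> (vm v) - comp_plus ?\<sigma> (vm v) * comp_minus ?\<sigma> (left_val z x s2), comp_plus ?\<sigma> (D (vp v))]" for v
  have lin: "vm (u + v) = vm u + vm v" "vm (c *s v) = c *s vm v" "vp (u + v) = vp u + vp v" "vp (c *s v) = c *s vp v"
    "D (u + v) = D u + D v" "D (c *s v) = c *s D v" for u v c
    by (simp_all add: vm_def vp_def D_def rhs_add rhs_smult vec_eq_iff algebra_simps)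
  have "\<exists>v. F v = vector [\<alpha> * comp_minus ?\<sigma> (left_val z x s1), \<beta>]"
  proof (rule linear_inj_surj)
    show "F (u + v) = F u + F v" "F (c *s v) = c *s F v" for u v c
      by (simp_all add: F_def lin comp_plus_add comp_plus_smult comp_minus_add comp_minus_smult vec_eq_iff forall_2 algebra_simps)
    fix v assume F0: "F v = 0"
    have "F v $ 1 = 0" "F v $ 2 = 0" by (simp_all add: F0)
    then have 1: "comp_minus ?\<sigma> (vm v) = 0 * comp_minus ?\<sigma> (left_val z x s1) + comp_plus ?\<sigma> (vm v) * comp_minus ?\<sigma> (left_val z x s2)" and 2: "comp_plus ?\<sigma> (D (vp v)) = 0"
      by (simp_all add: F_def)
    note k = key[OF 1]
    have "\<forall>t\<in>{0..<y}. w 0 v t = 0"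
      by (rule bvp_unique[OF ns im x(3)]) (use k 2 in auto)
    then show "v = 0" using k x0 x(2) by auto
  qed
  then obtain v where v: "F v = vector [\<alpha> * comp_minus ?\<sigma> (left_val z x s1), \<beta>]" by blast
  have "F v $ 1 = \<alpha> * comp_minus ?\<sigma> (left_val z x s1)" "F v $ 2 = \<beta>" by (simp_all add: v)
  then have 1: "comp_minus ?\<sigma> (vm v) = \<alpha> * comp_minus ?\<sigma> (left_val z x s1) + comp_plus ?\<sigma> (vm v) * comp_minus ?\<sigma> (left_val z x s2)" and 2: "comp_plus ?\<sigma> (D (vp v)) = \<beta>"
    by (simp_all add: F_def algebra_simps)
  show ?thesis using key[OF 1] 2 by (intro exI[of _ "w \<alpha> v"]) simp
qed

text \<open>
  This holds for every nonreal \<open>z\<close>, including those for which initial value problems are not solvable.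
\<close>

theorem bvp:
  assumes ns: "nonsingular z0" and im: "Im z \<noteq> 0" and c: "c \<in> oint b"
  shows "\<exists>u. solves z c u \<and> comp_minus (sgn (Im z)) (u 0) = \<alpha> \<and> comp_plus (sgn (Im z)) (left_val z c u) = \<beta>"
proof -
  let ?P = "\<lambda>x. \<forall>\<alpha> \<beta>. \<exists>u. solves z x u \<and> comp_minus (sgn (Im z)) (u 0) = \<alpha> \<and> comp_plus (sgn (Im z)) (left_val z x u) = \<beta>"
  have "?P c"
  proof (rule interval_induction[OF c, of "1/3" ?P])
    show "?P 0"
    proof (intro allI)
      fix \<alpha> \<beta>
      obtain p where "comp_plus (sgn (Im z)) p = \<beta>" "comp_minus (sgn (Im z)) p = \<alpha>" using comps_ex[OF sgn_Im(2)[OF im]] by blast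
      then show "\<exists>u. solves z 0 u \<and> comp_minus (sgn (Im z)) (u 0) = \<alpha> \<and> comp_plus (sgn (Im z)) (left_val z 0 u) = \<beta>"
        by (intro exI[of _ "\<lambda>_. p"]) simp
    qed
    fix x y assume xy: "0 \<le> x" "x < y" "y \<le> c" "mass z x y < 1/3" and IH: "?P x"
    have yo: "y \<in> oint b" using oint_smaller[OF c] xy by simp
    have "start_point x" using start_point_smaller[OF yo] xy by simp
    then show "?P y" using bvp_step[OF ns im _ xy(2) yo _ IH] xy(4) by simp
  qed simp
  then show ?thesis by blast
qed

text \<open>
  The solutions on \<open>(0, c)\<close> form a two-dimensional space by the boundary value problem, and taking the
  initial value is injective on it.
\<close>

theorem ivp:
  assumes ns: "nonsingular z" and im: "Im z \<noteq> 0" and c: "c \<in> oint b"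
  shows "\<exists>u. solves z c u \<and> u 0 = p"
proof -
  let ?\<sigma> = "sgn (Im z)"
  obtain s1 where s1: "solves z c s1" "comp_minus ?\<sigma> (s1 0) = 1" "comp_plus ?\<sigma> (left_val z c s1) = 0" using bvp[OF ns im c] by blast
  obtain s2 where s2: "solves z c s2" "comp_minus ?\<sigma> (s2 0) = 0" "comp_plus ?\<sigma> (left_val z c s2) = 1" using bvp[OF ns im c] by blast
  have dc: "start_point c" using c by (simp add: start_point_def)
  define U where "U v t = v $ 1 *s s1 t + v $ 2 *s s2 t" for v :: "complex^2" and t
  have U: "solves z c (U v)" for v unfolding U_def by (rule solves_lincomb'[OF dc s1(1) s2(1)])
  have EU: "left_val z c (U v) = v $ 1 *s left_val z c s1 + v $ 2 *s left_val z c s2" for v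
    unfolding U_def by (rule left_val_lincomb'[OF dc s1(1) s2(1)])
  have "\<exists>v. U v 0 = p"
  proof (rule linear_inj_surj)
    show "U (u + v) 0 = U u 0 + U v 0" "U (c *s v) 0 = c *s U v 0" for u v c
      by (simp_all add: U_def vec_eq_iff algebra_simps)
    fix v assume v0: "U v 0 = 0"
    have z: "\<forall>t\<in>{0..<c}. U v t = 0" by (rule solves_zero[OF ns c U v0])
    have "left_val z c (U v) = left_val z c (\<lambda>_. 0)" by (rule left_val_cong) (use z c in \<open>auto simp: oint_def\<close>)
    then have E0: "left_val z c (U v) = 0" by (simp add: left_val_def set_lebesgue_integral_def)
    have "v $ 2 = comp_plus ?\<sigma> (left_val z c (U v))" by (simp add: EU comp_plus_add comp_plus_smult s1 s2)
    moreover have "v $ 1 = comp_minus ?\<sigma> (U v 0)" by (simp add: U_def comp_minus_add comp_minus_smult s1 s2)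
    ultimately show "v = 0" using E0 v0 by (simp add: vec_eq_iff forall_2)
  qed
  then show ?thesis using U by blast
qed

end

section \<open>Square-integrable solutions and solutions of norm zero\<close>

text \<open>
  Linear combinations of two functions, as a constant so that terms stay small.
\<close>

definition comb :: "complex \<Rightarrow> (real \<Rightarrow> complex^2) \<Rightarrow> complex \<Rightarrow> (real \<Rightarrow> complex^2) \<Rightarrow> real \<Rightarrow> complex^2" where
  "comb a u c v = (\<lambda>t. a *s u t + c *s v t)"

context canonical_system begin

lemma bdd_borel_comb: "bdd_borel x y u \<Longrightarrow> bdd_borel x y v \<Longrightarrow> bdd_borel x y (comb a u c v)"
  unfolding comb_def by (rule bdd_borel_lincomb)

lemma solves_comb: "x \<in> oint b \<Longrightarrow> solves z x u \<Longrightarrow> solves z x v \<Longrightarrow> solves z x (comb a u c v)"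
  unfolding comb_def by (rule solves_lincomb)

lemma w_inner_comb: "x \<in> oint b \<Longrightarrow> bdd_borel 0 x u \<Longrightarrow> bdd_borel 0 x u' \<Longrightarrow> bdd_borel 0 x v \<Longrightarrow> w_inner x (comb a u c u') v = a * w_inner x u v + c * w_inner x u' v"
  unfolding comb_def by (rule w_inner_linear)

lemma w_inner_comb2: "x \<in> oint b \<Longrightarrow> bdd_borel 0 x u \<Longrightarrow> bdd_borel 0 x u' \<Longrightarrow> bdd_borel 0 x v \<Longrightarrow> w_inner x v (comb a u c u') = cnj a * w_inner x v u + cnj c * w_inner x v u'"
  unfolding comb_def by (rule w_inner_linear2)

lemma nrm2_comb: "x \<in> oint b \<Longrightarrow> bdd_borel 0 x u \<Longrightarrow> bdd_borel 0 x v \<Longrightarrow>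
   nrm2 x (comb a u c v) = (norm a)\<^sup>2 * nrm2 x u + (norm c)\<^sup>2 * nrm2 x v + 2 * Re (a * cnj c * w_inner x u v)"
  unfolding comb_def by (rule nrm2_lincomb)

text \<open>
  The inequality \<open>2 \<bar>a b\<bar> \<le> e a\<^sup>2 + b\<^sup>2 / e\<close> for the mixed term.
\<close>

lemma nrm2_comb_le:
  assumes x: "x \<in> oint b" and u: "bdd_borel 0 x u" and v: "bdd_borel 0 x v" and e: "0 < e"
  shows "nrm2 x (comb a u c v) \<le> (1 + e) * ((norm a)\<^sup>2 * nrm2 x u) + (1 + 1/e) * ((norm c)\<^sup>2 * nrm2 x v)"
proof -
  define k where "k = sqrt e"
  have k: "0 < k" "k\<^sup>2 = e" using e by (simp_all add: k_def)
  have "0 \<le> nrm2 x (comb (of_real k * a) u (- (of_real (1/k) * c)) v)"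
    by (rule nrm2_nonneg[OF x bdd_borel_comb[OF u v]])
  also have "\<dots> = k\<^sup>2 * ((norm a)\<^sup>2 * nrm2 x u) + (1/k)\<^sup>2 * ((norm c)\<^sup>2 * nrm2 x v) + 2 * Re (of_real k * a * cnj (- (of_real (1/k) * c)) * w_inner x u v)"
    unfolding nrm2_comb[OF x u v] using k(1) by (simp add: norm_mult norm_divide power_mult_distrib power_divide)
  also have "of_real k * a * cnj (- (of_real (1/k) * c)) * w_inner x u v = - (a * cnj c * w_inner x u v)"
    using k(1) by simp
  also have "(1/k)\<^sup>2 = 1/e" using k by (simp add: power_divide)
  finally have "2 * Re (a * cnj c * w_inner x u v) \<le> e * ((norm a)\<^sup>2 * nrm2 x u) + 1/e * ((norm c)\<^sup>2 * nrm2 x v)"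
    unfolding k(2) by simp
  then show ?thesis unfolding nrm2_comb[OF x u v] by (simp add: distrib_right)
qed

lemma nrm2_zero_w_inner:
  assumes x: "x \<in> oint b" and u: "bdd_borel 0 x u" and v: "bdd_borel 0 x v" and n: "nrm2 x v = 0"
  shows "w_inner x u v = 0" "w_inner x v u = 0"
proof -
  have "(norm (w_inner x u v))\<^sup>2 \<le> 0" using cauchy_schwarz[OF x u v] n by simp
  then show "w_inner x u v = 0" by simp
  then show "w_inner x v u = 0" using w_inner_cnj[of x v u] by simp
qed

lemma nrm2_comb_zero:
  assumes x: "x \<in> oint b" and u: "bdd_borel 0 x u" and v: "bdd_borel 0 x v" and n: "nrm2 x v = 0"
  shows "nrm2 x (comb a u c v) = (norm a)\<^sup>2 * nrm2 x u"
  unfolding nrm2_comb[OF x u v] nrm2_zero_w_inner[OF x u v n] n by simp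

text \<open>
  Values at negative arguments and beyond \<open>b\<close> are arbitrary, but the value at \<open>0\<close> is the initial value.
\<close>

definition sols :: "complex \<Rightarrow> (real \<Rightarrow> complex^2) set" where
  "sols z = {u. \<forall>x\<in>oint b. solves z x u}"

definition sq_int :: "(real \<Rightarrow> complex^2) \<Rightarrow> bool" where
  "sq_int u \<longleftrightarrow> (\<exists>C. \<forall>x\<in>oint b. nrm2 x u \<le> C)"

definition null_sols :: "(real \<Rightarrow> complex^2) set" where
  "null_sols = {u \<in> sols 0. \<forall>x\<in>oint b. nrm2 x u = 0}"

lemma sols_solves: "u \<in> sols z \<Longrightarrow> x \<in> oint b \<Longrightarrow> solves z x u" by (simp add: sols_def)
lemma sols_bdd_borel: "u \<in> sols z \<Longrightarrow> x \<in> oint b \<Longrightarrow> bdd_borel 0 x u" using sols_solves solves_bdd_borel by blast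

lemma null_sols_iff: "u \<in> null_sols \<longleftrightarrow> u \<in> sols z \<and> (\<forall>x\<in>oint b. nrm2 x u = 0)"
  unfolding null_sols_def sols_def using nrm2_zero_solves by blast

lemma sols_comb: "u \<in> sols z \<Longrightarrow> v \<in> sols z \<Longrightarrow> comb a u c v \<in> sols z"
  using solves_comb by (simp add: sols_def)

lemma null_sols_comb: "u \<in> null_sols \<Longrightarrow> v \<in> null_sols \<Longrightarrow> comb a u c v \<in> null_sols"
  unfolding null_sols_iff[of _ 0] using sols_comb nrm2_comb_zero sols_bdd_borel by auto

text \<open>
  An increasing sequence in \<open>(0, b)\<close> that tends to \<open>b\<close>.
\<close>

definition cut :: "nat \<Rightarrow> real" where
  "cut n = (if b = \<infinity> then real n + 1 else real_of_ereal b - real_of_ereal b / (real n + 2))"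

lemma cut_oint: "cut n \<in> oint b"
proof (cases b)
  case (real r)
  then have r: "0 < r" using b_pos by simp
  then have "r < r * (real n + 2)" using mult_strict_left_mono[of 1 "real n + 2" r] by simp
  then have "r / (real n + 2) < r" "0 < r / (real n + 2)" using r by (simp_all add: divide_less_eq)
  then show ?thesis unfolding cut_def oint_def using real by simp
next
  case PInf
  then show ?thesis unfolding cut_def oint_def by simp
qed (use b_pos in simp)

lemma cut_mono: "m \<le> n \<Longrightarrow> cut m \<le> cut n"
proof (cases b)
  case (real r)
  assume "m \<le> n"
  then have "r / (real n + 2) \<le> r / (real m + 2)" using b_pos real by (intro frac_le) auto
  then show ?thesis unfolding cut_def using real by simp
next
  case PInf
  assume "m \<le> n"
  then show ?thesis unfolding cut_def using PInf by simp
qed (use b_pos in simp)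

lemma cut_cofinal: "c \<in> oint b \<Longrightarrow> \<exists>n. c < cut n"
proof (cases b)
  case (real r)
  assume c: "c \<in> oint b"
  have r0: "0 < r" using b_pos real by simp
  have rc: "c < r" using c real by (simp add: oint_def)
  obtain n where "r / (r - c) < real n" using reals_Archimedean2 by blast
  then have "r < real n * (r - c)" using rc by (simp add: field_simps)
  also have "\<dots> \<le> (real n + 2) * (r - c)" using rc by (intro mult_right_mono) auto
  finally have "r / (real n + 2) < r - c" by (simp add: field_simps)
  then show ?thesis unfolding cut_def using real by (intro exI[of _ n]) simp
next
  case PInf
  obtain n where "c < real n" using reals_Archimedean2 by blast
  then show ?thesis unfolding cut_def using PInf by (intro exI[of _ n]) simp
qed (use b_pos in simp)

lemma cut_pos: "0 < cut n" using cut_oint[of n] by (simp add: oint_def)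

lemma sols_cut: "(\<And>n. n \<ge> N \<Longrightarrow> solves z (cut n) u) \<Longrightarrow> u \<in> sols z"
proof -
  assume *: "\<And>n. n \<ge> N \<Longrightarrow> solves z (cut n) u"
  have "solves z x u" if x: "x \<in> oint b" for x
  proof -
    obtain n where "x < cut n" using cut_cofinal[OF x] by blast
    then have "x \<le> cut (max n N)" using cut_mono[of n "max n N"] by simp
    then show ?thesis using solves_restrict[OF *[of "max n N"]] by simp
  qed
  then show ?thesis by (simp add: sols_def)
qed

lemma nrm2_le_cut:
  assumes u: "\<And>n. bdd_borel 0 (cut n) u" and n: "\<And>n. n \<ge> N \<Longrightarrow> nrm2 (cut n) u \<le> C" and x: "x \<in> oint b"
  shows "nrm2 x u \<le> C"
proof -
  obtain n where "x < cut n" using cut_cofinal[OF x] by blast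
  then have "x \<le> cut (max n N)" using cut_mono[of n "max n N"] by simp
  then have "nrm2 x u \<le> nrm2 (cut (max n N)) u" using x by (intro nrm2_mono[OF cut_oint u]) (simp_all add: oint_def)
  also have "\<dots> \<le> C" by (rule n) simp
  finally show ?thesis .
qed

text \<open>
  Functions given on increasing intervals and agreeing there define one function; for each \<open>t\<close> the first
  interval containing \<open>t\<close> is used.
\<close>

lemma coherent_limit:
  assumes "\<And>n t. n \<ge> N \<Longrightarrow> t \<in> {0..<cut n} \<Longrightarrow> f (Suc n) t = f n t"
  shows "\<exists>l. \<forall>n\<ge>N. \<forall>t\<in>{0..<cut n}. l t = f n t"
proof -
  have agree: "f n t = f m t" if "N \<le> m" "m \<le> n" "t \<in> {0..<cut m}" for m n t
    using that(2)
  proof (induction rule: dec_induct)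
    case (step k)
    have "t \<in> {0..<cut k}" using that(3) cut_mono[OF step(1)] by auto
    then show ?case using assms[of k t] step that by simp
  qed simp
  define k where "k t = (LEAST k. N \<le> k \<and> t < cut k)" for t
  have "f (k t) t = f n t" if "n \<ge> N" "t \<in> {0..<cut n}" for n t
  proof -
    have "N \<le> k t \<and> t < cut (k t)" unfolding k_def by (rule LeastI[of _ n]) (use that in simp)
    moreover have "k t \<le> n" unfolding k_def by (rule Least_le) (use that in simp)
    ultimately show ?thesis using agree[of "k t" n t] that by simp
  qed
  then show ?thesis by (intro exI[of _ "\<lambda>t. f (k t) t"]) blast
qed

lemma solves_eq:
  assumes ns: "nonsingular z" and x: "x \<in> oint b" and u: "solves z x u" and v: "solves z x v" and e: "u 0 = v 0"
  shows "\<forall>t\<in>{0..<x}. u t = v t"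
proof -
  have "\<forall>t\<in>{0..<x}. comb 1 u (-1) v t = 0"
    by (rule solves_zero[OF ns x solves_comb[OF x u v]]) (simp add: comb_def e vec_eq_iff)
  then show ?thesis by (simp add: comb_def vec_eq_iff)
qed

lemma ivp_global:
  assumes ns: "nonsingular z" and im: "Im z \<noteq> 0"
  shows "\<exists>u\<in>sols z. u 0 = p"
proof -
  have "\<forall>n. \<exists>u. solves z (cut n) u \<and> u 0 = p" using ivp[OF ns im cut_oint] by blast
  then obtain f where f: "\<And>n. solves z (cut n) (f n)" "\<And>n. f n 0 = p" by metis
  have "f (Suc n) t = f n t" if "t \<in> {0..<cut n}" for n t
    using solves_eq[OF ns cut_oint solves_restrict[OF f(1)[of "Suc n"] cut_mono[of n "Suc n"]] f(1)[of n]] f(2) that by simp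
  then obtain l where l: "\<And>n t. t \<in> {0..<cut n} \<Longrightarrow> l t = f n t" using coherent_limit[of 0 f] by blast
  have "solves z (cut n) l" for n
    by (rule solves_cong[OF _ _ f(1)[of n]]) (use l[of _ n] cut_pos[of n] in auto)
  then have "l \<in> sols z" by (rule sols_cut)
  moreover have "l 0 = p" using l[of 0 0] cut_pos[of 0] f(2) by simp
  ultimately show ?thesis by blast
qed

lemma vec_subspace_I:
  assumes "(0::complex^2) \<in> S" "\<And>u v a c. u \<in> S \<Longrightarrow> v \<in> S \<Longrightarrow> a *s u + c *s v \<in> S"
  shows "vec.subspace S"
proof (rule vec.subspaceI)
  show "u + v \<in> S" if "u \<in> S" "v \<in> S" for u v using assms(2)[OF that, of 1 1] by simp
  show "c *s u \<in> S" if "u \<in> S" for c u using assms(2)[OF that that, of c 0] by simp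
qed (rule assms(1))

lemma solves_zero_fun: "solves z x (\<lambda>_. 0)"
proof -
  have "left_val z t (\<lambda>_. 0) = 0" for t by (simp add: left_val_def set_lebesgue_integral_def)
  then show ?thesis using bdd_borel_const[of 0 x 0] by (simp add: solves_def)
qed

lemma nrm2_zero_fun: "nrm2 x (\<lambda>_. 0) = 0"
  by (simp add: nrm2_def w_inner_def w_form_def set_lebesgue_integral_def)

text \<open>
  On \<open>(0, x)\<close> there may be more solutions of norm \<open>0\<close> than on \<open>(0, b)\<close>.  For the nonsingular parameter \<open>z0\<close> their
  initial values form subspaces of \<open>\<complex>\<^sup>2\<close> that decrease as \<open>x\<close> grows, hence become stationary.
\<close>

lemma zero_norm_extends:
  assumes ns: "nonsingular z0" and im: "Im z0 \<noteq> 0"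
  shows "\<exists>N. \<forall>n\<ge>N. \<forall>z u. solves z (cut n) u \<longrightarrow> nrm2 (cut n) u = 0 \<longrightarrow> (\<exists>l\<in>null_sols. \<forall>t\<in>{0..<cut n}. l t = u t)"
proof -
  define K where "K n = {u 0 | u. solves z0 (cut n) u \<and> nrm2 (cut n) u = 0}" for n
  have sub: "vec.subspace (K n)" for n
  proof (rule vec_subspace_I)
    show "0 \<in> K n" unfolding K_def using solves_zero_fun nrm2_zero_fun by fastforce
    fix p r a c assume "p \<in> K n" "r \<in> K n"
    then obtain u v where uv: "solves z0 (cut n) u" "nrm2 (cut n) u = 0" "solves z0 (cut n) v" "nrm2 (cut n) v = 0" "p = u 0" "r = v 0"
      unfolding K_def by blast
    have "solves z0 (cut n) (comb a u c v)" by (rule solves_comb[OF cut_oint uv(1,3)])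
    moreover have "nrm2 (cut n) (comb a u c v) = 0"
      unfolding nrm2_comb_zero[OF cut_oint solves_bdd_borel[OF uv(1)] solves_bdd_borel[OF uv(3)] uv(4)] uv(2) by simp
    moreover have "a *s p + c *s r = comb a u c v 0" by (simp add: comb_def uv)
    ultimately show "a *s p + c *s r \<in> K n" unfolding K_def by blast
  qed
  have dec: "K n \<subseteq> K m" if mn: "m \<le> n" for m n
  proof
    fix p assume "p \<in> K n"
    then obtain u where u: "solves z0 (cut n) u" "nrm2 (cut n) u = 0" "p = u 0" unfolding K_def by blast
    have um: "solves z0 (cut m) u" by (rule solves_restrict[OF u(1) cut_mono[OF mn]])
    have "nrm2 (cut m) u \<le> nrm2 (cut n) u" by (rule nrm2_mono[OF cut_oint solves_bdd_borel[OF u(1)] cut_pos cut_mono[OF mn]])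
    then have "nrm2 (cut m) u = 0" using nrm2_nonneg[OF cut_oint solves_bdd_borel[OF um]] u(2) by simp
    then show "p \<in> K m" using um u(3) unfolding K_def by blast
  qed
  obtain N where N: "\<And>n. vec.dim (K N) \<le> vec.dim (K n)"
    using ex_has_least_nat[of "\<lambda>_. True" _ "\<lambda>n. vec.dim (K n)"] by blast
  have KN: "K n = K N" if "N \<le> n" for n
    by (rule vec.subspace_dim_equal[OF sub sub dec[OF that] N])
  show ?thesis
  proof (intro exI[of _ N] allI impI)
    fix n z u assume n: "N \<le> n" and u: "solves z (cut n) u" "nrm2 (cut n) u = 0"
    have u0: "solves z0 (cut n) u" by (rule nrm2_zero_solves[OF cut_oint u])
    have p: "u 0 \<in> K m" if "N \<le> m" for m
      using u0 u(2) KN[OF n] KN[OF that] unfolding K_def by blast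
    obtain l where l: "l \<in> sols z0" "l 0 = u 0" using ivp_global[OF ns im] by blast
    have z: "nrm2 (cut m) l = 0" if "N \<le> m" for m
    proof -
      have pm: "u 0 \<in> K m" by (rule p[OF that])
      obtain v where v: "solves z0 (cut m) v" "nrm2 (cut m) v = 0" "v 0 = u 0" using pm unfolding K_def by auto
      have "\<forall>t\<in>{0..<cut m}. l t = v t" by (rule solves_eq[OF ns cut_oint sols_solves[OF l(1) cut_oint] v(1)]) (simp add: l v)
      then have "nrm2 (cut m) l = nrm2 (cut m) v" by (intro nrm2_cong) auto
      then show ?thesis using v by simp
    qed
    have "nrm2 x l \<le> 0" if "x \<in> oint b" for x
      by (rule nrm2_le_cut[of l N, OF sols_bdd_borel[OF l(1) cut_oint] _ that]) (use z in simp)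
    then have "\<forall>x\<in>oint b. nrm2 x l = 0" using nrm2_nonneg[OF _ sols_bdd_borel[OF l(1)]] by (meson antisym)
    then have "l \<in> null_sols" using l(1) null_sols_iff[of l z0] by blast
    moreover have "\<forall>t\<in>{0..<cut n}. l t = u t" by (rule solves_eq[OF ns cut_oint sols_solves[OF l(1) cut_oint] u0 l(2)])
    ultimately show "\<exists>l\<in>null_sols. \<forall>t\<in>{0..<cut n}. l t = u t" by blast
  qed
qed

section \<open>Projections between solution spaces for different parameters\<close>

lemma sform_minus: "sform (p - r) (p - r) = sform p p - sform p r - sform r p + sform r r"
  by (simp add: sform_def algebra_simps)

lemma comp_plus_minus: "comp_plus \<sigma> (u - v) = comp_plus \<sigma> u - comp_plus \<sigma> v" and comp_minus_minus: "comp_minus \<sigma> (u - v) = comp_minus \<sigma> u - comp_minus \<sigma> v"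
  by (simp_all add: comp_plus_def comp_minus_def algebra_simps)

text \<open>
  Let \<open>d\<close> have the boundary data of \<open>u\<close> and put \<open>y = u - d\<close>.  By Lagrange's identity the boundary terms
  of \<open>y\<close> amount to \<open>2 Im ((z - \<zeta>) \<langle>u, y\<rangle>) + 2 Im \<zeta> \<parallel>y\<parallel>\<^sup>2\<close>.  As the prescribed components of \<open>y\<close> vanish, multiplying
  by \<open>sgn (Im \<zeta>)\<close> gives something non-positive, so \<open>\<bar>Im \<zeta>\<bar> \<parallel>y\<parallel>\<^sup>2 \<le> \<bar>z - \<zeta>\<bar> \<bar>\<langle>u, y\<rangle>\<bar>\<close>, and the Cauchy--Schwarz
  inequality applies.
\<close>

lemma gap_estimate:
  assumes ns: "nonsingular z0" and im: "Im \<zeta> \<noteq> 0" and x: "x \<in> oint b" and u: "solves z x u"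
  shows "\<exists>d. solves \<zeta> x d \<and> (Im \<zeta>)\<^sup>2 * nrm2 x (comb 1 u (-1) d) \<le> (norm (z - \<zeta>))\<^sup>2 * nrm2 x u"
proof -
  let ?\<sigma> = "sgn (Im \<zeta>)"
  obtain d where d: "solves \<zeta> x d" "comp_minus ?\<sigma> (d 0) = comp_minus ?\<sigma> (u 0)" "comp_plus ?\<sigma> (left_val \<zeta> x d) = comp_plus ?\<sigma> (left_val z x u)"
    using bvp[OF ns im x] by blast
  have uB: "bdd_borel 0 x u" and dB: "bdd_borel 0 x d" using u d(1) by (simp_all add: solves_bdd_borel)
  define y where "y = comb 1 u (-1) d"
  have yB: "bdd_borel 0 x y" unfolding y_def by (rule bdd_borel_comb[OF uB dB])
  have uy: "w_inner x u y = w_inner x u u - w_inner x u d" "w_inner x y u = w_inner x u u - w_inner x d u"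
    "w_inner x y y = w_inner x u u - w_inner x u d - w_inner x d u + w_inner x d d"
    unfolding y_def w_inner_comb[OF x uB dB bdd_borel_comb[OF uB dB]] w_inner_comb[OF x uB dB uB] w_inner_comb2[OF x uB dB uB] w_inner_comb2[OF x uB dB dB] by simp_all
  define e where "e = left_val z x u - left_val \<zeta> x d"
  define y0 where "y0 = u 0 - d 0"
  have "sform e e - sform y0 y0 = (z - cnj z) * w_inner x u u - (\<zeta> - cnj z) * w_inner x d u - (z - cnj \<zeta>) * w_inner x u d + (\<zeta> - cnj \<zeta>) * w_inner x d d"
    unfolding e_def y0_def sform_minus lagrange[OF x u u] lagrange[OF x d(1) u] lagrange[OF x u d(1)] lagrange[OF x d(1) d(1)]
    by (simp add: algebra_simps)
  also have "\<dots> = (z - \<zeta>) * w_inner x u y - (cnj z - cnj \<zeta>) * w_inner x y u + (\<zeta> - cnj \<zeta>) * w_inner x y y"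
    unfolding uy by (simp add: algebra_simps)
  also have "\<dots> = (z - \<zeta>) * w_inner x u y - cnj ((z - \<zeta>) * w_inner x u y) + (\<zeta> - cnj \<zeta>) * of_real (nrm2 x y)"
    unfolding w_inner_cnj[of x y u] w_inner_self by simp
  finally have "Im (sform e e - sform y0 y0) = Im ((z - \<zeta>) * w_inner x u y - cnj ((z - \<zeta>) * w_inner x u y) + (\<zeta> - cnj \<zeta>) * of_real (nrm2 x y))"
    by (rule arg_cong)
  then have h: "hform e - hform y0 = 2 * Im ((z - \<zeta>) * w_inner x u y) + 2 * Im \<zeta> * nrm2 x y"
    unfolding sform_self by (simp add: algebra_simps)
  have a: "comp_plus ?\<sigma> e = 0" "comp_minus ?\<sigma> y0 = 0" using d by (simp_all add: e_def y0_def comp_plus_minus comp_minus_minus)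
  have "2 * ?\<sigma> * (hform e - hform y0) = - (norm (comp_minus ?\<sigma> e))\<^sup>2 - (norm (comp_plus ?\<sigma> y0))\<^sup>2"
    using comps_hform[of ?\<sigma> e] comps_hform[of ?\<sigma> y0] a by (simp add: algebra_simps)
  then have "?\<sigma> * (hform e - hform y0) \<le> 0"
    using zero_le_power2[of "norm (comp_minus ?\<sigma> e)"] zero_le_power2[of "norm (comp_plus ?\<sigma> y0)"] by linarith
  then have 1: "?\<sigma> * Im \<zeta> * nrm2 x y \<le> - (?\<sigma> * Im ((z - \<zeta>) * w_inner x u y))"
    unfolding h by (simp add: algebra_simps)
  have s: "?\<sigma> * Im \<zeta> = \<bar>Im \<zeta>\<bar>" by (simp add: sgn_if)
  have "- (?\<sigma> * Im ((z - \<zeta>) * w_inner x u y)) \<le> \<bar>Im ((z - \<zeta>) * w_inner x u y)\<bar>" by (auto simp: sgn_if)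
  also have "\<dots> \<le> norm (z - \<zeta>) * norm (w_inner x u y)" using abs_Im_le_cmod[of "(z - \<zeta>) * w_inner x u y"] by (simp add: norm_mult)
  finally have 2: "\<bar>Im \<zeta>\<bar> * nrm2 x y \<le> norm (z - \<zeta>) * norm (w_inner x u y)" using 1 unfolding s by simp
  have n0: "0 \<le> nrm2 x y" "0 \<le> nrm2 x u" using nrm2_nonneg[OF x] yB uB by auto
  have "(\<bar>Im \<zeta>\<bar> * nrm2 x y)\<^sup>2 \<le> (norm (z - \<zeta>) * norm (w_inner x u y))\<^sup>2" by (rule power_mono[OF 2]) (use n0 in simp)
  also have "\<dots> \<le> (norm (z - \<zeta>))\<^sup>2 * (nrm2 x u * nrm2 x y)"
    unfolding power_mult_distrib by (intro mult_left_mono cauchy_schwarz[OF x uB yB]) simp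
  finally have 3: "((Im \<zeta>)\<^sup>2 * nrm2 x y) * nrm2 x y \<le> ((norm (z - \<zeta>))\<^sup>2 * nrm2 x u) * nrm2 x y"
    by (simp add: power_mult_distrib power2_eq_square mult_ac)
  have "(Im \<zeta>)\<^sup>2 * nrm2 x y \<le> (norm (z - \<zeta>))\<^sup>2 * nrm2 x u"
  proof (cases "nrm2 x y = 0")
    case False
    then show ?thesis using 3 n0 by (intro mult_right_le_imp_le[OF 3]) simp
  qed (use n0 in simp)
  then show ?thesis using d(1) unfolding y_def by blast
qed

text \<open>
  Two solutions of boundary value problems span all solutions; one step of the Gram--Schmidt process
  makes them orthogonal.
\<close>

lemma orthogonal_spanning_pair:
  assumes ns: "nonsingular z0" and im: "Im \<zeta> \<noteq> 0" and x: "x \<in> oint b"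
  shows "\<exists>s1 s2. solves \<zeta> x s1 \<and> solves \<zeta> x s2 \<and> w_inner x s2 s1 = 0 \<and>
     (\<forall>e. solves \<zeta> x e \<longrightarrow> (\<exists>c1 c2. \<forall>t\<in>{0..<x}. e t = comb c1 s1 c2 s2 t))"
proof -
  let ?\<sigma> = "sgn (Im \<zeta>)"
  obtain s1 where s1: "solves \<zeta> x s1" "comp_minus ?\<sigma> (s1 0) = 1" "comp_plus ?\<sigma> (left_val \<zeta> x s1) = 0" using bvp[OF ns im x] by blast
  obtain s2 where s2: "solves \<zeta> x s2" "comp_minus ?\<sigma> (s2 0) = 0" "comp_plus ?\<sigma> (left_val \<zeta> x s2) = 1" using bvp[OF ns im x] by blast
  have dx: "start_point x" using x by (simp add: start_point_def)
  have sp: "\<exists>c1 c2. \<forall>t\<in>{0..<x}. e t = comb c1 s1 c2 s2 t" if e: "solves \<zeta> x e" for e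
  proof -
    define c1 where "c1 = comp_minus ?\<sigma> (e 0)"
    define c2 where "c2 = comp_plus ?\<sigma> (left_val \<zeta> x e)"
    have i: "solves \<zeta> x (comb c1 s1 c2 s2)" by (rule solves_comb[OF x s1(1) s2(1)])
    have E1: "left_val \<zeta> x (comb c1 s1 c2 s2) = c1 *s left_val \<zeta> x s1 + c2 *s left_val \<zeta> x s2"
      unfolding comb_def by (rule left_val_lincomb'[OF dx s1(1) s2(1)])
    have "left_val \<zeta> x (comb 1 e (-1) (comb c1 s1 c2 s2)) = 1 *s left_val \<zeta> x e + (-1) *s left_val \<zeta> x (comb c1 s1 c2 s2)"
      unfolding comb_def[of 1 e] by (rule left_val_lincomb'[OF dx e i])
    note EE = this[unfolded E1]
    have e12: "comp_minus ?\<sigma> (e 0) = c1" "comp_plus ?\<sigma> (left_val \<zeta> x e) = c2" by (simp_all add: c1_def c2_def)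
    have "comp_minus ?\<sigma> (comb 1 e (-1) (comb c1 s1 c2 s2) 0) = 0"
      unfolding comb_def comp_minus_add comp_minus_smult s1 s2 e12 by simp
    moreover have "comp_plus ?\<sigma> (left_val \<zeta> x (comb 1 e (-1) (comb c1 s1 c2 s2))) = 0"
      unfolding EE comp_plus_add comp_plus_smult s1 s2 e12 by simp
    ultimately have "\<forall>t\<in>{0..<x}. comb 1 e (-1) (comb c1 s1 c2 s2) t = 0"
      by (rule bvp_unique[OF ns im x solves_comb[OF x e i]])
    then have "\<forall>t\<in>{0..<x}. e t = comb c1 s1 c2 s2 t" by (simp add: comb_def[of 1 e] vec_eq_iff)
    then show ?thesis by blast
  qed
  have B1: "bdd_borel 0 x s1" and B2: "bdd_borel 0 x s2" using s1 s2 by (simp_all add: solves_bdd_borel)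
  \<comment> \<open>If \<open>s1\<close> has norm \<open>0\<close>, division by \<open>0\<close> gives \<open>k = 0\<close>, and \<open>s2\<close> is orthogonal to \<open>s1\<close> already.\<close>
  define k where "k = w_inner x s2 s1 / of_real (nrm2 x s1)"
  have orth: "w_inner x (comb 1 s2 (-k) s1) s1 = 0"
  proof (cases "nrm2 x s1 = 0")
    case True
    then show ?thesis unfolding w_inner_comb[OF x B2 B1 B1] w_inner_self using nrm2_zero_w_inner(1)[OF x B2 B1] by simp
  next
    case False
    then show ?thesis unfolding w_inner_comb[OF x B2 B1 B1] w_inner_self k_def by simp
  qed
  have "\<exists>c1 c2. \<forall>t\<in>{0..<x}. e t = comb c1 s1 c2 (comb 1 s2 (-k) s1) t" if e: "solves \<zeta> x e" for e
  proof -
    obtain c1 c2 where "\<forall>t\<in>{0..<x}. e t = comb c1 s1 c2 s2 t" using sp[OF e] by blast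
    moreover have "comb c1 s1 c2 s2 t = comb (c1 + c2 * k) s1 c2 (comb 1 s2 (-k) s1) t" for t
      by (simp add: comb_def vec_eq_iff algebra_simps)
    ultimately show ?thesis by metis
  qed
  then show ?thesis using s1(1) solves_comb[OF x s2(1) s1(1), of 1 "-k"] orth by blast
qed

lemma w_inner_cong: "(\<And>t. t \<in> {0<..<x} \<Longrightarrow> u t = u' t) \<Longrightarrow> (\<And>t. t \<in> {0<..<x} \<Longrightarrow> v t = v' t) \<Longrightarrow> w_inner x u v = w_inner x u' v'"
  unfolding w_inner_def set_lebesgue_integral_def
  by (intro Bochner_Integration.integral_cong refl) (auto split: split_indicator)

text \<open>
  \<open>d\<close> is an orthogonal projection of \<open>u\<close> onto the solutions on \<open>(0, x)\<close>.  As the inner product may be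
  degenerate, \<open>d\<close> is determined only up to solutions of norm \<open>0\<close>; this is why it is a relation.
\<close>

definition proj :: "complex \<Rightarrow> real \<Rightarrow> (real \<Rightarrow> complex^2) \<Rightarrow> (real \<Rightarrow> complex^2) \<Rightarrow> bool" where
  "proj \<zeta> x u d \<longleftrightarrow> solves \<zeta> x d \<and> (\<forall>e. solves \<zeta> x e \<longrightarrow> w_inner x (comb 1 u (-1) d) e = 0)"

lemma parallel_component:
  assumes x: "x \<in> oint b" and u: "bdd_borel 0 x u" and s: "bdd_borel 0 x s"
  shows "\<exists>c. w_inner x u s = c * w_inner x s s"
proof (cases "nrm2 x s = 0")
  case True then show ?thesis using nrm2_zero_w_inner(1)[OF x u s] by simp
next
  case False then show ?thesis unfolding w_inner_self by (intro exI[of _ "w_inner x u s / of_real (nrm2 x s)"]) simp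
qed

lemma proj_ex:
  assumes ns: "nonsingular z0" and im: "Im \<zeta> \<noteq> 0" and x: "x \<in> oint b" and u: "bdd_borel 0 x u"
  shows "\<exists>d. proj \<zeta> x u d"
proof -
  obtain s1 s2 where s: "solves \<zeta> x s1" "solves \<zeta> x s2" "w_inner x s2 s1 = 0"
    and sp: "\<And>e. solves \<zeta> x e \<Longrightarrow> \<exists>c1 c2. \<forall>t\<in>{0..<x}. e t = comb c1 s1 c2 s2 t" using orthogonal_spanning_pair[OF ns im x] by blast
  have B1: "bdd_borel 0 x s1" and B2: "bdd_borel 0 x s2" using s by (simp_all add: solves_bdd_borel)
  obtain c1 where c1: "w_inner x u s1 = c1 * w_inner x s1 s1" using parallel_component[OF x u B1] by blast
  obtain c2 where c2: "w_inner x u s2 = c2 * w_inner x s2 s2" using parallel_component[OF x u B2] by blast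
  have s12: "w_inner x s1 s2 = 0" using s(3) w_inner_cnj[of x s1 s2] by simp
  let ?d = "comb c1 s1 c2 s2"
  have dB: "bdd_borel 0 x ?d" by (rule bdd_borel_comb[OF B1 B2])
  have rB: "bdd_borel 0 x (comb 1 u (-1) ?d)" by (rule bdd_borel_comb[OF u dB])
  have o: "w_inner x (comb 1 u (-1) ?d) s1 = 0" "w_inner x (comb 1 u (-1) ?d) s2 = 0"
    unfolding w_inner_comb[OF x u dB B1] w_inner_comb[OF x u dB B2] w_inner_comb[OF x B1 B2 B1] w_inner_comb[OF x B1 B2 B2] s12 s(3) c1 c2 by simp_all
  have "w_inner x (comb 1 u (-1) ?d) e = 0" if e: "solves \<zeta> x e" for e
  proof -
    obtain k1 k2 where k: "\<forall>t\<in>{0..<x}. e t = comb k1 s1 k2 s2 t" using sp[OF e] by blast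
    have "w_inner x (comb 1 u (-1) ?d) e = w_inner x (comb 1 u (-1) ?d) (comb k1 s1 k2 s2)" by (rule w_inner_cong) (use k in auto)
    also have "\<dots> = 0" unfolding w_inner_comb2[OF x B1 B2 rB] o by simp
    finally show ?thesis .
  qed
  then show ?thesis unfolding proj_def using solves_comb[OF x s(1,2)] by blast
qed

lemma proj_pyth:
  assumes x: "x \<in> oint b" and u: "bdd_borel 0 x u" and p: "proj \<zeta> x u d" and e: "solves \<zeta> x e"
  shows "nrm2 x (comb 1 u (-1) e) = nrm2 x (comb 1 u (-1) d) + nrm2 x (comb 1 d (-1) e)"
proof -
  have d: "solves \<zeta> x d" using p by (simp add: proj_def)
  have dB: "bdd_borel 0 x d" and eB: "bdd_borel 0 x e" using d e by (simp_all add: solves_bdd_borel)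
  have de: "solves \<zeta> x (comb 1 d (-1) e)" by (rule solves_comb[OF x d e])
  have "comb 1 u (-1) e = comb 1 (comb 1 u (-1) d) 1 (comb 1 d (-1) e)" by (simp add: comb_def fun_eq_iff vec_eq_iff)
  moreover have "w_inner x (comb 1 u (-1) d) (comb 1 d (-1) e) = 0" using p de by (simp add: proj_def)
  ultimately show ?thesis using nrm2_comb[OF x bdd_borel_comb[OF u dB] solves_bdd_borel[OF de], of 1 1 "-1" 1] by simp
qed

lemma proj_min:
  assumes x: "x \<in> oint b" and u: "bdd_borel 0 x u" and p: "proj \<zeta> x u d" and e: "solves \<zeta> x e"
  shows "nrm2 x (comb 1 u (-1) d) \<le> nrm2 x (comb 1 u (-1) e)"
proof -
  have "solves \<zeta> x d" using p by (simp add: proj_def)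
  then have "0 \<le> nrm2 x (comb 1 d (-1) e)" by (intro nrm2_nonneg[OF x] bdd_borel_comb solves_bdd_borel[OF e]) (rule solves_bdd_borel)
  then show ?thesis using proj_pyth[OF assms] by simp
qed

text \<open>
  The coefficients with respect to an orthogonal spanning pair converge, except for those of a vector
  of norm \<open>0\<close>, whose contribution has norm \<open>0\<close> whatever the coefficients are.
\<close>

lemma solves_complete:
  assumes ns: "nonsingular z0" and im: "Im \<zeta> \<noteq> 0" and x: "x \<in> oint b" and f: "\<And>n::nat. solves \<zeta> x (f n)"
    and C: "\<And>e. 0 < e \<Longrightarrow> \<exists>N. \<forall>m\<ge>N. \<forall>n\<ge>m. nrm2 x (comb 1 (f n) (-1) (f m)) < e"
  shows "\<exists>g. solves \<zeta> x g \<and> (\<lambda>n. nrm2 x (comb 1 (f n) (-1) g)) \<longlonglongrightarrow> 0"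
proof -
  obtain s1 s2 where s: "solves \<zeta> x s1" "solves \<zeta> x s2" "w_inner x s2 s1 = 0"
    and sp: "\<And>e. solves \<zeta> x e \<Longrightarrow> \<exists>c1 c2. \<forall>t\<in>{0..<x}. e t = comb c1 s1 c2 s2 t" using orthogonal_spanning_pair[OF ns im x] by blast
  have B1: "bdd_borel 0 x s1" and B2: "bdd_borel 0 x s2" using s by (simp_all add: solves_bdd_borel)
  have s12: "w_inner x s1 s2 = 0" using s(3) w_inner_cnj[of x s1 s2] by simp
  have "\<forall>n. \<exists>c1 c2. \<forall>t\<in>{0..<x}. f n t = comb c1 s1 c2 s2 t" using sp[OF f] by blast
  then obtain c1 c2 where c: "\<And>n t. t \<in> {0..<x} \<Longrightarrow> f n t = comb (c1 n) s1 (c2 n) s2 t" by metis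
  have nrd: "nrm2 x (comb 1 (f n) (-1) (comb k1 s1 k2 s2)) = (norm (c1 n - k1))\<^sup>2 * nrm2 x s1 + (norm (c2 n - k2))\<^sup>2 * nrm2 x s2" for n k1 k2
  proof -
    have "nrm2 x (comb 1 (f n) (-1) (comb k1 s1 k2 s2)) = nrm2 x (comb (c1 n - k1) s1 (c2 n - k2) s2)"
      by (rule nrm2_cong) (use c in \<open>simp add: comb_def vec_eq_iff algebra_simps\<close>)
    then show ?thesis unfolding nrm2_comb[OF x B1 B2] s12 by simp
  qed
  have nrm: "nrm2 x (comb 1 (f n) (-1) (f m)) = (norm (c1 n - c1 m))\<^sup>2 * nrm2 x s1 + (norm (c2 n - c2 m))\<^sup>2 * nrm2 x s2" for n m
  proof -
    have "nrm2 x (comb 1 (f n) (-1) (f m)) = nrm2 x (comb 1 (f n) (-1) (comb (c1 m) s1 (c2 m) s2))"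
      by (rule nrm2_cong) (use c in \<open>simp add: comb_def\<close>)
    then show ?thesis unfolding nrd .
  qed
  have pos: "0 \<le> nrm2 x s1" "0 \<le> nrm2 x s2" using nrm2_nonneg[OF x] B1 B2 by auto
  have lim: "\<exists>k. (\<lambda>n. (norm (c n - k))\<^sup>2 * r) \<longlonglongrightarrow> 0"
    if le: "\<And>m n. (norm (c n - c m))\<^sup>2 * r \<le> nrm2 x (comb 1 (f n) (-1) (f m))" and r: "0 \<le> r" for c :: "nat \<Rightarrow> complex" and r
  proof (cases "r = 0")
    case False
    then have r0: "0 < r" using r by simp
    have "Cauchy c"
    proof (rule CauchyI')
      fix e :: real assume e: "0 < e"
      obtain N where N: "\<And>m n. m \<ge> N \<Longrightarrow> n \<ge> m \<Longrightarrow> nrm2 x (comb 1 (f n) (-1) (f m)) < e\<^sup>2 * r"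
        using C[of "e\<^sup>2 * r"] e r0 by auto
      have "dist (c m) (c n) < e" if "m \<ge> N" "n > m" for m n
      proof -
        have "(norm (c n - c m))\<^sup>2 * r < e\<^sup>2 * r" using le[of n m] N[of m n] that by simp
        then have "(norm (c n - c m))\<^sup>2 < e\<^sup>2" using r0 by simp
        then have "norm (c n - c m) < e" using e by (simp add: power2_less_imp_less)
        then show ?thesis by (simp add: dist_norm norm_minus_commute)
      qed
      then show "\<exists>M. \<forall>m\<ge>M. \<forall>n>m. dist (c m) (c n) < e" by blast
    qed
    then obtain k where "c \<longlonglongrightarrow> k" using Cauchy_convergent_iff convergent_def by metis
    then have "(\<lambda>n. (norm (c n - k))\<^sup>2 * r) \<longlonglongrightarrow> (norm (k - k))\<^sup>2 * r" by (intro tendsto_intros)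
    then show ?thesis by auto
  qed simp
  have "\<exists>k. (\<lambda>n. (norm (c1 n - k))\<^sup>2 * nrm2 x s1) \<longlonglongrightarrow> 0"
    by (rule lim) (use pos in \<open>simp_all add: nrm\<close>)
  then obtain k1 where k1: "(\<lambda>n. (norm (c1 n - k1))\<^sup>2 * nrm2 x s1) \<longlonglongrightarrow> 0" by blast
  have "\<exists>k. (\<lambda>n. (norm (c2 n - k))\<^sup>2 * nrm2 x s2) \<longlonglongrightarrow> 0"
    by (rule lim) (use pos in \<open>simp_all add: nrm\<close>)
  then obtain k2 where k2: "(\<lambda>n. (norm (c2 n - k2))\<^sup>2 * nrm2 x s2) \<longlonglongrightarrow> 0" by blast
  have "(\<lambda>n. nrm2 x (comb 1 (f n) (-1) (comb k1 s1 k2 s2))) \<longlonglongrightarrow> 0 + 0"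
    unfolding nrd by (rule tendsto_add[OF k1 k2])
  then show ?thesis using solves_comb[OF x s(1,2)] by (intro exI[of _ "comb k1 s1 k2 s2"]) simp
qed

end

section \<open>Constancy of the deficiency index on half-planes\<close>

text \<open>
  A linear map from \<open>V\<close> to \<open>V'\<close> that is injective modulo \<open>L\<close> and \<open>L'\<close> carries independent families to independent
  families.  A linear relation does the same, and none of the maps used below is
  single-valued.
\<close>

lemma quotient_dim_le_rel:
  assumes tot: "\<And>u. u \<in> V \<Longrightarrow> \<exists>d\<in>V'. R u d"
    and lin: "\<And>a u c u' d d'. R u d \<Longrightarrow> R u' d' \<Longrightarrow> R (comb a u c u') (comb a d c d')"
    and zero: "R (\<lambda>_. 0) (\<lambda>_. 0)" and ker: "\<And>u d. R u d \<Longrightarrow> d \<in> L' \<Longrightarrow> u \<in> L" and L': "(\<lambda>_. 0) \<in> L'"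
  shows "quotient_dim V L \<le> quotient_dim V' L'"
  unfolding quotient_dim_def[of V L]
proof (rule SUP_least)
  fix B assume "B \<in> {B. finite B \<and> B \<subseteq> V \<and> (\<forall>c. (\<lambda>x. \<Sum>u\<in>B. c u *s u x) \<in> L \<longrightarrow> (\<forall>u\<in>B. c u = 0))}"
  then have B: "finite B" "B \<subseteq> V" and ind: "\<And>c. (\<lambda>x. \<Sum>u\<in>B. c u *s u x) \<in> L \<Longrightarrow> \<forall>u\<in>B. c u = 0" by auto
  have "\<forall>u\<in>B. \<exists>d. d \<in> V' \<and> R u d" using tot B by blast
  then obtain \<phi> where \<phi>: "\<And>u. u \<in> B \<Longrightarrow> \<phi> u \<in> V'" "\<And>u. u \<in> B \<Longrightarrow> R u (\<phi> u)" by metis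
  have Rsum: "R (\<lambda>x. \<Sum>u\<in>C. c u *s u x) (\<lambda>x. \<Sum>u\<in>C. c u *s \<phi> u x)" if "C \<subseteq> B" for C c
    using finite_subset[OF that B(1)] that
  proof (induction C rule: finite_induct)
    case (insert u C)
    have "R (comb (c u) u 1 (\<lambda>x. \<Sum>u\<in>C. c u *s u x)) (comb (c u) (\<phi> u) 1 (\<lambda>x. \<Sum>u\<in>C. c u *s \<phi> u x))"
      using insert \<phi> by (intro lin) auto
    then show ?case using insert(1,2) by (simp add: comb_def)
  qed (use zero in simp)
  have key: "\<forall>u\<in>B. c u = 0" if "(\<lambda>x. \<Sum>u\<in>B. c u *s \<phi> u x) \<in> L'" for c
    using ind ker[OF Rsum[OF subset_refl] that] by blast
  have inj: "inj_on \<phi> B"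
  proof (rule inj_onI, rule ccontr)
    fix u v assume uv: "u \<in> B" "v \<in> B" "\<phi> u = \<phi> v" "u \<noteq> v"
    let ?c = "\<lambda>w. if w = u then 1 else if w = v then -1 else 0 :: complex"
    have "(\<Sum>w\<in>B. ?c w *s \<phi> w x) = 0" for x
    proof -
      have "(\<Sum>w\<in>B. ?c w *s \<phi> w x) = (\<Sum>w\<in>{u,v}. ?c w *s \<phi> w x)"
        using uv B(1) by (intro sum.mono_neutral_right) auto
      then show ?thesis using uv by simp
    qed
    then have "(\<lambda>x. \<Sum>w\<in>B. ?c w *s \<phi> w x) \<in> L'" using L' by simp
    from key[OF this] have "?c u = 0" using uv(1) by blast
    then show False by simp
  qed
  have "enat (card (\<phi> ` B)) \<le> quotient_dim V' L'"
    unfolding quotient_dim_def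
  proof (rule SUP_upper, intro CollectI conjI allI impI)
    show "finite (\<phi> ` B)" "\<phi> ` B \<subseteq> V'" using B \<phi> by auto
    fix c assume "(\<lambda>x. \<Sum>u\<in>\<phi> ` B. c u *s u x) \<in> L'"
    moreover have "(\<lambda>x. \<Sum>u\<in>\<phi> ` B. c u *s u x) = (\<lambda>x. \<Sum>u\<in>B. c (\<phi> u) *s \<phi> u x)"
      by (simp add: sum.reindex[OF inj])
    ultimately have "\<forall>u\<in>B. c (\<phi> u) = 0" using key by simp
    then show "\<forall>u\<in>\<phi> ` B. c u = 0" by blast
  qed
  then show "enat (card B) \<le> quotient_dim V' L'" by (simp add: card_image[OF inj])
qed

context canonical_system begin

lemma proj_comb:
  assumes x: "x \<in> oint b" and u: "bdd_borel 0 x u" "bdd_borel 0 x u'" and p: "proj \<zeta> x u d" "proj \<zeta> x u' d'"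
  shows "proj \<zeta> x (comb a u c u') (comb a d c d')"
  unfolding proj_def
proof (intro conjI allI impI)
  have d: "solves \<zeta> x d" "solves \<zeta> x d'" using p by (simp_all add: proj_def)
  show "solves \<zeta> x (comb a d c d')" by (rule solves_comb[OF x d])
  fix e assume e: "solves \<zeta> x e"
  have B: "bdd_borel 0 x (comb 1 u (-1) d)" "bdd_borel 0 x (comb 1 u' (-1) d')" using bdd_borel_comb u solves_bdd_borel[OF d(1)] solves_bdd_borel[OF d(2)] by auto
  have eq: "comb 1 (comb a u c u') (-1) (comb a d c d') = comb a (comb 1 u (-1) d) c (comb 1 u' (-1) d')"
    by (simp add: comb_def fun_eq_iff vec_eq_iff algebra_simps)
  show "w_inner x (comb 1 (comb a u c u') (-1) (comb a d c d')) e = 0"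
    unfolding eq w_inner_comb[OF x B solves_bdd_borel[OF e]] using p e by (simp add: proj_def)
qed

text \<open>
  \<open>d\<close> is a limit of projections of \<open>u\<close> onto the solutions on \<open>(0, cut n)\<close>, in the seminorm of each fixed
  \<open>(0, cut m)\<close>.
\<close>

definition proj_limit :: "complex \<Rightarrow> (real \<Rightarrow> complex^2) \<Rightarrow> (real \<Rightarrow> complex^2) \<Rightarrow> bool" where
  "proj_limit \<zeta> u d \<longleftrightarrow> (\<forall>n. bdd_borel 0 (cut n) u) \<and> d \<in> sols \<zeta> \<and>
     (\<exists>dn. (\<forall>n. proj \<zeta> (cut n) u (dn n)) \<and> (\<forall>m. (\<lambda>n. nrm2 (cut m) (comb 1 (dn n) (-1) d)) \<longlonglongrightarrow> 0))"

lemma nrm2_comb_tendsto_0: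
  assumes x: "x \<in> oint b" and u: "\<And>n. n \<ge> N \<Longrightarrow> bdd_borel 0 x (u n)" and v: "\<And>n. n \<ge> N \<Longrightarrow> bdd_borel 0 x (v n)"
    and lu: "(\<lambda>n. nrm2 x (u n)) \<longlonglongrightarrow> 0" and lv: "(\<lambda>n. nrm2 x (v n)) \<longlonglongrightarrow> 0"
  shows "(\<lambda>n. nrm2 x (comb a (u n) c (v n))) \<longlonglongrightarrow> 0"
proof (rule tendsto_sandwich)
  show "\<forall>\<^sub>F n in sequentially. 0 \<le> nrm2 x (comb a (u n) c (v n))"
    unfolding eventually_sequentially using nrm2_nonneg[OF x bdd_borel_comb] u v by blast
  show "\<forall>\<^sub>F n in sequentially. nrm2 x (comb a (u n) c (v n)) \<le> (1 + 1) * ((norm a)\<^sup>2 * nrm2 x (u n)) + (1 + 1/1) * ((norm c)\<^sup>2 * nrm2 x (v n))"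
    unfolding eventually_sequentially using nrm2_comb_le[OF x u v zero_less_one] by blast
  have "(\<lambda>n. (1 + 1) * ((norm a)\<^sup>2 * nrm2 x (u n)) + (1 + 1/1) * ((norm c)\<^sup>2 * nrm2 x (v n))) \<longlonglongrightarrow>
     (1 + 1) * ((norm a)\<^sup>2 * 0) + (1 + 1/1) * ((norm c)\<^sup>2 * 0)"
    by (intro tendsto_intros lu lv)
  then show "(\<lambda>n. (1 + 1) * ((norm a)\<^sup>2 * nrm2 x (u n)) + (1 + 1/1) * ((norm c)\<^sup>2 * nrm2 x (v n))) \<longlonglongrightarrow> 0" by simp
qed simp

lemma proj_bdd_borel: "proj \<zeta> (cut n) u d \<Longrightarrow> m \<le> n \<Longrightarrow> bdd_borel 0 (cut m) d"
  unfolding proj_def using solves_bdd_borel[OF solves_restrict[OF _ cut_mono[of m n]]] by blast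

lemma proj_limit_comb:
  assumes "proj_limit \<zeta> u d" "proj_limit \<zeta> u' d'" shows "proj_limit \<zeta> (comb a u c u') (comb a d c d')"
proof -
  obtain dn where dn: "\<And>n. proj \<zeta> (cut n) u (dn n)" "\<And>m. (\<lambda>n. nrm2 (cut m) (comb 1 (dn n) (-1) d)) \<longlonglongrightarrow> 0"
    using assms(1) unfolding proj_limit_def by blast
  obtain dn' where dn': "\<And>n. proj \<zeta> (cut n) u' (dn' n)" "\<And>m. (\<lambda>n. nrm2 (cut m) (comb 1 (dn' n) (-1) d')) \<longlonglongrightarrow> 0"
    using assms(2) unfolding proj_limit_def by blast
  have B: "\<And>n. bdd_borel 0 (cut n) u" "\<And>n. bdd_borel 0 (cut n) u'" "d \<in> sols \<zeta>" "d' \<in> sols \<zeta>" using assms unfolding proj_limit_def by auto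
  have eq: "comb 1 (comb a p c p') (-1) (comb a d c d') = comb a (comb 1 p (-1) d) c (comb 1 p' (-1) d')" for p p'
    by (simp add: comb_def fun_eq_iff vec_eq_iff algebra_simps)
  have "(\<lambda>n. nrm2 (cut m) (comb 1 (comb a (dn n) c (dn' n)) (-1) (comb a d c d'))) \<longlonglongrightarrow> 0" for m
    unfolding eq
    by (rule nrm2_comb_tendsto_0[OF cut_oint, of m _ _ _ , OF bdd_borel_comb[OF proj_bdd_borel[OF dn(1)] sols_bdd_borel[OF B(3) cut_oint]]
         bdd_borel_comb[OF proj_bdd_borel[OF dn'(1)] sols_bdd_borel[OF B(4) cut_oint]] dn(2) dn'(2)])
  moreover have "proj \<zeta> (cut n) (comb a u c u') (comb a (dn n) c (dn' n))" for n
    by (rule proj_comb[OF cut_oint B(1,2) dn(1) dn'(1)])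
  moreover have "comb a d c d' \<in> sols \<zeta>" by (rule sols_comb[OF B(3,4)])
  moreover have "bdd_borel 0 (cut n) (comb a u c u')" for n by (rule bdd_borel_comb[OF B(1,2)])
  ultimately show ?thesis unfolding proj_limit_def by (intro conjI exI[of _ "\<lambda>n. comb a (dn n) c (dn' n)"]) blast+
qed

lemma proj_gap:
  assumes ns: "nonsingular z0" and im: "Im \<zeta> \<noteq> 0" and x: "x \<in> oint b" and u: "solves z x u" and p: "proj \<zeta> x u d"
  shows "(Im \<zeta>)\<^sup>2 * nrm2 x (comb 1 u (-1) d) \<le> (norm (z - \<zeta>))\<^sup>2 * nrm2 x u"
proof -
  obtain e where e: "solves \<zeta> x e" "(Im \<zeta>)\<^sup>2 * nrm2 x (comb 1 u (-1) e) \<le> (norm (z - \<zeta>))\<^sup>2 * nrm2 x u"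
    using gap_estimate[OF ns im x u] by blast
  have "(Im \<zeta>)\<^sup>2 * nrm2 x (comb 1 u (-1) d) \<le> (Im \<zeta>)\<^sup>2 * nrm2 x (comb 1 u (-1) e)"
    by (intro mult_left_mono proj_min[OF x solves_bdd_borel[OF u] p e(1)]) simp
  then show ?thesis using e(2) by simp
qed

text \<open>
  Let \<open>D n\<close> be the squared distance of \<open>u\<close> from the solutions for \<open>\<zeta>\<close> on \<open>(0, cut n)\<close>.  It increases with \<open>n\<close>, and it
  is bounded by the gap estimate.  By the theorem of Pythagoras the projections on \<open>(0, cut m)\<close> and
  \<open>(0, cut n)\<close> differ on \<open>(0, cut m)\<close> by at most \<open>D n - D m\<close> in squared norm, hence they form a Cauchy sequence on each \<open>(0, cut m)\<close>.
  The limits \<open>g m\<close> on these intervals agree only up to solutions of norm \<open>0\<close>.  For large \<open>m\<close> the differences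
  extend to elements \<open>l m\<close> of \<open>null_sols\<close>, and subtracting their partial sums makes the
  limits coherent.
\<close>

lemma proj_limit_ex:
  assumes ns: "nonsingular z0" and im0: "Im z0 \<noteq> 0" and im: "Im \<zeta> \<noteq> 0" and u: "u \<in> sols z" and f: "sq_int u"
  shows "\<exists>d. proj_limit \<zeta> u d"
proof -
  have uB: "bdd_borel 0 (cut n) u" for n by (rule sols_bdd_borel[OF u cut_oint])
  have "\<forall>n. \<exists>d. proj \<zeta> (cut n) u d" using proj_ex[OF ns im cut_oint uB] by blast
  then obtain dn where dn: "\<And>n. proj \<zeta> (cut n) u (dn n)" by metis
  have di: "solves \<zeta> (cut m) (dn n)" if "m \<le> n" for m n
    using dn[of n] solves_restrict[OF _ cut_mono[OF that]] unfolding proj_def by blast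
  have dB: "bdd_borel 0 (cut m) (dn n)" if "m \<le> n" for m n by (rule solves_bdd_borel[OF di[OF that]])
  define D where "D n = nrm2 (cut n) (comb 1 u (-1) (dn n))" for n
  obtain C where C: "\<And>x. x \<in> oint b \<Longrightarrow> nrm2 x u \<le> C" using f unfolding sq_int_def by blast
  have Db: "D n \<le> (norm (z - \<zeta>))\<^sup>2 * C / (Im \<zeta>)\<^sup>2" for n
  proof -
    have "(Im \<zeta>)\<^sup>2 * D n \<le> (norm (z - \<zeta>))\<^sup>2 * nrm2 (cut n) u"
      unfolding D_def by (rule proj_gap[OF ns im cut_oint sols_solves[OF u cut_oint] dn])
    also have "\<dots> \<le> (norm (z - \<zeta>))\<^sup>2 * C" by (intro mult_left_mono C cut_oint) simp
    finally show ?thesis using im by (simp add: field_simps)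
  qed
  have step: "nrm2 (cut m) (comb 1 (dn m) (-1) (dn n)) \<le> D n - D m" if mn: "m \<le> n" for m n
  proof -
    have "nrm2 (cut m) (comb 1 u (-1) (dn n)) = D m + nrm2 (cut m) (comb 1 (dn m) (-1) (dn n))"
      unfolding D_def by (rule proj_pyth[OF cut_oint uB dn di[OF mn]])
    moreover have "nrm2 (cut m) (comb 1 u (-1) (dn n)) \<le> D n"
      unfolding D_def by (rule nrm2_mono[OF cut_oint bdd_borel_comb[OF uB dB[OF order_refl]] cut_pos cut_mono[OF mn]])
    ultimately show ?thesis by simp
  qed
  have Dmono: "incseq D"
  proof (rule incseq_SucI)
    fix n
    have "0 \<le> nrm2 (cut n) (comb 1 (dn n) (-1) (dn (Suc n)))" by (intro nrm2_nonneg[OF cut_oint] bdd_borel_comb dB) simp_all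
    then show "D n \<le> D (Suc n)" using step[of n "Suc n"] by simp
  qed
  obtain L where "D \<longlonglongrightarrow> L" using incseq_convergent[OF Dmono] Db by blast
  then have "Cauchy D" by (rule LIMSEQ_imp_Cauchy)
  have cau: "\<exists>N. \<forall>n\<ge>N. \<forall>n'\<ge>n. nrm2 (cut m) (comb 1 (dn (m + n')) (-1) (dn (m + n))) < e" if e: "0 < e" for m e
  proof -
    obtain N where N: "\<And>i j. i \<ge> N \<Longrightarrow> j \<ge> N \<Longrightarrow> dist (D i) (D j) < e" using \<open>Cauchy D\<close> e unfolding Cauchy_def by blast
    have "nrm2 (cut m) (comb 1 (dn (m + n')) (-1) (dn (m + n))) < e" if n: "n \<ge> N" "n' \<ge> n" for n n'
    proof -
      have B: "bdd_borel 0 (cut (m + n)) (comb 1 (dn (m + n)) (-1) (dn (m + n')))" using n by (intro bdd_borel_comb dB) simp_all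
      have "comb 1 (dn (m + n')) (-1) (dn (m + n)) = comb (-1) (comb 1 (dn (m + n)) (-1) (dn (m + n'))) 0 (\<lambda>_. 0)"
        by (simp add: comb_def fun_eq_iff vec_eq_iff)
      then have "nrm2 (cut m) (comb 1 (dn (m + n')) (-1) (dn (m + n))) = nrm2 (cut m) (comb 1 (dn (m + n)) (-1) (dn (m + n')))"
        using nrm2_comb_zero[OF cut_oint bdd_borel_subset[OF B order_refl cut_mono[of m "m + n"]] bdd_borel_const[of 0 "cut m" 0] nrm2_zero_fun, of "-1" 0] by simp
      also have "\<dots> \<le> nrm2 (cut (m + n)) (comb 1 (dn (m + n)) (-1) (dn (m + n')))"
        by (rule nrm2_mono[OF cut_oint B cut_pos cut_mono]) simp
      also have "\<dots> \<le> D (m + n') - D (m + n)" by (rule step) (use n in simp)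
      also have "\<dots> < e" using N[of "m + n'" "m + n"] n by (simp add: dist_real_def)
      finally show ?thesis .
    qed
    then show ?thesis by blast
  qed
  have "\<exists>g. solves \<zeta> (cut m) g \<and> (\<lambda>n. nrm2 (cut m) (comb 1 (dn (m + n)) (-1) g)) \<longlonglongrightarrow> 0" for m
    by (rule solves_complete[OF ns im cut_oint di cau]) simp_all
  then obtain g where g: "\<And>m. solves \<zeta> (cut m) (g m)" "\<And>m. (\<lambda>n. nrm2 (cut m) (comb 1 (dn (m + n)) (-1) (g m))) \<longlonglongrightarrow> 0" by metis
  have gB: "bdd_borel 0 (cut m) (g m)" for m by (rule solves_bdd_borel[OF g(1)])
  have glim: "(\<lambda>n. nrm2 (cut m) (comb 1 (dn n) (-1) (g m))) \<longlonglongrightarrow> 0" for m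
    using g(2)[of m] LIMSEQ_offset[of "\<lambda>n. nrm2 (cut m) (comb 1 (dn n) (-1) (g m))" m] by (simp add: add.commute)
  have gS: "solves \<zeta> (cut m) (g (Suc m))" for m using solves_restrict[OF g(1)[of "Suc m"] cut_mono[of m "Suc m"]] by simp
  have gz: "nrm2 (cut m) (comb 1 (g (Suc m)) (-1) (g m)) = 0" for m
  proof -
    have B1: "bdd_borel 0 (cut m) (comb 1 (dn n) (-1) (g (Suc m)))" "bdd_borel 0 (cut m) (comb 1 (dn n) (-1) (g m))" if "n \<ge> Suc m" for n
      using that by (intro bdd_borel_comb dB solves_bdd_borel[OF gS] gB; simp)+
    have l1: "(\<lambda>n. nrm2 (cut m) (comb 1 (dn n) (-1) (g (Suc m)))) \<longlonglongrightarrow> 0"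
    proof (rule tendsto_sandwich[OF _ _ tendsto_const glim[of "Suc m"]])
      show "\<forall>\<^sub>F n in sequentially. 0 \<le> nrm2 (cut m) (comb 1 (dn n) (-1) (g (Suc m)))"
        unfolding eventually_sequentially using nrm2_nonneg[OF cut_oint B1(1)] by blast
      have "nrm2 (cut m) (comb 1 (dn n) (-1) (g (Suc m))) \<le> nrm2 (cut (Suc m)) (comb 1 (dn n) (-1) (g (Suc m)))" if "n \<ge> Suc m" for n
        by (rule nrm2_mono[OF cut_oint bdd_borel_comb[OF dB[OF that] gB] cut_pos cut_mono]) simp
      then show "\<forall>\<^sub>F n in sequentially. nrm2 (cut m) (comb 1 (dn n) (-1) (g (Suc m))) \<le> nrm2 (cut (Suc m)) (comb 1 (dn n) (-1) (g (Suc m)))"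
        unfolding eventually_sequentially by blast
    qed
    have eq: "comb (-1) (comb 1 p (-1) q) 1 (comb 1 p (-1) r) = comb 1 q (-1) r" for p q r
      by (simp add: comb_def fun_eq_iff vec_eq_iff)
    have "(\<lambda>n. nrm2 (cut m) (comb (-1) (comb 1 (dn n) (-1) (g (Suc m))) 1 (comb 1 (dn n) (-1) (g m)))) \<longlonglongrightarrow> 0"
      by (rule nrm2_comb_tendsto_0[OF cut_oint B1 l1 glim])
    then show ?thesis unfolding eq by (simp add: LIMSEQ_const_iff)
  qed
  obtain N where N: "\<And>n z u. n \<ge> N \<Longrightarrow> solves z (cut n) u \<Longrightarrow> nrm2 (cut n) u = 0 \<Longrightarrow> \<exists>l\<in>null_sols. \<forall>t\<in>{0..<cut n}. l t = u t"
    using zero_norm_extends[OF ns im0] by blast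
  have "\<forall>m. \<exists>l. l \<in> null_sols \<and> (m \<ge> N \<longrightarrow> (\<forall>t\<in>{0..<cut m}. l t = comb 1 (g (Suc m)) (-1) (g m) t))"
  proof
    fix m
    have z: "(\<lambda>_. 0) \<in> null_sols" unfolding null_sols_def sols_def using solves_zero_fun nrm2_zero_fun by simp
    show "\<exists>l. l \<in> null_sols \<and> (m \<ge> N \<longrightarrow> (\<forall>t\<in>{0..<cut m}. l t = comb 1 (g (Suc m)) (-1) (g m) t))"
    proof (cases "m \<ge> N")
      case True
      then show ?thesis using N[OF True solves_comb[OF cut_oint gS g(1)] gz] by blast
    qed (use z in auto)
  qed
  then obtain l where l: "\<And>m. l m \<in> null_sols" "\<And>m t. m \<ge> N \<Longrightarrow> t \<in> {0..<cut m} \<Longrightarrow> l m t = comb 1 (g (Suc m)) (-1) (g m) t" by metis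
  \<comment> \<open>\<open>A m\<close> is the sum of \<open>l k\<close> over \<open>k < m\<close>.\<close>
  define A where "A = rec_nat (\<lambda>_::real. 0::complex^2) (\<lambda>m a. comb 1 a 1 (l m))"
  have A0: "A 0 = (\<lambda>_. 0)" and AS: "A (Suc m) = comb 1 (A m) 1 (l m)" for m by (simp_all add: A_def)
  have AL: "A m \<in> null_sols" for m
  proof (induction m)
    case 0 show ?case unfolding A0 null_sols_def sols_def using solves_zero_fun nrm2_zero_fun by simp
  next
    case (Suc m) show ?case unfolding AS by (rule null_sols_comb[OF Suc l(1)])
  qed
  have AB: "bdd_borel 0 (cut n) (A m)" "nrm2 (cut n) (A m) = 0" "solves \<zeta> (cut n) (A m)" for m n
    using AL[of m] null_sols_iff[of "A m" \<zeta>] sols_solves solves_bdd_borel cut_oint by blast+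
  define h where "h m = comb 1 (g m) (-1) (A m)" for m
  have hi: "solves \<zeta> (cut m) (h m)" for m unfolding h_def by (rule solves_comb[OF cut_oint g(1) AB(3)])
  have "h (Suc m) t = h m t" if "m \<ge> N" "t \<in> {0..<cut m}" for m t
    unfolding h_def AS using l(2)[OF that] by (simp add: comb_def vec_eq_iff)
  then obtain d where d: "\<And>n t. n \<ge> N \<Longrightarrow> t \<in> {0..<cut n} \<Longrightarrow> d t = h n t" using coherent_limit[of N h] by blast
  have dG: "d \<in> sols \<zeta>"
  proof (rule sols_cut[of N])
    fix n assume n: "N \<le> n"
    show "solves \<zeta> (cut n) d" by (rule solves_cong[OF _ _ hi[of n]]) (use d[OF n] cut_pos[of n] in auto)
  qed
  have lim_ge: "(\<lambda>n. nrm2 (cut m) (comb 1 (dn n) (-1) d)) \<longlonglongrightarrow> 0" if m: "m \<ge> N" for m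
  proof -
    have "nrm2 (cut m) (comb 1 (dn n) (-1) d) = nrm2 (cut m) (comb 1 (comb 1 (dn n) (-1) (g m)) 1 (A m))" for n
      by (rule nrm2_cong) (use d[OF m] in \<open>simp add: h_def comb_def vec_eq_iff\<close>)
    moreover have "(\<lambda>n. nrm2 (cut m) (comb 1 (comb 1 (dn n) (-1) (g m)) 1 (A m))) \<longlonglongrightarrow> 0"
      by (rule nrm2_comb_tendsto_0[OF cut_oint bdd_borel_comb[OF dB gB] AB(1) glim, of m]) (simp_all add: AB(2))
    ultimately show ?thesis by simp
  qed
  have "(\<lambda>n. nrm2 (cut m) (comb 1 (dn n) (-1) d)) \<longlonglongrightarrow> 0" for m
  proof (rule tendsto_sandwich[OF _ _ tendsto_const lim_ge[of "max m N"]])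
    have "0 \<le> nrm2 (cut m) (comb 1 (dn n) (-1) d)" if "n \<ge> m" for n
      by (intro nrm2_nonneg[OF cut_oint] bdd_borel_comb dB[OF that] sols_bdd_borel[OF dG cut_oint])
    then show "\<forall>\<^sub>F n in sequentially. 0 \<le> nrm2 (cut m) (comb 1 (dn n) (-1) d)" unfolding eventually_sequentially by blast
    have "nrm2 (cut m) (comb 1 (dn n) (-1) d) \<le> nrm2 (cut (max m N)) (comb 1 (dn n) (-1) d)" if "n \<ge> max m N" for n
      by (intro nrm2_mono[OF cut_oint _ cut_pos cut_mono] bdd_borel_comb dB[OF that] sols_bdd_borel[OF dG cut_oint]) simp
    then show "\<forall>\<^sub>F n in sequentially. nrm2 (cut m) (comb 1 (dn n) (-1) d) \<le> nrm2 (cut (max m N)) (comb 1 (dn n) (-1) d)"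
      unfolding eventually_sequentially by blast
  qed simp
  then show ?thesis unfolding proj_limit_def using uB dG dn by blast
qed

text \<open>
  The gap estimate for the limit; the factor \<open>1 + e\<close> pays for replacing the projection by its limit
  without a triangle inequality for square roots.
\<close>

lemma proj_limit_bound:
  assumes ns: "nonsingular z0" and im: "Im \<zeta> \<noteq> 0" and u: "u \<in> sols z" and R: "proj_limit \<zeta> u d"
    and k: "(norm (z - \<zeta>))\<^sup>2 \<le> k * (Im \<zeta>)\<^sup>2" and B: "\<And>x. x \<in> oint b \<Longrightarrow> nrm2 x u \<le> B" and e: "0 < e"
    and x: "x \<in> oint b"
  shows "nrm2 x (comb 1 u (-1) d) \<le> (1 + e) * (k * B)"
proof -
  have uB: "bdd_borel 0 (cut n) u" for n by (rule sols_bdd_borel[OF u cut_oint])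
  have dG: "d \<in> sols \<zeta>" using R unfolding proj_limit_def by blast
  obtain dn where dn: "\<And>n. proj \<zeta> (cut n) u (dn n)" "\<And>m. (\<lambda>n. nrm2 (cut m) (comb 1 (dn n) (-1) d)) \<longlonglongrightarrow> 0"
    using R unfolding proj_limit_def by blast
  have B0: "0 \<le> B" using nrm2_nonneg[OF cut_oint uB[of 0]] B[OF cut_oint[of 0]] by simp
  have 1: "nrm2 (cut n) (comb 1 u (-1) (dn n)) \<le> k * B" for n
  proof -
    have "(Im \<zeta>)\<^sup>2 * nrm2 (cut n) (comb 1 u (-1) (dn n)) \<le> (norm (z - \<zeta>))\<^sup>2 * nrm2 (cut n) u"
      by (rule proj_gap[OF ns im cut_oint sols_solves[OF u cut_oint] dn(1)])
    also have "\<dots> \<le> (norm (z - \<zeta>))\<^sup>2 * B" by (intro mult_left_mono B cut_oint) simp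
    also have "\<dots> \<le> (k * (Im \<zeta>)\<^sup>2) * B" by (rule mult_right_mono[OF k B0])
    finally have "(Im \<zeta>)\<^sup>2 * nrm2 (cut n) (comb 1 u (-1) (dn n)) \<le> (Im \<zeta>)\<^sup>2 * (k * B)" by (simp add: mult_ac)
    then show ?thesis using im by simp
  qed
  have "nrm2 (cut m) (comb 1 u (-1) d) \<le> (1 + e) * (k * B)" for m
  proof (rule LIMSEQ_le_const)
    have "(\<lambda>n. (1 + e) * (k * B) + (1 + 1/e) * nrm2 (cut m) (comb 1 (dn n) (-1) d)) \<longlonglongrightarrow> (1 + e) * (k * B) + (1 + 1/e) * 0"
      by (intro tendsto_intros dn(2))
    then show "(\<lambda>n. (1 + e) * (k * B) + (1 + 1/e) * nrm2 (cut m) (comb 1 (dn n) (-1) d)) \<longlonglongrightarrow> (1 + e) * (k * B)" by simp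
    have "nrm2 (cut m) (comb 1 u (-1) d) \<le> (1 + e) * (k * B) + (1 + 1/e) * nrm2 (cut m) (comb 1 (dn n) (-1) d)" if n: "n \<ge> m" for n
    proof -
      have B1: "bdd_borel 0 (cut m) (comb 1 u (-1) (dn n))" and B2: "bdd_borel 0 (cut m) (comb 1 (dn n) (-1) d)"
        using bdd_borel_comb uB proj_bdd_borel[OF dn(1) n] sols_bdd_borel[OF dG cut_oint] by auto
      have Bn: "bdd_borel 0 (cut n) (comb 1 u (-1) (dn n))" by (rule bdd_borel_comb[OF uB proj_bdd_borel[OF dn(1) order_refl]])
      have "comb 1 u (-1) d = comb 1 (comb 1 u (-1) (dn n)) 1 (comb 1 (dn n) (-1) d)" by (simp add: comb_def fun_eq_iff vec_eq_iff)
      then have "nrm2 (cut m) (comb 1 u (-1) d) \<le> (1 + e) * nrm2 (cut m) (comb 1 u (-1) (dn n)) + (1 + 1/e) * nrm2 (cut m) (comb 1 (dn n) (-1) d)"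
        using nrm2_comb_le[OF cut_oint B1 B2 e, of 1 1] by simp
      moreover have "nrm2 (cut m) (comb 1 u (-1) (dn n)) \<le> k * B"
        using nrm2_mono[OF cut_oint Bn cut_pos cut_mono[OF n]] 1[of n] by simp
      then have "(1 + e) * nrm2 (cut m) (comb 1 u (-1) (dn n)) \<le> (1 + e) * (k * B)" using e by (intro mult_left_mono) auto
      ultimately show ?thesis by simp
    qed
    then show "\<exists>N. \<forall>n\<ge>N. nrm2 (cut m) (comb 1 u (-1) d) \<le> (1 + e) * (k * B) + (1 + 1/e) * nrm2 (cut m) (comb 1 (dn n) (-1) d)" by blast
  qed
  then show ?thesis by (intro nrm2_le_cut[of _ 0, OF bdd_borel_comb[OF uB sols_bdd_borel[OF dG cut_oint]] _ x])
qed

definition L2_sols :: "complex \<Rightarrow> (real \<Rightarrow> complex^2) set" where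
  "L2_sols z = {u \<in> sols z. sq_int u}"

text \<open>
  The deficiency index in terms of the integral equation.
\<close>

definition defect :: "complex \<Rightarrow> enat" where
  "defect z = quotient_dim (L2_sols z) null_sols"

lemma zero_null_sols: "(\<lambda>_. 0) \<in> null_sols"
  unfolding null_sols_def sols_def using solves_zero_fun nrm2_zero_fun by simp

lemma zero_sols: "(\<lambda>_. 0) \<in> sols z"
  unfolding sols_def using solves_zero_fun by simp

lemma sq_int_comb:
  assumes "u \<in> sols z" "v \<in> sols \<zeta>" "sq_int u" "sq_int v" shows "sq_int (comb a u c v)"
proof -
  obtain C D where "\<And>x. x \<in> oint b \<Longrightarrow> nrm2 x u \<le> C" "\<And>x. x \<in> oint b \<Longrightarrow> nrm2 x v \<le> D" using assms unfolding sq_int_def by blast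
  then have "nrm2 x (comb a u c v) \<le> (1 + 1) * ((norm a)\<^sup>2 * C) + (1 + 1/1) * ((norm c)\<^sup>2 * D)" if "x \<in> oint b" for x
    using that
    by (intro order_trans[OF nrm2_comb_le[OF that sols_bdd_borel[OF assms(1) that] sols_bdd_borel[OF assms(2) that] zero_less_one]] add_mono mult_left_mono) auto
  then show ?thesis unfolding sq_int_def by blast
qed

text \<open>
  The limit of projections is a linear relation between the square-integrable solutions for \<open>z\<close> and those
  for \<open>\<zeta>\<close>.  If it relates \<open>u\<close> to a solution of norm \<open>0\<close>, then \<open>\<parallel>u\<parallel>\<^sup>2 \<le> \<theta> \<parallel>u\<parallel>\<^sup>2\<close> with \<open>\<theta> < 1\<close>, and so \<open>u\<close> has norm \<open>0\<close>.
\<close>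

theorem defect_le_if_close:
  assumes ns: "nonsingular z0" and im0: "Im z0 \<noteq> 0" and close: "norm (z - \<zeta>) < \<bar>Im \<zeta>\<bar>"
  shows "defect z \<le> defect \<zeta>"
proof -
  have im: "Im \<zeta> \<noteq> 0" using close norm_ge_zero[of "z - \<zeta>"] by auto
  define k where "k = (norm (z - \<zeta>))\<^sup>2 / (Im \<zeta>)\<^sup>2"
  have k: "(norm (z - \<zeta>))\<^sup>2 \<le> k * (Im \<zeta>)\<^sup>2" "0 \<le> k" using im by (simp_all add: k_def)
  have "(norm (z - \<zeta>))\<^sup>2 < \<bar>Im \<zeta>\<bar>\<^sup>2" using close by (intro power_strict_mono) auto
  then have k1: "k < 1" using im by (simp add: k_def)
  \<comment> \<open>Chosen such that \<open>(1 + e) k = 2 k / (1 + k)\<close> is less than \<open>1\<close>.\<close>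
  define e where "e = (1 - k) / (1 + k)"
  have e: "0 < e" using k1 k(2) by (simp add: e_def)
  define \<theta> where "\<theta> = (1 + e) * k"
  have \<theta>: "0 \<le> \<theta>" "\<theta> < 1" using k(2) k1 e by (simp_all add: \<theta>_def e_def field_simps)
  have bound: "nrm2 x (comb 1 u (-1) d) \<le> \<theta> * B"
    if "u \<in> sols z" "proj_limit \<zeta> u d" "\<And>x. x \<in> oint b \<Longrightarrow> nrm2 x u \<le> B" "x \<in> oint b" for u d B x
    using proj_limit_bound[OF ns im that(1,2) k(1) that(3) e that(4)] by (simp add: \<theta>_def mult.assoc)
  have dG: "d \<in> sols \<zeta>" if "proj_limit \<zeta> u d" for u d using that unfolding proj_limit_def by blast
  show ?thesis unfolding defect_def
  proof (rule quotient_dim_le_rel[where R="\<lambda>u d. u \<in> L2_sols z \<and> proj_limit \<zeta> u d"])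
    fix u assume u: "u \<in> L2_sols z"
    then have uG: "u \<in> sols z" and uf: "sq_int u" by (simp_all add: L2_sols_def)
    obtain d where d: "proj_limit \<zeta> u d" using proj_limit_ex[OF ns im0 im uG uf] by blast
    obtain B where B: "\<And>x. x \<in> oint b \<Longrightarrow> nrm2 x u \<le> B" using uf unfolding sq_int_def by blast
    have "nrm2 x d \<le> 2 * B + 2 * (\<theta> * B)" if x: "x \<in> oint b" for x
    proof -
      have uB: "bdd_borel 0 x u" and dB: "bdd_borel 0 x d" using sols_bdd_borel[OF uG x] sols_bdd_borel[OF dG[OF d] x] .
      have "d = comb 1 u (-1) (comb 1 u (-1) d)" by (simp add: comb_def fun_eq_iff vec_eq_iff)
      then have "nrm2 x d \<le> (1 + 1) * nrm2 x u + (1 + 1/1) * nrm2 x (comb 1 u (-1) d)"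
        using nrm2_comb_le[OF x uB bdd_borel_comb[OF uB dB] zero_less_one, of 1 "-1" 1 "-1"] by simp
      then show ?thesis using B[OF x] bound[OF uG d B x] by simp
    qed
    then have "sq_int d" unfolding sq_int_def by blast
    then show "\<exists>d\<in>L2_sols \<zeta>. u \<in> L2_sols z \<and> proj_limit \<zeta> u d" using u d dG[OF d] by (intro bexI[of _ d]) (simp_all add: L2_sols_def)
  next
    fix a u c u' d d' assume "u \<in> L2_sols z \<and> proj_limit \<zeta> u d" "u' \<in> L2_sols z \<and> proj_limit \<zeta> u' d'"
    then show "comb a u c u' \<in> L2_sols z \<and> proj_limit \<zeta> (comb a u c u') (comb a d c d')"
      using proj_limit_comb sols_comb sq_int_comb unfolding L2_sols_def by blast
  next
    have z: "solves \<zeta> x (\<lambda>_. 0)" for x by (rule solves_zero_fun)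
    have eq: "comb 1 (\<lambda>_. 0) (-1) (\<lambda>_. 0) = (\<lambda>_. 0)" by (simp add: comb_def)
    have "w_inner x (\<lambda>_. 0) v = 0" for x v by (simp add: w_inner_def w_form_def set_lebesgue_integral_def)
    then have "proj_limit \<zeta> (\<lambda>_. 0) (\<lambda>_. 0)"
      unfolding proj_limit_def proj_def using zero_sols bdd_borel_const z nrm2_zero_fun by (intro conjI exI[of _ "\<lambda>_ _. 0"]) (auto simp: eq)
    moreover have "sq_int (\<lambda>_. 0)" unfolding sq_int_def using nrm2_zero_fun by auto
    ultimately show "(\<lambda>_. 0) \<in> L2_sols z \<and> proj_limit \<zeta> (\<lambda>_. 0) (\<lambda>_. 0)" using zero_sols by (simp add: L2_sols_def)
  next
    fix u d assume R: "u \<in> L2_sols z \<and> proj_limit \<zeta> u d" and d: "d \<in> null_sols"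
    then have uG: "u \<in> sols z" and uf: "sq_int u" by (simp_all add: L2_sols_def)
    obtain B where B: "\<And>x. x \<in> oint b \<Longrightarrow> nrm2 x u \<le> B" using uf unfolding sq_int_def by blast
    have dz: "nrm2 x d = 0" if "x \<in> oint b" for x using d that by (simp add: null_sols_def)
    have eq: "nrm2 x (comb 1 u (-1) d) = nrm2 x u" if x: "x \<in> oint b" for x
      using R nrm2_comb_zero[OF x sols_bdd_borel[OF uG x] sols_bdd_borel[OF dG x] dz[OF x], of u 1 "-1"] by simp
    have it: "nrm2 x u \<le> \<theta> ^ n * B" if "x \<in> oint b" for x n
      using that
    proof (induction n arbitrary: x)
      case (Suc n)
      then show ?case using bound[OF uG _ Suc.IH, of d x] R eq[of x] by (simp add: mult_ac)
    qed (simp add: B)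
    have "nrm2 x u = 0" if x: "x \<in> oint b" for x
    proof -
      have "(\<lambda>n. \<theta> ^ n * B) \<longlonglongrightarrow> 0 * B" by (intro tendsto_intros LIMSEQ_realpow_zero \<theta>)
      then have "(\<lambda>n. \<theta> ^ n * B) \<longlonglongrightarrow> 0" by simp
      then have "nrm2 x u \<le> 0" by (rule LIMSEQ_le_const) (use it[OF x] in blast)
      then show ?thesis using nrm2_nonneg[OF x sols_bdd_borel[OF uG x]] by simp
    qed
    then show "u \<in> null_sols" using uG null_sols_iff[of u z] by blast
  qed (rule zero_null_sols)
qed

text \<open>
  If \<open>x\<close> is closer to \<open>w\<close> than \<open>\<bar>Im w\<bar> / 2\<close>, then it is closer to \<open>w\<close> than both \<open>\<bar>Im w\<bar>\<close> and \<open>\<bar>Im x\<bar>\<close>, and the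
  previous inequality holds in both directions.
\<close>

theorem defect_constant:
  assumes ns: "nonsingular z0" and im0: "Im z0 \<noteq> 0" and z: "0 < Im z * Im \<zeta>"
  shows "defect z = defect \<zeta>"
proof -
  define \<sigma> where "\<sigma> = sgn (Im z)"
  have \<sigma>: "\<sigma> = 1 \<or> \<sigma> = -1" using z by (auto simp: \<sigma>_def sgn_if)
  define S where "S = {w. 0 < \<sigma> * Im w}"
  have zS: "z \<in> S" "\<zeta> \<in> S" using z by (auto simp: S_def \<sigma>_def sgn_if zero_less_mult_iff)
  have "convex S"
  proof (rule convexI)
    fix x y u v assume x: "x \<in> S" "y \<in> S" and uv: "0 \<le> u" "0 \<le> v" "u + v = (1::real)"
    have "0 < u * (\<sigma> * Im x) + v * (\<sigma> * Im y)"
    proof (cases "u = 0")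
      case False
      then have "0 < u * (\<sigma> * Im x)" "0 \<le> v * (\<sigma> * Im y)" using x uv by (simp_all add: S_def)
      then show ?thesis by simp
    qed (use x uv in \<open>simp add: S_def\<close>)
    then show "u *\<^sub>R x + v *\<^sub>R y \<in> S" by (simp add: S_def algebra_simps)
  qed
  then have "connected S" by (rule convex_connected)
  moreover have "\<exists>T. openin (top_of_set S) T \<and> w \<in> T \<and> (\<forall>x\<in>T. defect x = defect w)" if w: "w \<in> S" for w
  proof (intro exI[of _ "S \<inter> ball w (\<sigma> * Im w / 2)"] conjI ballI)
    show "openin (top_of_set S) (S \<inter> ball w (\<sigma> * Im w / 2))" by (simp add: openin_open_Int)
    show "w \<in> S \<inter> ball w (\<sigma> * Im w / 2)" using w by (simp add: S_def)
    fix x assume "x \<in> S \<inter> ball w (\<sigma> * Im w / 2)"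
    then have d: "norm (w - x) < \<sigma> * Im w / 2" and xS: "x \<in> S" by (simp_all add: dist_norm)
    have "\<bar>Im (w - x)\<bar> \<le> norm (w - x)" by (rule abs_Im_le_cmod)
    then have "\<bar>Im w - Im x\<bar> < \<sigma> * Im w / 2" using d by simp
    moreover have "\<sigma> * Im w \<le> \<sigma> * Im x + \<bar>Im w - Im x\<bar>" using \<sigma> by auto
    moreover have "\<bar>Im x\<bar> = \<sigma> * Im x" "\<bar>Im w\<bar> = \<sigma> * Im w" using \<sigma> w xS by (auto simp: S_def)
    ultimately have "norm (w - x) < \<bar>Im x\<bar>" "norm (w - x) < \<bar>Im w\<bar>" using d norm_ge_zero[of "w - x"] by linarith+
    then show "defect x = defect w"
      using defect_le_if_close[OF ns im0, of w x] defect_le_if_close[OF ns im0, of x w] by (simp add: norm_minus_commute)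
  qed
  ultimately have "defect constant_on S" by (intro locally_constant_imp_constant) blast
  then show ?thesis using zS unfolding constant_on_def by metis
qed

section \<open>Initial values of square-integrable solutions\<close>

lemma sols_eqI:
  assumes ns: "nonsingular z" and u: "u \<in> sols z" and v: "v \<in> sols z" and e: "u 0 = v 0" and x: "x \<in> oint b"
  shows "\<forall>t\<in>{0..<x}. u t = v t"
  by (rule solves_eq[OF ns x sols_solves[OF u x] sols_solves[OF v x] e])

lemma sols_nrm2_eq:
  assumes "nonsingular z" "u \<in> sols z" "v \<in> sols z" "u 0 = v 0" "x \<in> oint b"
  shows "nrm2 x u = nrm2 x v"
  by (rule nrm2_cong) (use sols_eqI[OF assms] in auto)

lemma comb_0: "comb a u c v 0 = a *s u 0 + c *s v 0"
  by (simp add: comb_def)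

definition null_values :: "(complex^2) set" where "null_values = {u 0 | u. u \<in> null_sols}"
definition L2_values :: "complex \<Rightarrow> (complex^2) set" where "L2_values z = {u 0 | u. u \<in> L2_sols z}"

lemma null_values_subspace: "vec.subspace null_values"
proof (rule vec_subspace_I)
  show "0 \<in> null_values" unfolding null_values_def using zero_null_sols by force
  fix p q a c assume "p \<in> null_values" "q \<in> null_values"
  then obtain u v where "u \<in> null_sols" "v \<in> null_sols" "p = u 0" "q = v 0" unfolding null_values_def by blast
  then show "a *s p + c *s q \<in> null_values" unfolding null_values_def using null_sols_comb[of u v a c] comb_0[of a u c v] by (metis (mono_tags, lifting) mem_Collect_eq)
qed

lemma L2_values_subspace: "vec.subspace (L2_values z)"
proof (rule vec_subspace_I)
  have "(\<lambda>_. 0) \<in> L2_sols z" unfolding L2_sols_def sq_int_def using zero_sols nrm2_zero_fun by auto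
  then show "0 \<in> L2_values z" unfolding L2_values_def by force
  fix p q a c assume "p \<in> L2_values z" "q \<in> L2_values z"
  then obtain u v where "u \<in> L2_sols z" "v \<in> L2_sols z" "p = u 0" "q = v 0" unfolding L2_values_def by blast
  moreover from this have "comb a u c v \<in> L2_sols z" unfolding L2_sols_def using sols_comb sq_int_comb by blast
  ultimately show "a *s p + c *s q \<in> L2_values z" unfolding L2_values_def using comb_0[of a u c v] by (metis (mono_tags, lifting) mem_Collect_eq)
qed

lemma null_sols_L2_sols: "null_sols \<subseteq> L2_sols z"
proof
  fix u assume u: "u \<in> null_sols"
  then have "u \<in> sols z" "\<forall>x\<in>oint b. nrm2 x u = 0" using null_sols_iff[of u z] by blast+
  then show "u \<in> L2_sols z" unfolding L2_sols_def sq_int_def by auto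
qed

lemma null_values_L2_values: "null_values \<subseteq> L2_values z"
  unfolding null_values_def L2_values_def using null_sols_L2_sols by blast

lemma null_sols_iff_null_values:
  assumes ns: "nonsingular z" and u: "u \<in> sols z" shows "u \<in> null_sols \<longleftrightarrow> u 0 \<in> null_values"
proof
  assume "u 0 \<in> null_values"
  then obtain l where l: "l \<in> null_sols" "u 0 = l 0" unfolding null_values_def by blast
  then have lG: "l \<in> sols z" and z: "\<forall>x\<in>oint b. nrm2 x l = 0" using null_sols_iff[of l z] by blast+
  have "nrm2 x u = 0" if "x \<in> oint b" for x using sols_nrm2_eq[OF ns u lG l(2) that] z that by simp
  then show "u \<in> null_sols" using u null_sols_iff[of u z] by blast
qed (auto simp: null_values_def)

lemma sum_sols:
  assumes "finite B" "B \<subseteq> sols z" shows "(\<lambda>x. \<Sum>u\<in>B. c u *s u x) \<in> sols z"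
  using assms
proof (induction B rule: finite_induct)
  case (insert u B)
  have "comb (c u) u 1 (\<lambda>x. \<Sum>u\<in>B. c u *s u x) \<in> sols z" using insert by (intro sols_comb) auto
  then show ?case using insert by (simp add: comb_def)
qed (simp add: zero_sols)

text \<open>
  Taking the initial value is injective on solutions and identifies \<open>L2_sols z\<close> and \<open>null_sols\<close>
  with subspaces of \<open>\<complex>\<^sup>2\<close>.
\<close>

lemma defect_eq_dim:
  assumes ns: "nonsingular z"
  shows "defect z = enat (vec.dim (L2_values z) - vec.dim null_values)"
proof (rule antisym)
  obtain KB where KB: "KB \<subseteq> null_values" "vec.independent KB" "null_values \<subseteq> vec.span KB" "card KB = vec.dim null_values"
    using vec.basis_exists by blast
  have KBf: "finite KB" using KB(2) by (rule vec.finiteI_independent)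
  show "defect z \<le> enat (vec.dim (L2_values z) - vec.dim null_values)"
    unfolding defect_def quotient_dim_def
  proof (rule SUP_least)
    fix B assume "B \<in> {B. finite B \<and> B \<subseteq> L2_sols z \<and> (\<forall>c. (\<lambda>x. \<Sum>u\<in>B. c u *s u x) \<in> null_sols \<longrightarrow> (\<forall>u\<in>B. c u = 0))}"
    then have B: "finite B" "B \<subseteq> L2_sols z" and ind: "\<And>c. (\<lambda>x. \<Sum>u\<in>B. c u *s u x) \<in> null_sols \<Longrightarrow> \<forall>u\<in>B. c u = 0" by auto
    have BG: "B \<subseteq> sols z" using B(2) unfolding L2_sols_def by blast
    have ind': "\<forall>u\<in>B. c u = 0" if "(\<Sum>u\<in>B. c u *s u 0) \<in> null_values" for c
      using ind[of c] null_sols_iff_null_values[OF ns sum_sols[OF B(1) BG, of c]] that by blast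
    let ?e = "\<lambda>u::real \<Rightarrow> complex^2. u 0"
    have inj: "inj_on ?e B"
    proof (rule inj_onI, rule ccontr)
      fix u v assume uv: "u \<in> B" "v \<in> B" "u 0 = v 0" "u \<noteq> v"
      let ?c = "\<lambda>w. if w = u then 1 else if w = v then -1 else 0 :: complex"
      have "(\<Sum>w\<in>B. ?c w *s w 0) = (\<Sum>w\<in>{u,v}. ?c w *s w 0)"
        using uv B(1) by (intro sum.mono_neutral_right) auto
      then have "(\<Sum>w\<in>B. ?c w *s w 0) = 0" using uv by simp
      then have "(\<Sum>w\<in>B. ?c w *s w 0) \<in> null_values" using vec.subspace_0[OF null_values_subspace] by simp
      from ind'[OF this] have "?c u = 0" using uv(1) by blast
      then show False by simp
    qed
    have disj: "?e ` B \<inter> KB = {}"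
    proof (rule ccontr)
      assume "\<not> ?thesis"
      then obtain u where u: "u \<in> B" "u 0 \<in> null_values" using KB(1) by auto
      have "(\<Sum>w\<in>B. (if w = u then 1 else 0) *s w 0) = (\<Sum>w\<in>{u}. (if w = u then 1 else 0) *s w 0)"
        using u B(1) by (intro sum.mono_neutral_right) auto
      then have "(\<Sum>w\<in>B. (if w = u then 1 else 0) *s w 0) \<in> null_values" using u by simp
      from ind'[OF this] show False using u by auto
    qed
    have "vec.independent (?e ` B \<union> KB)"
    proof (rule vec.independent_if_scalars_zero)
      show fin: "finite (?e ` B \<union> KB)" using B(1) KBf by simp
      fix f x assume s: "(\<Sum>x\<in>?e ` B \<union> KB. f x *s x) = 0" and x: "x \<in> ?e ` B \<union> KB"
      have s2: "(\<Sum>u\<in>B. f (u 0) *s u 0) + (\<Sum>x\<in>KB. f x *s x) = 0"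
        using s B(1) KBf disj by (simp add: sum.union_disjoint sum.reindex[OF inj])
      then have "(\<Sum>u\<in>B. f (u 0) *s u 0) = - (\<Sum>x\<in>KB. f x *s x)" by (simp add: eq_neg_iff_add_eq_0)
      moreover have "(\<Sum>x\<in>KB. f x *s x) \<in> null_values"
        using KB(1) by (intro vec.subspace_sum[OF null_values_subspace] vec.subspace_scale[OF null_values_subspace]) auto
      ultimately have "(\<Sum>u\<in>B. f (u 0) *s u 0) \<in> null_values" using vec.subspace_neg[OF null_values_subspace] by simp
      from ind'[OF this] have f0: "\<forall>u\<in>B. f (u 0) = 0" by simp
      then have "(\<Sum>x\<in>KB. f x *s x) = 0" using s2 by simp
      then have "\<forall>x\<in>KB. f x = 0" using vec.independentD[OF KB(2) KBf subset_refl] by blast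
      then show "f x = 0" using x f0 by auto
    qed
    moreover have "?e ` B \<union> KB \<subseteq> L2_values z" using B(2) KB(1) null_values_L2_values unfolding L2_values_def by blast
    ultimately have "card (?e ` B \<union> KB) \<le> vec.dim (L2_values z)" using vec.independent_card_le_dim by blast
    moreover have "card (?e ` B \<union> KB) = card B + vec.dim null_values"
      using B(1) KBf disj KB(4) by (simp add: card_Un_disjoint card_image[OF inj])
    ultimately show "enat (card B) \<le> enat (vec.dim (L2_values z) - vec.dim null_values)" by simp
  qed
  \<comment> \<open>A basis of \<open>null_values\<close> is extended to one of \<open>L2_values z\<close>; the additional vectors are the
    initial values of solutions that are independent modulo \<open>null_sols\<close>.\<close>
  obtain S where S: "KB \<subseteq> S" "S \<subseteq> L2_values z" "vec.independent S" "L2_values z \<subseteq> vec.span S"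
    using vec.maximal_independent_subset_extend[of KB "L2_values z"] KB(1,2) null_values_L2_values[of z] by blast
  have Sf: "finite S" using S(3) by (rule vec.finiteI_independent)
  have cS: "card S = vec.dim (L2_values z)" using vec.basis_card_eq_dim[OF S(2) S(4) S(3)] by blast
  have "\<forall>p\<in>S - KB. \<exists>u. u \<in> L2_sols z \<and> u 0 = p" using S(2) unfolding L2_values_def by blast
  then obtain g where g: "\<And>p. p \<in> S - KB \<Longrightarrow> g p \<in> L2_sols z" "\<And>p. p \<in> S - KB \<Longrightarrow> g p 0 = p" by metis
  have inj: "inj_on g (S - KB)" by (rule inj_onI) (metis g(2))
  have "enat (card (g ` (S - KB))) \<le> defect z"
    unfolding defect_def quotient_dim_def
  proof (rule SUP_upper, intro CollectI conjI allI impI)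
    show f: "finite (g ` (S - KB))" using Sf by simp
    show "g ` (S - KB) \<subseteq> L2_sols z" using g by blast
    fix c assume L: "(\<lambda>x. \<Sum>u\<in>g ` (S - KB). c u *s u x) \<in> null_sols"
    have "(\<Sum>u\<in>g ` (S - KB). c u *s u 0) \<in> null_values" unfolding null_values_def
      by (rule CollectI, rule exI[of _ "\<lambda>x. \<Sum>u\<in>g ` (S - KB). c u *s u x"]) (simp add: L)
    moreover have "(\<Sum>u\<in>g ` (S - KB). c u *s u 0) = (\<Sum>p\<in>S - KB. c (g p) *s p)"
      unfolding sum.reindex[OF inj] using g(2) by (intro sum.cong) auto
    ultimately have "(\<Sum>p\<in>S - KB. c (g p) *s p) \<in> vec.span KB" using KB(3) by auto
    then obtain h where h: "(\<Sum>p\<in>S - KB. c (g p) *s p) = (\<Sum>v\<in>KB. h v *s v)"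
      unfolding vec.span_finite[OF KBf] by blast
    let ?f = "\<lambda>p. if p \<in> KB then - h p else c (g p)"
    have "(\<Sum>p\<in>S. ?f p *s p) = (\<Sum>p\<in>S - KB. ?f p *s p) + (\<Sum>p\<in>KB. ?f p *s p)"
      by (rule sum.subset_diff[OF S(1) Sf])
    also have "(\<Sum>p\<in>S - KB. ?f p *s p) = (\<Sum>p\<in>S - KB. c (g p) *s p)" by (intro sum.cong) auto
    also have "(\<Sum>p\<in>KB. ?f p *s p) = (\<Sum>p\<in>KB. - (h p *s p))" by (intro sum.cong) (auto simp: vec_eq_iff)
    finally have s0: "(\<Sum>p\<in>S. ?f p *s p) = 0" unfolding h by (simp add: sum_negf)
    have z: "?f p = 0" if "p \<in> S" for p by (rule vec.independentD[OF S(3) Sf subset_refl s0 that])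
    show "\<forall>u\<in>g ` (S - KB). c u = 0"
    proof
      fix u assume "u \<in> g ` (S - KB)"
      then obtain p where p: "p \<in> S" "p \<notin> KB" "u = g p" by blast
      then show "c u = 0" using z[OF p(1)] by simp
    qed
  qed
  moreover have "card (g ` (S - KB)) = vec.dim (L2_values z) - vec.dim null_values"
    using card_image[OF inj] card_Diff_subset[OF KBf S(1)] cS KB(4) by simp
  ultimately show "enat (vec.dim (L2_values z) - vec.dim null_values) \<le> defect z" by simp
qed

text \<open>
  Let \<open>d n\<close> be the solution on \<open>(0, cut n)\<close> with \<open>comp_minus\<close> equal to \<open>1\<close> at \<open>0\<close> and \<open>comp_plus\<close> equal to \<open>0\<close> at
  \<open>cut n\<close>.  The balance of energy bounds its initial value and its norm independently of \<open>n\<close>.  The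
  solution starting from a limit point \<open>q\<close> of the initial values inherits the bound
  \<open>4 \<bar>Im z\<bar> \<parallel>\<phi>\<parallel>\<^sup>2 \<le> - 2 sgn (Im z) hform q\<close>, which says that \<open>sgn (Im z) hform\<close> is not positive along it.
\<close>

lemma weyl_solution:
  assumes ns: "nonsingular z" and im: "Im z \<noteq> 0"
  shows "\<exists>\<phi>\<in>L2_sols z. \<phi> 0 \<noteq> 0 \<and> (\<forall>x\<in>oint b. sgn (Im z) * hform (left_val z x \<phi>) \<le> 0)"
proof -
  let ?\<sigma> = "sgn (Im z)"
  have pos: "0 < ?\<sigma> * Im z" by (rule sgn_Im(1)[OF im])
  obtain u1 where u1: "u1 \<in> sols z" "u1 0 = vector [1, 0]" using ivp_global[OF ns im] by blast
  obtain u2 where u2: "u2 \<in> sols z" "u2 0 = vector [0, 1]" using ivp_global[OF ns im] by blast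
  define U where "U p = comb (p $ 1) u1 (p $ 2) u2" for p :: "complex^2"
  have UG: "U p \<in> sols z" for p unfolding U_def by (rule sols_comb[OF u1(1) u2(1)])
  have U0: "U p 0 = p" for p by (simp add: U_def comb_0 u1 u2 vec_eq_iff forall_2)
  have "\<forall>n. \<exists>d. solves z (cut n) d \<and> comp_minus ?\<sigma> (d 0) = 1 \<and> comp_plus ?\<sigma> (left_val z (cut n) d) = 0"
    using bvp[OF ns im cut_oint] by blast
  then obtain d where d: "\<And>n. solves z (cut n) (d n)" "\<And>n. comp_minus ?\<sigma> (d n 0) = 1" "\<And>n. comp_plus ?\<sigma> (left_val z (cut n) (d n)) = 0" by metis
  define p where "p n = d n 0" for n
  have nrd: "4 * (?\<sigma> * Im z) * nrm2 (cut n) (U (p n)) \<le> 1 - (norm (comp_plus ?\<sigma> (p n)))\<^sup>2" for n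
  proof -
    have "\<forall>t\<in>{0..<cut n}. U (p n) t = d n t"
      by (rule solves_eq[OF ns cut_oint sols_solves[OF UG cut_oint] d(1)]) (simp add: U0 p_def)
    then have "nrm2 (cut n) (U (p n)) = nrm2 (cut n) (d n)" by (intro nrm2_cong) auto
    moreover have "1 = (norm (comp_plus ?\<sigma> (p n)))\<^sup>2 + (norm (comp_minus ?\<sigma> (left_val z (cut n) (d n))))\<^sup>2 + 4 * ?\<sigma> * Im z * nrm2 (cut n) (d n)"
      using boundary_energy[OF cut_oint d(1), of ?\<sigma> n] d(2,3) by (simp add: p_def)
    ultimately show ?thesis using zero_le_power2[of "norm (comp_minus ?\<sigma> (left_val z (cut n) (d n)))"]
      by (simp only: mult.assoc)
  qed
  have ca1: "norm (comp_plus ?\<sigma> (p n)) \<le> 1" for n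
  proof -
    have "0 \<le> 4 * (?\<sigma> * Im z) * nrm2 (cut n) (U (p n))"
      by (rule mult_nonneg_nonneg[OF mult_nonneg_nonneg[OF _ less_imp_le[OF pos]] nrm2_nonneg[OF cut_oint sols_bdd_borel[OF UG cut_oint]]]) simp
    then have "0 \<le> 1 - (norm (comp_plus ?\<sigma> (p n)))\<^sup>2" using nrd[of n] by (rule order_trans)
    then have "(norm (comp_plus ?\<sigma> (p n)))\<^sup>2 \<le> 1\<^sup>2" by simp
    then show ?thesis by (rule power2_le_imp_le) simp
  qed
  have "bounded (range p)"
  proof (rule boundedI)
    fix v assume "v \<in> range p"
    then obtain n where v: "v = p n" by blast
    have s1: "norm ?\<sigma> = 1" using im by (simp add: sgn_if)
    have "2 * norm (v $ 1) = norm (comp_plus ?\<sigma> v + comp_minus ?\<sigma> v)" by (simp add: comp_plus_def comp_minus_def norm_mult[symmetric])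
    also have "\<dots> \<le> 1 + 1" unfolding v using ca1[of n] d(2)[of n] by (intro order_trans[OF norm_triangle_ineq] add_mono) (simp_all add: p_def)
    finally have 1: "norm (v $ 1) \<le> 1" by simp
    have "comp_plus ?\<sigma> v - comp_minus ?\<sigma> v = 2 * (of_real ?\<sigma> * \<i> * v $ 2)" by (simp add: comp_plus_def comp_minus_def)
    then have "2 * norm (v $ 2) = norm (comp_plus ?\<sigma> v - comp_minus ?\<sigma> v)" using s1 by (simp add: norm_mult)
    also have "\<dots> \<le> 1 + 1" unfolding v using ca1[of n] d(2)[of n] by (intro order_trans[OF norm_triangle_ineq4] add_mono) (simp_all add: p_def)
    finally have 2: "norm (v $ 2) \<le> 1" by simp
    have "norm v \<le> norm (v $ 1) + norm (v $ 2)"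
      using L2_set_le_sum[of UNIV "\<lambda>i. norm (v $ i)"] by (simp add: norm_vec_def sum_2)
    then show "norm v \<le> 2" using 1 2 by simp
  qed
  then obtain q r where r: "strict_mono r" "(p \<circ> r) \<longlonglongrightarrow> q"
    using bounded_imp_convergent_subsequence[of p] by blast
  have pj: "(\<lambda>n. p (r n) $ j) \<longlonglongrightarrow> q $ j" for j using tendsto_vec_nth[OF r(2), of j] by (simp add: o_def)
  have lca: "(\<lambda>n. comp_plus ?\<sigma> (p (r n))) \<longlonglongrightarrow> comp_plus ?\<sigma> q" unfolding comp_plus_def by (intro tendsto_intros pj)
  have "(\<lambda>n. comp_minus ?\<sigma> (p (r n))) \<longlonglongrightarrow> comp_minus ?\<sigma> q" unfolding comp_minus_def by (intro tendsto_intros pj)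
  then have cbq: "comp_minus ?\<sigma> q = 1" using d(2) by (simp add: p_def LIMSEQ_const_iff)
  have bnd: "4 * (?\<sigma> * Im z) * nrm2 (cut m) (U q) \<le> 1 - (norm (comp_plus ?\<sigma> q))\<^sup>2" for m
  proof (rule LIMSEQ_le)
    have B: "bdd_borel 0 (cut m) u1" "bdd_borel 0 (cut m) u2" using sols_bdd_borel u1 u2 cut_oint by blast+
    have "(\<lambda>n. (norm (p (r n) $ 1))\<^sup>2 * nrm2 (cut m) u1 + (norm (p (r n) $ 2))\<^sup>2 * nrm2 (cut m) u2 + 2 * Re (p (r n) $ 1 * cnj (p (r n) $ 2) * w_inner (cut m) u1 u2))
      \<longlonglongrightarrow> (norm (q $ 1))\<^sup>2 * nrm2 (cut m) u1 + (norm (q $ 2))\<^sup>2 * nrm2 (cut m) u2 + 2 * Re (q $ 1 * cnj (q $ 2) * w_inner (cut m) u1 u2)"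
      by (intro tendsto_intros pj)
    then have "(\<lambda>n. nrm2 (cut m) (U (p (r n)))) \<longlonglongrightarrow> nrm2 (cut m) (U q)" unfolding U_def nrm2_comb[OF cut_oint B] .
    then show "(\<lambda>n. 4 * (?\<sigma> * Im z) * nrm2 (cut m) (U (p (r n)))) \<longlonglongrightarrow> 4 * (?\<sigma> * Im z) * nrm2 (cut m) (U q)" by (rule tendsto_mult_left)
    show "(\<lambda>n. 1 - (norm (comp_plus ?\<sigma> (p (r n))))\<^sup>2) \<longlonglongrightarrow> 1 - (norm (comp_plus ?\<sigma> q))\<^sup>2" by (intro tendsto_intros lca)
    have "4 * (?\<sigma> * Im z) * nrm2 (cut m) (U (p (r n))) \<le> 1 - (norm (comp_plus ?\<sigma> (p (r n))))\<^sup>2" if "n \<ge> m" for n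
    proof -
      have "m \<le> r n" using seq_suble[OF r(1), of n] that by simp
      then have "nrm2 (cut m) (U (p (r n))) \<le> nrm2 (cut (r n)) (U (p (r n)))"
        by (intro nrm2_mono[OF cut_oint sols_bdd_borel[OF UG cut_oint] cut_pos cut_mono])
      then have "4 * (?\<sigma> * Im z) * nrm2 (cut m) (U (p (r n))) \<le> 4 * (?\<sigma> * Im z) * nrm2 (cut (r n)) (U (p (r n)))"
        using pos by (intro mult_left_mono) auto
      then show ?thesis using nrd[of "r n"] by simp
    qed
    then show "\<exists>N. \<forall>n\<ge>N. 4 * (?\<sigma> * Im z) * nrm2 (cut m) (U (p (r n))) \<le> 1 - (norm (comp_plus ?\<sigma> (p (r n))))\<^sup>2" by blast
  qed
  define c where "c = (1 - (norm (comp_plus ?\<sigma> q))\<^sup>2) / (4 * (?\<sigma> * Im z))"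
  have nrU: "nrm2 x (U q) \<le> c" if "x \<in> oint b" for x
  proof (rule nrm2_le_cut[of _ 0, OF sols_bdd_borel[OF UG cut_oint] _ that])
    show "nrm2 (cut n) (U q) \<le> c" for n using bnd[of n] pos by (simp add: c_def pos_le_divide_eq mult.commute)
  qed
  have "?\<sigma> * hform (left_val z x (U q)) \<le> 0" if x: "x \<in> oint b" for x
  proof -
    have "4 * (?\<sigma> * Im z) * nrm2 x (U q) \<le> 4 * (?\<sigma> * Im z) * c" using pos nrU[OF x] by (intro mult_left_mono) auto
    also have "\<dots> = 1 - (norm (comp_plus ?\<sigma> q))\<^sup>2" unfolding c_def times_divide_eq_right by (rule nonzero_mult_div_cancel_left) (use pos in linarith)
    also have "\<dots> = - (2 * ?\<sigma> * hform q)" using comps_hform[of ?\<sigma> q] cbq by simp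
    finally have "4 * (?\<sigma> * Im z) * nrm2 x (U q) \<le> - (2 * ?\<sigma> * hform q)" .
    moreover have "2 * (?\<sigma> * hform (left_val z x (U q))) = 2 * ?\<sigma> * hform q + 4 * (?\<sigma> * Im z) * nrm2 x (U q)"
      unfolding energy_identity[OF x sols_solves[OF UG x]] U0 by (simp add: algebra_simps)
    ultimately show ?thesis by linarith
  qed
  moreover have "U q \<in> L2_sols z" using UG nrU unfolding L2_sols_def sq_int_def by blast
  moreover have "U q 0 \<noteq> 0" using cbq unfolding U0 by auto
  ultimately show ?thesis by blast
qed

lemma independent_pair_spans:
  fixes p r :: "complex^2"
  assumes "\<And>a c. a *s p + c *s r = 0 \<Longrightarrow> a = 0 \<and> c = 0"
  shows "\<exists>a c. v = a *s p + c *s r"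
proof -
  have "\<exists>w::complex^2. (w $ 1) *s p + (w $ 2) *s r = v"
  proof (rule linear_inj_surj[of "\<lambda>w. (w $ 1) *s p + (w $ 2) *s r"])
    show "((u + v) $ 1) *s p + ((u + v) $ 2) *s r = ((u $ 1) *s p + (u $ 2) *s r) + ((v $ 1) *s p + (v $ 2) *s r)" for u v :: "complex^2"
      by (simp add: vec_eq_iff algebra_simps)
    show "((c *s v) $ 1) *s p + ((c *s v) $ 2) *s r = c *s ((v $ 1) *s p + (v $ 2) *s r)" for c and v :: "complex^2"
      by (simp add: vec_eq_iff algebra_simps)
    show "v = 0" if "(v $ 1) *s p + (v $ 2) *s r = 0" for v :: "complex^2"
      using assms[OF that] by (simp add: vec_eq_iff forall_2)
  qed
  then show ?thesis by metis
qed

definition limit_circle :: "complex \<Rightarrow> bool" where "limit_circle z \<longleftrightarrow> (\<forall>u\<in>sols z. sq_int u)"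

lemma hform_smult: "hform (c *s v) = (norm c)\<^sup>2 * hform v"
proof -
  have "cnj ((c *s v) $ 2) * (c *s v) $ 1 = of_real ((norm c)\<^sup>2) * (cnj (v $ 2) * v $ 1)"
    unfolding complex_norm_square by simp
  then have "Im (cnj ((c *s v) $ 2) * (c *s v) $ 1) = (norm c)\<^sup>2 * Im (cnj (v $ 2) * v $ 1)"
    by (simp only: Im_complex_of_real Re_complex_of_real times_complex.sel)
  then show ?thesis by (simp add: hform_def)
qed

section \<open>Solutions with isotropic initial value\<close>

text \<open>
  On \<open>\<psi>\<close> the form \<open>sgn (Im z) hform\<close> starts at \<open>0\<close> and becomes positive, but on multiples of the Weyl solution it is
  never positive.  So the two are independent, and all solutions are combinations of two
  square-integrable ones.
\<close>

lemma isotropic_limit_circle: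
  assumes ns: "nonsingular z" and im: "Im z \<noteq> 0" and \<psi>: "\<psi> \<in> sols z" "hform (\<psi> 0) = 0" "sq_int \<psi>"
    and x: "x \<in> oint b" "nrm2 x \<psi> \<noteq> 0"
  shows "limit_circle z"
proof -
  let ?\<sigma> = "sgn (Im z)"
  obtain \<phi> where \<phi>: "\<phi> \<in> L2_sols z" "\<phi> 0 \<noteq> 0" "\<And>x. x \<in> oint b \<Longrightarrow> ?\<sigma> * hform (left_val z x \<phi>) \<le> 0"
    using weyl_solution[OF ns im] by blast
  have \<phi>G: "\<phi> \<in> sols z" "sq_int \<phi>" using \<phi>(1) by (simp_all add: L2_sols_def)
  have npos: "0 < nrm2 x \<psi>" using x(2) nrm2_nonneg[OF x(1) sols_bdd_borel[OF \<psi>(1) x(1)]] by simp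
  have hpos: "0 < ?\<sigma> * hform (left_val z x \<psi>)"
  proof -
    have eq: "?\<sigma> * hform (left_val z x \<psi>) = 2 * ((?\<sigma> * Im z) * nrm2 x \<psi>)"
      unfolding energy_identity[OF x(1) sols_solves[OF \<psi>(1) x(1)]] \<psi>(2) by simp
    show ?thesis unfolding eq using mult_pos_pos[OF sgn_Im(1)[OF im] npos] by simp
  qed
  have ind: "a = 0 \<and> c = 0" if e: "a *s \<psi> 0 + c *s \<phi> 0 = 0" for a c
  proof -
    have "a = 0"
    proof (rule ccontr)
      assume a: "a \<noteq> 0"
      define k where "k = - c / a"
      have "a *s (\<psi> 0 - k *s \<phi> 0) = 0" using e a by (simp add: k_def vec_eq_iff algebra_simps)
      then have "\<psi> 0 = k *s \<phi> 0" using a by (simp add: vec_eq_iff)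
      then have e0: "\<psi> 0 = comb k \<phi> 0 \<phi> 0" by (simp add: comb_0)
      have lG: "comb k \<phi> 0 \<phi> \<in> sols z" by (rule sols_comb[OF \<phi>G(1) \<phi>G(1)])
      have "\<forall>t\<in>{0..<x}. \<psi> t = comb k \<phi> 0 \<phi> t" by (rule sols_eqI[OF ns \<psi>(1) lG e0 x(1)])
      then have "left_val z x \<psi> = left_val z x (comb k \<phi> 0 \<phi>)" by (intro left_val_cong) (use e0 in auto)
      also have "\<dots> = k *s left_val z x \<phi>"
        unfolding comb_def using left_val_lincomb[OF x(1) sols_bdd_borel[OF \<phi>G(1) x(1)] sols_bdd_borel[OF \<phi>G(1) x(1)], of z k 0] by simp
      finally have "?\<sigma> * hform (left_val z x \<psi>) = (norm k)\<^sup>2 * (?\<sigma> * hform (left_val z x \<phi>))" by (simp add: hform_smult)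
      also have "\<dots> \<le> 0" using \<phi>(3)[OF x(1)] by (simp add: mult_nonneg_nonpos)
      finally show False using hpos by simp
    qed
    then show ?thesis using e \<phi>(2) by (auto simp: vec_eq_iff)
  qed
  show ?thesis unfolding limit_circle_def
  proof
    fix u assume u: "u \<in> sols z"
    obtain a c where ac: "u 0 = a *s \<psi> 0 + c *s \<phi> 0" using independent_pair_spans[OF ind] by blast
    have lG: "comb a \<psi> c \<phi> \<in> sols z" by (rule sols_comb[OF \<psi>(1) \<phi>G(1)])
    have "nrm2 x u = nrm2 x (comb a \<psi> c \<phi>)" if "x \<in> oint b" for x
      by (rule sols_nrm2_eq[OF ns u lG _ that]) (simp add: ac comb_0)
    then show "sq_int u" using sq_int_comb[OF \<psi>(1) \<phi>G(1) \<psi>(3) \<phi>G(2), of a c] unfolding sq_int_def by simp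
  qed
qed

lemma sform_linear: "sform w (a *s p + c *s r) = a * sform w p + c * sform w r"
  and sform_linear2: "sform (a *s p + c *s r) w = cnj a * sform p w + cnj c * sform r w"
  and sform_cnj: "sform v u = - cnj (sform u v)"
  by (simp_all add: sform_def algebra_simps)

text \<open>
  Let \<open>u\<close> be a second solution for \<open>z\<close>.  The Wronskians of \<open>\<psi>\<close> and of \<open>u\<close> with a solution \<open>v\<close> for \<open>cnj z\<close> are constant.
  They determine the coefficients of \<open>v (x-)\<close> with respect to the basis \<open>\<psi> (x-)\<close>, \<open>u (x-)\<close>.  By the energy
  identity \<open>hform (u (x-))\<close> stays bounded because \<open>u\<close> is square-integrable; this bounds the coefficients,
  hence \<open>hform (v (x-))\<close>, and by the energy identity for \<open>v\<close> its norm.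
\<close>

lemma isotropic_null_sols_limit_circle:
  assumes ns: "nonsingular z" and im: "Im z \<noteq> 0" and \<psi>: "\<psi> \<in> null_sols" "\<psi> 0 \<noteq> 0" "hform (\<psi> 0) = 0" and all: "limit_circle z"
  shows "limit_circle (cnj z)"
proof -
  have \<psi>G: "\<psi> \<in> sols z" and \<psi>z: "\<And>x. x \<in> oint b \<Longrightarrow> nrm2 x \<psi> = 0" using \<psi>(1) null_sols_iff[of \<psi> z] by blast+
  \<comment> \<open>The initial value of \<open>u\<close> is chosen such that its Wronskian with \<open>\<psi>\<close> is \<open>\<parallel>\<psi> 0\<parallel>\<^sup>2\<close>.\<close>
  obtain u where u: "u \<in> sols z" "u 0 = vector [\<psi> 0 $ 2, - \<psi> 0 $ 1]" using ivp_global[OF ns im] by blast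
  define c where "c = sform (\<psi> 0) (u 0)"
  have "c = of_real ((norm (\<psi> 0 $ 2))\<^sup>2 + (norm (\<psi> 0 $ 1))\<^sup>2)"
    unfolding c_def sform_def u of_real_add complex_norm_square by (simp add: mult.commute)
  moreover have "(norm (\<psi> 0 $ 2))\<^sup>2 + (norm (\<psi> 0 $ 1))\<^sup>2 \<noteq> 0" using \<psi>(2) by (auto simp: vec_eq_iff forall_2 sum_power2_eq_zero_iff)
  ultimately have c0: "c \<noteq> 0" by (simp only: of_real_eq_0_iff not_False_eq_True)
  obtain C where C: "\<And>x. x \<in> oint b \<Longrightarrow> nrm2 x u \<le> C" using all u unfolding limit_circle_def sq_int_def by blast
  define H where "H = \<bar>hform (u 0)\<bar> + 2 * \<bar>Im z\<bar> * C"
  have H: "\<bar>hform (left_val z x u)\<bar> \<le> H" if x: "x \<in> oint b" for x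
  proof -
    have "\<bar>2 * Im z * nrm2 x u\<bar> = 2 * \<bar>Im z\<bar> * nrm2 x u" using nrm2_nonneg[OF x sols_bdd_borel[OF u(1) x]] by (simp add: abs_mult)
    also have "\<dots> \<le> 2 * \<bar>Im z\<bar> * C" by (rule mult_left_mono[OF C[OF x]]) simp
    finally show ?thesis unfolding energy_identity[OF x sols_solves[OF u(1) x]] H_def by (smt (verit))
  qed
  have "sq_int v" if v: "v \<in> sols (cnj z)" for v
  proof -
    define c1 where "c1 = sform (\<psi> 0) (v 0)"
    define c2 where "c2 = sform (u 0) (v 0)"
    define B where "B = norm (c1 / c)"
    define A where "A = (norm c2 + B * H) / norm c"
    define X where "X = 2 * A * B * norm c + B\<^sup>2 * H"
    have "nrm2 x v \<le> (X + \<bar>hform (v 0)\<bar>) / (2 * \<bar>Im z\<bar>)" if x: "x \<in> oint b" for x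
    proof -
      let ?p = "left_val z x \<psi>" and ?r = "left_val z x u" and ?w = "left_val (cnj z) x v"
      have pB: "bdd_borel 0 x \<psi>" and uB: "bdd_borel 0 x u" and vB: "bdd_borel 0 x v" using sols_bdd_borel \<psi>G u(1) v x by blast+
      have pr: "sform ?p ?r = c"
        using lagrange[OF x sols_solves[OF u(1) x] sols_solves[OF \<psi>G x]] nrm2_zero_w_inner(1)[OF x uB pB \<psi>z[OF x]] by (simp add: c_def)
      have pp: "sform ?p ?p = 0"
        using lagrange[OF x sols_solves[OF \<psi>G x] sols_solves[OF \<psi>G x]] nrm2_zero_w_inner(1)[OF x pB pB \<psi>z[OF x]] sform_self[of "\<psi> 0"] \<psi>(3) by simp
      have rp: "sform ?r ?p = - cnj c" using sform_cnj[of ?r ?p] pr by simp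
      have pw: "sform ?p ?w = c1" and rw: "sform ?r ?w = c2"
        using lagrange[OF x sols_solves[OF v x] sols_solves[OF \<psi>G x]] lagrange[OF x sols_solves[OF v x] sols_solves[OF u(1) x]] by (simp_all add: c1_def c2_def)
      have ind: "a = 0 \<and> d = 0" if e: "a *s ?p + d *s ?r = 0" for a d
      proof -
        have "sform ?p (a *s ?p + d *s ?r) = 0" unfolding e by (simp add: sform_def)
        then have "d = 0" unfolding sform_linear pp pr using c0 by simp
        moreover have "sform ?r (a *s ?p + d *s ?r) = 0" unfolding e by (simp add: sform_def)
        then have "a * cnj c = 0" unfolding sform_linear rp using \<open>d = 0\<close> by simp
        ultimately show ?thesis using c0 by simp
      qed
      obtain a d where w: "?w = a *s ?p + d *s ?r" using independent_pair_spans[OF ind] by blast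
      have d: "d * c = c1" using pw unfolding w sform_linear pp pr by simp
      then have "d = c1 / c" using c0 by (simp add: field_simps)
      then have nd: "norm d = B" by (simp add: B_def)
      have "c2 = a * (- cnj c) + d * sform ?r ?r" using rw unfolding w sform_linear rp by simp
      then have "a * cnj c = d * (\<i> * hform ?r) - c2" unfolding sform_self by (simp add: algebra_simps)
      then have "norm a * norm c = norm (d * (\<i> * hform ?r) - c2)" by (metis norm_mult complex_mod_cnj)
      also have "\<dots> \<le> B * H + norm c2"
        using H[OF x] by (intro order_trans[OF norm_triangle_ineq4] add_mono) (auto simp: norm_mult nd B_def intro!: mult_left_mono)
      finally have na: "norm a \<le> A" using c0 by (simp add: A_def field_simps)
      have B0: "0 \<le> B" by (simp add: B_def)
      have A0: "0 \<le> A" using na norm_ge_zero order_trans by blast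
      have "\<i> * hform ?w = cnj a * (d * c) + (- (cnj d * (a * cnj c)) + cnj d * (d * (\<i> * hform ?r)))"
        unfolding sform_self[symmetric] w sform_linear2 sform_linear pp pr rp by (simp add: algebra_simps)
      then have "norm (\<i> * hform ?w) = norm (cnj a * (d * c) + (- (cnj d * (a * cnj c)) + cnj d * (d * (\<i> * hform ?r))))"
        by (rule arg_cong)
      also have "\<dots> \<le> norm (cnj a * (d * c)) + (norm (cnj d * (a * cnj c)) + norm (cnj d * (d * (\<i> * hform ?r))))"
        by (intro order_trans[OF norm_triangle_ineq] add_mono order_refl) simp
      also have "\<dots> = 2 * (norm a * B * norm c) + B\<^sup>2 * \<bar>hform ?r\<bar>" by (simp add: norm_mult nd power2_eq_square)
      also have "\<dots> \<le> 2 * (A * B * norm c) + B\<^sup>2 * H"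
        using na H[OF x] B0 by (intro add_mono mult_left_mono mult_right_mono) simp_all
      finally have hw: "\<bar>hform ?w\<bar> \<le> X" by (simp add: X_def norm_mult)
      have n0: "0 \<le> nrm2 x v" by (rule nrm2_nonneg[OF x vB])
      have "hform ?w = hform (v 0) - 2 * Im z * nrm2 x v" using energy_identity[OF x sols_solves[OF v x]] by simp
      then have "\<bar>2 * Im z * nrm2 x v\<bar> \<le> X + \<bar>hform (v 0)\<bar>" using hw by linarith
      then have "nrm2 x v * (2 * \<bar>Im z\<bar>) \<le> X + \<bar>hform (v 0)\<bar>" using n0 by (simp add: abs_mult mult_ac)
      then show ?thesis using im by (simp add: pos_le_divide_eq)
    qed
    then show ?thesis unfolding sq_int_def by blast
  qed
  then show ?thesis unfolding limit_circle_def by blast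
qed

lemma dim_L2_values:
  assumes ns: "nonsingular z" and im: "Im z \<noteq> 0"
  shows "vec.dim (L2_values z) = (if limit_circle z then 2 else 1)"
proof -
  have two: "vec.dim (UNIV :: (complex^2) set) = 2" by (simp add: card_cart_basis)
  have le: "vec.dim (L2_values z) \<le> 2" using vec.dim_subset[of "L2_values z" UNIV] unfolding two by blast
  have ne: "vec.dim (L2_values z) \<noteq> 0"
  proof -
    obtain \<phi> where "\<phi> \<in> L2_sols z" "\<phi> 0 \<noteq> 0" using weyl_solution[OF ns im] by blast
    then have "\<not> L2_values z \<subseteq> {0}" unfolding L2_values_def by blast
    then show ?thesis by (simp add: vec.dim_eq_0)
  qed
  have iff: "vec.dim (L2_values z) = 2 \<longleftrightarrow> limit_circle z"
  proof
    assume d: "vec.dim (L2_values z) = 2"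
    have "L2_values z = UNIV" by (rule vec.subspace_dim_equal[OF L2_values_subspace vec.subspace_UNIV]) (simp_all add: d card_cart_basis)
    show "limit_circle z" unfolding limit_circle_def
    proof
      fix u assume u: "u \<in> sols z"
      have "u 0 \<in> L2_values z" using \<open>L2_values z = UNIV\<close> by simp
      then obtain w where w: "w \<in> sols z" "sq_int w" "u 0 = w 0" unfolding L2_values_def L2_sols_def by blast
      then show "sq_int u" using sols_nrm2_eq[OF ns u w(1,3)] unfolding sq_int_def by simp
    qed
  next
    assume all: "limit_circle z"
    have "p \<in> L2_values z" for p
    proof -
      obtain u where "u \<in> sols z" "u 0 = p" using ivp_global[OF ns im] by blast
      then show ?thesis using all unfolding L2_values_def L2_sols_def limit_circle_def by blast
    qed
    then have V: "L2_values z = UNIV" by blast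
    show "vec.dim (L2_values z) = 2" unfolding V by (rule two)
  qed
  show ?thesis
  proof (cases "limit_circle z")
    case False
    then have "vec.dim (L2_values z) \<noteq> 2" using iff by blast
    then have "vec.dim (L2_values z) = 1" using le ne by linarith
    then show ?thesis using False by simp
  qed (use iff in simp)
qed

text \<open>
  Both indices are obtained by subtracting the same number \<open>vec.dim null_values\<close>, so they differ if
  and only if exactly one of \<open>z\<close> and \<open>cnj z\<close> is in the limit circle case.
\<close>

theorem deficiency_dichotomy:
  assumes ns: "nonsingular z" "nonsingular (cnj z)" and im: "Im z \<noteq> 0"
    and \<psi>: "\<psi> \<in> sols z" "\<psi>' \<in> sols (cnj z)" "\<psi> 0 = \<psi>' 0" "\<psi> 0 \<noteq> 0" "hform (\<psi> 0) = 0"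
  shows "defect z \<noteq> defect (cnj z) \<longleftrightarrow> sq_int \<psi> \<noteq> sq_int \<psi>'"
proof -
  have im': "Im (cnj z) \<noteq> 0" using im by simp
  note d = dim_L2_values[OF ns(1) im] dim_L2_values[OF ns(2) im']
  have k: "vec.dim null_values \<le> vec.dim (L2_values z)" "vec.dim null_values \<le> vec.dim (L2_values (cnj z))" using null_values_L2_values by (auto intro: vec.dim_subset)
  have n: "defect z \<noteq> defect (cnj z) \<longleftrightarrow> limit_circle z \<noteq> limit_circle (cnj z)"
    unfolding defect_eq_dim[OF ns(1)] defect_eq_dim[OF ns(2)] using k unfolding d by (auto split: if_splits)
  show ?thesis
  proof (cases "\<psi> \<in> null_sols")
    case True
    have \<psi>G: "\<psi> \<in> sols (cnj z)" and z: "\<And>x. x \<in> oint b \<Longrightarrow> nrm2 x \<psi> = 0" using True null_sols_iff[of \<psi> "cnj z"] by blast+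
    have "nrm2 x \<psi>' = 0" if "x \<in> oint b" for x using sols_nrm2_eq[OF ns(2) \<psi>G \<psi>(2,3) that] z that by simp
    then have "sq_int \<psi>" "sq_int \<psi>'" using z unfolding sq_int_def by auto
    moreover have "limit_circle z \<longleftrightarrow> limit_circle (cnj z)"
      using isotropic_null_sols_limit_circle[OF ns(1) im True \<psi>(4,5)] isotropic_null_sols_limit_circle[OF ns(2) im' True \<psi>(4,5)] by auto
    ultimately show ?thesis using n by simp
  next
    case False
    have "\<psi>' \<notin> null_sols"
    proof
      assume "\<psi>' \<in> null_sols"
      then have G': "\<psi>' \<in> sols z" and z: "\<And>x. x \<in> oint b \<Longrightarrow> nrm2 x \<psi>' = 0" using null_sols_iff[of \<psi>' z] by blast+
      have "nrm2 x \<psi> = 0" if "x \<in> oint b" for x using sols_nrm2_eq[OF ns(1) \<psi>(1) G' \<psi>(3) that] z that by simp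
      then show False using False \<psi>(1) null_sols_iff[of \<psi> z] by blast
    qed
    then obtain x' where x': "x' \<in> oint b" "nrm2 x' \<psi>' \<noteq> 0" using \<psi>(2) null_sols_iff[of \<psi>' "cnj z"] by blast
    obtain x where x: "x \<in> oint b" "nrm2 x \<psi> \<noteq> 0" using False \<psi>(1) null_sols_iff[of \<psi> z] by blast
    have "sq_int \<psi> \<longleftrightarrow> limit_circle z"
      using isotropic_limit_circle[OF ns(1) im \<psi>(1,5) _ x] \<psi>(1) unfolding limit_circle_def by blast
    moreover have "hform (\<psi>' 0) = 0" using \<psi>(3,5) by simp
    then have "sq_int \<psi>' \<longleftrightarrow> limit_circle (cnj z)"
      using isotropic_limit_circle[OF ns(2) im' \<psi>(2) _ _ x'] \<psi>(2) unfolding limit_circle_def by blast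
    ultimately show ?thesis using n by simp
  qed
qed

end

section \<open>Solutions in the sense of measures satisfy the integral equation\<close>

lemma measure_on_signed_ring:
  fixes \<mu> :: "real set \<Rightarrow> 'a::real_normed_vector"
  assumes m: "measure_on K \<mu>" and lin: "bounded_linear f" and K: "K \<in> sets borel"
  shows "signed_ring {A \<in> sets borel. A \<subseteq> K} (\<lambda>A. f (\<mu> A))"
proof
  fix F :: "nat \<Rightarrow> real set"
  assume F: "\<And>n. F n \<in> {A \<in> sets borel. A \<subseteq> K}" "disjoint_family F"
  then have "(\<lambda>n. \<mu> (F n)) sums \<mu> (\<Union>n. F n)" using m unfolding measure_on_def by blast
  then show "(\<lambda>n. f (\<mu> (F n))) sums f (\<mu> (\<Union>n. F n))" by (rule bounded_linear.sums[OF lin])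
qed auto

text \<open>
  Such a distribution function is a difference of two monotone ones, by the Jordan decomposition.
\<close>

lemma signed_cdf_measurable:
  assumes s: "signed_ring {A \<in> sets borel. A \<subseteq> {x..y::real}} \<nu>"
  shows "(\<lambda>t. \<nu> ({x..t} \<inter> {x..y})) \<in> borel_measurable borel" "(\<lambda>t. \<nu> ({x..<t} \<inter> {x..y})) \<in> borel_measurable borel"
proof -
  let ?R = "{A \<in> sets borel. A \<subseteq> {x..y::real}}"
  have mono: "(\<lambda>t. measure (variation ?R \<nu>) (A t)) \<in> borel_measurable borel"
    if s: "signed_ring ?R \<nu>" and A: "\<And>t. A t \<in> sets borel" "\<And>t. A t \<subseteq> {x..y}" "\<And>t t'. t \<le> t' \<Longrightarrow> A t \<subseteq> A t'" for A :: "real \<Rightarrow> real set" and \<nu> :: "real set \<Rightarrow> real"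
  proof (rule Borel_Space.borel_measurable_mono, rule monoI)
    fix t t' :: real assume t: "t \<le> t'"
    have "emeasure (variation ?R \<nu>) (A t) \<le> emeasure (variation ?R \<nu>) (A t')"
      using A by (intro emeasure_mono A(3)[OF t]) simp
    moreover have "emeasure (variation ?R \<nu>) (A t') < top"
      using signed_ring.variation_finite[OF s, of "A t'"] A by simp
    ultimately show "measure (variation ?R \<nu>) (A t) \<le> measure (variation ?R \<nu>) (A t')"
      unfolding measure_def by (rule enn2real_mono)
  qed
  have *: "(\<lambda>t. \<nu> (A t)) \<in> borel_measurable borel"
    if A: "\<And>t. A t \<in> sets borel" "\<And>t. A t \<subseteq> {x..y}" "\<And>t t'. t \<le> t' \<Longrightarrow> A t \<subseteq> A t'" for A :: "real \<Rightarrow> real set"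
  proof -
    have "\<nu> (A t) = measure (variation ?R \<nu>) (A t) - measure (variation ?R (\<lambda>A. - \<nu> A)) (A t)" for t
      by (rule signed_ring.jordan_decomposition[OF s]) (use A in simp)
    then show ?thesis using mono[OF s A] mono[OF signed_ring.signed_ring_uminus[OF s] A] by simp
  qed
  show "(\<lambda>t. \<nu> ({x..t} \<inter> {x..y})) \<in> borel_measurable borel" by (rule *) auto
  show "(\<lambda>t. \<nu> ({x..<t} \<inter> {x..y})) \<in> borel_measurable borel" by (rule *) auto
qed

lemma cdensity_integral:
  assumes "cdensity R M \<nu> g" "X \<in> R" "(\<lambda>x. indicator X x *\<^sub>R f x) \<in> borel_measurable borel"
    "\<exists>C. \<forall>x\<in>X. norm (f x) \<le> C"
  shows "cmeasure_integral \<nu> X f = (LINT x:X|M. g x * f x)"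
  using assms unfolding cdensity_def by simp

text \<open>
  A canonical system together with the measures whose densities \<open>Q\<close> and \<open>W\<close> are.
\<close>

locale represented_system = canonical_system +
  fixes q w :: "real set \<Rightarrow> complex^2^2"
  assumes q_dens: "\<And>i j. cdensity (reg_sets b) M (\<lambda>A. q A $ i $ j) (\<lambda>x. Q x $ i $ j)"
    and w_dens: "\<And>i j. cdensity (reg_sets b) M (\<lambda>A. w A $ i $ j) (\<lambda>x. W x $ i $ j)"
begin

lemma reg_setsI: "X \<in> sets borel \<Longrightarrow> 0 \<le> x \<Longrightarrow> y \<in> oint b \<Longrightarrow> X \<subseteq> {x<..<y} \<Longrightarrow> X \<in> reg_sets b"
  unfolding reg_sets_def by force

lemma bdd_borel_on:
  assumes u: "bdd_borel x y u" and X: "X \<in> sets borel" "X \<subseteq> {x<..<y}"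
  shows "(\<lambda>t. indicator X t *\<^sub>R (u t $ j)) \<in> borel_measurable borel" "\<exists>C. \<forall>t\<in>X. norm (u t $ j) \<le> C"
proof -
  have "(\<lambda>t. indicator {x<..<y} t *\<^sub>R (u t $ j)) \<in> borel_measurable borel" using u unfolding bdd_borel_def by blast
  then have "(\<lambda>t. indicator X t *\<^sub>R (indicator {x<..<y} t *\<^sub>R (u t $ j))) \<in> borel_measurable borel"
    by (rule borel_measurable_scaleR[rotated]) (use X(1) in simp)
  moreover have "(\<lambda>t. indicator X t *\<^sub>R (indicator {x<..<y} t *\<^sub>R (u t $ j))) = (\<lambda>t. indicator X t *\<^sub>R (u t $ j))"
    using X(2) by (auto simp: fun_eq_iff split: split_indicator)
  ultimately show "(\<lambda>t. indicator X t *\<^sub>R (u t $ j)) \<in> borel_measurable borel" by simp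
  obtain C where "\<forall>t\<in>{x<..<y}. norm (u t) \<le> C" using u unfolding bdd_borel_def by blast
  then show "\<exists>C. \<forall>t\<in>X. norm (u t $ j) \<le> C"
    using X(2) Finite_Cartesian_Product.norm_nth_le order_trans by (meson subsetD)
qed

lemma mat_measure_mult_rhs:
  assumes x: "0 \<le> x" "y \<in> oint b" and u: "bdd_borel x y u" and X: "X \<in> sets borel" "X \<subseteq> {x<..<y}"
  shows "J *v (mat_measure_mult q u X - z *s mat_measure_mult w u X) = (LINT t:X|M. rhs z t (u t))"
proof -
  have R: "X \<in> reg_sets b" by (rule reg_setsI[OF X(1) x X(2)])
  have iq: "set_integrable M X (\<lambda>t. Q t $ i $ j * u t $ j)" "cmeasure_integral (\<lambda>A. q A $ i $ j) X (\<lambda>t. u t $ j) = (LINT t:X|M. Q t $ i $ j * u t $ j)"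
    and iw: "set_integrable M X (\<lambda>t. W t $ i $ j * u t $ j)" "cmeasure_integral (\<lambda>A. w A $ i $ j) X (\<lambda>t. u t $ j) = (LINT t:X|M. W t $ i $ j * u t $ j)" for i j
  proof -
    obtain C where C: "\<And>t. t \<in> X \<Longrightarrow> norm (u t $ j) \<le> C" using bdd_borel_on(2)[OF u X, of j] by blast
    show "set_integrable M X (\<lambda>t. Q t $ i $ j * u t $ j)" "set_integrable M X (\<lambda>t. W t $ i $ j * u t $ j)"
      using q_dens[of i j] w_dens[of i j] R unfolding cdensity_def
      by (intro set_integrable_mult_bounded[OF sets_M _ _ bdd_borel_on(1)[OF u X] C]; simp)+
    show "cmeasure_integral (\<lambda>A. q A $ i $ j) X (\<lambda>t. u t $ j) = (LINT t:X|M. Q t $ i $ j * u t $ j)"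
      "cmeasure_integral (\<lambda>A. w A $ i $ j) X (\<lambda>t. u t $ j) = (LINT t:X|M. W t $ i $ j * u t $ j)"
      by (rule cdensity_integral[OF q_dens R bdd_borel_on[OF u X]], rule cdensity_integral[OF w_dens R bdd_borel_on[OF u X]])
  qed
  have comb: "(mat_measure_mult q u X - z *s mat_measure_mult w u X) $ i = (LINT t:X|M. \<Sum>j\<in>UNIV. (Q t $ i $ j - z * W t $ i $ j) * u t $ j)" for i
  proof -
    have zw: "set_integrable M X (\<lambda>t. z * (W t $ i $ j * u t $ j))" for j
    proof -
      have "integrable M (\<lambda>t. z * (indicator X t *\<^sub>R (W t $ i $ j * u t $ j)))"
        using iw(1)[of i j] unfolding set_integrable_def by (rule integrable_mult_right)
      then show ?thesis unfolding set_integrable_def by simp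
    qed
    have d: "set_integrable M X (\<lambda>t. Q t $ i $ j * u t $ j - z * (W t $ i $ j * u t $ j))" for j
      by (rule set_integral_diff(1)[OF iq(1) zw])
    have "(LINT t:X|M. \<Sum>j\<in>UNIV. (Q t $ i $ j - z * W t $ i $ j) * u t $ j) =
       (LINT t:X|M. (Q t $ i $ 1 * u t $ 1 - z * (W t $ i $ 1 * u t $ 1)) + (Q t $ i $ 2 * u t $ 2 - z * (W t $ i $ 2 * u t $ 2)))"
      by (simp add: sum_2 algebra_simps)
    also have "\<dots> = (LINT t:X|M. Q t $ i $ 1 * u t $ 1 - z * (W t $ i $ 1 * u t $ 1)) + (LINT t:X|M. Q t $ i $ 2 * u t $ 2 - z * (W t $ i $ 2 * u t $ 2))"
      by (rule set_integral_add(2)[OF d d])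
    also have "\<dots> = (\<Sum>j\<in>UNIV. (LINT t:X|M. Q t $ i $ j * u t $ j) - z * (LINT t:X|M. W t $ i $ j * u t $ j))"
    proof -
      have "(LINT t:X|M. Q t $ i $ j * u t $ j - z * (W t $ i $ j * u t $ j)) = (LINT t:X|M. Q t $ i $ j * u t $ j) - z * (LINT t:X|M. W t $ i $ j * u t $ j)" for j
        unfolding set_integral_diff(2)[OF iq(1) zw] by simp
      then show ?thesis by (simp add: sum_2)
    qed
    finally show ?thesis unfolding mat_measure_mult_def using iq(2) iw(2) by (simp add: sum_2 algebra_simps)
  qed
  have ir: "set_integrable M X (\<lambda>t. rhs z t (u t))" by (rule rhs_integrable_sub[OF x u X])
  have "(LINT t:X|M. rhs z t (u t)) $ 1 = - (mat_measure_mult q u X - z *s mat_measure_mult w u X) $ 2"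
    unfolding comb set_integral_vec_nth(2)[OF ir] rhs_nth by (simp add: set_lebesgue_integral_def)
  moreover have "(LINT t:X|M. rhs z t (u t)) $ 2 = (mat_measure_mult q u X - z *s mat_measure_mult w u X) $ 1"
    unfolding comb set_integral_vec_nth(2)[OF ir] rhs_nth ..
  ultimately show ?thesis by (simp add: vec_eq_iff forall_2 J_mult)
qed

lemma oint_neighbourhood:
  assumes "x \<in> oint b" "y \<in> oint b" "x \<le> y"
  obtains x' y' where "0 < x'" "x' \<in> oint b" "y' \<in> oint b" "{x..y} \<subseteq> {x'<..<y'}"
proof -
  obtain y' where "y' \<in> oint b" "y < y'" using oint_larger[OF assms(2)] by blast
  moreover have "0 < x / 2" "x / 2 < x" "x / 2 \<in> oint b" using assms oint_smaller[of x b "x/2"] by (auto simp: oint_def)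
  moreover have "{x..y} \<subseteq> {x/2<..<y'}"
  proof
    fix t assume "t \<in> {x..y}"
    then have "x / 2 < t" "t < y'" using \<open>x / 2 < x\<close> \<open>y < y'\<close> by auto
    then show "t \<in> {x/2<..<y'}" by simp
  qed
  ultimately show ?thesis by (intro that[of "x/2" y'])
qed

text \<open>
  Boundedness comes from bounded variation.  For measurability, the one-sided limits of \<open>u\<close> at \<open>t\<close> are
  distribution functions of the measure \<open>u'\<close>, and \<open>u\<close> is their mean.
\<close>

lemma solution_bdd_borel:
  assumes s: "solution b q w z u" and x: "x \<in> oint b" "y \<in> oint b" "x < y"
  shows "bdd_borel x y u"
proof -
  have K: "{x..y} \<subseteq> oint b" using oint_smaller[OF x(2)] x by (auto simp: oint_def)
  obtain du where du: "derivative_measure b u du" and bv: "locally_bv b u" and bal: "balanced b u"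
    using s unfolding solution_def by blast
  have mu: "measure_on {x..y} du" using du K unfolding derivative_measure_def local_measure_def by auto
  have dd: "du {s..t} = right_lim u t - left_lim u s" if "s \<in> {x..y}" "t \<in> {x..y}" "s \<le> t" for s t
    using du that K unfolding derivative_measure_def by blast
  have "bounded_variation_on u x y" using bv x(1,2) unfolding locally_bv_def by simp
  then obtain C where C: "\<forall>(n::nat) (t::nat \<Rightarrow> real). (\<forall>i\<le>n. t i \<in> {x..y}) \<and> (\<forall>i<n. t i \<le> t (Suc i))
       \<longrightarrow> (\<Sum>i<n. norm (u (t (Suc i)) - u (t i))) \<le> C"
    unfolding bounded_variation_on_def by (rule exE)
  have bd: "norm (u t) \<le> norm (u x) + C" if t: "t \<in> {x<..<y}" for t
  proof -
    have "norm (u t - u x) \<le> C" using C[rule_format, of 1 "\<lambda>i. if i = 0 then x else t"] t x by simp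
    moreover have "norm (u t) \<le> norm (u x) + norm (u t - u x)" by (metis norm_triangle_sub add.commute)
    ultimately show ?thesis by simp
  qed
  let ?R = "{A \<in> sets borel. A \<subseteq> {x..y}}"
  have real: "(\<lambda>t. indicator {x<..<y} t *\<^sub>R f (u t)) \<in> borel_measurable borel" if lin: "bounded_linear f" for f :: "complex^2 \<Rightarrow> real"
  proof -
    interpret f: bounded_linear f by (rule lin)
    interpret sr: signed_ring ?R "\<lambda>A. f (du A)" by (rule measure_on_signed_ring[OF mu lin]) simp
    note cdf = signed_cdf_measurable[OF sr.signed_ring_axioms]
    have eq: "f (u t) = f (left_lim u x) + (f (du ({x..<t} \<inter> {x..y})) + f (du ({x..t} \<inter> {x..y}))) / 2" if t: "t \<in> {x<..<y}" for t
    proof -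
      have s: "{x..<t} \<inter> {x..y} = {x..<t}" "{x..t} \<inter> {x..y} = {x..t}" "{x..t} = {x..<t} \<union> {t}"
        using t by (simp_all add: set_eq_iff) linarith+
      have "f (du ({x..<t} \<union> {t})) = f (du {x..<t}) + f (du {t})" by (rule sr.measure_Un) (use t in auto)
      then have a: "f (du {x..t}) = f (du {x..<t}) + f (du {t})" unfolding s(3) .
      have t': "du {x..t} = right_lim u t - left_lim u x" "du {t} = right_lim u t - left_lim u t"
        using dd[of x t] dd[of t t] t by auto
      have l: "f (left_lim u t) = f (left_lim u x) + f (du {x..<t})" using a unfolding t' by (simp add: f.diff)
      have r: "f (right_lim u t) = f (left_lim u x) + f (du {x..t})" unfolding t' by (simp add: f.diff)
      have "t \<in> oint b" using K t by auto
      then have "u t = (1/2) *\<^sub>R (left_lim u t + right_lim u t)" using bal unfolding balanced_def by blast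
      then have "f (u t) = (f (left_lim u t) + f (right_lim u t)) / 2" by (simp add: f.scaleR f.add)
      then show ?thesis unfolding s(1,2) l r by (simp add: field_simps)
    qed
    have "(\<lambda>t. indicator {x<..<y} t *\<^sub>R (f (left_lim u x) + (f (du ({x..<t} \<inter> {x..y})) + f (du ({x..t} \<inter> {x..y}))) / 2)) \<in> borel_measurable borel"
      using cdf by (intro borel_measurable_scaleR borel_measurable_add borel_measurable_divide borel_measurable_const) simp_all
    moreover have "(\<lambda>t. indicator {x<..<y} t *\<^sub>R f (u t)) = (\<lambda>t. indicator {x<..<y} t *\<^sub>R (f (left_lim u x) + (f (du ({x..<t} \<inter> {x..y})) + f (du ({x..t} \<inter> {x..y}))) / 2))"
      using eq by (auto simp: fun_eq_iff split: split_indicator)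
    ultimately show ?thesis by simp
  qed
  have "(\<lambda>t. indicator {x<..<y} t *\<^sub>R (u t $ j)) \<in> borel_measurable borel" for j
    unfolding borel_measurable_complex_iff
    using real[OF bounded_linear_compose[OF bounded_linear_Re bounded_linear_vec_nth], of j]
      real[OF bounded_linear_compose[OF bounded_linear_Im bounded_linear_vec_nth], of j] by simp
  then show ?thesis using bd unfolding bdd_borel_def by blast
qed

text \<open>
  The equation for the measure \<open>u'\<close> on compact intervals is the integral equation there.  At the regular endpoint
  \<open>0\<close> a solution is bounded: if \<open>(0, y0]\<close> has small mass, then on every \<open>(x, y0)\<close> it is bounded by twice the
  modulus of \<open>u y0\<close>.  So the integral extends to \<open>0\<close>, and \<open>p\<close> is the initial value.
\<close>

lemma solution_imp_sols:
  assumes s: "solution b q w z u"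
  shows "\<exists>u'\<in>sols z. \<forall>t>0. u' t = u t"
proof -
  obtain du where du: "derivative_measure b u du" and bal: "balanced b u"
    and eq: "\<And>E. E \<in> rel_compact_borel b \<Longrightarrow> J *v du E + mat_measure_mult q u E = z *s mat_measure_mult w u E"
    using s unfolding solution_def by blast
  have SB: "bdd_borel x y u" if "0 < x" "y \<in> oint b" "x < y" for x y
    by (rule solution_bdd_borel[OF s oint_smaller[OF that(2,1) less_imp_le[OF that(3)]] that(2,3)])
  have int: "right_lim u y - left_lim u x = (LINT t:{x..y}|M. rhs z t (u t))" if xy: "x \<in> oint b" "y \<in> oint b" "x \<le> y" for x y
  proof -
    obtain x' y' where x': "0 < x'" "x' \<in> oint b" "y' \<in> oint b" "{x..y} \<subseteq> {x'<..<y'}" using oint_neighbourhood[OF xy] by blast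
    have K: "{x..y} \<subseteq> oint b" using oint_smaller[OF xy(2)] xy(1) by (auto simp: oint_def)
    have rc: "{x..y} \<in> rel_compact_borel b" unfolding rel_compact_borel_def using K compact_Icc by auto
    have lt: "x' < y'" using x'(4) xy(3) by force
    have "J *v (mat_measure_mult q u {x..y} - z *s mat_measure_mult w u {x..y}) = (LINT t:{x..y}|M. rhs z t (u t))"
      by (rule mat_measure_mult_rhs[OF less_imp_le[OF x'(1)] x'(3) SB[OF x'(1,3) lt] _ x'(4)]) simp
    moreover have "mat_measure_mult q u {x..y} - z *s mat_measure_mult w u {x..y} = - (J *v du {x..y})"
      using eq[OF rc] by (simp add: algebra_simps)
    moreover have "J *v (- (J *v du {x..y})) = du {x..y}" by (simp add: vec_eq_iff forall_2 J_mult)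
    moreover have "du {x..y} = right_lim u y - left_lim u x" using du xy unfolding derivative_measure_def by blast
    ultimately show ?thesis by simp
  qed
  have at: "right_lim u x = left_lim u x + measure M {x} *\<^sub>R rhs z x (u x)" if x: "x \<in> oint b" for x
    using int[OF x x order_refl] singleton_integral(2)[OF x, of "\<lambda>t. rhs z t (u t)"] by (simp add: algebra_simps)
  have ub: "u x = left_lim u x + (measure M {x} / 2) *\<^sub>R rhs z x (u x)" if x: "x \<in> oint b" for x
  proof -
    have "u x = (1/2) *\<^sub>R (left_lim u x + right_lim u x)" using bal x unfolding balanced_def by blast
    also have "\<dots> = (1/2) *\<^sub>R ((left_lim u x + left_lim u x) + measure M {x} *\<^sub>R rhs z x (u x))"
      unfolding at[OF x] by (simp only: add.assoc)
    also have "\<dots> = (1/2) *\<^sub>R (left_lim u x + left_lim u x) + (1/2) *\<^sub>R (measure M {x} *\<^sub>R rhs z x (u x))"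
      by (rule scaleR_add_right)
    finally show ?thesis unfolding scaleR_half_double by simp
  qed
  have ll: "left_lim u y = left_lim u x + (LINT t:{x..<y}|M. rhs z t (u t))" if xy: "x \<in> oint b" "y \<in> oint b" "x < y" for x y
  proof -
    obtain x' y' where x': "0 < x'" "x' \<in> oint b" "y' \<in> oint b" "{x..y} \<subseteq> {x'<..<y'}" using oint_neighbourhood[OF xy(1,2)] xy(3) by auto
    have lt: "x' < y'" using x'(4) xy(3) by force
    have i: "set_integrable M A (\<lambda>t. rhs z t (u t))" if "A \<in> sets borel" "A \<subseteq> {x..y}" for A
      by (rule rhs_integrable_sub[OF less_imp_le[OF x'(1)] x'(3) SB[OF x'(1,3) lt] that(1) subset_trans[OF that(2) x'(4)]])
    have "{x..y} = {x..<y} \<union> {y}" using xy by auto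
    then have "(LINT t:{x..y}|M. rhs z t (u t)) = (LINT t:{x..<y}|M. rhs z t (u t)) + (LINT t:{y}|M. rhs z t (u t))"
      using set_integral_Un[OF _ i i, of "{x..<y}" "{y}"] xy by auto
    then show ?thesis using int[OF xy(1,2)] xy(3) at[OF xy(2)] singleton_integral(2)[OF xy(2), of "\<lambda>t. rhs z t (u t)"]
      by (simp add: algebra_simps)
  qed
  obtain c where c: "c \<in> oint b" using cut_oint by blast
  have c0: "0 < c" using c by (simp add: oint_def)
  \<comment> \<open>With mass at most \<open>1/4\<close>, the estimate below reads \<open>C \<le> 9/8 \<bar>u y0\<bar> + 3/8 C\<close> for the supremum \<open>C\<close>.\<close>
  obtain y1 where y1: "0 < y1" "y1 \<le> c" "mass z 0 y1 < 1/4" using mass_right[of 0 c "1/4" z] c c0 by auto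
  have y1o: "y1 \<in> oint b" by (rule oint_smaller[OF c y1(1,2)])
  define y0 where "y0 = y1 / 2"
  have y0: "0 < y0" "y0 < y1" using y1 by (simp_all add: y0_def)
  have y0o: "y0 \<in> oint b" using oint_smaller[OF y1o] y0 by simp
  have small: "norm (u t) \<le> 2 * norm (u y0)" if t: "t \<in> {0<..<y0}" for t
  proof -
    define x where "x = t / 2"
    have x: "0 < x" "x < t" using t by (simp_all add: x_def)
    define S where "S = (\<lambda>t. norm (u t)) ` {x<..<y0}"
    have tx: "t \<in> {x<..<y0}" using x t by simp
    have B: "bdd_borel x y0 u" using SB[OF x(1) y0o] x t by simp
    obtain D where "\<forall>t\<in>{x<..<y0}. norm (u t) \<le> D" using B unfolding bdd_borel_def by blast
    then have bdd: "bdd_above S" unfolding S_def by (intro bdd_aboveI[of _ D]) auto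
    define C where "C = Sup S"
    have C: "norm (u s) \<le> C" if "s \<in> {x<..<y0}" for s unfolding C_def by (rule cSup_upper[OF _ bdd]) (use that in \<open>simp add: S_def\<close>)
    have C0: "0 \<le> C" using C[OF tx] norm_ge_zero order_trans by blast
    have m0: "0 \<le> mass z 0 y1" by (rule mass_nonneg)
    have est: "norm (u s) \<le> (9/8) * norm (u y0) + (3/8) * C" if s: "s \<in> {x<..<y0}" for s
    proof -
      have so: "s \<in> oint b" using oint_smaller[OF y0o] s x by simp
      have sy: "s < y0" using s by simp
      have E: "{s..<y0} \<subseteq> {x<..<y0}" using s by auto
      have "norm (LINT t:{s..<y0}|M. rhs z t (u t)) \<le> C * (LINT t:{s..<y0}|M. coeff_size z t)"
        by (rule norm_rhs_integral_le[OF less_imp_le[OF x(1)] y0o B C _ E]) simp_all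
      also have "\<dots> \<le> C * mass z 0 y1"
        unfolding mass_def using s x y0 by (intro mult_left_mono[OF _ C0] coeff_size_integral_mono[of 0 y1] y1o) auto
      also have "\<dots> \<le> C * (1/4)" using y1(3) by (intro mult_left_mono[OF _ C0]) simp
      finally have 1: "norm (LINT t:{s..<y0}|M. rhs z t (u t)) \<le> C * (1/4)" .
      have atom: "norm ((measure M {r} / 2) *\<^sub>R rhs z r (u r)) \<le> (1/8) * norm (u r)" if r: "r \<in> {0<..<y1}" for r
      proof -
        have "norm ((measure M {r} / 2) *\<^sub>R rhs z r (u r)) \<le> measure M {r} / 2 * (coeff_size z r * norm (u r))"
          using norm_rhs_le[of z r "u r"] by (simp add: mult_left_mono)
        also have "\<dots> = (measure M {r} * coeff_size z r) * (norm (u r) / 2)" by simp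
        also have "\<dots> \<le> (1/4) * (norm (u r) / 2)"
          using atom_le_mass[of 0 y1 r z] y1o r y1(3) by (intro mult_right_mono) auto
        finally show ?thesis by simp
      qed
      have us: "u s = u y0 - (measure M {y0} / 2) *\<^sub>R rhs z y0 (u y0) - (LINT t:{s..<y0}|M. rhs z t (u t)) + (measure M {s} / 2) *\<^sub>R rhs z s (u s)"
      proof -
        define m1 where "m1 = (measure M {s} / 2) *\<^sub>R rhs z s (u s)"
        define m2 where "m2 = (measure M {y0} / 2) *\<^sub>R rhs z y0 (u y0)"
        have "u s = left_lim u s + m1" "u y0 = left_lim u y0 + m2" using ub[OF so] ub[OF y0o] by (simp_all only: m1_def m2_def)
        then have "u s = u y0 - m2 - (LINT t:{s..<y0}|M. rhs z t (u t)) + m1" using ll[OF so y0o sy] by (simp add: algebra_simps)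
        then show ?thesis unfolding m1_def m2_def .
      qed
      have "norm (u s) \<le> norm (u y0) + (1/8) * norm (u y0) + C * (1/4) + (1/8) * norm (u s)"
        by (subst us) (intro norm_triangle_le norm_triangle_le_diff add_mono order_refl atom 1; use s x y0 in simp)
      then show ?thesis using C[OF s] by simp
    qed
    have "C \<le> (9/8) * norm (u y0) + (3/8) * C"
      unfolding C_def by (rule cSup_least) (use tx est in \<open>auto simp: S_def C_def\<close>)
    then have "C \<le> 2 * norm (u y0)" using norm_ge_zero[of "u y0"] by linarith
    then show ?thesis using C[OF tx] by simp
  qed
  have B0: "bdd_borel 0 y u" if y: "y \<in> oint b" for y
  proof -
    have y': "0 < y" using y by (simp add: oint_def)
    have meas: "(\<lambda>t. indicator {0<..<y} t *\<^sub>R (u t $ j)) \<in> borel_measurable borel" for j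
    proof (rule borel_measurable_LIMSEQ_metric)
      let ?a = "\<lambda>n. y / real (n + 2)"
      have a: "0 < ?a n" "?a n < y" for n
      proof -
        show "0 < ?a n" using y' by simp
        have "y * 1 < y * real (n + 2)" using y' by (intro mult_strict_left_mono) simp_all
        then show "?a n < y" by (simp add: pos_divide_less_eq)
      qed
      show "(\<lambda>t. indicat_real {?a n<..<y} t *\<^sub>R (u t $ j)) \<in> borel_measurable borel" for n
        using SB[OF a(1) y a(2)] unfolding bdd_borel_def by blast
      fix t
      show "(\<lambda>n. indicat_real {?a n<..<y} t *\<^sub>R (u t $ j)) \<longlonglongrightarrow> indicat_real {0<..<y} t *\<^sub>R (u t $ j)"
      proof (cases "t \<in> {0<..<y}")
        case True
        obtain N where N: "y / t < real N" using reals_Archimedean2 by blast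
        have "?a n < t" if "n \<ge> N" for n
        proof -
          have "y / t < real (n + 2)" using N that by simp
          then show ?thesis using True by (simp add: field_simps)
        qed
        then have "\<forall>\<^sub>F n in sequentially. indicat_real {?a n<..<y} t *\<^sub>R (u t $ j) = indicat_real {0<..<y} t *\<^sub>R (u t $ j)"
          unfolding eventually_sequentially using True by (intro exI[of _ N]) simp
        then show ?thesis by (rule tendsto_eventually)
      next
        case False
        then have "indicat_real {?a n<..<y} t = 0" for n using a(1)[of n] by (auto split: split_indicator)
        then show ?thesis using False by simp
      qed
    qed
    have "max y y0 \<in> oint b" using y y0o by (simp add: max_def)
    then have "bdd_borel (y0/2) (max y y0) u" by (rule SB[rotated]) (use y0 in simp_all)
    then obtain D where D: "\<forall>t\<in>{y0/2<..<max y y0}. norm (u t) \<le> D" unfolding bdd_borel_def by blast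
    have "\<forall>t\<in>{0<..<y}. norm (u t) \<le> max D (2 * norm (u y0))"
    proof
      fix t assume t: "t \<in> {0<..<y}"
      show "norm (u t) \<le> max D (2 * norm (u y0))"
      proof (cases "t < y0")
        case True
        then show ?thesis using small[of t] t by simp
      next
        case False
        then have "t \<in> {y0/2<..<max y y0}" using t y0 by auto
        then show ?thesis using D by (simp add: le_max_iff_disj)
      qed
    qed
    then show ?thesis using meas unfolding bdd_borel_def by blast
  qed
  \<comment> \<open>The right limit of \<open>u\<close> at \<open>0\<close>; it does not depend on \<open>c\<close>.\<close>
  define p where "p = left_lim u c - (LINT t:{0<..<c}|M. rhs z t (u t))"
  have lp: "left_lim u y = p + (LINT t:{0<..<y}|M. rhs z t (u t))" if y: "y \<in> oint b" for y
  proof -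
    have y': "0 < y" using y by (simp add: oint_def)
    have sp: "(LINT t:{0<..<s}|M. rhs z t (u t)) = (LINT t:{0<..<r}|M. rhs z t (u t)) + (LINT t:{r..<s}|M. rhs z t (u t))"
      if "0 < r" "r < s" "s \<in> oint b" for r s
    proof -
      have i: "set_integrable M A (\<lambda>t. rhs z t (u t))" if "A \<in> sets borel" "A \<subseteq> {0<..<s}" for A
        by (rule rhs_integrable_sub[OF order_refl \<open>s \<in> oint b\<close> B0[OF \<open>s \<in> oint b\<close>] that])
      have "{0<..<s} = {0<..<r} \<union> {r..<s}" using that by auto
      moreover have "{0<..<r} \<inter> {r..<s} = {}" by auto
      moreover have "{0<..<r} \<subseteq> {0<..<s}" "{r..<s} \<subseteq> {0<..<s}" using that by auto
      ultimately show ?thesis by (simp add: set_integral_Un[OF _ i i])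
    qed
    consider "y = c" | "y < c" | "c < y" by linarith
    then show ?thesis
    proof cases
      case 2 then show ?thesis using ll[OF y c] sp[OF y' _ c] by (simp add: p_def algebra_simps)
    next
      case 3 then show ?thesis using ll[OF c y] sp[OF c0 _ y] by (simp add: p_def algebra_simps)
    qed (simp add: p_def)
  qed
  define u' where "u' = u(0 := p)"
  have u': "u' t = u t" if "0 < t" for t using that by (simp add: u'_def)
  have "solves z x u'" if x: "x \<in> oint b" for x
    unfolding solves_def
  proof (intro conjI ballI)
    show "bdd_borel 0 x u'" by (rule bdd_borel_cong[OF _ B0[OF x]]) (simp add: u')
    fix t assume t: "t \<in> {0<..<x}"
    have to: "t \<in> oint b" using oint_smaller[OF x] t by simp
    have "(LINT s:{0<..<t}|M. rhs z s (u' s)) = (LINT s:{0<..<t}|M. rhs z s (u s))"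
      unfolding set_lebesgue_integral_def using u' by (intro Bochner_Integration.integral_cong refl) (auto split: split_indicator)
    then have "left_val z t u' = left_lim u t" unfolding left_val_def lp[OF to] by (simp add: u'_def)
    then show "u' t = left_val z t u' + (measure M {t} / 2) *\<^sub>R rhs z t (u' t)" using ub[OF to] u'[of t] t by simp
  qed
  then show ?thesis using u' unfolding sols_def by blast
qed

end

context canonical_system begin

section \<open>Solutions of the integral equation are solutions in the sense of measures\<close>

lemma sols_bound: "u \<in> sols z \<Longrightarrow> c \<in> oint b \<Longrightarrow> \<exists>C\<ge>0. \<forall>t\<in>{0<..<c}. norm (u t) \<le> C"
proof -
  assume "u \<in> sols z" "c \<in> oint b"
  then obtain C where "\<forall>t\<in>{0<..<c}. norm (u t) \<le> C" using sols_bdd_borel unfolding bdd_borel_def by blast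
  then have "\<forall>t\<in>{0<..<c}. norm (u t) \<le> max 0 C" by (simp add: le_max_iff_disj)
  then show ?thesis by (intro exI[of _ "max 0 C"]) simp
qed

lemma sols_value: "u \<in> sols z \<Longrightarrow> t \<in> oint b \<Longrightarrow> u t = left_val z t u + (measure M {t} / 2) *\<^sub>R rhs z t (u t)"
proof -
  assume u: "u \<in> sols z" and t: "t \<in> oint b"
  obtain y where "y \<in> oint b" "t < y" using oint_larger[OF t] by blast
  then show ?thesis using sols_solves[OF u \<open>y \<in> oint b\<close>] t unfolding solves_def by (simp add: oint_def)
qed

lemma sols_increment:
  assumes u: "u \<in> sols z" and st: "s \<in> oint b" "s < t" "t \<in> oint b"
  shows "u t - u s = (measure M {t} / 2) *\<^sub>R rhs z t (u t) + (measure M {s} / 2) *\<^sub>R rhs z s (u s) + (LINT r:{s<..<t}|M. rhs z r (u r))"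
proof -
  define m where "m = (measure M {s} / 2) *\<^sub>R rhs z s (u s)"
  define n where "n = (measure M {t} / 2) *\<^sub>R rhs z t (u t)"
  have m2: "measure M {s} *\<^sub>R rhs z s (u s) = m + m" unfolding m_def by (simp add: scaleR_left_distrib[symmetric])
  have "left_val z t u = left_val z s u + (m + m) + (LINT r:{s<..<t}|M. rhs z r (u r))"
    using left_val_split[OF _ st(2,3) sols_bdd_borel[OF u st(3)], of z] st(1) unfolding m2 by (simp add: oint_def)
  moreover have "u t = left_val z t u + n" "u s = left_val z s u + m" unfolding m_def n_def by (rule sols_value[OF u], fact)+
  ultimately show ?thesis unfolding m_def[symmetric] n_def[symmetric] by (simp add: algebra_simps)
qed

lemma norm_atom_le:
  assumes "norm v \<le> C" shows "norm ((measure M {t} / 2) *\<^sub>R rhs z t v) \<le> C * (measure M {t} * coeff_size z t / 2)"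
proof -
  have "norm ((measure M {t} / 2) *\<^sub>R rhs z t v) \<le> measure M {t} / 2 * (coeff_size z t * norm v)"
    using norm_rhs_le[of z t v] by (simp add: mult_left_mono)
  also have "\<dots> \<le> measure M {t} / 2 * (coeff_size z t * C)" using assms by (intro mult_left_mono) simp_all
  finally show ?thesis by (simp add: mult_ac)
qed

text \<open>
  The value \<open>u t\<close> differs from \<open>left_val z s u\<close> by half the atom at \<open>t\<close> and an integral over \<open>(t, s)\<close>, both of which are
  controlled by the mass of an interval shrinking to \<open>s\<close>.
\<close>

lemma sols_left_limit:
  assumes u: "u \<in> sols z" and s: "s \<in> oint b"
  shows "(u \<longlongrightarrow> left_val z s u) (at_left s)"
proof (rule tendstoI)
  fix e :: real assume e: "0 < e"
  obtain C where C: "0 \<le> C" "\<forall>t\<in>{0<..<s}. norm (u t) \<le> C" using sols_bound[OF u s] by blast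
  obtain x0 where x0: "0 \<le> x0" "x0 < s" "mass z x0 s < e / (2 * (C + 1))"
    using mass_left[OF s, of "e / (2 * (C + 1))" z] e C(1) by auto
  have "dist (u t) (left_val z s u) < e" if t: "x0 < t" "t < s" for t
  proof -
    have t0: "0 < t" using t x0 by simp
    have to: "t \<in> oint b" using oint_smaller[OF s t0] t by simp
    have ut: "norm (u t) \<le> C" using C(2) t t0 by simp
    define m where "m = (measure M {t} / 2) *\<^sub>R rhs z t (u t)"
    have m2: "measure M {t} *\<^sub>R rhs z t (u t) = m + m" unfolding m_def by (simp add: scaleR_left_distrib[symmetric])
    have "left_val z s u = left_val z t u + (m + m) + (LINT r:{t<..<s}|M. rhs z r (u r))"
      using left_val_split[OF less_imp_le[OF t0] t(2) s sols_bdd_borel[OF u s], of z] unfolding m2 .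
    moreover have "u t = left_val z t u + m" unfolding m_def by (rule sols_value[OF u to])
    ultimately have "u t - left_val z s u = - (m + (LINT r:{t<..<s}|M. rhs z r (u r)))" by (simp add: algebra_simps)
    then have "dist (u t) (left_val z s u) = norm (m + (LINT r:{t<..<s}|M. rhs z r (u r)))"
      unfolding dist_norm by (simp only: norm_minus_cancel)
    also have "\<dots> \<le> C * (measure M {t} * coeff_size z t / 2) + C * (LINT r:{t<..<s}|M. coeff_size z r)"
      unfolding m_def
      by (intro norm_triangle_mono norm_atom_le[OF ut] norm_rhs_integral_le[of 0 s u] sols_bdd_borel[OF u s] s order_refl)
        (use C t t0 in auto)
    also have "\<dots> \<le> C * (mass z x0 s / 2) + C * mass z x0 s"
    proof -
      have "measure M {t} * coeff_size z t \<le> mass z x0 s" by (rule atom_le_mass) (use x0 s t in auto)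
      moreover have "(LINT r:{t<..<s}|M. coeff_size z r) \<le> mass z x0 s"
        unfolding mass_def by (rule coeff_size_integral_mono[of x0 s]) (use x0 s t in auto)
      ultimately show ?thesis using C(1) by (intro add_mono mult_left_mono) simp_all
    qed
    also have "\<dots> \<le> 2 * (C + 1) * mass z x0 s"
    proof -
      have "0 \<le> C * mass z x0 s" "0 \<le> mass z x0 s" using C(1) mass_nonneg by simp_all
      then show ?thesis by (simp add: algebra_simps)
    qed
    also have "\<dots> < e" using x0(3) C(1) by (simp add: field_simps)
    finally show ?thesis .
  qed
  then show "\<forall>\<^sub>F t in at_left s. dist (u t) (left_val z s u) < e"
    unfolding eventually_at_left[OF x0(2)] using x0(2) by blast
qed

lemma sols_right_limit:
  assumes u: "u \<in> sols z" and s: "start_point s"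
  shows "(u \<longlongrightarrow> left_val z s u + measure M {s} *\<^sub>R rhs z s (u s)) (at_right s)"
proof (rule tendstoI)
  fix e :: real assume e: "0 < e"
  have s0: "0 \<le> s" by (rule start_point_nonneg[OF s])
  obtain c where c: "c \<in> oint b" "s < c"
  proof (cases "s = 0")
    case True then show ?thesis using that[OF cut_oint] cut_pos by simp
  next
    case False
    then have "s \<in> oint b" using s by (simp add: start_point_def)
    then show ?thesis using oint_larger that by blast
  qed
  obtain C where C: "0 \<le> C" "\<forall>t\<in>{0<..<c}. norm (u t) \<le> C" using sols_bound[OF u c(1)] by blast
  obtain y where y: "s < y" "y \<le> c" "mass z s y < e / (2 * (C + 1))"
    using mass_right[OF s0 c(2,1), of "e / (2 * (C + 1))" z] e C(1) by auto
  have yo: "y \<in> oint b" using oint_smaller[OF c(1) _ y(2)] s0 y(1) by simp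
  have uy: "solves z y u" by (rule sols_solves[OF u yo])
  have "dist (u t) (left_val z s u + measure M {s} *\<^sub>R rhs z s (u s)) < e" if t: "s < t" "t < y" for t
  proof -
    have "u t = (left_val z s u + measure M {s} *\<^sub>R rhs z s (u s)) + balanced_integral z s u t"
      using solves_local_sol[OF s0 y(1) yo uy] t unfolding local_sol_def by simp
    then have "dist (u t) (left_val z s u + measure M {s} *\<^sub>R rhs z s (u s)) = norm (balanced_integral z s u t)" by (simp add: dist_norm)
    also have "\<dots> \<le> 3/2 * C * mass z s y"
      by (rule balanced_integral_bound[OF s0 yo bdd_borel_subset[OF solves_bdd_borel[OF uy] s0 order_refl]]) (use C(2) t s0 y(2) in auto)
    also have "\<dots> \<le> 2 * (C + 1) * mass z s y"
      using C(1) by (intro mult_right_mono mass_nonneg) simp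
    also have "\<dots> < e" using y(3) C(1) by (simp add: field_simps)
    finally show ?thesis .
  qed
  then show "\<forall>\<^sub>F t in at_right s. dist (u t) (left_val z s u + measure M {s} *\<^sub>R rhs z s (u s)) < e"
    unfolding eventually_at_right[OF y(1)] using y(1) by blast
qed

lemma sols_right_limit_0: "u \<in> sols z \<Longrightarrow> (u \<longlongrightarrow> u 0) (at_right 0)"
  using sols_right_limit[of u z 0] measure_zero[of 0] by (simp add: start_point_def oint_def)

text \<open>
  Increments of \<open>u\<close> are dominated by those of a monotone function \<open>g\<close>, whose sums telescope.
\<close>

lemma sols_locally_bv:
  assumes u: "u \<in> sols z" shows "locally_bv b u"
  unfolding locally_bv_def bounded_variation_on_def
proof (intro ballI)
  fix x y assume x: "x \<in> oint b" and y: "y \<in> oint b"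
  obtain c where c: "c \<in> oint b" "y < c" using oint_larger[OF y] by blast
  obtain C where C: "0 \<le> C" "\<forall>t\<in>{0<..<c}. norm (u t) \<le> C" using sols_bound[OF u c(1)] by blast
  \<comment> \<open>the balanced distribution function of the measure that controls the increments\<close>
  define g where "g t = mass z 0 t + measure M {t} * coeff_size z t / 2" for t
  have inc: "norm (u t - u s) \<le> C * (g t - g s)" if st: "s \<in> {x..y}" "t \<in> {x..y}" "s \<le> t" for s t
  proof (cases "s = t")
    case False
    then have lt: "s < t" using st by simp
    have s0: "0 < s" using st x by (simp add: oint_def)
    have so: "s \<in> oint b" "t \<in> oint b" using oint_smaller[OF y] st s0 by auto
    have "norm (u t - u s) \<le> C * (measure M {t} * coeff_size z t / 2) + C * (measure M {s} * coeff_size z s / 2) + C * (LINT r:{s<..<t}|M. coeff_size z r)"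
      unfolding sols_increment[OF u so(1) lt so(2)]
      by (intro norm_triangle_mono norm_atom_le norm_rhs_integral_le[of 0 c u] sols_bdd_borel[OF u c(1)] c(1) order_refl)
        (use C st s0 c(2) in auto)
    also have "\<dots> = C * (g t - g s)"
    proof -
      have i: "set_integrable M A (coeff_size z)" if "A \<in> sets borel" "A \<subseteq> {0<..<t}" for A
        by (rule coeff_size_integrable'[OF order_refl so(2) that])
      have "{0<..<t} = {0<..<s} \<union> {s} \<union> {s<..<t}" using s0 lt by auto
      moreover have "{0<..<s} \<inter> {s} = {}" "({0<..<s} \<union> {s}) \<inter> {s<..<t} = {}" by auto
      moreover have "{0<..<s} \<union> {s} \<subseteq> {0<..<t}" "{0<..<s} \<subseteq> {0<..<t}" "{s} \<subseteq> {0<..<t}" "{s<..<t} \<subseteq> {0<..<t}"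
        using s0 lt by auto
      ultimately have "mass z 0 t = mass z 0 s + (LINT r:{s}|M. coeff_size z r) + (LINT r:{s<..<t}|M. coeff_size z r)"
        unfolding mass_def by (simp only: set_integral_Un[OF _ i i] sets.Un[of _ borel] borel_singleton borel_open open_greaterThanLessThan sets.empty_sets)
      then show ?thesis unfolding g_def using singleton_integral(2)[OF so(1), of "coeff_size z"] by (simp add: field_simps)
    qed
    finally show ?thesis .
  qed simp
  show "\<exists>V. \<forall>(n::nat) (t::nat \<Rightarrow> real). (\<forall>i\<le>n. t i \<in> {x..y}) \<and> (\<forall>i<n. t i \<le> t (Suc i))
          \<longrightarrow> (\<Sum>i<n. norm (u (t (Suc i)) - u (t i))) \<le> V"
  proof (intro exI allI impI, elim conjE)
    fix n :: nat and t :: "nat \<Rightarrow> real"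
    assume t: "\<forall>i\<le>n. t i \<in> {x..y}" "\<forall>i<n. t i \<le> t (Suc i)"
    have "(\<Sum>i<n. norm (u (t (Suc i)) - u (t i))) \<le> (\<Sum>i<n. C * (g (t (Suc i)) - g (t i)))"
      by (intro sum_mono inc) (use t in auto)
    also have "\<dots> = C * (g (t n) - g (t 0))"
      unfolding sum_distrib_left[symmetric] by (simp only: sum_lessThan_telescope[of "\<lambda>i. g (t i)"])
    also have "\<dots> \<le> C * (2 * mass z 0 c)"
    proof (intro mult_left_mono C(1))
      have tn: "t n \<in> {x..y}" using t by simp
      have tn': "t n \<in> {0<..<c}" using tn x c(2) by (auto simp: oint_def)
      have "mass z 0 (t n) \<le> mass z 0 c" using mass_mono[of 0 0 "t n" c z] tn' c(1) by simp
      moreover have "measure M {t n} * coeff_size z (t n) \<le> mass z 0 c" using atom_le_mass[OF order_refl c(1) tn'] .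
      moreover have "0 \<le> g (t 0)" unfolding g_def using mass_nonneg[of z 0 "t 0"] by simp
      moreover have "0 \<le> mass z 0 c" by (rule mass_nonneg)
      ultimately show "g (t n) - g (t 0) \<le> 2 * mass z 0 c" unfolding g_def[of "t n"] by linarith
    qed
    finally show "(\<Sum>i<n. norm (u (t (Suc i)) - u (t i))) \<le> C * (2 * mass z 0 c)" .
  qed
qed

end

lemma set_integral_measure_on:
  fixes f :: "real \<Rightarrow> 'a::{banach,second_countable_topology}"
  assumes M: "sets M = sets borel" and f: "set_integrable M K f"
  shows "measure_on K (\<lambda>A. LINT t:A|M. f t)"
  unfolding measure_on_def
proof (intro allI impI, elim conjE)
  fix A :: "nat \<Rightarrow> real set"
  assume A: "\<forall>n. A n \<in> sets borel \<and> A n \<subseteq> K" and d: "disjoint_family A"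
  have Am: "A n \<in> sets M" for n using A M by simp
  have i: "set_integrable M B f" if "B \<in> sets M" "B \<subseteq> (\<Union>n. A n)" for B
    by (rule set_integrable_subset[OF f that(1)]) (use that(2) A in blast)
  have "(\<lambda>n. LINT t:(\<Union>k<n. A k)|M. f t) \<longlonglongrightarrow> (LINT t:(\<Union>n. \<Union>k<n. A k)|M. f t)"
    by (rule set_integral_cont_up) (use Am in \<open>auto intro!: i incseq_SucI simp: lessThan_Suc\<close>)
  moreover have "(\<Union>n. \<Union>k<n. A k) = (\<Union>n. A n)" by auto
  moreover have "(LINT t:(\<Union>k<n. A k)|M. f t) = (\<Sum>k<n. LINT t:A k|M. f t)" for n
    by (rule set_integral_finite_Union) (use d Am in \<open>auto intro!: i simp: disjoint_family_on_def\<close>)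
  ultimately show "(\<lambda>n. LINT t:A n|M. f t) sums (LINT t:\<Union> (range A)|M. f t)" unfolding sums_def by simp
qed

context represented_system begin

text \<open>
  The measure \<open>u'\<close> has the density \<open>rhs z t (u t)\<close>; its values on compact intervals are the differences of the
  one-sided limits of \<open>u\<close>.
\<close>

lemma sols_imp_solution:
  assumes u': "u' \<in> sols z" and eq: "\<And>t. 0 < t \<Longrightarrow> u t = u' t"
  shows "solution b q w z u"
proof -
  have l: "left_lim u s = left_val z s u'" and r: "right_lim u s = left_val z s u' + measure M {s} *\<^sub>R rhs z s (u' s)" if s: "s \<in> oint b" for s
  proof -
    have s0: "0 < s" using s by (simp add: oint_def)
    have "\<forall>\<^sub>F t in at_left s. u' t = u t" unfolding eventually_at_left[OF s0] using s0 eq by metis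
    then have "(u \<longlongrightarrow> left_val z s u') (at_left s)" using sols_left_limit[OF u' s] by (rule Lim_transform_eventually[rotated])
    then show "left_lim u s = left_val z s u'" unfolding left_lim_def by (rule tendsto_Lim[rotated]) simp
    have "\<forall>\<^sub>F t in at_right s. u' t = u t" unfolding eventually_at_right[OF less_add_one] using s0 eq by (intro exI[of _ "s+1"]) simp
    moreover have "start_point s" using s by (simp add: start_point_def)
    ultimately have "(u \<longlongrightarrow> left_val z s u' + measure M {s} *\<^sub>R rhs z s (u' s)) (at_right s)"
      using sols_right_limit[OF u'] by (blast intro: Lim_transform_eventually)
    then show "right_lim u s = left_val z s u' + measure M {s} *\<^sub>R rhs z s (u' s)" unfolding right_lim_def by (rule tendsto_Lim[rotated]) simp
  qed
  have bv: "locally_bv b u" unfolding locally_bv_def bounded_variation_on_def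
  proof (intro ballI)
    fix x y assume x: "x \<in> oint b" and y: "y \<in> oint b"
    have "bounded_variation_on u' x y" using sols_locally_bv[OF u'] x y unfolding locally_bv_def by simp
    then obtain V where V: "\<forall>(n::nat) (t::nat \<Rightarrow> real). (\<forall>i\<le>n. t i \<in> {x..y}) \<and> (\<forall>i<n. t i \<le> t (Suc i))
          \<longrightarrow> (\<Sum>i<n. norm (u' (t (Suc i)) - u' (t i))) \<le> V"
      unfolding bounded_variation_on_def by (rule exE)
    show "\<exists>V. \<forall>(n::nat) (t::nat \<Rightarrow> real). (\<forall>i\<le>n. t i \<in> {x..y}) \<and> (\<forall>i<n. t i \<le> t (Suc i))
          \<longrightarrow> (\<Sum>i<n. norm (u (t (Suc i)) - u (t i))) \<le> V"
    proof (intro exI[of _ V] allI impI, elim conjE)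
      fix n :: nat and t :: "nat \<Rightarrow> real"
      assume t: "\<forall>i\<le>n. t i \<in> {x..y}" "\<forall>i<n. t i \<le> t (Suc i)"
      have "u (t i) = u' (t i)" if "i \<le> n" for i
      proof -
        have "t i \<in> {x..y}" using t(1) that by simp
        then show ?thesis using x by (intro eq) (simp add: oint_def)
      qed
      then have "(\<Sum>i<n. norm (u (t (Suc i)) - u (t i))) = (\<Sum>i<n. norm (u' (t (Suc i)) - u' (t i)))"
        by (intro sum.cong) simp_all
      then show "(\<Sum>i<n. norm (u (t (Suc i)) - u (t i))) \<le> V" using V[rule_format, OF conjI[OF t]] by simp
    qed
  qed
  have bal: "balanced b u" unfolding balanced_def
  proof
    fix x assume x: "x \<in> oint b"
    have "u x = left_val z x u' + (measure M {x} / 2) *\<^sub>R rhs z x (u' x)" using sols_value[OF u' x] eq[of x] x by (simp add: oint_def)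
    also have "\<dots> = (1/2) *\<^sub>R (left_val z x u' + (left_val z x u' + measure M {x} *\<^sub>R rhs z x (u' x)))"
    proof -
      have "(1/2) *\<^sub>R (left_val z x u' + left_val z x u') = left_val z x u'" by (rule scaleR_half_double)
      then show ?thesis unfolding add.assoc[symmetric] scaleR_add_right[of "1/2" "left_val z x u' + left_val z x u'"] by simp
    qed
    finally show "u x = (1/2) *\<^sub>R (left_lim u x + right_lim u x)" unfolding l[OF x] r[OF x] .
  qed
  define du where "du A = (LINT t:A|M. rhs z t (u' t))" for A
  have int: "set_integrable M {0<..<c} (\<lambda>t. rhs z t (u' t))" if "c \<in> oint b" for c
    by (rule rhs_integrable[OF order_refl that sols_bdd_borel[OF u' that]])
  have loc: "local_measure b du" unfolding local_measure_def
  proof (intro allI impI, elim conjE)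
    fix K assume K: "compact K" "K \<subseteq> oint b"
    have "K \<in> rel_compact_borel b" unfolding rel_compact_borel_def using K borel_compact by blast
    then have "K \<in> reg_sets b" by (rule rel_compact_reg[OF b_pos])
    then obtain c where c: "c \<in> oint b" "K \<subseteq> {0<..<c}" "K \<in> sets borel" unfolding reg_sets_def by blast
    show "measure_on K du" unfolding du_def
      by (rule set_integral_measure_on[OF sets_M set_integrable_subset[OF int[OF c(1)] _ c(2)]]) (use c(3) sets_M in simp)
  qed
  have deriv: "derivative_measure b u du" unfolding derivative_measure_def
  proof (intro conjI loc ballI impI)
    fix x y assume x: "x \<in> oint b" and y: "y \<in> oint b" and xy: "x \<le> y"
    obtain c where c: "c \<in> oint b" "y < c" using oint_larger[OF y] by blast
    have i: "set_integrable M A (\<lambda>t. rhs z t (u' t))" if "A \<in> sets borel" "A \<subseteq> {x..y}" for A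
      by (rule set_integrable_subset[OF int[OF c(1)]]) (use that sets_M x c(2) in \<open>auto simp: oint_def\<close>)
    show "du {x..y} = right_lim u y - left_lim u x"
    proof (cases "x = y")
      case True
      then show ?thesis unfolding l[OF x] r[OF y] du_def using singleton_integral(2)[OF y, of "\<lambda>t. rhs z t (u' t)"] by simp
    next
      case False
      then have lt: "x < y" using xy by simp
      have "{x..y} = ({x} \<union> {x<..<y}) \<union> {y}" using lt by auto
      moreover have "{x} \<inter> {x<..<y} = {}" "({x} \<union> {x<..<y}) \<inter> {y} = {}" using lt by auto
      moreover have "{x} \<union> {x<..<y} \<subseteq> {x..y}" "{x} \<subseteq> {x..y}" "{x<..<y} \<subseteq> {x..y}" "{y} \<subseteq> {x..y}" using lt by auto
      ultimately have "du {x..y} = (LINT t:{x}|M. rhs z t (u' t)) + (LINT t:{x<..<y}|M. rhs z t (u' t)) + (LINT t:{y}|M. rhs z t (u' t))"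
        unfolding du_def by (simp only: set_integral_Un[OF _ i i] sets.Un[of _ borel] borel_singleton borel_open open_greaterThanLessThan sets.empty_sets)
      moreover have "0 \<le> x" using x by (simp add: oint_def)
      ultimately show ?thesis unfolding l[OF x] r[OF y] left_val_split[OF \<open>0 \<le> x\<close> lt y sols_bdd_borel[OF u' y]]
        singleton_integral(2)[OF x] singleton_integral(2)[OF y] by simp
    qed
  qed
  have equ: "J *v du A + mat_measure_mult q u A = z *s mat_measure_mult w u A" if A: "A \<in> rel_compact_borel b" for A
  proof -
    obtain c where c: "c \<in> oint b" "A \<subseteq> {0<..<c}" "A \<in> sets borel"
      using rel_compact_reg[OF b_pos A] unfolding reg_sets_def by blast
    have "bdd_borel 0 c u" by (rule bdd_borel_cong[OF _ sols_bdd_borel[OF u' c(1)]]) (simp add: eq)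
    then have "J *v (mat_measure_mult q u A - z *s mat_measure_mult w u A) = (LINT t:A|M. rhs z t (u t))"
      by (rule mat_measure_mult_rhs[OF order_refl c(1) _ c(3,2)])
    also have "\<dots> = du A" unfolding du_def set_lebesgue_integral_def
    proof (intro Bochner_Integration.integral_cong refl)
      fix t show "indicat_real A t *\<^sub>R rhs z t (u t) = indicat_real A t *\<^sub>R rhs z t (u' t)"
      proof (cases "t \<in> A")
        case True then show ?thesis using eq[of t] c(2) by force
      qed simp
    qed
    finally have "du A = J *v (mat_measure_mult q u A - z *s mat_measure_mult w u A)" ..
    moreover have "J *v (J *v v) = - v" for v by (simp add: vec_eq_iff forall_2 J_mult)
    ultimately have "J *v du A = - (mat_measure_mult q u A - z *s mat_measure_mult w u A)" by (simp only:)
    then show ?thesis by simp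
  qed
  show ?thesis unfolding solution_def using bv bal deriv equ by blast
qed

section \<open>Norms and deficiency indices\<close>

lemma norm_term:
  assumes c: "c \<in> oint b" and u: "bdd_borel 0 c u" and X: "X \<in> sets borel" "X \<subseteq> {0<..<c}"
  shows "(\<Sum>i\<in>UNIV. \<Sum>j\<in>UNIV. cmeasure_integral (\<lambda>A. w A $ i $ j) X (\<lambda>t. cnj (u t $ i) * u t $ j)) = (LINT t:X|M. w_form t (u t) (u t))"
proof -
  have R: "X \<in> reg_sets b" by (rule reg_setsI[OF X(1) order_refl c X(2)])
  have "set_integrable M X (\<lambda>t. W t $ i $ j * (cnj (u t $ i) * u t $ j)) \<and>
    cmeasure_integral (\<lambda>A. w A $ i $ j) X (\<lambda>t. cnj (u t $ i) * u t $ j) = (LINT t:X|M. W t $ i $ j * (cnj (u t $ i) * u t $ j))" for i j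
  proof -
    obtain C where C: "\<forall>t\<in>{0<..<c}. norm (u t) \<le> C" using u unfolding bdd_borel_def by blast
    have c: "cnj \<in> borel_measurable borel" by (intro borel_measurable_continuous_onI continuous_intros)
    have "(\<lambda>t. cnj (indicator X t *\<^sub>R (u t $ i)) * (indicator X t *\<^sub>R (u t $ j))) \<in> borel_measurable borel"
      by (rule borel_measurable_times[OF measurable_compose[OF bdd_borel_on(1)[OF u X] c] bdd_borel_on(1)[OF u X]])
    moreover have "(\<lambda>t. cnj (indicator X t *\<^sub>R (u t $ i)) * (indicator X t *\<^sub>R (u t $ j))) = (\<lambda>t. indicator X t *\<^sub>R (cnj (u t $ i) * u t $ j))"
      by (auto simp: fun_eq_iff split: split_indicator)
    ultimately have m: "(\<lambda>t. indicator X t *\<^sub>R (cnj (u t $ i) * u t $ j)) \<in> borel_measurable borel" by simp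
    have bd: "norm (cnj (u t $ i) * u t $ j) \<le> C * C" if "t \<in> X" for t
    proof -
      have "norm (u t) \<le> C" using C X(2) that by blast
      then have "norm (u t $ k) \<le> C" for k using Finite_Cartesian_Product.norm_nth_le order_trans by blast
      then show ?thesis unfolding norm_mult complex_mod_cnj by (intro mult_mono) (auto intro: order_trans[OF norm_ge_zero])
    qed
    have g: "set_integrable M X (\<lambda>t. W t $ i $ j)" using w_dens[of i j] R unfolding cdensity_def by simp
    show ?thesis
      using set_integrable_mult_bounded[OF sets_M g W_meas m bd] cdensity_integral[OF w_dens R m] bd by blast
  qed
  then show ?thesis
    using set_integral_double_sum(2)[of M X "\<lambda>i j t. W t $ i $ j * (cnj (u t $ i) * u t $ j)" "\<lambda>_ _. 1"]
    by (simp add: w_form_def mult_ac)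
qed

text \<open>
  The norm is a supremum over compact subintervals of \<open>(0, b)\<close>, whereas \<open>nrm2\<close> refers to \<open>(0, c)\<close>.  For the second
  inequality \<open>(0, c)\<close> is exhausted by compact intervals.
\<close>

lemma norm_sq_nrm2:
  assumes u': "u' \<in> sols z" and eq: "\<And>t. 0 < t \<Longrightarrow> u t = u' t"
  shows norm_sq_le: "(\<And>x. x \<in> oint b \<Longrightarrow> nrm2 x u' \<le> C) \<Longrightarrow> norm_sq b w u \<le> ennreal C"
    and nrm2_le_norm_sq: "c \<in> oint b \<Longrightarrow> ennreal (nrm2 c u') \<le> norm_sq b w u"
proof -
  have int: "set_integrable M A (\<lambda>t. Re (w_form t (u' t) (u' t)))" if "c \<in> oint b" "A \<in> sets borel" "A \<subseteq> {0<..<c}" for A c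
    by (rule set_integral_Re(1)[OF w_form_integrable[OF that(1) sols_bdd_borel[OF u' that(1)] sols_bdd_borel[OF u' that(1)] that(2,3)]])
  have term_eq: "Re (\<Sum>i\<in>UNIV. \<Sum>j\<in>UNIV. cmeasure_integral (\<lambda>A. w A $ i $ j) {x..y} (\<lambda>t. cnj (u t $ i) * u t $ j))
      = (LINT t:{x..y}|M. Re (w_form t (u' t) (u' t)))" if x: "0 < x" and y: "c \<in> oint b" "y < c" for x y c
  proof -
    have S: "{x..y} \<subseteq> {0<..<c}" using x y by auto
    have Bu: "bdd_borel 0 c u" by (rule bdd_borel_cong[OF _ sols_bdd_borel[OF u' y(1)]]) (simp add: eq)
    have "(LINT t:{x..y}|M. w_form t (u t) (u t)) = (LINT t:{x..y}|M. w_form t (u' t) (u' t))"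
      unfolding set_lebesgue_integral_def
    proof (intro Bochner_Integration.integral_cong refl)
      fix t show "indicat_real {x..y} t *\<^sub>R w_form t (u t) (u t) = indicat_real {x..y} t *\<^sub>R w_form t (u' t) (u' t)"
        using eq[of t] x by (cases "t \<in> {x..y}") simp_all
    qed
    then show ?thesis unfolding norm_term[OF y(1) Bu _ S, simplified]
      using set_integral_Re(2)[OF w_form_integrable[OF y(1) sols_bdd_borel[OF u' y(1)] sols_bdd_borel[OF u' y(1)] _ S]] by simp
  qed
  { assume C: "\<And>x. x \<in> oint b \<Longrightarrow> nrm2 x u' \<le> C"
    show "norm_sq b w u \<le> ennreal C"
      unfolding norm_sq_def
    proof (rule SUP_least, clarsimp)
      fix x y assume x: "x \<in> oint b" and y: "y \<in> oint b" and xy: "x \<le> y"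
      obtain c where c: "c \<in> oint b" "y < c" using oint_larger[OF y] by blast
      have x0: "0 < x" using x by (simp add: oint_def)
      have S: "{x..y} \<subseteq> {0<..<c}" using x0 c by auto
      have "(LINT t:{x..y}|M. Re (w_form t (u' t) (u' t))) \<le> (LINT t:{0<..<c}|M. Re (w_form t (u' t) (u' t)))"
        using int[OF c(1) _ S] int[OF c(1) _ order_refl] unfolding set_lebesgue_integral_def set_integrable_def
        by (intro integral_mono) (use S w_form_nonneg in \<open>auto split: split_indicator\<close>)
      also have "\<dots> = nrm2 c u'" by (rule nrm2_eq[OF c(1) sols_bdd_borel[OF u' c(1)], symmetric])
      also have "\<dots> \<le> C" by (rule C[OF c(1)])
      finally have "ennreal (LINT t:{x..y}|M. Re (w_form t (u' t) (u' t))) \<le> ennreal C" by (rule ennreal_leI)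
      then show "ennreal (\<Sum>i\<in>UNIV. \<Sum>j\<in>UNIV. Re (cmeasure_integral (\<lambda>A. w A $ i $ j) {x..y} (\<lambda>t. cnj (u t $ i) * u t $ j))) \<le> ennreal C"
        using term_eq[OF x0 c] by simp
    qed }
  { assume c: "c \<in> oint b"
    have c0: "0 < c" using c by (simp add: oint_def)
    \<comment> \<open>The summand \<open>3\<close> makes \<open>a n\<close> at most \<open>c / 3\<close>, so that the intervals below are not empty.\<close>
    define a where "a n = c / (real n + 3)" for n :: nat
    have a: "0 < a n" "a n \<le> c / 3" for n
      using c0 unfolding a_def by (simp, intro divide_left_mono) simp_all
    have dec: "a (Suc n) \<le> a n" for n using c0 unfolding a_def by (intro divide_left_mono) simp_all
    let ?A = "\<lambda>n. {a n..c - a n}"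
    have U: "(\<Union>n. ?A n) = {0<..<c}"
    proof
      show "(\<Union>n. ?A n) \<subseteq> {0<..<c}"
      proof
        fix t assume "t \<in> (\<Union>n. ?A n)"
        then obtain n where "t \<in> ?A n" by blast
        then show "t \<in> {0<..<c}" using a(1)[of n] by simp
      qed
      show "{0<..<c} \<subseteq> (\<Union>n. ?A n)"
      proof
        fix t assume t: "t \<in> {0<..<c}"
        define d where "d = min t (c - t)"
        have d: "0 < d" "d \<le> t" "d \<le> c - t" using t by (simp_all add: d_def)
        obtain n where "c / d < real n" using reals_Archimedean2 by blast
        then have "c < real n * d" using d(1) by (simp add: divide_less_eq)
        also have "\<dots> \<le> (real n + 3) * d" using d(1) by (intro mult_right_mono) simp_all
        finally have "a n < d" unfolding a_def by (simp add: divide_less_eq mult.commute)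
        then have "t \<in> ?A n" using d by simp
        then show "t \<in> (\<Union>n. ?A n)" by blast
      qed
    qed
    have "(\<lambda>n. LINT t:?A n|M. Re (w_form t (u' t) (u' t))) \<longlonglongrightarrow> (LINT t:(\<Union>n. ?A n)|M. Re (w_form t (u' t) (u' t)))"
    proof (rule set_integral_cont_up)
      show "?A n \<in> sets M" for n by (simp add: sets_M)
      show "incseq ?A"
      proof (rule incseq_SucI)
        fix n show "?A n \<subseteq> ?A (Suc n)" using dec[of n] by simp
      qed
      show "set_integrable M (\<Union>n. ?A n) (\<lambda>t. Re (w_form t (u' t) (u' t)))"
        unfolding U by (rule int[OF c _ order_refl]) simp
    qed
    then have lim: "(\<lambda>n. ennreal (LINT t:?A n|M. Re (w_form t (u' t) (u' t)))) \<longlonglongrightarrow> ennreal (nrm2 c u')"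
      unfolding U nrm2_eq[OF c sols_bdd_borel[OF u' c]] by (rule tendsto_ennrealI)
    show "ennreal (nrm2 c u') \<le> norm_sq b w u"
    proof (rule LIMSEQ_le_const2[OF lim], intro exI allI impI)
      fix n :: nat
      have ao: "a n \<in> oint b" "c - a n \<in> oint b" "a n \<le> c - a n" "c - a n < c"
        using oint_smaller[OF c, of "a n"] oint_smaller[OF c, of "c - a n"] a[of n] c0 by auto
      then have "ennreal (Re (\<Sum>i\<in>UNIV. \<Sum>j\<in>UNIV. cmeasure_integral (\<lambda>A. w A $ i $ j) {a n..c - a n} (\<lambda>t. cnj (u t $ i) * u t $ j))) \<le> norm_sq b w u"
        unfolding norm_sq_def by (intro SUP_upper2[of "(a n, c - a n)"]) simp_all
      then show "ennreal (LINT t:?A n|M. Re (w_form t (u' t) (u' t))) \<le> norm_sq b w u"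
        unfolding term_eq[OF a(1) c ao(4)] .
    qed }
qed

lemma norm_sq_finite_iff:
  assumes u': "u' \<in> sols z" and eq: "\<And>t. 0 < t \<Longrightarrow> u t = u' t"
  shows "norm_sq b w u < \<infinity> \<longleftrightarrow> sq_int u'"
proof
  assume "norm_sq b w u < \<infinity>"
  then obtain r where r: "0 \<le> r" "norm_sq b w u = ennreal r" by (cases "norm_sq b w u") auto
  have "nrm2 x u' \<le> r" if "x \<in> oint b" for x
    using nrm2_le_norm_sq[OF u' eq that] r by (simp add: ennreal_le_iff)
  then show "sq_int u'" unfolding sq_int_def by blast
next
  assume "sq_int u'"
  then obtain C where C: "\<And>x. x \<in> oint b \<Longrightarrow> nrm2 x u' \<le> C" unfolding sq_int_def by blast
  have "norm_sq b w u \<le> ennreal C" by (rule norm_sq_le[OF u' eq C])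
  then show "norm_sq b w u < \<infinity>" by (rule order_le_less_trans) simp
qed

lemma norm_sq_zero_iff:
  assumes u': "u' \<in> sols z" and eq: "\<And>t. 0 < t \<Longrightarrow> u t = u' t"
  shows "norm_sq b w u = 0 \<longleftrightarrow> (\<forall>x\<in>oint b. nrm2 x u' = 0)"
proof
  assume n: "norm_sq b w u = 0"
  show "\<forall>x\<in>oint b. nrm2 x u' = 0"
  proof
    fix x assume x: "x \<in> oint b"
    have "ennreal (nrm2 x u') \<le> 0" using nrm2_le_norm_sq[OF u' eq x] n by simp
    then have "nrm2 x u' \<le> 0" by (simp add: ennreal_eq_0_iff)
    then show "nrm2 x u' = 0" using nrm2_nonneg[OF x sols_bdd_borel[OF u' x]] by simp
  qed
next
  assume "\<forall>x\<in>oint b. nrm2 x u' = 0"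
  then have C: "nrm2 x u' \<le> 0" if "x \<in> oint b" for x using that by (metis order_refl)
  have "norm_sq b w u \<le> ennreal 0" by (rule norm_sq_le[OF u' eq C])
  then show "norm_sq b w u = 0" by simp
qed

text \<open>
  Solutions in the sense of measures and solutions of the integral equation are related by equality on the
  positive half-line.  The relation is linear, total in both directions, and respects elements
  of norm \<open>0\<close>, so the quotient dimensions agree.
\<close>

lemma deficiency_index_eq: "deficiency_index b q w z = defect z"
proof (rule antisym)
  have comb: "\<forall>t>0. comb a d c d' t = comb a u c u' t" if "\<forall>t>0. d t = u t" "\<forall>t>0. d' t = u' t" for a c and d u d' u' :: "real \<Rightarrow> complex^2"
    using that by (simp add: comb_def)
  have Wlc: "comb a u c v \<in> L2_sols z" if "u \<in> L2_sols z" "v \<in> L2_sols z" for a c u v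
    using that sols_comb[of u z v a c] sq_int_comb[of u z v z a c] unfolding L2_sols_def by simp
  have W0: "(\<lambda>_. 0) \<in> L2_sols z" unfolding L2_sols_def sq_int_def using zero_sols zero_null_sols unfolding null_sols_def by force
  have L_0: "u \<in> L_0 b q w \<longleftrightarrow> d \<in> null_sols" if "d \<in> sols z" and eq: "\<forall>t>0. d t = u t" for u d
  proof
    assume "u \<in> L_0 b q w"
    then have "\<forall>x\<in>oint b. nrm2 x d = 0" using norm_sq_zero_iff[OF \<open>d \<in> sols z\<close>, of u] eq unfolding L_0_def by simp
    then show "d \<in> null_sols" using null_sols_iff[of d z] \<open>d \<in> sols z\<close> by simp
  next
    assume "d \<in> null_sols"
    then have d: "d \<in> sols 0" "\<forall>x\<in>oint b. nrm2 x d = 0" unfolding null_sols_def by simp_all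
    then show "u \<in> L_0 b q w" using norm_sq_zero_iff[OF d(1), of u] sols_imp_solution[OF d(1), of u] eq unfolding L_0_def by simp
  qed
  show "deficiency_index b q w z \<le> defect z" unfolding deficiency_index_def defect_def
  proof (rule quotient_dim_le_rel[where R="\<lambda>u d. d \<in> L2_sols z \<and> (\<forall>t>0. d t = u t)"])
    fix u assume "u \<in> L2_solutions b q w z"
    then have s: "solution b q w z u" and n: "norm_sq b w u < \<infinity>" unfolding L2_solutions_def by simp_all
    obtain d where d: "d \<in> sols z" "\<forall>t>0. d t = u t" using solution_imp_sols[OF s] by blast
    then have "sq_int d" using norm_sq_finite_iff[OF d(1), of u] n by simp
    then show "\<exists>d\<in>L2_sols z. d \<in> L2_sols z \<and> (\<forall>t>0. d t = u t)" using d unfolding L2_sols_def by blast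
  next
    fix a u c u' d d' assume "d \<in> L2_sols z \<and> (\<forall>t>0. d t = u t)" "d' \<in> L2_sols z \<and> (\<forall>t>0. d' t = u' t)"
    then show "comb a d c d' \<in> L2_sols z \<and> (\<forall>t>0. comb a d c d' t = comb a u c u' t)" using Wlc comb by simp
  next
    fix u d assume "d \<in> L2_sols z \<and> (\<forall>t>0. d t = u t)" "d \<in> null_sols"
    then show "u \<in> L_0 b q w" using L_0[of d u] unfolding L2_sols_def by simp
  qed (simp_all add: W0 zero_null_sols)
  show "defect z \<le> deficiency_index b q w z" unfolding deficiency_index_def defect_def
  proof (rule quotient_dim_le_rel[where R="\<lambda>d u. d \<in> L2_sols z \<and> (\<forall>t>0. d t = u t)"])
    fix d assume d: "d \<in> L2_sols z"
    then have "d \<in> L2_solutions b q w z" unfolding L2_solutions_def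
      using sols_imp_solution[of d z d] norm_sq_finite_iff[of d z d] unfolding L2_sols_def by simp
    then show "\<exists>u\<in>L2_solutions b q w z. d \<in> L2_sols z \<and> (\<forall>t>0. d t = u t)" using d by blast
  next
    fix a u c u' d d' assume "u \<in> L2_sols z \<and> (\<forall>t>0. u t = d t)" "u' \<in> L2_sols z \<and> (\<forall>t>0. u' t = d' t)"
    then show "comb a u c u' \<in> L2_sols z \<and> (\<forall>t>0. comb a u c u' t = comb a d c d' t)" using Wlc comb by simp
  next
    fix d u assume "d \<in> L2_sols z \<and> (\<forall>t>0. d t = u t)" "u \<in> L_0 b q w"
    then show "d \<in> null_sols" using L_0[of d u] unfolding L2_sols_def by simp
  next
    show "(\<lambda>_. 0) \<in> L_0 b q w" using L_0[of "\<lambda>_. 0" "\<lambda>_. 0"] zero_sols zero_null_sols by simp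
  qed (simp add: W0)
qed

section \<open>The exceptional set\<close>

lemma atom_q: "x \<in> oint b \<Longrightarrow> q {x} $ i $ j = of_real (measure M {x}) * Q x $ i $ j"
  and atom_w: "x \<in> oint b \<Longrightarrow> w {x} $ i $ j = of_real (measure M {x}) * W x $ i $ j"
proof -
  assume x: "x \<in> oint b"
  obtain c where "c \<in> oint b" "x < c" using oint_larger[OF x] by blast
  then have R: "{x} \<in> reg_sets b" using x by (intro reg_setsI[of _ 0 c]) (simp_all add: oint_def)
  show "q {x} $ i $ j = of_real (measure M {x}) * Q x $ i $ j" "w {x} $ i $ j = of_real (measure M {x}) * W x $ i $ j"
    using q_dens[of i j] w_dens[of i j] R singleton_integral(2)[OF x, of "\<lambda>x. Q x $ i $ j"] singleton_integral(2)[OF x, of "\<lambda>x. W x $ i $ j"]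
    unfolding cdensity_def by (simp_all add: scaleR_conv_of_real)
qed

lemma B_nth:
  "B_plus q w x z $ i $ j = J $ i $ j + (q {x} $ i $ j - z * w {x} $ i $ j) / 2"
  "B_minus q w x z $ i $ j = J $ i $ j - (q {x} $ i $ j - z * w {x} $ i $ j) / 2"
proof -
  have "(mat z ** w {x}) $ i $ j = z * w {x} $ i $ j"
    using exhaust_2[of i] by (auto simp: matrix_matrix_mult_def mat_def sum_2)
  then show "B_plus q w x z $ i $ j = J $ i $ j + (q {x} $ i $ j - z * w {x} $ i $ j) / 2"
    "B_minus q w x z $ i $ j = J $ i $ j - (q {x} $ i $ j - z * w {x} $ i $ j) / 2"
    unfolding B_plus_def B_minus_def vector_add_component vector_minus_component vector_scaleR_component
    by (simp_all add: scaleR_conv_of_real)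
qed

text \<open>
  Multiplied by \<open>J\<close>, the equation \<open>v = M{x}/2 rhs z x v\<close> becomes \<open>B_plus v = 0\<close>.
\<close>

lemma nonsingular_if_det:
  assumes "\<And>x. x \<in> oint b \<Longrightarrow> det (B_plus q w x z) \<noteq> 0"
  shows "nonsingular z"
  unfolding nonsingular_def
proof (intro ballI allI impI)
  fix x v assume x: "x \<in> oint b" and v: "v = (measure M {x} / 2) *\<^sub>R rhs z x v"
  have "B_plus q w x z *v v = 0"
  proof -
    have 1: "v $ 1 = - ((q {x} $ 2 $ 1 - z * w {x} $ 2 $ 1) * v $ 1 + (q {x} $ 2 $ 2 - z * w {x} $ 2 $ 2) * v $ 2) / 2"
      unfolding atom_q[OF x] atom_w[OF x]
      by (subst v, subst vector_scaleR_component, subst rhs_nth(1)) (simp add: sum_2 scaleR_conv_of_real algebra_simps)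
    have 2: "v $ 2 = ((q {x} $ 1 $ 1 - z * w {x} $ 1 $ 1) * v $ 1 + (q {x} $ 1 $ 2 - z * w {x} $ 1 $ 2) * v $ 2) / 2"
      unfolding atom_q[OF x] atom_w[OF x]
      by (subst v, subst vector_scaleR_component, subst rhs_nth(2)) (simp add: sum_2 scaleR_conv_of_real algebra_simps)
    have J: "J $ 1 $ 1 = 0" "J $ 1 $ 2 = -1" "J $ 2 $ 1 = 1" "J $ 2 $ 2 = 0" by (simp_all add: J_def)
    have "(B_plus q w x z *v v) $ 1 = 0"
    proof -
      have "(B_plus q w x z *v v) $ 1 = ((q {x} $ 1 $ 1 - z * w {x} $ 1 $ 1) * v $ 1 + (q {x} $ 1 $ 2 - z * w {x} $ 1 $ 2) * v $ 2) / 2 - v $ 2"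
        by (simp add: matrix_vector_mult_def sum_2 B_nth J algebra_simps add_divide_distrib diff_divide_distrib)
      then show ?thesis unfolding 2[symmetric] by simp
    qed
    moreover have "(B_plus q w x z *v v) $ 2 = 0"
    proof -
      have "(B_plus q w x z *v v) $ 2 = v $ 1 - - ((q {x} $ 2 $ 1 - z * w {x} $ 2 $ 1) * v $ 1 + (q {x} $ 2 $ 2 - z * w {x} $ 2 $ 2) * v $ 2) / 2"
        by (simp add: matrix_vector_mult_def sum_2 B_nth J algebra_simps add_divide_distrib diff_divide_distrib)
      then show ?thesis unfolding 1[symmetric] by simp
    qed
    ultimately show ?thesis by (simp add: vec_eq_iff forall_2)
  qed
  moreover have "invertible (B_plus q w x z)" using assms[OF x] invertible_det_nz by blast
  ultimately show "v = 0"
    by (metis invertible_def matrix_vector_mul_assoc matrix_vector_mul_lid matrix_vector_mult_0_right)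
qed

text \<open>
  Since \<open>J\<^sup>* = - J\<close>, the adjoint of \<open>B_minus\<close> for \<open>z\<close> is \<open>- B_plus\<close> for \<open>cnj z\<close>.
\<close>

lemma det_B_cnj:
  assumes x: "x \<in> oint b"
  shows "det (B_plus q w x (cnj z)) = cnj (det (B_minus q w x z))" "det (B_minus q w x (cnj z)) = cnj (det (B_plus q w x z))"
proof -
  have q: "cnj (q {x} $ i $ j) = q {x} $ j $ i" and w: "cnj (w {x} $ i $ j) = w {x} $ j $ i" for i j
    unfolding atom_q[OF x] atom_w[OF x] complex_cnj_mult Q_cnj[of x i j] W_cnj[of x i j] by simp_all
  have J: "cnj (J $ i $ j) = - J $ j $ i" for i j
    using exhaust_2[of i] exhaust_2[of j] by (auto simp: J_def)
  have 1: "B_plus q w x (cnj z) $ i $ j = - cnj (B_minus q w x z $ j $ i)" and 2: "B_minus q w x (cnj z) $ i $ j = - cnj (B_plus q w x z $ j $ i)" for i j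
    unfolding B_nth by (simp_all add: q[of j i] w[of j i] J[of j i] diff_divide_distrib)
  show "det (B_plus q w x (cnj z)) = cnj (det (B_minus q w x z))" "det (B_minus q w x (cnj z)) = cnj (det (B_plus q w x z))"
    unfolding det_2 1 2 by (simp_all add: mult.commute)
qed

lemma Lambda_cnj: "z \<notin> Lambda_set b q w \<Longrightarrow> cnj z \<notin> Lambda_set b q w"
  unfolding Lambda_set_def using det_B_cnj[of _ z] by simp

lemma nonsingular_if_not_Lambda: "z \<notin> Lambda_set b q w \<Longrightarrow> nonsingular z"
  by (rule nonsingular_if_det) (simp add: Lambda_set_def)

text \<open>
  The value at \<open>0\<close> of the corresponding solution of the integral equation is its right limit.
\<close>

lemma solution_initial_value:
  assumes s: "solution b q w z u" and l: "(u \<longlongrightarrow> p) (at_right 0)"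
  shows "\<exists>u'\<in>sols z. u' 0 = p \<and> (\<forall>t>0. u' t = u t)"
proof -
  obtain u' where u': "u' \<in> sols z" "\<forall>t>0. u' t = u t" using solution_imp_sols[OF s] by blast
  have "\<forall>\<^sub>F t in at_right 0. u t = u' t"
    unfolding eventually_at_right[OF zero_less_one] using u'(2) by (intro exI[of _ 1]) simp
  then have "(u' \<longlongrightarrow> p) (at_right 0)" using l by (rule Lim_transform_eventually[rotated])
  then have "u' 0 = p" using sols_right_limit_0[OF u'(1)] by (intro tendsto_unique[of "at_right 0" u']) simp_all
  then show ?thesis using u' by blast
qed

end

theorem theorem3p4:
  fixes b :: ereal
    and q w :: "real set \<Rightarrow> complex^2^2"
    and \<alpha> :: real
    and \<psi> :: "complex \<Rightarrow> real \<Rightarrow> complex^2"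
    and z z_upper z_lower :: complex
  assumes "0 < b"
    and "local_measure b q" "local_measure b w"
    and "hermitian_measure b q"
    and "nonneg_measure b w" "nonzero_measure b w"
    and "regular_at_0 b q" "regular_at_0 b w"
    and "Lambda_set b q w \<noteq> UNIV"
    and "0 \<le> \<alpha>" "\<alpha> < pi"
    and "\<And>\<zeta>. \<zeta> \<notin> Lambda_set b q w \<Longrightarrow> solution b q w \<zeta> (\<psi> \<zeta>)"
    and "\<And>\<zeta>. \<zeta> \<notin> Lambda_set b q w \<Longrightarrow>
           (\<psi> \<zeta> \<longlongrightarrow> vector [- complex_of_real (sin \<alpha>), complex_of_real (cos \<alpha>)]) (at_right 0)"
    and "z \<notin> \<real>" "z \<notin> Lambda_set b q w"
    and "Im z_upper > 0" "Im z_lower < 0"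
  shows "deficiency_index b q w z_upper \<noteq> deficiency_index b q w z_lower \<longleftrightarrow>
         (norm_sq b w (\<psi> z) = \<infinity>) \<noteq> (norm_sq b w (\<psi> (cnj z)) = \<infinity>)"
proof -
  obtain M Q W where *: "canonical_system b M Q W"
    "\<And>i j. cdensity (reg_sets b) M (\<lambda>A. q A $ i $ j) (\<lambda>x. Q x $ i $ j)"
    "\<And>i j. cdensity (reg_sets b) M (\<lambda>A. w A $ i $ j) (\<lambda>x. W x $ i $ j)"
    using representation[OF assms(1,7,4,8,5)] by metis
  interpret represented_system b M Q W q w
    unfolding represented_system_def represented_system_axioms_def using * by blast
  let ?p = "vector [- complex_of_real (sin \<alpha>), complex_of_real (cos \<alpha>)] :: complex^2"
  have L: "z \<notin> Lambda_set b q w" "cnj z \<notin> Lambda_set b q w" using assms(15) Lambda_cnj by blast+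
  have im: "Im z \<noteq> 0" using assms(14) by (simp add: complex_is_Real_iff)
  obtain s where s: "s \<in> sols z" "s 0 = ?p" "\<forall>t>0. s t = \<psi> z t"
    using solution_initial_value[OF assms(12)[OF L(1)] assms(13)[OF L(1)]] by blast
  obtain s' where s': "s' \<in> sols (cnj z)" "s' 0 = ?p" "\<forall>t>0. s' t = \<psi> (cnj z) t"
    using solution_initial_value[OF assms(12)[OF L(2)] assms(13)[OF L(2)]] by blast
  have p: "?p \<noteq> 0" "hform ?p = 0"
  proof
    assume "?p = 0"
    then have "?p $ 1 = 0" "?p $ 2 = 0" by (simp_all only: zero_index)
    then have "sin \<alpha> = 0" "cos \<alpha> = 0" by simp_all
    then show False using sin_cos_squared_add[of \<alpha>] by simp
  qed (simp add: hform_def)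
  have ns: "nonsingular z" "nonsingular (cnj z)" using L nonsingular_if_not_Lambda by blast+
  have "defect z \<noteq> defect (cnj z) \<longleftrightarrow> sq_int s \<noteq> sq_int s'"
    by (rule deficiency_dichotomy[OF ns im s(1) s'(1)]) (use s(2) s'(2) p in simp_all)
  moreover have "norm_sq b w (\<psi> z) = \<infinity> \<longleftrightarrow> \<not> sq_int s"
    using norm_sq_finite_iff[OF s(1), of "\<psi> z"] s(3) by (metis infinity_ennreal_def less_top)
  moreover have "norm_sq b w (\<psi> (cnj z)) = \<infinity> \<longleftrightarrow> \<not> sq_int s'"
    using norm_sq_finite_iff[OF s'(1), of "\<psi> (cnj z)"] s'(3) by (metis infinity_ennreal_def less_top)
  \<comment> \<open>The half-planes containing \<open>z\<close> and \<open>cnj z\<close> are the upper and the lower one, in an order given by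
    the sign of \<open>Im z\<close>.\<close>
  moreover have "defect z_upper \<noteq> defect z_lower \<longleftrightarrow> defect z \<noteq> defect (cnj z)"
  proof (cases "0 < Im z")
    case True
    then have "defect z_upper = defect z" "defect z_lower = defect (cnj z)"
      by (intro defect_constant[OF ns(1) im] mult_pos_pos mult_neg_neg; use assms(16,17) in simp)+
    then show ?thesis by simp
  next
    case False
    then have "Im z < 0" using im by simp
    then have "defect z_upper = defect (cnj z)" "defect z_lower = defect z"
      by (intro defect_constant[OF ns(1) im] mult_pos_pos mult_neg_neg; use assms(16,17) in simp)+
    then show ?thesis by auto
  qed
  ultimately show ?thesis unfolding deficiency_index_eq by blast
qed

end
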